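(* Let $(k,l)$ be an exponent pair such that $4k-2l+1>0$, and let $\gamma$ satisfy $$ \max\Big\{\frac{13}{15},\ \frac{12k+10}{12k-2l+13}\Big\}<\gamma<1. $$ Then for every sufficiently small $\varepsilon>0$ the following holds: for all sufficiently large $x$, all $H$ with $1\le H\le x^{1-\gamma+\varepsilon}$, all $0\le u\le 1$ and all $\alpha\in\mathbb{R}$, $$ \sum_{h\sim H}\Big|\sum_{n\sim x}\Lambda(n)\,\mathbf{e}\big(\alpha n+h(n+u)^\gamma\big)\Big|\ll x^{1-\varepsilon}, $$ where the implied constant depends only on $\gamma,\varepsilon$ (and $k,l$), and not on $\alpha,u,H$.
   Context: $\Lambda$ is the von Mangoldt function and $\mathbf{e}(t)=e^{2\pi i t}$. The notation $n\sim X$ means that $n$ runs over the integers in a subinterval of $(X,2X]$. An exponent pair $(k,l)$ (with $0\le k\le \frac12\le l\le 1$) is understood in the sense of van der Corput's method (Graham–Kolesnik, "Van der Corput's Method of Exponential Sums", p. 30): roughly, for every interval $I\subset(N,2N]$ and every sufficiently smooth $f$ on $I$ whose derivatives satisfy $|f^{(r)}(t)|\asymp FN^{-r}$ (in the precise form of that definition) one has $\sum_{n\in I}\mathbf{e}(f(n))\ll (F/N)^kN^l+N/F$. *)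

theory Defs
  imports "HOL-Analysis.Analysis" "HOL-Number_Theory.Prime_Powers"
begin

definition expi :: "real \<Rightarrow> complex" where
  "expi t = exp (2 * complex_of_real pi * \<i> * complex_of_real t)"

(*
  The class F(N, P, s, y, eps) of Graham and Kolesnik ("Van der Corput's Method of
  Exponential Sums", p. 30), with the interval [a, b] made explicit: f has P continuous
  derivatives on [a, b], a subset of [N, 2N], and
    |f^(p+1)(t) - (-1)^p (s)_p y t^(-s-p)| < eps (s)_p y t^(-s-p)   (0 <= p <= P - 1),
  where (s)_p is the rising factorial.  D p is the p-th derivative of f, one-sided at the
  end points of [a, b].
*)
definition vdc_class ::
  "real \<Rightarrow> nat \<Rightarrow> real \<Rightarrow> real \<Rightarrow> real \<Rightarrow> real \<Rightarrow> real \<Rightarrow> (real \<Rightarrow> real) set" where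
  "vdc_class N P s y \<epsilon> a b =
     {f. N \<le> a \<and> a < b \<and> b \<le> 2 * N \<and>
         (\<exists>D :: nat \<Rightarrow> real \<Rightarrow> real.
            (\<forall>t\<in>{a..b}. D 0 t = f t) \<and>
            (\<forall>p<P. \<forall>t\<in>{a..b}. (D p has_real_derivative D (Suc p) t) (at t within {a..b})) \<and>
            continuous_on {a..b} (D P) \<and>
            (\<forall>p<P. \<forall>t\<in>{a..b}.
               \<bar>D (Suc p) t - (-1) ^ p * pochhammer s p * y * t powr (- s - real p)\<bar>
                 < \<epsilon> * pochhammer s p * y * t powr (- s - real p)))}"

(*
  In the usual notation F / N = y N^(-s), the bound is (F/N)^k N^l + N/F.  P, eps and the
  implied constant depend on k, l and s only.
*)
definition exponent_pair :: "real \<Rightarrow> real \<Rightarrow> bool" where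
  "exponent_pair k l \<longleftrightarrow>
     0 \<le> k \<and> k \<le> 1/2 \<and> 1/2 \<le> l \<and> l \<le> 1 \<and>
     (\<forall>s>0. \<exists>P. \<exists>\<epsilon>>0. \<epsilon> < 1/2 \<and>
        (\<exists>C. \<forall>N>0. \<forall>y>0. \<forall>a b. \<forall>f\<in>vdc_class N P s y \<epsilon> a b.
           norm (\<Sum>n | a \<le> real n \<and> real n \<le> b. expi (f (real n)))
             \<le> C * ((y * N powr (- s)) powr k * N powr l + inverse y * N powr s)))"

(*
  The set of n with n ~ X, for a chosen subinterval J of (X, 2X]: assertions about sums over
  n ~ X are meant uniformly in J.  For X >= 0 every integer in J is a natural number.
*)
definition dyadic_subinterval :: "real \<Rightarrow> real set \<Rightarrow> bool" where
  "dyadic_subinterval X J \<longleftrightarrow> is_interval J \<and> J \<subseteq> {X<..2 * X}"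

end

(*
  Put delta = 1 - gamma.  Partial summation removes u at the cost of a factor 1 + H x^(-delta).
  Heath-Brown's identity with three factors, truncated at (2x)^(1/3), splits Lambda into boundedly
  many convolutions f * g (up to divisor-bounded coefficients) in which either g is supported in
  [x^(delta + 20 eps), (2x)^(1/3)] (type II), or g is 1 or log restricted to n >= x^(1/2 - delta/2 - 10 eps)
  (type I).

  Type II: the pairs (h, n) are grouped into K classes according to the value of h n^gamma.  Cauchy's
  inequality over the long variable and the classes leaves pairs with h n^gamma close to h' n'^gamma; these
  are counted elementarily, and the sum over the long variable is estimated by the second derivative
  test.  This is where gamma > 13/15 is needed.

  Type I: if n > x^(1/2 + delta + 10 eps), the second derivative test over n suffices.  Otherwise a Weyl shift
  q in the smooth variable n and Poisson summation over m lead to integrals over m.  The substitution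
  m = M rho_n sigma with rho_n = N (((n + q)^gamma - n^gamma) / (gamma q))^(1 / (1 - gamma)) gives all n
  phases X rho_n (sigma^gamma - mu sigma), proportional to rho_n.  For small q/n this is so close to N/n that the
  exponent pair applies for each sigma; alpha enters only through mu, so the bound is uniform in alpha.
  This is where the second lower bound for gamma comes from.
*)
theory Submission
  imports Defs "HOL-Complex_Analysis.Complex_Analysis" "HOL-Computational_Algebra.Squarefree" "HOL-Real_Asymp.Real_Asymp"
begin

section \<open>The exponential\<close>

text \<open>The twist alpha n is the obstacle. After a Weyl shift it leaves a term beta m with
  arbitrary beta, so the stationary point in m moves with n and has no fixed position. In the
  variable sigma it is the same for all n, and integration by parts then acts on the whole sum over
  n: no stationary phase expansion is needed, and the exponent pair is used with s = 2, the model
  phase being N / n. The bounds on gamma are worst cases. With delta = 1 - gamma: type II takes K as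
  large as the diagonal allows, and at N = x^(1/3) the off-diagonal terms then require 15 delta < 2.
  In type I the diagonal forces Q = H^2 x^(20 eps); by 4k - 2l + 1 > 0 the resulting exponent
  decreases in N, so the shortest length x^(1/2 - delta/2) decides, and there the requirement is
  delta (12k - 2l + 13) < 3 - 2l. The two ranges fit because z = x^(delta + 20 eps) and Y = x^(1/2 -
  delta/2 - 10 eps) satisfy z Y^2 = x: a factor below z times at most two factors below Y does not
  pass x, so some factor or subproduct is always usable.\<close>

lemma expi_eq_cis: "expi t = cis (2 * pi * t)"
  by (simp add: expi_def cis_conv_exp mult_ac)

lemma norm_expi [simp]: "norm (expi t) = 1"
  by (simp add: expi_eq_cis)

lemma expi_add: "expi (s + t) = expi s * expi t"
  by (simp add: expi_eq_cis cis_mult ring_distribs)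

lemma expi_0 [simp]: "expi 0 = 1"
  by (simp add: expi_eq_cis)

lemma expi_minus: "expi (- t) = cnj (expi t)"
  by (simp add: expi_eq_cis cis_cnj)

lemma expi_diff: "expi (s - t) = expi s * cnj (expi t)"
  using expi_add[of s "-t"] by (simp add: expi_minus)

lemma expi_of_int [simp]: "expi (of_int k) = 1"
  by (simp add: expi_eq_cis)

lemma expi_of_nat [simp]: "expi (of_nat k) = 1"
  by (simp add: expi_eq_cis)

lemma expi_nonzero [simp]: "expi t \<noteq> 0"
  by (simp add: expi_eq_cis)

lemma expi_power: "expi t ^ n = expi (real n * t)"
  by (simp add: expi_eq_cis Complex.DeMoivre mult_ac)

lemma expi_has_vector_derivative:
  "(expi has_vector_derivative (2 * pi * \<i> * expi t)) (at t within S)"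
proof -
  have "((\<lambda>z. exp (2 * complex_of_real pi * \<i> * z)) has_field_derivative
      (exp (2 * complex_of_real pi * \<i> * of_real t) * (2 * complex_of_real pi * \<i>))) (at (of_real t))"
    by (auto intro!: derivative_eq_intros)
  from has_vector_derivative_real_field[OF this, of S] show ?thesis
    unfolding expi_def by (simp add: mult_ac)
qed

lemma continuous_on_expi [continuous_intros]:
  assumes "continuous_on S f"
  shows "continuous_on S (\<lambda>t. expi (f t))"
  unfolding expi_def by (intro continuous_intros assms)

lemma expi_chain:
  assumes "(f has_real_derivative f') (at t within S)"
  shows "((\<lambda>t. expi (f t)) has_vector_derivative (2 * pi * \<i> * f' * expi (f t))) (at t within S)"
proof -
  have "(f has_vector_derivative f') (at t within S)"
    using assms by (simp add: has_real_derivative_iff_has_vector_derivative)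
  from vector_diff_chain_within[OF this expi_has_vector_derivative]
  show ?thesis by (simp add: o_def scaleR_conv_of_real mult_ac)
qed

lemma norm_expi_diff_le: "norm (expi s - expi t) \<le> 2 * pi * \<bar>s - t\<bar>"
proof -
  have "norm (expi s - expi t) \<le> 2 * pi * norm (s - t)"
  proof (rule differentiable_bound[of UNIV expi "\<lambda>t h. h *\<^sub>R (2 * pi * \<i> * expi t)"])
    show "(expi has_derivative (\<lambda>h. h *\<^sub>R (2 * pi * \<i> * expi x))) (at x within UNIV)" for x
      using expi_has_vector_derivative[of x UNIV] by (simp add: has_vector_derivative_def)
    show "onorm (\<lambda>h. h *\<^sub>R (2 * pi * \<i> * expi x)) \<le> 2 * pi" for x
      by (rule onorm_le) (simp add: norm_mult)
  qed auto
  thus ?thesis by simp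
qed

lemma norm_one_minus_expi: "norm (1 - expi t) = 2 * \<bar>sin (pi * t)\<bar>"
proof -
  have "(norm (1 - expi t))\<^sup>2 = (2 * \<bar>sin (pi * t)\<bar>)\<^sup>2"
  proof -
    have "(norm (1 - expi t))\<^sup>2 = (1 - cos (2 * (pi * t)))\<^sup>2 + (sin (2 * (pi * t)))\<^sup>2"
      by (simp add: cmod_power2 expi_eq_cis mult_ac)
    also have "\<dots> = 1 - 2 * cos (2 * (pi * t)) + ((cos (2 * (pi * t)))\<^sup>2 + (sin (2 * (pi * t)))\<^sup>2)"
      by (simp add: power2_eq_square algebra_simps)
    also have "\<dots> = 2 - 2 * cos (2 * (pi * t))" by simp
    also have "\<dots> = 4 * (sin (pi * t))\<^sup>2"
      by (simp add: cos_double_sin)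
    finally show ?thesis by (simp add: power_mult_distrib)
  qed
  thus ?thesis by (rule power2_eq_imp_eq) auto
qed

text \<open>Concavity of the sine: on \<open>{0..pi/2}\<close> it lies above the chord with end
  values 0 and 1, and \<open>2 * t\<close> is the position on that chord.\<close>

lemma sin_pi_ge:
  assumes "0 \<le> t" "t \<le> 1/2"
  shows "2 * t \<le> sin (pi * t)"
proof -
  have "convex_on {0..pi/2} (\<lambda>x. - sin x)"
  proof (rule f''_ge0_imp_convex)
    show "((\<lambda>x. - sin x) has_real_derivative - cos x) (at x)" for x :: real
      by (auto intro!: derivative_eq_intros)
    show "((\<lambda>x. - cos x) has_real_derivative sin x) (at x)" for x :: real
      by (auto intro!: derivative_eq_intros)
    show "0 \<le> sin x" if "x \<in> {0..pi/2}" for x :: real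
      using that by (intro sin_ge_zero) auto
  qed auto
  from convex_onD[OF this, of "2 * t" 0 "pi/2"] assms
  show ?thesis by (simp add: mult_ac)
qed

lemma norm_one_minus_expi_ge:
  assumes "\<bar>t\<bar> \<le> 1/2"
  shows "4 * \<bar>t\<bar> \<le> norm (1 - expi t)"
proof -
  have "2 * \<bar>t\<bar> \<le> sin (pi * \<bar>t\<bar>)" by (rule sin_pi_ge) (use assms in auto)
  also have "\<dots> \<le> \<bar>sin (pi * t)\<bar>" by (cases "t \<ge> 0") auto
  finally show ?thesis by (simp add: norm_one_minus_expi)
qed

text \<open>Abel summation. The weights enter through a last value and a total variation, so bounded
  monotone weights cost a constant factor only.\<close>

lemma norm_sum_abel_le:
  fixes c z :: "nat \<Rightarrow> complex"
  assumes E: "\<And>n. a \<le> n \<Longrightarrow> n \<le> b \<Longrightarrow> norm (\<Sum>i\<in>{a..n}. z i) \<le> E" and ab: "a \<le> b"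
  shows "norm (\<Sum>i\<in>{a..b}. c i * z i) \<le> E * (norm (c b) + (\<Sum>i\<in>{a..<b}. norm (c i - c (Suc i))))"
proof -
  define S where "S n = (\<Sum>i\<in>{a..n}. z i)" for n
  have "(\<Sum>i\<in>{a..a + d}. c i * z i) = c (a + d) * S (a + d) + (\<Sum>i\<in>{a..<a + d}. (c i - c (Suc i)) * S i)" for d
  proof (induction d)
    case (Suc d)
    have "S (Suc (a + d)) = S (a + d) + z (Suc (a + d))" unfolding S_def by (simp add: sum.cl_ivl_Suc)
    thus ?case using Suc by (simp add: sum.cl_ivl_Suc algebra_simps)
  qed (simp add: S_def)
  from this[of "b - a"] have "(\<Sum>i\<in>{a..b}. c i * z i) = c b * S b + (\<Sum>i\<in>{a..<b}. (c i - c (Suc i)) * S i)"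
    using ab by simp
  also have "norm \<dots> \<le> norm (c b) * E + (\<Sum>i\<in>{a..<b}. norm (c i - c (Suc i)) * E)"
    using E ab unfolding S_def
    by (intro order.trans[OF norm_triangle_ineq] add_mono sum_norm_le) (auto simp: norm_mult intro!: mult_left_mono)
  finally show ?thesis by (simp add: algebra_simps sum_distrib_left)
qed

section \<open>Kusmin-Landau inequality and van der Corput's second derivative test\<close>

section \<open>The second derivative test\<close>

text \<open>The real part is constant. Differences of \<open>1 / (1 - expi t)\<close> are therefore
  imaginary multiples of differences of the cotangent, and along an increasing \<open>t\<close>
  their absolute values telescope.\<close>

lemma inverse_one_minus_expi:
  assumes "0 < t" "t < 1"
  shows "1 / (1 - expi t) = 1/2 + \<i>/2 * complex_of_real (cot (pi * t))"
proof -
  define s c where "s = sin (pi * t)" and "c = cos (pi * t)"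
  have s: "s > 0" unfolding s_def using assms by (intro sin_gt_zero) (auto simp: mult_less_cancel_left1)
  have e: "expi t = Complex (1 - 2 * s\<^sup>2) (2 * s * c)"
    using cos_double_sin[of "pi * t"] sin_double[of "pi * t"]
    by (simp add: expi_eq_cis s_def c_def cis.code mult_ac)
  have sc: "s * s + c * c = 1" unfolding s_def c_def using sin_cos_squared_add[of "pi*t"]
    by (simp add: power2_eq_square)
  have "(1 - expi t) * (1/2 + \<i>/2 * complex_of_real (c / s)) = 1"
  proof (rule complex_eqI)
    have "Re ((1 - expi t) * (1/2 + \<i>/2 * complex_of_real (c / s))) = s\<^sup>2 + c * c"
      using s by (simp add: e power2_eq_square field_simps)
    thus "Re ((1 - expi t) * (1/2 + \<i>/2 * complex_of_real (c / s))) = Re 1"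
      using sc by (simp add: power2_eq_square)
    show "Im ((1 - expi t) * (1/2 + \<i>/2 * complex_of_real (c / s))) = Im 1"
      using s by (simp add: e power2_eq_square field_simps)
  qed
  moreover have "1 - expi t \<noteq> 0"
    using calculation by (metis mult_zero_left zero_neq_one)
  ultimately show ?thesis unfolding cot_def s_def c_def by (simp add: field_simps)
qed

lemma cot_antimono:
  assumes "0 < x" "x \<le> y" "y < pi"
  shows "cot y \<le> cot (x :: real)"
proof -
  have sx: "sin x > 0" and sy: "sin y > 0" using assms by (auto intro!: sin_gt_zero)
  have "0 \<le> sin (y - x)" using assms by (intro sin_ge_zero) auto
  hence "cos y * sin x \<le> cos x * sin y" by (simp add: sin_diff mult_ac)
  thus ?thesis unfolding cot_def using sx sy by (simp add: field_simps)
qed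

text \<open>With \<open>c n = 1 / (1 - expi (\<theta> n))\<close> each term is \<open>c n\<close>
  times a difference of consecutive exponentials. Summation by parts moves the differences to
  \<open>c\<close>, where they telescope by monotonicity of the cotangent; \<Delta> controls the
  boundary terms.\<close>

lemma kusmin_landau:
  fixes f :: "nat \<Rightarrow> real" and \<nu> :: int and \<Delta> :: real
  assumes \<Delta>: "0 < \<Delta>"
    and rng: "\<And>n. p \<le> n \<Longrightarrow> n < q \<Longrightarrow> \<nu> + \<Delta> \<le> f (Suc n) - f n \<and> f (Suc n) - f n \<le> \<nu> + 1 - \<Delta>"
    and mono: "\<And>n. p \<le> n \<Longrightarrow> Suc n < q \<Longrightarrow> f (Suc n) - f n \<le> f (Suc (Suc n)) - f (Suc n)"
  shows "norm (\<Sum>n\<in>{p..<q}. expi (f n)) \<le> 1 / \<Delta>"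
proof (cases "p < q")
  case False thus ?thesis using \<Delta> by simp
next
  case True
  define \<theta> where "\<theta> n = f (Suc n) - f n - \<nu>" for n
  define c where "c n = 1 / (1 - expi (\<theta> n))" for n
  define k where "k n = cot (pi * \<theta> n)" for n
  have r: "\<Delta> \<le> \<theta> n" "\<theta> n \<le> 1 - \<Delta>" if "p \<le> n" "n < q" for n
    using rng[OF that] by (auto simp: \<theta>_def)
  have r': "0 < \<theta> n" "\<theta> n < 1" if "p \<le> n" "n < q" for n
    using r[OF that] \<Delta> by auto
  have sin: "2 * \<Delta> \<le> sin (pi * \<theta> n)" if "p \<le> n" "n < q" for n
  proof (cases "\<theta> n \<le> 1/2")
    case True
    have "2 * \<theta> n \<le> sin (pi * \<theta> n)" using r'[OF that] True by (intro sin_pi_ge) auto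
    thus ?thesis using r[OF that] by simp
  next
    case False
    have "2 * (1 - \<theta> n) \<le> sin (pi * (1 - \<theta> n))" using r'[OF that] False by (intro sin_pi_ge) auto
    moreover have "sin (pi * (1 - \<theta> n)) = sin (pi * \<theta> n)" using sin_pi_minus[of "pi * \<theta> n"]
      by (simp add: algebra_simps)
    ultimately show ?thesis using r[OF that] by simp
  qed
  have cn: "norm (c n) \<le> 1 / (4 * \<Delta>)" if "p \<le> n" "n < q" for n
  proof -
    have "4 * \<Delta> \<le> norm (1 - expi (\<theta> n))" using sin[OF that] by (simp add: norm_one_minus_expi)
    thus ?thesis unfolding c_def using \<Delta> by (simp add: norm_divide frac_le)
  qed
  have kn: "\<bar>k n\<bar> \<le> 1 / (2 * \<Delta>)" if "p \<le> n" "n < q" for n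
  proof -
    have "\<bar>k n\<bar> = \<bar>cos (pi * \<theta> n)\<bar> / sin (pi * \<theta> n)"
      unfolding k_def cot_def using sin[OF that] \<Delta> by (simp add: abs_divide)
    also have "\<dots> \<le> 1 / (2 * \<Delta>)" using sin[OF that] \<Delta> by (intro frac_le) auto
    finally show ?thesis .
  qed
  have ceq: "c n = 1/2 + \<i>/2 * complex_of_real (k n)" if "p \<le> n" "n < q" for n
    unfolding c_def k_def by (rule inverse_one_minus_expi) (use r'[OF that] in auto)
  have cdiff: "norm (c (Suc n) - c n) \<le> (k n - k (Suc n)) / 2" if "p \<le> n" "Suc n < q" for n
  proof -
    have "c (Suc n) - c n = \<i>/2 * complex_of_real (k (Suc n) - k n)"
      using ceq[of n] ceq[of "Suc n"] that by (simp add: algebra_simps)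
    hence "norm (c (Suc n) - c n) = \<bar>k (Suc n) - k n\<bar> / 2"
      by (simp only: norm_mult norm_of_real norm_divide norm_ii) simp
    moreover have "k (Suc n) \<le> k n" unfolding k_def
      using r'[of n] r'[of "Suc n"] mono[of n] that
      by (intro cot_antimono) (auto simp: \<theta>_def mult_less_cancel_left1)
    ultimately show ?thesis by simp
  qed
  have E: "expi (f n) = c n * (expi (f n) - expi (f (Suc n)))" if "p \<le> n" "n < q" for n
  proof -
    have "f (Suc n) = f n + \<theta> n + \<nu>" by (simp add: \<theta>_def)
    hence "expi (f (Suc n)) = expi (f n) * expi (\<theta> n)" by (simp add: expi_add)
    moreover have "1 - expi (\<theta> n) \<noteq> 0"
    proof
      assume "1 - expi (\<theta> n) = 0"
      hence "norm (1 - expi (\<theta> n)) = 0" by simp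
      thus False using sin[OF that] \<Delta> by (simp add: norm_one_minus_expi)
    qed
    ultimately show ?thesis unfolding c_def by (simp add: field_simps)
  qed
  \<comment> \<open>The boundary term at \<open>p + d + 1\<close> stays on the left, so that adding
    one summand changes the expression only by a multiple of \<open>c (Suc n) - c n\<close>.\<close>
  have main: "p + d < q \<Longrightarrow> norm ((\<Sum>n\<in>{p..<p + d + 1}. expi (f n)) + c (p + d) * expi (f (p + d + 1)))
      \<le> norm (c p) + (k p - k (p + d)) / 2" for d
  proof (induction d)
    case 0
    thus ?case using E[of p] by (simp add: algebra_simps norm_mult)
  next
    case (Suc d)
    let ?n = "p + d"
    have "(\<Sum>n\<in>{p..<p + Suc d + 1}. expi (f n)) + c (p + Suc d) * expi (f (p + Suc d + 1))
       = (\<Sum>n\<in>{p..<p + d + 1}. expi (f n)) + c (Suc ?n) * expi (f (Suc ?n))"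
      using E[of "Suc ?n"] Suc.prems by (simp add: algebra_simps)
    also have "\<dots> = ((\<Sum>n\<in>{p..<p + d + 1}. expi (f n)) + c (p + d) * expi (f (p + d + 1)))
        + (c (Suc ?n) - c ?n) * expi (f (Suc ?n))"
      by (simp add: algebra_simps)
    also have "norm \<dots> \<le> (norm (c p) + (k p - k (p + d)) / 2) + (k ?n - k (Suc ?n)) / 2"
    proof (rule order.trans[OF norm_triangle_ineq], rule add_mono)
      show "norm ((\<Sum>n\<in>{p..<p + d + 1}. expi (f n)) + c (p + d) * expi (f (p + d + 1))) \<le> norm (c p) + (k p - k (p + d)) / 2"
        by (rule Suc.IH) (use Suc.prems in simp)
      show "norm ((c (Suc ?n) - c ?n) * expi (f (Suc ?n))) \<le> (k ?n - k (Suc ?n)) / 2"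
        using cdiff[of ?n] Suc.prems by (simp only: norm_mult norm_expi) simp
    qed
    finally show ?case by (simp add: field_simps)
  qed
  define d where "d = q - 1 - p"
  have d: "p + d < q" "p + d + 1 = q" "q - 1 = p + d" using True by (auto simp: d_def)
  have "norm (\<Sum>n\<in>{p..<q}. expi (f n)) \<le> norm ((\<Sum>n\<in>{p..<q}. expi (f n)) + c (p+d) * expi (f q)) + norm (c (p+d) * expi (f q))"
    using norm_triangle_ineq4[of "(\<Sum>n\<in>{p..<q}. expi (f n)) + c (p+d) * expi (f q)" "c (p+d) * expi (f q)"] by simp
  also have "\<dots> \<le> (norm (c p) + (k p - k (p + d)) / 2) + norm (c (p+d))"
    using main[OF d(1)] d by (intro add_mono) (auto simp: norm_mult)
  \<comment> \<open>Two values of \<open>c\<close> give \<open>1 / (4 * \<Delta>)\<close> each and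
    the variation of the cotangent \<open>1 / (2 * \<Delta>)\<close>; the sum is exactly
    \<open>1 / \<Delta>\<close>.\<close>
  also have "\<dots> \<le> (1 / (4 * \<Delta>) + (1 / (2 * \<Delta>) + 1 / (2 * \<Delta>)) / 2) + 1 / (4 * \<Delta>)"
    using cn[of p] cn[of "p+d"] kn[of p] kn[of "p+d"] True d by (intro add_mono divide_right_mono) auto
  also have "\<dots> = 1 / \<Delta>" using \<Delta> by (simp add: field_simps)
  finally show ?thesis .
qed

lemma convex_nat_set_eq_interval:
  fixes S :: "nat set"
  assumes "finite S" "\<And>x y z. x \<in> S \<Longrightarrow> z \<in> S \<Longrightarrow> x \<le> y \<Longrightarrow> y \<le> z \<Longrightarrow> y \<in> S"
  shows "\<exists>p q. S = {p..<q}"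
proof (cases "S = {}")
  case True thus ?thesis by (intro exI[of _ 0]) auto
next
  case False
  have "S = {Min S..<Suc (Max S)}"
  proof
    show "S \<subseteq> {Min S..<Suc (Max S)}" using assms(1) by (auto simp: less_Suc_eq_le)
    show "{Min S..<Suc (Max S)} \<subseteq> S"
    proof
      fix y assume "y \<in> {Min S..<Suc (Max S)}"
      thus "y \<in> S" using assms(2)[of "Min S" "Max S" y] assms(1) False by auto
    qed
  qed
  thus ?thesis by blast
qed

lemma card_le_of_spread:
  fixes S :: "nat set" and \<theta> :: "nat \<Rightarrow> real"
  assumes S: "finite S" and \<kappa>: "0 < \<kappa>" and lohi: "lo \<le> hi"
    and rng: "\<And>n. n \<in> S \<Longrightarrow> lo \<le> \<theta> n \<and> \<theta> n \<le> hi"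
    and inc: "\<And>m n. m \<in> S \<Longrightarrow> n \<in> S \<Longrightarrow> m \<le> n \<Longrightarrow> \<kappa> * (real n - real m) \<le> \<theta> n - \<theta> m"
  shows "real (card S) \<le> (hi - lo) / \<kappa> + 1"
proof (cases "S = {}")
  case True thus ?thesis using lohi \<kappa> by simp
next
  case False
  have mm: "Min S \<in> S" "Max S \<in> S" "Min S \<le> Max S" using S False by auto
  have "S \<subseteq> {Min S..Max S}" using S by auto
  hence "card S \<le> card {Min S..Max S}" by (intro card_mono) auto
  hence "real (card S) \<le> real (Max S) - real (Min S) + 1" using mm by auto
  moreover have "\<kappa> * (real (Max S) - real (Min S)) \<le> hi - lo"
    using inc[OF mm] rng[OF mm(1)] rng[OF mm(2)] by linarith
  hence "real (Max S) - real (Min S) \<le> (hi - lo) / \<kappa>" using \<kappa> by (simp add: field_simps)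
  ultimately show ?thesis by linarith
qed

text \<open>The \<open>n\<close> are grouped by the integer part \<nu> of the difference
  \<open>f (Suc n) - f n\<close>. Inside a group the differences at distance at least \<Delta> from
  the integers are covered by \<open>kusmin_landau\<close> at cost \<open>1 / \<Delta>\<close>; the
  rest are counted, at most \<open>\<Delta> / \<kappa> + 1\<close> at each end because consecutive
  differences grow by at least \<kappa>. The choice \<open>\<Delta> = sqrt \<kappa>\<close> balances
  the two costs, and there are at most \<open>C * \<kappa> * (b - a) + 2\<close> groups.\<close>

lemma second_difference_test:
  fixes f :: "nat \<Rightarrow> real"
  assumes \<kappa>: "0 < \<kappa>" "\<kappa> \<le> 1" and C: "1 \<le> C" and True: "a < b"
    and d2: "\<And>n. a \<le> n \<Longrightarrow> Suc n < b \<Longrightarrow>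
      \<kappa> \<le> (f (Suc (Suc n)) - f (Suc n)) - (f (Suc n) - f n) \<and> (f (Suc (Suc n)) - f (Suc n)) - (f (Suc n) - f n) \<le> C * \<kappa>"
  shows "norm (\<Sum>n\<in>{a..<b}. expi (f n)) \<le> (C * \<kappa> * (real b - real a) + 2) * (5 / sqrt \<kappa>)"
proof -
  define \<theta> where "\<theta> n = f (Suc n) - f n" for n
  define \<Delta> where "\<Delta> = sqrt \<kappa>"
  have \<Delta>: "0 < \<Delta>" "\<Delta> \<le> 1" "\<Delta> * \<Delta> = \<kappa>" using \<kappa> by (auto simp: \<Delta>_def)
  have step: "\<kappa> \<le> \<theta> (Suc n) - \<theta> n" "\<theta> (Suc n) - \<theta> n \<le> C * \<kappa>" if "a \<le> n" "Suc n < b" for n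
    using d2[OF that] by (auto simp: \<theta>_def)
  have inc0: "m + d < b \<Longrightarrow> a \<le> m \<Longrightarrow> \<kappa> * real d \<le> \<theta> (m + d) - \<theta> m \<and> \<theta> (m + d) - \<theta> m \<le> C * \<kappa> * real d" for m d
  proof (induction d)
    case (Suc d)
    thus ?case using step[of "m + d"] by (auto simp: algebra_simps)
  qed auto
  have inc: "\<kappa> * (real n - real m) \<le> \<theta> n - \<theta> m" "\<theta> n - \<theta> m \<le> C * \<kappa> * (real n - real m)"
    if "a \<le> m" "m \<le> n" "n < b" for m n
    using inc0[of m "n - m"] that by (auto simp: of_nat_diff)
  have mono: "\<theta> m \<le> \<theta> n" if "a \<le> m" "m \<le> n" "n < b" for m n
  proof -
    have "0 \<le> \<kappa> * (real n - real m)" using that \<kappa> by auto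
    thus ?thesis using inc(1)[OF that] by linarith
  qed
  define A where "A \<nu> = {n \<in> {a..<b}. \<lfloor>\<theta> n\<rfloor> = \<nu>}" for \<nu>
  have A_bound: "norm (\<Sum>n\<in>A \<nu>. expi (f n)) \<le> 5 / sqrt \<kappa>" for \<nu> :: int
  proof -
    define Mid where "Mid = {n \<in> A \<nu>. \<nu> + \<Delta> \<le> \<theta> n \<and> \<theta> n \<le> \<nu> + 1 - \<Delta>}"
    define Lo where "Lo = {n \<in> A \<nu>. \<theta> n \<le> \<nu> + \<Delta>}"
    define Hi where "Hi = {n \<in> A \<nu>. \<nu> + 1 - \<Delta> \<le> \<theta> n}"
    have fin: "finite (A \<nu>)" "finite Mid" "finite Lo" "finite Hi" by (auto simp: A_def Mid_def Lo_def Hi_def)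
    have fl: "\<nu> \<le> \<theta> n \<and> \<theta> n \<le> \<nu> + 1" if "n \<in> A \<nu>" for n using that unfolding A_def by (auto; linarith)
    have "\<exists>p q. Mid = {p..<q}"
    proof (rule convex_nat_set_eq_interval[OF fin(2)])
      fix x y z assume *: "x \<in> Mid" "z \<in> Mid" "x \<le> y" "y \<le> z"
      hence "\<theta> x \<le> \<theta> y" "\<theta> y \<le> \<theta> z" by (auto simp: Mid_def A_def intro!: mono)
      moreover have "a \<le> y" "y < b" using * by (auto simp: Mid_def A_def)
      moreover have "\<nu> \<le> \<theta> x" "\<theta> z < \<nu> + 1" using * \<Delta> unfolding Mid_def by auto
      ultimately show "y \<in> Mid" using * unfolding Mid_def A_def by (auto simp: floor_eq_iff)
    qed
    then obtain p q where pq: "Mid = {p..<q}" by blast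
    have pqM: "n \<in> Mid" if "p \<le> n" "n < q" for n using that pq by auto
    have 1: "norm (\<Sum>n\<in>Mid. expi (f n)) \<le> 1 / \<Delta>"
      unfolding pq
    proof (rule kusmin_landau[where \<nu> = \<nu>])
      fix n assume n: "p \<le> n" "n < q"
      show "\<nu> + \<Delta> \<le> f (Suc n) - f n \<and> f (Suc n) - f n \<le> \<nu> + 1 - \<Delta>"
        using pqM[OF n] by (simp add: Mid_def \<theta>_def)
    next
      fix n assume n: "p \<le> n" "Suc n < q"
      have "n \<in> Mid" "Suc n \<in> Mid" using pqM n by auto
      hence "\<theta> n \<le> \<theta> (Suc n)" by (auto simp: Mid_def A_def intro!: mono)
      thus "f (Suc n) - f n \<le> f (Suc (Suc n)) - f (Suc n)" by (simp add: \<theta>_def)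
    qed (use \<Delta> in auto)
    have incA: "\<kappa> * (real n - real m) \<le> \<theta> n - \<theta> m" if "m \<in> A \<nu>" "n \<in> A \<nu>" "m \<le> n" for m n
      using that by (intro inc) (auto simp: A_def)
    have 2: "real (card Lo) \<le> ((\<nu> + \<Delta>) - \<nu>) / \<kappa> + 1"
      using fin \<kappa>(1) \<Delta>(1) fl incA by (intro card_le_of_spread[where \<theta> = \<theta>]) (auto simp: Lo_def)
    have 3: "real (card Hi) \<le> ((\<nu> + 1) - (\<nu> + 1 - \<Delta>)) / \<kappa> + 1"
      using fin \<kappa>(1) \<Delta>(1) fl incA by (intro card_le_of_spread[where \<theta> = \<theta>]) (auto simp: Hi_def)
    have "A \<nu> - Mid \<subseteq> Lo \<union> Hi" by (auto simp: Mid_def Lo_def Hi_def)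
    hence "card (A \<nu> - Mid) \<le> card (Lo \<union> Hi)" using fin by (intro card_mono) auto
    also have "\<dots> \<le> card Lo + card Hi" by (rule card_Un_le)
    finally have 4: "real (card (A \<nu> - Mid)) \<le> real (card Lo) + real (card Hi)" by linarith
    have "(\<Sum>n\<in>A \<nu>. expi (f n)) = (\<Sum>n\<in>A \<nu> - Mid. expi (f n)) + (\<Sum>n\<in>Mid. expi (f n))"
      using fin by (intro sum.subset_diff) (auto simp: Mid_def)
    also have "norm \<dots> \<le> real (card (A \<nu> - Mid)) + 1 / \<Delta>"
    proof (intro order.trans[OF norm_triangle_ineq] add_mono 1)
      have "norm (\<Sum>n\<in>A \<nu> - Mid. expi (f n)) \<le> (\<Sum>n\<in>A \<nu> - Mid. 1)" by (rule sum_norm_le) simp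
      thus "norm (\<Sum>n\<in>A \<nu> - Mid. expi (f n)) \<le> real (card (A \<nu> - Mid))" by simp
    qed
    also have "\<dots> \<le> 2 * (\<Delta> / \<kappa> + 1) + 1 / \<Delta>" using 2 3 4 by simp
    also have "\<Delta> / \<kappa> = 1 / \<Delta>" using \<Delta> by (metis div_by_0 nonzero_divide_mult_cancel_left less_irrefl)
    also have "2 * (1 / \<Delta> + 1) + 1 / \<Delta> \<le> 5 / \<Delta>" using \<Delta> by (simp add: field_simps)
    finally show ?thesis by (simp add: \<Delta>_def)
  qed
  define \<N> where "\<N> = (\<lambda>n. \<lfloor>\<theta> n\<rfloor>) ` {a..<b}"
  have "\<N> \<subseteq> {\<lfloor>\<theta> a\<rfloor>..\<lfloor>\<theta> (b - 1)\<rfloor>}" using True by (auto simp: \<N>_def intro!: floor_mono mono)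
  hence "card \<N> \<le> card {\<lfloor>\<theta> a\<rfloor>..\<lfloor>\<theta> (b - 1)\<rfloor>}" by (intro card_mono) auto
  also have "\<dots> = nat (\<lfloor>\<theta> (b - 1)\<rfloor> - \<lfloor>\<theta> a\<rfloor> + 1)" by simp
  finally have c1: "real (card \<N>) \<le> real (nat (\<lfloor>\<theta> (b - 1)\<rfloor> - \<lfloor>\<theta> a\<rfloor> + 1))" by simp
  have "\<lfloor>\<theta> a\<rfloor> \<le> \<lfloor>\<theta> (b - 1)\<rfloor>" using True by (intro floor_mono mono) auto
  hence "real (card \<N>) \<le> \<theta> (b - 1) - \<theta> a + 2" using c1 by linarith
  also have "\<dots> \<le> C * \<kappa> * (real (b - 1) - real a) + 2" using inc(2)[of a "b - 1"] True by auto
  also have "\<dots> \<le> C * \<kappa> * (real b - real a) + 2" using C \<kappa> by (auto intro!: mult_left_mono)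
  finally have card: "real (card \<N>) \<le> C * \<kappa> * (real b - real a) + 2" .
  have "(\<Sum>n\<in>{a..<b}. expi (f n)) = (\<Sum>\<nu>\<in>\<N>. \<Sum>n\<in>A \<nu>. expi (f n))"
    unfolding \<N>_def A_def by (rule sum.image_gen) auto
  also have "norm \<dots> \<le> (\<Sum>\<nu>\<in>\<N>. 5 / sqrt \<kappa>)" by (rule sum_norm_le) (rule A_bound)
  also have "\<dots> = real (card \<N>) * (5 / sqrt \<kappa>)" by simp
  also have "\<dots> \<le> (C * \<kappa> * (real b - real a) + 2) * (5 / sqrt \<kappa>)"
    using card \<kappa> by (intro mult_right_mono) auto
  finally show ?thesis .
qed

lemma powr_second_difference:
  fixes \<gamma> t :: real
  assumes "0 < \<gamma>" "\<gamma> < 1" "0 < t"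
  shows "\<exists>\<xi>. t < \<xi> \<and> \<xi> < t + 2 \<and>
     ((t + 2) powr \<gamma> - (t + 1) powr \<gamma>) - ((t + 1) powr \<gamma> - t powr \<gamma>) = - (\<gamma> * (1 - \<gamma>) * \<xi> powr (\<gamma> - 2))"
proof -
  define g where "g s = (s + 1) powr \<gamma> - s powr \<gamma>" for s :: real
  have "\<exists>z. t < z \<and> z < t + 1 \<and> g (t + 1) - g t = (t + 1 - t) * (\<gamma> * (z + 1) powr (\<gamma> - 1) - \<gamma> * z powr (\<gamma> - 1))"
    using assms unfolding g_def by (intro MVT2) (auto intro!: derivative_eq_intros)
  then obtain z where z: "t < z" "z < t + 1" "g (t + 1) - g t = \<gamma> * (z + 1) powr (\<gamma> - 1) - \<gamma> * z powr (\<gamma> - 1)"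
    by auto
  have "\<exists>w. z < w \<and> w < z + 1 \<and> \<gamma> * (z + 1) powr (\<gamma> - 1) - \<gamma> * z powr (\<gamma> - 1)
     = (z + 1 - z) * (\<gamma> * ((\<gamma> - 1) * w powr (\<gamma> - 1 - 1)))"
    using assms z by (intro MVT2) (auto intro!: derivative_eq_intros)
  then obtain w where w: "z < w" "w < z + 1" "\<gamma> * (z + 1) powr (\<gamma> - 1) - \<gamma> * z powr (\<gamma> - 1)
     = \<gamma> * ((\<gamma> - 1) * w powr (\<gamma> - 1 - 1))" by auto
  show ?thesis
    using z w by (intro exI[of _ w]) (auto simp: g_def algebra_simps)
qed

text \<open>Second differences annihilate the linear term, so the bound is uniform in \<alpha>;
  those of \<open>m powr \<gamma>\<close> are of order \<open>M powr (\<gamma> - 2)\<close>. The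
  bound \<open>4 * M + 1\<close> for \<open>b\<close> lets the half-open range reach
  \<open>m = 4 * M\<close>.\<close>

theorem exp_sum_monomial:
  fixes \<gamma> :: real
  assumes \<gamma>: "0 < \<gamma>" "\<gamma> < 1"
  shows "\<exists>C>0. \<forall>M\<ge>1. \<forall>\<alpha> \<beta>. \<forall>a b::nat. \<beta> \<noteq> 0 \<longrightarrow> M \<le> real a \<longrightarrow> real b \<le> 4 * M + 1 \<longrightarrow>
    norm (\<Sum>m\<in>{a..<b}. expi (\<alpha> * real m + \<beta> * real m powr \<gamma>))
      \<le> C * (sqrt \<bar>\<beta>\<bar> * M powr (\<gamma>/2) + M powr (1 - \<gamma>/2) / sqrt \<bar>\<beta>\<bar>)"
proof -
  \<comment> \<open>The intermediate point of a second difference is below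
    \<open>4 * M + 1 \<le> 6 * M\<close>, whence the 6; the ratio of upper to lower bound is then at
    most \<open>6 powr (2 - \<gamma>) \<le> 36\<close>.\<close>
  define c where "c = \<gamma> * (1 - \<gamma>) * 6 powr (\<gamma> - 2)"
  have c: "c > 0" using \<gamma> by (simp add: c_def)
  define C where "C = 720 * sqrt c + 10 / sqrt c"
  have C: "C > 0" using c by (simp add: C_def add_pos_pos)
  have "norm (\<Sum>m\<in>{a..<b}. expi (\<alpha> * real m + \<beta> * real m powr \<gamma>))
      \<le> C * (sqrt \<bar>\<beta>\<bar> * M powr (\<gamma>/2) + M powr (1 - \<gamma>/2) / sqrt \<bar>\<beta>\<bar>)"
    if M: "M \<ge> 1" and \<beta>: "\<beta> \<noteq> 0" and ab: "M \<le> real a" "real b \<le> 4 * M + 1" for M \<alpha> \<beta> :: real and a b :: nat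
  proof -
    define \<kappa> where "\<kappa> = \<bar>\<beta>\<bar> * c * M powr (\<gamma> - 2)"
    have \<kappa>: "\<kappa> > 0" using \<beta> c M by (simp add: \<kappa>_def)
    have sq: "sqrt \<kappa> = sqrt \<bar>\<beta>\<bar> * sqrt c * M powr (\<gamma>/2 - 1)"
    proof -
      have "M powr (\<gamma> - 2) = (M powr (\<gamma>/2 - 1))\<^sup>2" using M by (simp add: power2_eq_square flip: powr_add)
      thus ?thesis by (simp add: \<kappa>_def real_sqrt_mult)
    qed
    have e1: "M * sqrt \<kappa> = sqrt c * (sqrt \<bar>\<beta>\<bar> * M powr (\<gamma>/2))"
    proof -
      have "M * M powr (\<gamma>/2 - 1) = M powr (\<gamma>/2)" using M powr_mult_base[of M "\<gamma>/2 - 1"] by simp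
      thus ?thesis by (simp add: sq)
    qed
    have e2: "1 / sqrt \<kappa> = (1 / sqrt c) * (M powr (1 - \<gamma>/2) / sqrt \<bar>\<beta>\<bar>)"
    proof -
      have "M powr (1 - \<gamma>/2) = 1 / M powr (\<gamma>/2 - 1)" using powr_minus_divide[of M "\<gamma>/2 - 1"] by simp
      thus ?thesis by (simp add: sq)
    qed
    have "norm (\<Sum>m\<in>{a..<b}. expi (\<alpha> * real m + \<beta> * real m powr \<gamma>)) \<le> 720 * (M * sqrt \<kappa>) + 10 * (1 / sqrt \<kappa>)"
    proof (cases "a < b")
      case False thus ?thesis using \<kappa> M by simp
    next
      case ltab: True
      show ?thesis
    proof (cases "\<kappa> \<le> 1")
      case False
      \<comment> \<open>For \<open>\<kappa> > 1\<close> the claimed bound exceeds the number of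
        terms.\<close>
      hence s1: "sqrt \<kappa> \<ge> 1" by simp
      have "norm (\<Sum>m\<in>{a..<b}. expi (\<alpha> * real m + \<beta> * real m powr \<gamma>)) \<le> (\<Sum>m\<in>{a..<b}. 1)"
        by (rule sum_norm_le) simp
      also have "\<dots> \<le> 4 * M + 1" using ab M ltab by (simp add: of_nat_diff)
      also have "\<dots> \<le> 720 * (M * 1)" using M by simp
      also have "\<dots> \<le> 720 * (M * sqrt \<kappa>)" using M s1 by (intro mult_left_mono) auto
      also have "\<dots> \<le> 720 * (M * sqrt \<kappa>) + 10 * (1 / sqrt \<kappa>)" using \<kappa> by simp
      finally show ?thesis .
    next
      case True
      \<comment> \<open>The second difference of \<open>m powr \<gamma>\<close> is negative;
        \<sigma> makes the curvature of the phase positive. A change of sign conjugates the sum and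
        keeps its norm.\<close>
      define \<sigma> where "\<sigma> = (if \<beta> > 0 then -1 else (1::real))"
      have \<sigma>\<beta>: "\<sigma> * \<beta> = - \<bar>\<beta>\<bar>" by (simp add: \<sigma>_def)
      define f where "f m = \<sigma> * (\<alpha> * real m + \<beta> * real m powr \<gamma>)" for m :: nat
      have "norm (\<Sum>m\<in>{a..<b}. expi (f m)) \<le> (36 * \<kappa> * (real b - real a) + 2) * (5 / sqrt \<kappa>)"
      proof (rule second_difference_test)
        fix n assume n: "a \<le> n" "Suc n < b"
        have n0: "M \<le> real n" "real n + 2 \<le> 4 * M + 1" using n ab by linarith+
        obtain \<xi> where \<xi>: "real n < \<xi>" "\<xi> < real n + 2" and eq:
          "((real n + 2) powr \<gamma> - (real n + 1) powr \<gamma>) - ((real n + 1) powr \<gamma> - real n powr \<gamma>) = - (\<gamma> * (1 - \<gamma>) * \<xi> powr (\<gamma> - 2))"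
          using powr_second_difference[of \<gamma> "real n"] \<gamma> n0 M by auto
        have "(f (Suc (Suc n)) - f (Suc n)) - (f (Suc n) - f n)
           = (\<sigma> * \<beta>) * (((real n + 2) powr \<gamma> - (real n + 1) powr \<gamma>) - ((real n + 1) powr \<gamma> - real n powr \<gamma>))"
          by (simp add: f_def algebra_simps)
        also have "\<dots> = \<bar>\<beta>\<bar> * (\<gamma> * (1 - \<gamma>) * \<xi> powr (\<gamma> - 2))" unfolding eq \<sigma>\<beta> by simp
        finally have eq2: "(f (Suc (Suc n)) - f (Suc n)) - (f (Suc n) - f n) = \<bar>\<beta>\<bar> * (\<gamma> * (1 - \<gamma>) * \<xi> powr (\<gamma> - 2))" .
        have "(6 * M) powr (\<gamma> - 2) \<le> \<xi> powr (\<gamma> - 2)" using \<xi> n0 M \<gamma> by (intro powr_mono2') auto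
        hence l: "6 powr (\<gamma> - 2) * M powr (\<gamma> - 2) \<le> \<xi> powr (\<gamma> - 2)" using M by (simp add: powr_mult)
        have "\<xi> powr (\<gamma> - 2) \<le> M powr (\<gamma> - 2)" using \<xi> n0 M \<gamma> by (intro powr_mono2') auto
        also have "\<dots> \<le> 36 * (6 powr (\<gamma> - 2) * M powr (\<gamma> - 2))"
        proof -
          have "6 powr (-2) \<le> 6 powr (\<gamma> - 2)" using \<gamma> by (intro powr_mono) auto
          hence "1 \<le> 36 * 6 powr (\<gamma> - 2)" by (simp add: powr_minus powr_numeral)
          hence "1 * M powr (\<gamma> - 2) \<le> (36 * 6 powr (\<gamma> - 2)) * M powr (\<gamma> - 2)" by (intro mult_right_mono) auto
          thus ?thesis by simp
        qed
        finally have u: "\<xi> powr (\<gamma> - 2) \<le> 36 * (6 powr (\<gamma> - 2) * M powr (\<gamma> - 2))" .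
        have b0: "0 \<le> \<bar>\<beta>\<bar> * (\<gamma> * (1 - \<gamma>))" using \<gamma> by simp
        show "\<kappa> \<le> (f (Suc (Suc n)) - f (Suc n)) - (f (Suc n) - f n) \<and> (f (Suc (Suc n)) - f (Suc n)) - (f (Suc n) - f n) \<le> 36 * \<kappa>"
          unfolding eq2 \<kappa>_def c_def using mult_left_mono[OF l b0] mult_left_mono[OF u b0] by (simp add: mult_ac)
      qed (use \<kappa> True ltab in auto)
      also have "\<dots> \<le> (36 * \<kappa> * (4 * M) + 2) * (5 / sqrt \<kappa>)"
        using ab \<kappa> M by (intro mult_right_mono add_mono mult_left_mono) auto
      also have "\<dots> = 720 * (M * (\<kappa> / sqrt \<kappa>)) + 10 * (1 / sqrt \<kappa>)" by (simp add: add_divide_distrib algebra_simps)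
      also have "\<kappa> / sqrt \<kappa> = sqrt \<kappa>" using \<kappa> by (simp add: real_div_sqrt)
      also have "norm (\<Sum>m\<in>{a..<b}. expi (f m)) = norm (\<Sum>m\<in>{a..<b}. expi (\<alpha> * real m + \<beta> * real m powr \<gamma>))"
      proof (cases "\<beta> > 0")
        case True
        hence "(\<Sum>m\<in>{a..<b}. expi (f m)) = cnj (\<Sum>m\<in>{a..<b}. expi (\<alpha> * real m + \<beta> * real m powr \<gamma>))"
          by (simp add: f_def \<sigma>_def flip: expi_minus)
        thus ?thesis by (simp only: complex_mod_cnj)
      qed (simp add: f_def \<sigma>_def)
      finally show ?thesis .
    qed
    qed
    also have "\<dots> \<le> C * (sqrt \<bar>\<beta>\<bar> * M powr (\<gamma>/2)) + C * (M powr (1 - \<gamma>/2) / sqrt \<bar>\<beta>\<bar>)"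
    proof (intro add_mono)
      show "720 * (M * sqrt \<kappa>) \<le> C * (sqrt \<bar>\<beta>\<bar> * M powr (\<gamma>/2))"
        unfolding e1 C_def using c by (simp add: algebra_simps)
      show "10 * (1 / sqrt \<kappa>) \<le> C * (M powr (1 - \<gamma>/2) / sqrt \<bar>\<beta>\<bar>)"
        unfolding e2 C_def using c by (simp add: algebra_simps)
    qed
    finally show ?thesis by (simp add: algebra_simps)
  qed
  thus ?thesis using C by blast
qed

section \<open>Counting near-coincidences of h n^gamma through the spacing of fractions\<close>

section \<open>Close pairs\<close>

text \<open>Cells of length \<delta> contain at most one value \<open>g r\<close> each.\<close>

lemma card_separated_le:
  fixes g :: "'a \<Rightarrow> real"
  assumes R: "finite R" and \<delta>: "0 < \<delta>" and D: "0 \<le> D"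
    and sep: "\<And>r s. r \<in> R \<Longrightarrow> s \<in> R \<Longrightarrow> r \<noteq> s \<Longrightarrow> \<delta> \<le> \<bar>g r - g s\<bar>"
  shows "real (card {r\<in>R. \<bar>y - g r\<bar> \<le> D}) \<le> 1 + 2 * D / \<delta>"
proof -
  let ?S = "{r\<in>R. \<bar>y - g r\<bar> \<le> D}"
  define \<kappa> where "\<kappa> r = \<lfloor>(g r - y + D) / \<delta>\<rfloor>" for r
  have "inj_on \<kappa> ?S"
  proof (rule inj_onI, rule ccontr)
    fix r s assume rs: "r \<in> ?S" "s \<in> ?S" "\<kappa> r = \<kappa> s" "r \<noteq> s"
    have sep': "\<delta> \<le> \<bar>g r - g s\<bar>" using sep rs by auto
    have "\<bar>(g r - y + D) / \<delta> - (g s - y + D) / \<delta>\<bar> < 1"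
      using rs(3) unfolding \<kappa>_def by linarith
    moreover have "(g r - y + D) / \<delta> - (g s - y + D) / \<delta> = (g r - g s) / \<delta>"
      using \<delta> by (simp add: field_simps)
    ultimately have "\<bar>(g r - g s) / \<delta>\<bar> < 1" by simp
    hence "\<bar>g r - g s\<bar> < \<delta>" using \<delta> by (simp add: abs_divide)
    with sep' show False by simp
  qed
  moreover have "\<kappa> ` ?S \<subseteq> {0..\<lfloor>2 * D / \<delta>\<rfloor>}"
  proof
    fix z assume "z \<in> \<kappa> ` ?S"
    then obtain r where r: "\<bar>y - g r\<bar> \<le> D" "z = \<kappa> r" by auto
    have "0 \<le> (g r - y + D) / \<delta>" "(g r - y + D) / \<delta> \<le> 2 * D / \<delta>"
      using r \<delta> by (auto simp: divide_right_mono)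
    thus "z \<in> {0..\<lfloor>2 * D / \<delta>\<rfloor>}" unfolding r(2) \<kappa>_def by (auto intro: floor_mono)
  qed
  ultimately have "card ?S \<le> card {0..\<lfloor>2 * D / \<delta>\<rfloor>}" by (metis card_image card_mono finite_atLeastAtMost_int)
  also have "\<dots> = nat (\<lfloor>2 * D / \<delta>\<rfloor> + 1)" by simp
  finally have "real (card ?S) \<le> real (nat (\<lfloor>2 * D / \<delta>\<rfloor> + 1))" by simp
  moreover have "0 \<le> 2 * D / \<delta>" using D \<delta> by simp
  ultimately show ?thesis by linarith
qed

lemma card_close_pairs_le:
  fixes f :: "'a \<Rightarrow> real" and g :: "'b \<Rightarrow> real"
  assumes P: "finite P" and R: "finite R" and \<delta>: "0 < \<delta>" and D: "0 \<le> D"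
    and sep: "\<And>r s. r \<in> R \<Longrightarrow> s \<in> R \<Longrightarrow> r \<noteq> s \<Longrightarrow> \<delta> \<le> \<bar>g r - g s\<bar>"
  shows "real (card {(p,r). p \<in> P \<and> r \<in> R \<and> \<bar>f p - g r\<bar> \<le> D}) \<le> real (card P) * (1 + 2 * D / \<delta>)"
proof -
  have "{(p,r). p \<in> P \<and> r \<in> R \<and> \<bar>f p - g r\<bar> \<le> D} = (SIGMA p:P. {r\<in>R. \<bar>f p - g r\<bar> \<le> D})" by auto
  hence "real (card {(p,r). p \<in> P \<and> r \<in> R \<and> \<bar>f p - g r\<bar> \<le> D}) = (\<Sum>p\<in>P. real (card {r\<in>R. \<bar>f p - g r\<bar> \<le> D}))"
    using P R by simp
  also have "\<dots> \<le> (\<Sum>p\<in>P. 1 + 2 * D / \<delta>)"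
    by (intro sum_mono card_separated_le assms)
  finally show ?thesis by simp
qed

text \<open>Fixing the gcd is what makes the fractions \<open>a / b\<close> pairwise distinct;
  without it one value would be taken by many pairs and no spacing could hold.\<close>

definition gcd_block :: "real \<Rightarrow> nat \<Rightarrow> (nat \<times> nat) set" where
  "gcd_block N d = {(a, b). N < real a \<and> real a \<le> 2 * N \<and> N < real b \<and> real b \<le> 2 * N \<and> gcd a b = d}"

lemma gcd_block_subset:
  assumes "d > 0"
  shows "gcd_block N d \<subseteq> (\<lambda>(u, v). (d * u, d * v)) ` ({1..nat \<lfloor>2 * N / d\<rfloor>} \<times> {1..nat \<lfloor>2 * N / d\<rfloor>})"
proof
  fix p assume "p \<in> gcd_block N d"
  then obtain a b where p: "p = (a, b)" and ab: "N < real a" "real a \<le> 2 * N" "N < real b" "real b \<le> 2 * N" "gcd a b = d"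
    by (auto simp: gcd_block_def)
  obtain u v where uv: "a = d * u" "b = d * v" using ab(5) by (metis dvd_def gcd_dvd1 gcd_dvd2)
  have "a > 0" "b > 0" using ab by (auto intro!: gr0I)
  hence "u > 0" "v > 0" using uv by auto
  moreover have "real u \<le> 2 * N / d" "real v \<le> 2 * N / d"
    using ab uv assms by (simp_all add: field_simps)
  hence "u \<le> nat \<lfloor>2 * N / d\<rfloor>" "v \<le> nat \<lfloor>2 * N / d\<rfloor>" by (simp_all add: le_nat_floor)
  ultimately show "p \<in> (\<lambda>(u, v). (d * u, d * v)) ` ({1..nat \<lfloor>2 * N / d\<rfloor>} \<times> {1..nat \<lfloor>2 * N / d\<rfloor>})"
    unfolding p uv by (intro image_eqI[of _ _ "(u, v)"]) auto
qed

lemma finite_gcd_block: "d > 0 \<Longrightarrow> finite (gcd_block N d)"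
  by (rule finite_subset[OF gcd_block_subset]) auto

lemma card_gcd_block_le:
  assumes "d > 0" "N > 0"
  shows "real (card (gcd_block N d)) \<le> 4 * N\<^sup>2 / (real d)\<^sup>2"
proof -
  let ?k = "nat \<lfloor>2 * N / d\<rfloor>"
  have "card (gcd_block N d) \<le> card ((\<lambda>(u, v). (d * u, d * v)) ` ({1..?k} \<times> {1..?k}))"
    by (intro card_mono gcd_block_subset assms) auto
  also have "\<dots> \<le> card ({1..?k} \<times> {1..?k})" by (intro card_image_le) auto
  also have "\<dots> = ?k * ?k" by simp
  finally have "real (card (gcd_block N d)) \<le> real ?k * real ?k" by (metis of_nat_le_iff of_nat_mult)
  also have "\<dots> \<le> (2 * N / d) * (2 * N / d)" using assms by (intro mult_mono) auto
  finally show ?thesis by (simp add: power2_eq_square)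
qed

text \<open>In lowest terms the denominators are at most \<open>2 * N / d\<close>, and distinct
  fractions differ by at least the reciprocal of the product of their denominators.\<close>

lemma gcd_block_separated:
  assumes "d > 0" "N > 0" and p: "(a, b) \<in> gcd_block N d" "(a', b') \<in> gcd_block N d" "(a, b) \<noteq> (a', b')"
  shows "(real d)\<^sup>2 / (4 * N\<^sup>2) \<le> \<bar>real a / real b - real a' / real b'\<bar>"
proof -
  have ab: "0 < real b" "real b \<le> 2 * N" "gcd a b = d" "0 < real b'" "real b' \<le> 2 * N" "gcd a' b' = d" "N < real b'" "N < real b"
    using p assms(2) by (auto simp: gcd_block_def)
  obtain u v where uv: "a = d * u" "b = d * v" "coprime u v"
    using gcd_coprime_exists[of a b] ab(3) assms(1) by (auto simp: mult.commute)
  obtain u' v' where uv': "a' = d * u'" "b' = d * v'" "coprime u' v'"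
    using gcd_coprime_exists[of a' b'] ab(6) assms(1) by (auto simp: mult.commute)
  have v: "v > 0" "v' > 0" using ab(1,4) uv(2) uv'(2) by (auto intro!: gr0I)
  have ne: "u * v' \<noteq> u' * v"
  proof
    assume "u * v' = u' * v"
    hence "u = u' \<and> v = v'" using coprime_crossproduct_nat[of u v' u' v] uv(3) uv'(3)
      by (metis coprime_commute coprime_crossproduct_nat mult.commute)
    thus False using p(3) uv uv' by simp
  qed
  have "1 \<le> \<bar>real u * real v' - real u' * real v\<bar>"
  proof -
    have "\<bar>int (u * v') - int (u' * v)\<bar> \<ge> 1" using ne by linarith
    hence "real_of_int \<bar>int (u * v') - int (u' * v)\<bar> \<ge> 1" by linarith
    thus ?thesis by simp
  qed
  hence "1 / (real v * real v') \<le> \<bar>real u * real v' - real u' * real v\<bar> / (real v * real v')"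
    using v by (intro divide_right_mono) auto
  also have "\<dots> = \<bar>(real u * real v' - real u' * real v) / (real v * real v')\<bar>" using v by (simp add: abs_mult)
  also have "(real u * real v' - real u' * real v) / (real v * real v') = real a / real b - real a' / real b'"
    using v assms(1) by (simp add: uv uv' field_simps)
  finally have 1: "1 / (real v * real v') \<le> \<bar>real a / real b - real a' / real b'\<bar>" .
  have "(real d)\<^sup>2 / (4 * N\<^sup>2) \<le> 1 / (real v * real v')"
  proof -
    have "real v \<le> 2 * N / d" "real v' \<le> 2 * N / d" using ab uv uv' assms(1) by (simp_all add: field_simps)
    hence "real v * real v' \<le> (2 * N / d) * (2 * N / d)" using v assms by (intro mult_mono) auto
    hence "1 / ((2 * N / d) * (2 * N / d)) \<le> 1 / (real v * real v')" using v assms by (intro divide_left_mono) auto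
    thus ?thesis by (simp add: power2_eq_square)
  qed
  thus ?thesis using 1 by linarith
qed

text \<open>Transfers the spacing of the ratios \<open>n1 / n2\<close>, which are at most 2 within a
  dyadic block, to their powers with exponent \<gamma>.\<close>

lemma powr_diff_ge:
  fixes x y \<gamma> :: real
  assumes \<gamma>: "0 < \<gamma>" "\<gamma> < 1" and xy: "0 < x" "x \<le> 2" "0 < y" "y \<le> 2"
  shows "\<gamma> / 2 * \<bar>x - y\<bar> \<le> \<bar>x powr \<gamma> - y powr \<gamma>\<bar>"
proof -
  have *: "\<gamma> / 2 * (v - u) \<le> v powr \<gamma> - u powr \<gamma>" if "0 < u" "u < v" "v \<le> 2" for u v :: real
  proof -
    have "\<exists>z. u < z \<and> z < v \<and> v powr \<gamma> - u powr \<gamma> = (v - u) * (\<gamma> * z powr (\<gamma> - 1))"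
      using that by (intro MVT2) (auto intro!: derivative_eq_intros)
    then obtain z where z: "u < z" "z < v" "v powr \<gamma> - u powr \<gamma> = (v - u) * (\<gamma> * z powr (\<gamma> - 1))" by blast
    have "1 / 2 = (2::real) powr (-1)" by (simp add: powr_minus)
    also have "\<dots> \<le> 2 powr (\<gamma> - 1)" using \<gamma> by (intro powr_mono) auto
    also have "\<dots> \<le> z powr (\<gamma> - 1)" using z that \<gamma> by (intro powr_mono2') auto
    finally have "\<gamma> * (1 / 2) \<le> \<gamma> * z powr (\<gamma> - 1)" using \<gamma> by (intro mult_left_mono) auto
    hence "(v - u) * (\<gamma> * (1 / 2)) \<le> (v - u) * (\<gamma> * z powr (\<gamma> - 1))" by (rule mult_left_mono) (use that in simp)
    hence "(v - u) * (\<gamma> * (1 / 2)) \<le> v powr \<gamma> - u powr \<gamma>" by (simp only: z(3))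
    moreover have "\<gamma> / 2 * (v - u) = (v - u) * (\<gamma> * (1 / 2))" by simp
    ultimately show ?thesis by (simp only:)
  qed
  show ?thesis
  proof (cases x y rule: linorder_cases)
    case less
    thus ?thesis using *[of x y] xy by (simp add: abs_minus_commute powr_mono2 less_imp_le) (smt (verit))
  next
    case greater
    thus ?thesis using *[of y x] xy by simp (smt (verit))
  qed simp
qed

lemma min_square_le:
  fixes s t :: real
  assumes "0 \<le> s" "0 \<le> t"
  shows "min (s\<^sup>2) (t\<^sup>2) \<le> s * t"
proof (cases "s \<le> t")
  case True
  hence "s * s \<le> s * t" using assms by (intro mult_left_mono) auto
  thus ?thesis by (simp add: power2_eq_square min.coboundedI1)
next
  case False
  hence "t * t \<le> s * t" using assms by (intro mult_right_mono) auto
  thus ?thesis by (simp add: power2_eq_square min.coboundedI2)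
qed

lemma sum_inverse_le_ln:
  assumes "n \<ge> 1"
  shows "(\<Sum>d=1..n. 1 / real d) \<le> 1 + ln (real n)"
proof -
  have "harm (Suc (n - 1)) - ln (real (Suc (n - 1))) \<le> harm (Suc 0) - ln (real (Suc 0))"
    by (rule decseqD[OF decseq_harm_diff_ln]) simp
  hence "harm n - ln (real n) \<le> (1::real)" using assms by (simp add: harm_def)
  thus ?thesis by (simp add: harm_def divide_inverse)
qed

text \<open>Division by \<open>h1 * n2 powr \<gamma>\<close> turns the condition into
  \<open>(n1 / n2) powr \<gamma>\<close> being within \<open>D\<close> of \<open>h2 / h1\<close>.
  Once both gcds are fixed, either family is well spaced, so the pairs can be counted from either
  side; the sum over the gcds costs two logarithms.\<close>

theorem card_close_products_le:
  fixes H N D \<gamma> :: real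
  assumes \<gamma>: "0 < \<gamma>" "\<gamma> < 1" and HN: "1 \<le> H" "1 \<le> N" and D: "0 \<le> D"
  defines "S \<equiv> {h::nat. H < real h \<and> real h \<le> 2 * H} \<times> {n::nat. N < real n \<and> real n \<le> 2 * N}"
  defines "v \<equiv> \<lambda>p. real (fst p) * real (snd p) powr \<gamma>"
  shows "real (card {(p, p'). p \<in> S \<and> p' \<in> S \<and> \<bar>v p - v p'\<bar> \<le> D * H * N powr \<gamma>})
    \<le> 64 / \<gamma> * (1 + ln (2 * N)) * (1 + ln (2 * H)) * (H * N + D * H\<^sup>2 * N\<^sup>2)"
proof -
  define f where "f p = (real (fst p) / real (snd p)) powr \<gamma>" for p :: "nat \<times> nat"
  define g where "g p = real (fst p) / real (snd p)" for p :: "nat \<times> nat"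
  define T where "T d e = {(p, r). p \<in> gcd_block N d \<and> r \<in> gcd_block H e \<and> \<bar>f p - g r\<bar> \<le> D}" for d e
  define \<phi> :: "(nat\<times>nat)\<times>(nat\<times>nat) \<Rightarrow> (nat\<times>nat)\<times>(nat\<times>nat)" where "\<phi> = (\<lambda>((n1,n2),(h2,h1)). ((h1,n1),(h2,n2)))"
  define X where "X = H * N + D * H\<^sup>2 * N\<^sup>2"
  have X: "X \<ge> 0" using HN D by (simp add: X_def)
  let ?Q = "{(p, p'). p \<in> S \<and> p' \<in> S \<and> \<bar>v p - v p'\<bar> \<le> D * H * N powr \<gamma>}"
  let ?ds = "{1..nat \<lfloor>2 * N\<rfloor>}" and ?es = "{1..nat \<lfloor>2 * H\<rfloor>}"
  have Tb: "finite (T d e) \<and> real (card (T d e)) \<le> 64 / \<gamma> * X * (1 / real d * (1 / real e))" if de: "d > 0" "e > 0" for d e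
  proof -
    have sepH: "(real e)\<^sup>2 / (4 * H\<^sup>2) \<le> \<bar>g r - g s\<bar>" if "r \<in> gcd_block H e" "s \<in> gcd_block H e" "r \<noteq> s" for r s
      using gcd_block_separated[of e H "fst r" "snd r" "fst s" "snd s"] that de HN by (simp add: g_def prod_eq_iff)
    have sepN: "\<gamma> * (real d)\<^sup>2 / (8 * N\<^sup>2) \<le> \<bar>f r - f s\<bar>" if rs: "r \<in> gcd_block N d" "s \<in> gcd_block N d" "r \<noteq> s" for r s
    proof -
      have le: "real (fst r) / real (snd r) \<le> 2 \<and> 0 < real (fst r) / real (snd r)" if "r \<in> gcd_block N d" for r
        using that HN by (auto simp: gcd_block_def field_simps)
      have "\<gamma> * (real d)\<^sup>2 / (8 * N\<^sup>2) = \<gamma> / 2 * ((real d)\<^sup>2 / (4 * N\<^sup>2))" by simp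
      also have "\<dots> \<le> \<gamma> / 2 * \<bar>real (fst r) / real (snd r) - real (fst s) / real (snd s)\<bar>"
        using gcd_block_separated[of d N "fst r" "snd r" "fst s" "snd s"] rs de HN \<gamma>
        by (intro mult_left_mono) (auto simp: prod_eq_iff)
      also have "\<dots> \<le> \<bar>f r - f s\<bar>" unfolding f_def using le[OF rs(1)] le[OF rs(2)] \<gamma>
        by (intro powr_diff_ge) auto
      finally show ?thesis .
    qed
    have finT: "finite (T d e)"
      by (rule finite_subset[of _ "gcd_block N d \<times> gcd_block H e"]) (auto simp: T_def finite_gcd_block de)
    have 1: "real (card (T d e)) \<le> real (card (gcd_block N d)) * (1 + 2 * D / ((real e)\<^sup>2 / (4 * H\<^sup>2)))"
      unfolding T_def using de HN D sepH by (intro card_close_pairs_le) (auto simp: finite_gcd_block)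
    have "card (T d e) = card ((\<lambda>(p, r). (r, p)) ` T d e)"
      by (rule card_image[symmetric]) (auto simp: inj_on_def)
    also have "(\<lambda>(p, r). (r, p)) ` T d e = {(r, p). r \<in> gcd_block H e \<and> p \<in> gcd_block N d \<and> \<bar>g r - f p\<bar> \<le> D}"
      by (auto simp: T_def image_def abs_minus_commute)
    finally have "real (card (T d e)) \<le> real (card (gcd_block H e)) * (1 + 2 * D / (\<gamma> * (real d)\<^sup>2 / (8 * N\<^sup>2)))"
      using de HN D \<gamma> sepN by (simp only:, intro card_close_pairs_le) (auto simp: finite_gcd_block)
    also have "\<dots> \<le> 4 * H\<^sup>2 / (real e)\<^sup>2 * (1 + 2 * D / (\<gamma> * (real d)\<^sup>2 / (8 * N\<^sup>2)))"
      using card_gcd_block_le[of e H] de HN D \<gamma> by (intro mult_right_mono) auto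
    also have "\<dots> = 4 * (H / e)\<^sup>2 + 64 / \<gamma> * D * H\<^sup>2 * N\<^sup>2 / ((real d)\<^sup>2 * (real e)\<^sup>2)"
      using de \<gamma> HN by (simp add: field_simps power2_eq_square)
    finally have 2: "real (card (T d e)) \<le> 4 * (H / e)\<^sup>2 + 64 / \<gamma> * D * H\<^sup>2 * N\<^sup>2 / ((real d)\<^sup>2 * (real e)\<^sup>2)" .
    have "real (card (T d e)) \<le> 4 * N\<^sup>2 / (real d)\<^sup>2 * (1 + 2 * D / ((real e)\<^sup>2 / (4 * H\<^sup>2)))"
      using 1 card_gcd_block_le[of d N] de HN D by (elim order.trans) (intro mult_right_mono, auto)
    also have "\<dots> = 4 * (N / d)\<^sup>2 + 32 * D * H\<^sup>2 * N\<^sup>2 / ((real d)\<^sup>2 * (real e)\<^sup>2)"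
      using de HN by (simp add: field_simps power2_eq_square)
    also have "\<dots> \<le> 4 * (N / d)\<^sup>2 + 64 / \<gamma> * D * H\<^sup>2 * N\<^sup>2 / ((real d)\<^sup>2 * (real e)\<^sup>2)"
      using \<gamma> D by (intro add_left_mono divide_right_mono mult_right_mono) (auto simp: field_simps)
    finally have 3: "real (card (T d e)) \<le> 4 * (N / d)\<^sup>2 + 64 / \<gamma> * D * H\<^sup>2 * N\<^sup>2 / ((real d)\<^sup>2 * (real e)\<^sup>2)" .
    \<comment> \<open>The two counts differ in the diagonal term only. The geometric mean of
      \<open>(H / e)\<^sup>2\<close> and \<open>(N / d)\<^sup>2\<close> is the choice that sums over
      \<open>d\<close> and \<open>e\<close> to logarithms and keeps \<open>H * N\<close>.\<close>
    have "min ((H / e)\<^sup>2) ((N / d)\<^sup>2) \<le> (H / e) * (N / d)"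
      by (rule min_square_le) (use HN in simp_all)
    hence "real (card (T d e)) \<le> 4 * ((H / e) * (N / d)) + 64 / \<gamma> * D * H\<^sup>2 * N\<^sup>2 / ((real d)\<^sup>2 * (real e)\<^sup>2)"
      using 2 3 by linarith
    also have "\<dots> \<le> 64 / \<gamma> * ((H / e) * (N / d)) + 64 / \<gamma> * D * H\<^sup>2 * N\<^sup>2 / (real d * real e)"
    proof (intro add_mono mult_right_mono divide_left_mono)
      show "real d * real e \<le> (real d)\<^sup>2 * (real e)\<^sup>2" using de by (intro mult_mono) (auto simp: power2_eq_square)
    qed (use \<gamma> D HN de in \<open>auto simp: field_simps\<close>)
    also have "\<dots> = 64 / \<gamma> * X * (1 / real d * (1 / real e))"
      by (simp add: X_def add_divide_distrib algebra_simps)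
    finally show ?thesis using finT by blast
  qed
  have "?Q \<subseteq> (\<Union>d\<in>?ds. \<Union>e\<in>?es. \<phi> ` T d e)"
  proof
    fix z assume "z \<in> ?Q"
    then obtain h1 n1 h2 n2 where z: "z = ((h1,n1),(h2,n2))" and
      h: "H < real h1" "real h1 \<le> 2 * H" "H < real h2" "real h2 \<le> 2 * H" and
      n: "N < real n1" "real n1 \<le> 2 * N" "N < real n2" "real n2 \<le> 2 * N" and
      c: "\<bar>real h1 * real n1 powr \<gamma> - real h2 * real n2 powr \<gamma>\<bar> \<le> D * H * N powr \<gamma>"
      by (auto simp: S_def v_def)
    have pos: "h1 > 0" "h2 > 0" "n1 > 0" "n2 > 0" using h n HN by (auto intro!: gr0I)
    define d e where "d = gcd n1 n2" and "e = gcd h2 h1"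
    have "d > 0" "e > 0" using pos by (auto simp: d_def e_def)
    moreover have "d \<le> n1" "e \<le> h1" using pos by (auto simp: d_def e_def)
    hence "d \<le> nat \<lfloor>2 * N\<rfloor>" "e \<le> nat \<lfloor>2 * H\<rfloor>" using n h by (auto intro!: le_nat_floor)
    ultimately have de: "d \<in> ?ds" "e \<in> ?es" by auto
    have "f (n1, n2) - g (h2, h1) = (real h1 * real n1 powr \<gamma> - real h2 * real n2 powr \<gamma>) / (real h1 * real n2 powr \<gamma>)"
      using pos by (simp add: f_def g_def powr_divide field_simps)
    hence "\<bar>f (n1, n2) - g (h2, h1)\<bar> \<le> (D * H * N powr \<gamma>) / (real h1 * real n2 powr \<gamma>)"
      using c pos by (simp add: abs_divide abs_mult divide_right_mono)
    also have "\<dots> \<le> (D * H * N powr \<gamma>) / (H * N powr \<gamma>)"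
      using h n HN D \<gamma> by (intro divide_left_mono mult_mono powr_mono2) auto
    also have "\<dots> = D" using HN by simp
    finally have "((n1, n2), (h2, h1)) \<in> T d e"
      using h n by (simp add: T_def gcd_block_def d_def e_def)
    hence "z \<in> \<phi> ` T d e" unfolding z by (intro image_eqI[of _ _ "((n1, n2), (h2, h1))"]) (auto simp: \<phi>_def)
    thus "z \<in> (\<Union>d\<in>?ds. \<Union>e\<in>?es. \<phi> ` T d e)" using de by blast
  qed
  hence "card ?Q \<le> card (\<Union>d\<in>?ds. \<Union>e\<in>?es. \<phi> ` T d e)"
    by (rule card_mono[rotated]) (use Tb in auto)
  also have "\<dots> \<le> (\<Sum>d\<in>?ds. card (\<Union>e\<in>?es. \<phi> ` T d e))" by (rule card_UN_le) auto
  also have "\<dots> \<le> (\<Sum>d\<in>?ds. \<Sum>e\<in>?es. card (\<phi> ` T d e))" by (intro sum_mono card_UN_le) auto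
  also have "\<dots> \<le> (\<Sum>d\<in>?ds. \<Sum>e\<in>?es. card (T d e))" using Tb by (intro sum_mono card_image_le) auto
  finally have "real (card ?Q) \<le> (\<Sum>d\<in>?ds. \<Sum>e\<in>?es. real (card (T d e)))"
    by (metis (mono_tags, lifting) of_nat_le_iff of_nat_sum sum.cong)
  also have "\<dots> \<le> (\<Sum>d\<in>?ds. \<Sum>e\<in>?es. 64 / \<gamma> * X * (1 / real d * (1 / real e)))"
    using Tb by (intro sum_mono) auto
  also have "\<dots> = 64 / \<gamma> * X * ((\<Sum>d\<in>?ds. 1 / real d) * (\<Sum>e\<in>?es. 1 / real e))"
    unfolding sum_product by (simp only: sum_distrib_left)
  also have "\<dots> \<le> 64 / \<gamma> * X * ((1 + ln (2 * N)) * (1 + ln (2 * H)))"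
  proof (intro mult_left_mono mult_mono)
    have *: "(\<Sum>d\<in>{1..nat \<lfloor>2 * N\<rfloor>}. 1 / real d) \<le> 1 + ln (2 * N)" if "N \<ge> 1" for N :: real
    proof -
      have "nat \<lfloor>2 * N\<rfloor> \<ge> 1" using that by linarith
      hence "(\<Sum>d\<in>{1..nat \<lfloor>2 * N\<rfloor>}. 1 / real d) \<le> 1 + ln (real (nat \<lfloor>2 * N\<rfloor>))" by (rule sum_inverse_le_ln)
      also have "ln (real (nat \<lfloor>2 * N\<rfloor>)) \<le> ln (2 * N)" using \<open>nat \<lfloor>2 * N\<rfloor> \<ge> 1\<close> that by (subst ln_le_cancel_iff) auto
      finally show ?thesis by simp
    qed
    show "(\<Sum>d\<in>?ds. 1 / real d) \<le> 1 + ln (2 * N)" "(\<Sum>e\<in>?es. 1 / real e) \<le> 1 + ln (2 * H)"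
      using * HN by auto
  qed (use X \<gamma> HN in \<open>auto intro!: sum_nonneg\<close>)
  also have "64 / \<gamma> * X * ((1 + ln (2 * N)) * (1 + ln (2 * H))) = 64 / \<gamma> * (1 + ln (2 * N)) * (1 + ln (2 * H)) * X"
    by (simp only: mult.assoc mult.commute[of X])
  finally show ?thesis by (simp only: X_def)
qed

section \<open>Type II sums: Cauchy's inequality over classes of pairs\<close>

section \<open>Bilinear sums\<close>

lemma norm_sum_le_card_classes:
  fixes z :: "'p \<Rightarrow> complex" and cl :: "'p \<Rightarrow> int"
  assumes S: "finite S" and k: "real (card (cl ` S)) \<le> k"
  shows "(norm (\<Sum>p\<in>S. z p))\<^sup>2 \<le> k * (\<Sum>j\<in>cl ` S. (norm (\<Sum>p\<in>{p\<in>S. cl p = j}. z p))\<^sup>2)"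
proof -
  have "(\<Sum>p\<in>S. z p) = (\<Sum>j\<in>cl ` S. \<Sum>p\<in>{p\<in>S. cl p = j}. z p)" by (rule sum.image_gen[OF S])
  hence "norm (\<Sum>p\<in>S. z p) \<le> (\<Sum>j\<in>cl ` S. norm (\<Sum>p\<in>{p\<in>S. cl p = j}. z p))" by (simp add: norm_sum)
  hence "(norm (\<Sum>p\<in>S. z p))\<^sup>2 \<le> (\<Sum>j\<in>cl ` S. norm (\<Sum>p\<in>{p\<in>S. cl p = j}. z p))\<^sup>2"
    by (intro power_mono) auto
  also have "\<dots> \<le> (\<Sum>j\<in>cl ` S. (norm (\<Sum>p\<in>{p\<in>S. cl p = j}. z p))\<^sup>2) * card (cl ` S)"
    by (rule sum_squared_le_sum_of_squares)
  also have "\<dots> \<le> (\<Sum>j\<in>cl ` S. (norm (\<Sum>p\<in>{p\<in>S. cl p = j}. z p))\<^sup>2) * k"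
    using k by (intro mult_left_mono) (auto intro!: sum_nonneg)
  finally show ?thesis by (simp add: mult.commute)
qed

lemma sum_norm_square_le_pairs:
  fixes z :: "'p \<Rightarrow> 'm \<Rightarrow> complex"
  shows "(\<Sum>m\<in>A. (norm (\<Sum>p\<in>P. z p m))\<^sup>2) \<le> (\<Sum>p\<in>P. \<Sum>p'\<in>P. norm (\<Sum>m\<in>A. z p m * cnj (z p' m)))"
proof -
  have "complex_of_real (\<Sum>m\<in>A. (norm (\<Sum>p\<in>P. z p m))\<^sup>2) = (\<Sum>m\<in>A. (\<Sum>p\<in>P. z p m) * cnj (\<Sum>p\<in>P. z p m))"
    by (simp only: of_real_sum complex_norm_square)
  also have "\<dots> = (\<Sum>m\<in>A. \<Sum>p\<in>P. \<Sum>p'\<in>P. z p m * cnj (z p' m))" by (simp add: sum_product)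
  also have "\<dots> = (\<Sum>p\<in>P. \<Sum>m\<in>A. \<Sum>p'\<in>P. z p m * cnj (z p' m))" by (rule sum.swap)
  also have "\<dots> = (\<Sum>p\<in>P. \<Sum>p'\<in>P. \<Sum>m\<in>A. z p m * cnj (z p' m))" by (intro sum.cong refl sum.swap)
  finally have eq: "complex_of_real (\<Sum>m\<in>A. (norm (\<Sum>p\<in>P. z p m))\<^sup>2) = (\<Sum>p\<in>P. \<Sum>p'\<in>P. \<Sum>m\<in>A. z p m * cnj (z p' m))" .
  have "(\<Sum>m\<in>A. (norm (\<Sum>p\<in>P. z p m))\<^sup>2) = norm (complex_of_real (\<Sum>m\<in>A. (norm (\<Sum>p\<in>P. z p m))\<^sup>2))"
    by (simp only: norm_of_real) (simp add: sum_nonneg)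
  also have "\<dots> \<le> (\<Sum>p\<in>P. \<Sum>p'\<in>P. norm (\<Sum>m\<in>A. z p m * cnj (z p' m)))"
    unfolding eq by (intro sum_norm_le order.refl)
  finally show ?thesis .
qed

text \<open>\<open>c h\<close> is meant for the phases that remove absolute values from the sum over
  \<open>h\<close>. Cauchy's inequality over \<open>m\<close> and over about \<open>K\<close>
  classes leaves pairs \<open>p\<close>, \<open>p'\<close> with
  \<open>\<bar>v p - v p'\<bar> \<le> W\<close>. This difference is the coefficient of
  \<open>m powr \<gamma>\<close> in the sum over \<open>m\<close>, and there are fewer such pairs
  for smaller \<open>W\<close>, while the factor \<open>K\<close> in front penalises many
  classes.\<close>

theorem bilinear_bound:
  fixes \<gamma> :: real
  assumes \<gamma>: "0 < \<gamma>" "\<gamma> < 1"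
  shows "\<exists>C>0. \<forall>M\<ge>1. \<forall>N\<ge>1. \<forall>H\<ge>1. \<forall>K\<ge>1. \<forall>A\<ge>0. \<forall>B\<ge>0. \<forall>\<alpha>. \<forall>(a :: nat \<Rightarrow> complex) (b :: nat \<Rightarrow> complex) (c :: nat \<Rightarrow> complex) (J :: nat \<Rightarrow> real set).
    (\<forall>m. M \<le> real m \<and> real m \<le> 4 * M \<longrightarrow> norm (a m) \<le> A) \<longrightarrow> (\<forall>n. N < real n \<and> real n \<le> 2 * N \<longrightarrow> norm (b n) \<le> B) \<longrightarrow>
    (\<forall>h. norm (c h) \<le> 1) \<longrightarrow> (\<forall>h. is_interval (J h)) \<longrightarrow>
    (norm (\<Sum>h | H < real h \<and> real h \<le> 2 * H. c h * (\<Sum>m | M \<le> real m \<and> real m \<le> 4 * M.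
        \<Sum>n | N < real n \<and> real n \<le> 2 * N \<and> real (m * n) \<in> J h.
          a m * b n * expi (\<alpha> * real (m * n) + real h * real (m * n) powr \<gamma>))))\<^sup>2
    \<le> C * A\<^sup>2 * B\<^sup>2 * (1 + ln (2 * N)) * (1 + ln (2 * H)) * M * K * (H * N * M + (H * N + H\<^sup>2 * N\<^sup>2 / K) *
        (sqrt (H * N powr \<gamma> / K) * M powr (\<gamma>/2) + M powr (1 - \<gamma>/2) * N powr ((1 - \<gamma>) / 2)))"
proof -
  obtain C1 where C1: "C1 > 0" and monomial: "\<And>M \<alpha> \<beta> (a::nat) b. M \<ge> 1 \<Longrightarrow> \<beta> \<noteq> 0 \<Longrightarrow> M \<le> real a \<Longrightarrow> real b \<le> 4 * M + 1 \<Longrightarrow>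
    norm (\<Sum>m\<in>{a..<b}. expi (\<alpha> * real m + \<beta> * real m powr \<gamma>))
      \<le> C1 * (sqrt \<bar>\<beta>\<bar> * M powr (\<gamma>/2) + M powr (1 - \<gamma>/2) / sqrt \<bar>\<beta>\<bar>)"
    using exp_sum_monomial[OF \<gamma>] by blast
  define C where "C = 20 * (512 / \<gamma> + C1 * (64 / \<gamma>))"
  have C: "C > 0" using C1 \<gamma> by (simp add: C_def add_pos_pos)
  show ?thesis
  proof (intro exI[of _ C] conjI C allI impI)
    fix M N H K A B \<alpha> :: real and a b c :: "nat \<Rightarrow> complex" and J :: "nat \<Rightarrow> real set"
    assume MNHK: "1 \<le> M" "1 \<le> N" "1 \<le> H" "1 \<le> K" and AB: "0 \<le> A" "0 \<le> B"
      and a: "\<forall>m. M \<le> real m \<and> real m \<le> 4 * M \<longrightarrow> norm (a m) \<le> A"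
      and b: "\<forall>n. N < real n \<and> real n \<le> 2 * N \<longrightarrow> norm (b n) \<le> B"
      and c: "\<forall>h. norm (c h) \<le> 1" and J: "\<forall>h. is_interval (J h)"
    define Ms where "Ms = {m::nat. M \<le> real m \<and> real m \<le> 4 * M}"
    define Hs where "Hs = {h::nat. H < real h \<and> real h \<le> 2 * H}"
    define Ns where "Ns = {n::nat. N < real n \<and> real n \<le> 2 * N}"
    define S where "S = Hs \<times> Ns"
    have finM: "finite Ms" unfolding Ms_def by (rule finite_subset[of _ "{..nat \<lfloor>4 * M\<rfloor>}"]) (auto simp: le_nat_floor)
    have finH: "finite Hs" unfolding Hs_def by (rule finite_subset[of _ "{..nat \<lfloor>2 * H\<rfloor>}"]) (auto simp: le_nat_floor)
    have finN: "finite Ns" unfolding Ns_def by (rule finite_subset[of _ "{..nat \<lfloor>2 * N\<rfloor>}"]) (auto simp: le_nat_floor)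
    have finS: "finite S" using finH finN by (simp add: S_def)
    have cardM: "real (card Ms) \<le> 4 * M"
    proof -
      have "Ms \<subseteq> {1..nat \<lfloor>4 * M\<rfloor>}" using MNHK by (auto simp: Ms_def le_nat_floor)
      hence "card Ms \<le> nat \<lfloor>4 * M\<rfloor>" using card_mono[of "{1..nat \<lfloor>4 * M\<rfloor>}" Ms] by simp
      thus ?thesis using MNHK by linarith
    qed
    define v where "v p = real (fst p) * real (snd p) powr \<gamma>" for p :: "nat \<times> nat"
    \<comment> \<open>\<open>v\<close> stays below \<open>4 * H * N powr \<gamma>\<close>, so cells
      of length \<open>W\<close> form at most \<open>5 * K\<close> classes.\<close>
    define W where "W = H * N powr \<gamma> / K"
    have W: "W > 0" using MNHK by (simp add: W_def)
    define cl where "cl p = \<lfloor>v p / W\<rfloor>" for p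
    define z where "z p m = (if real (m * snd p) \<in> J (fst p) then c (fst p) * b (snd p) * expi (\<alpha> * real (m * snd p) + real (fst p) * real (m * snd p) powr \<gamma>) else 0)"
      for p :: "nat \<times> nat" and m :: nat
    define \<Theta> where "\<Theta> = C1 * (sqrt W * M powr (\<gamma>/2) + M powr (1 - \<gamma>/2) * N powr ((1 - \<gamma>) / 2))"
    have \<Theta>: "\<Theta> \<ge> 0" unfolding \<Theta>_def using C1 W by simp
    have "(\<Sum>h\<in>Hs. c h * (\<Sum>m\<in>Ms. \<Sum>n | N < real n \<and> real n \<le> 2 * N \<and> real (m * n) \<in> J h.
          a m * b n * expi (\<alpha> * real (m * n) + real h * real (m * n) powr \<gamma>)))
       = (\<Sum>h\<in>Hs. \<Sum>m\<in>Ms. \<Sum>n\<in>Ns. a m * z (h, n) m)"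
    proof (unfold sum_distrib_left, rule sum.cong[OF refl], rule sum.cong[OF refl])
      fix h m
      have eq: "{n. N < real n \<and> real n \<le> 2 * N \<and> real (m * n) \<in> J h} = {n\<in>Ns. real (m * n) \<in> J h}" by (auto simp: Ns_def)
      show "(\<Sum>n | N < real n \<and> real n \<le> 2 * N \<and> real (m * n) \<in> J h. c h * (a m * b n * expi (\<alpha> * real (m * n) + real h * real (m * n) powr \<gamma>)))
        = (\<Sum>n\<in>Ns. a m * z (h, n) m)"
        unfolding eq by (subst sum.inter_filter[OF finN]) (intro sum.cong refl, simp add: z_def)
    qed
    also have "\<dots> = (\<Sum>m\<in>Ms. a m * (\<Sum>p\<in>S. z p m))"
      unfolding S_def by (subst sum.swap) (simp add: sum_distrib_left sum.cartesian_product case_prod_beta)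
    finally have T_eq: "(\<Sum>h\<in>Hs. c h * (\<Sum>m\<in>Ms. \<Sum>n | N < real n \<and> real n \<le> 2 * N \<and> real (m * n) \<in> J h.
          a m * b n * expi (\<alpha> * real (m * n) + real h * real (m * n) powr \<gamma>))) = (\<Sum>m\<in>Ms. a m * (\<Sum>p\<in>S. z p m))" .
    have vrng: "0 < v p \<and> v p \<le> 4 * H * N powr \<gamma>" if "p \<in> S" for p
    proof -
      have hn: "H < real (fst p)" "real (fst p) \<le> 2 * H" "N < real (snd p)" "real (snd p) \<le> 2 * N"
        using that by (auto simp: S_def Hs_def Ns_def)
      have "real (snd p) powr \<gamma> \<le> (2 * N) powr \<gamma>" using hn \<gamma> MNHK by (intro powr_mono2) auto
      also have "\<dots> = 2 powr \<gamma> * N powr \<gamma>" using MNHK by (simp add: powr_mult)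
      also have "\<dots> \<le> 2 powr 1 * N powr \<gamma>" using \<gamma> by (intro mult_right_mono powr_mono) auto
      finally have "real (snd p) powr \<gamma> \<le> 2 * N powr \<gamma>" by simp
      hence "v p \<le> (2 * H) * (2 * N powr \<gamma>)" unfolding v_def using hn MNHK by (intro mult_mono) auto
      moreover have "0 < v p" unfolding v_def using hn MNHK by (intro mult_pos_pos) auto
      ultimately show ?thesis by simp
    qed
    have card_cl: "real (card (cl ` S)) \<le> 5 * K"
    proof -
      have "cl ` S \<subseteq> {0..\<lfloor>4 * K\<rfloor>}"
      proof
        fix j assume "j \<in> cl ` S"
        then obtain p where p: "p \<in> S" "j = \<lfloor>v p / W\<rfloor>" by (auto simp: cl_def)
        have "v p / W \<le> 4 * H * N powr \<gamma> / W" using vrng[OF p(1)] W by (intro divide_right_mono) auto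
        also have "\<dots> = 4 * K" using MNHK by (simp add: W_def)
        finally have "v p / W \<le> 4 * K" .
        moreover have "0 \<le> v p / W" using vrng[OF p(1)] W by simp
        ultimately show "j \<in> {0..\<lfloor>4 * K\<rfloor>}" unfolding p(2) by (auto intro: floor_mono)
      qed
      hence "card (cl ` S) \<le> card {0..\<lfloor>4 * K\<rfloor>}" by (intro card_mono) auto
      also have "\<dots> = nat (\<lfloor>4 * K\<rfloor> + 1)" by simp
      finally have "real (card (cl ` S)) \<le> real (nat (\<lfloor>4 * K\<rfloor> + 1))" by simp
      thus ?thesis using MNHK by linarith
    qed
    define G where "G p p' = norm (\<Sum>m\<in>Ms. z p m * cnj (z p' m))" for p p'
    define R where "R D = {(p, p'). p \<in> S \<and> p' \<in> S \<and> \<bar>v p - v p'\<bar> \<le> D * H * N powr \<gamma>}" for D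
    have finR: "finite (R D)" for D by (rule finite_subset[of _ "S \<times> S"]) (auto simp: R_def finS)
    have cardR: "real (card (R D)) \<le> 64 / \<gamma> * (1 + ln (2 * N)) * (1 + ln (2 * H)) * (H * N + D * H\<^sup>2 * N\<^sup>2)" if "D \<ge> 0" for D
      using card_close_products_le[OF \<gamma> MNHK(3) MNHK(2) that] unfolding R_def S_def Hs_def Ns_def v_def by simp
    have zb: "norm (z p m) \<le> B" if "p \<in> S" for p m
    proof -
      have bb: "norm (b (snd p)) \<le> B" using that b by (auto simp: S_def Ns_def)
      have "norm (c (fst p)) * norm (b (snd p)) \<le> 1 * B" using bb c by (intro mult_mono) auto
      thus ?thesis using AB by (simp add: z_def norm_mult)
    qed
    have G_triv: "G p p' \<le> B\<^sup>2 * (4 * M)" if "p \<in> S" "p' \<in> S" for p p'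
    proof -
      have "G p p' \<le> (\<Sum>m\<in>Ms. B * B)" unfolding G_def
        using zb[OF that(1)] zb[OF that(2)] AB by (intro sum_norm_le) (auto simp: norm_mult intro!: mult_mono)
      also have "\<dots> = B\<^sup>2 * real (card Ms)" by (simp add: power2_eq_square)
      also have "\<dots> \<le> B\<^sup>2 * (4 * M)" using cardM by (intro mult_left_mono) auto
      finally show ?thesis .
    qed
    have G_far: "G p p' \<le> B\<^sup>2 * \<Theta>" if p: "p \<in> S" "p' \<in> S" and far: "\<bar>v p - v p'\<bar> > N powr (\<gamma> - 1)" and near: "\<bar>v p - v p'\<bar> \<le> W" for p p'
    proof -
      obtain h n h' n' where pp: "p = (h, n)" "p' = (h', n')" by (cases p, cases p')
      \<comment> \<open>For fixed \<open>p\<close> and \<open>p'\<close> the two conditions on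
        \<open>m\<close> describe intervals, so \<open>m\<close> runs through consecutive integers
        and \<open>monomial\<close> applies.\<close>
      define A0 where "A0 = {m\<in>Ms. real (m * n) \<in> J h \<and> real (m * n') \<in> J h'}"
      have "\<exists>x y. A0 = {x..<y}"
      proof (rule convex_nat_set_eq_interval)
        show "finite A0" using finM by (auto simp: A0_def)
        fix x y w assume *: "x \<in> A0" "w \<in> A0" "x \<le> y" "y \<le> w"
        have "real (y * n) \<in> J h"
          using J[rule_format, of h] * unfolding is_interval_1 A0_def
          by (smt (verit, best) mem_Collect_eq mult_le_mono1 of_nat_le_iff)
        moreover have "real (y * n') \<in> J h'"
          using J[rule_format, of h'] * unfolding is_interval_1 A0_def
          by (smt (verit, best) mem_Collect_eq mult_le_mono1 of_nat_le_iff)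
        moreover have "M \<le> real y" "real y \<le> 4 * M" using * unfolding A0_def Ms_def by (auto; linarith)+
        ultimately show "y \<in> A0" by (auto simp: A0_def Ms_def)
      qed
      then obtain x y where xy: "A0 = {x..<y}" by blast
      define \<beta> where "\<beta> = v p - v p'"
      have "(\<Sum>m\<in>Ms. z p m * cnj (z p' m)) = (\<Sum>m\<in>A0. z p m * cnj (z p' m))"
        unfolding A0_def using finM by (intro sum.mono_neutral_right) (auto simp: z_def pp)
      also have "\<dots> = (\<Sum>m\<in>A0. (c h * b n * cnj (c h' * b n')) * expi (\<alpha> * (real n - real n') * real m + \<beta> * real m powr \<gamma>))"
      proof (intro sum.cong refl)
        fix m assume m: "m \<in> A0"
        have "expi (\<alpha> * real (m * n) + real h * real (m * n) powr \<gamma>) * cnj (expi (\<alpha> * real (m * n') + real h' * real (m * n') powr \<gamma>))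
           = expi (\<alpha> * (real n - real n') * real m + \<beta> * real m powr \<gamma>)"
          unfolding expi_diff[symmetric] by (rule arg_cong[of _ _ expi]) (simp add: \<beta>_def v_def pp powr_mult algebra_simps)
        thus "z p m * cnj (z p' m) = (c h * b n * cnj (c h' * b n')) * expi (\<alpha> * (real n - real n') * real m + \<beta> * real m powr \<gamma>)"
          using m by (simp add: z_def pp A0_def mult_ac)
      qed
      also have "\<dots> = (c h * b n * cnj (c h' * b n')) * (\<Sum>m\<in>A0. expi (\<alpha> * (real n - real n') * real m + \<beta> * real m powr \<gamma>))"
        by (simp only: sum_distrib_left)
      finally have "G p p' = norm (c h * b n * cnj (c h' * b n')) * norm (\<Sum>m\<in>A0. expi (\<alpha> * (real n - real n') * real m + \<beta> * real m powr \<gamma>))"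
        unfolding G_def by (simp only: norm_mult)
      also have "\<dots> \<le> B\<^sup>2 * \<Theta>"
      proof (intro mult_mono)
        have "norm (c h * b n) \<le> 1 * B" "norm (c h' * b n') \<le> 1 * B"
          using p b c unfolding norm_mult by (intro mult_mono; auto simp: S_def Ns_def pp)+
        hence "norm (c h * b n) * norm (c h' * b n') \<le> B * B" using AB by (intro mult_mono) auto
        thus "norm (c h * b n * cnj (c h' * b n')) \<le> B\<^sup>2" by (simp add: norm_mult power2_eq_square)
        show "norm (\<Sum>m\<in>A0. expi (\<alpha> * (real n - real n') * real m + \<beta> * real m powr \<gamma>)) \<le> \<Theta>"
        proof (cases "x < y")
          case False thus ?thesis using \<Theta> by (simp add: xy)
        next
          case True
          have \<beta>0: "\<beta> \<noteq> 0" using far unfolding \<beta>_def by (smt (verit) powr_ge_zero)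
          have "x \<in> A0" "y - 1 \<in> A0" using True xy by auto
          hence "M \<le> real x" "real y \<le> 4 * M + 1" using True by (auto simp: A0_def Ms_def)
          hence "norm (\<Sum>m\<in>A0. expi (\<alpha> * (real n - real n') * real m + \<beta> * real m powr \<gamma>))
             \<le> C1 * (sqrt \<bar>\<beta>\<bar> * M powr (\<gamma>/2) + M powr (1 - \<gamma>/2) / sqrt \<bar>\<beta>\<bar>)"
            unfolding xy by (intro monomial MNHK \<beta>0)
          also have "\<dots> \<le> \<Theta>" unfolding \<Theta>_def
          proof (intro mult_left_mono add_mono mult_right_mono)
            show "sqrt \<bar>\<beta>\<bar> \<le> sqrt W" using near by (simp add: \<beta>_def)
            have "sqrt (N powr (\<gamma> - 1)) \<le> sqrt \<bar>\<beta>\<bar>" using far by (simp add: \<beta>_def)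
            moreover have "sqrt (N powr (\<gamma> - 1)) = N powr ((\<gamma> - 1) / 2)" using MNHK by (simp add: powr_half_sqrt[symmetric] powr_powr)
            ultimately have "M powr (1 - \<gamma>/2) / sqrt \<bar>\<beta>\<bar> \<le> M powr (1 - \<gamma>/2) / N powr ((\<gamma> - 1) / 2)"
              using MNHK \<beta>0 by (intro divide_left_mono) auto
            also have "1 / N powr ((\<gamma> - 1) / 2) = N powr (- ((\<gamma> - 1) / 2))" by (simp only: powr_minus_divide)
            hence "M powr (1 - \<gamma>/2) / N powr ((\<gamma> - 1) / 2) = M powr (1 - \<gamma>/2) * N powr ((1 - \<gamma>) / 2)"
              by (metis divide_inverse inverse_eq_divide minus_diff_eq minus_divide_left mult_1)
            finally show "M powr (1 - \<gamma>/2) / sqrt \<bar>\<beta>\<bar> \<le> M powr (1 - \<gamma>/2) * N powr ((1 - \<gamma>) / 2)" .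
          qed (use C1 in auto)
          finally show ?thesis .
        qed
      qed (use \<Theta> AB in auto)
      finally show ?thesis .
    qed
    \<comment> \<open>At scale \<open>D1\<close> the two terms of the count agree, so the number of
      pairs is still that of the diagonal up to logarithms; pairs this close are estimated
      trivially. \<open>D2\<close> is the scale of a class.\<close>
    define D1 D2 where "D1 = 1 / (H * N)" and "D2 = 1 / K"
    have D1: "D1 * H * N powr \<gamma> = N powr (\<gamma> - 1)" using MNHK by (simp add: D1_def powr_diff)
    have D2: "D2 * H * N powr \<gamma> = W" by (simp add: D2_def W_def)
    define \<L> where "\<L> = (1 + ln (2 * N)) * (1 + ln (2 * H))"
    have \<L>: "\<L> \<ge> 0" unfolding \<L>_def using MNHK by (intro mult_nonneg_nonneg) (auto intro!: add_nonneg_nonneg ln_ge_zero)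
    have "(\<Sum>m\<in>Ms. (norm (\<Sum>p\<in>S. z p m))\<^sup>2) \<le> (\<Sum>m\<in>Ms. 5 * K * (\<Sum>j\<in>cl ` S. (norm (\<Sum>p\<in>{p\<in>S. cl p = j}. z p m))\<^sup>2))"
      by (intro sum_mono norm_sum_le_card_classes finS card_cl)
    also have "\<dots> = 5 * K * (\<Sum>j\<in>cl ` S. \<Sum>m\<in>Ms. (norm (\<Sum>p\<in>{p\<in>S. cl p = j}. z p m))\<^sup>2)"
      by (subst sum.swap) (simp add: sum_distrib_left)
    also have "\<dots> \<le> 5 * K * (\<Sum>j\<in>cl ` S. \<Sum>p\<in>{p\<in>S. cl p = j}. \<Sum>p'\<in>{p\<in>S. cl p = j}. G p p')"
      unfolding G_def using MNHK by (intro mult_left_mono sum_mono sum_norm_square_le_pairs) auto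
    also have "(\<Sum>j\<in>cl ` S. \<Sum>p\<in>{p\<in>S. cl p = j}. \<Sum>p'\<in>{p\<in>S. cl p = j}. G p p')
        = (\<Sum>j\<in>cl ` S. \<Sum>p\<in>{p\<in>S. cl p = j}. \<Sum>p'\<in>{p'\<in>S. cl p' = cl p}. G p p')"
      by (intro sum.cong refl) auto
    also have "\<dots> = (\<Sum>p\<in>S. \<Sum>p'\<in>{p'\<in>S. cl p' = cl p}. G p p')"
      by (rule sum.image_gen[OF finS, symmetric])
    also have "\<dots> = (\<Sum>(p, p')\<in>(SIGMA p:S. {p'\<in>S. cl p' = cl p}). G p p')"
      by (rule sum.Sigma) (auto simp: finS)
    also have "\<dots> \<le> (\<Sum>(p, p')\<in>R D2. G p p')"
    proof (intro sum_mono2 finR)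
      show "(SIGMA p:S. {p'\<in>S. cl p' = cl p}) \<subseteq> R D2"
      proof
        fix u assume "u \<in> (SIGMA p:S. {p'\<in>S. cl p' = cl p})"
        then obtain p p' where u: "u = (p, p')" "p \<in> S" "p' \<in> S" "cl p' = cl p" by auto
        have "\<bar>v p / W - v p' / W\<bar> < 1" using u(4) unfolding cl_def by linarith
        moreover have "v p / W - v p' / W = (v p - v p') / W" by (simp add: diff_divide_distrib)
        ultimately have "\<bar>v p - v p'\<bar> / W < 1" using W by (simp add: abs_divide)
        hence "\<bar>v p - v p'\<bar> \<le> W" using W by (simp add: field_simps)
        thus "u \<in> R D2" using u D2 by (simp add: R_def)
      qed
    qed (auto simp: G_def)
    also have "\<dots> \<le> (\<Sum>(p, p')\<in>R D2. (if (p, p') \<in> R D1 then B\<^sup>2 * (4 * M) else 0) + B\<^sup>2 * \<Theta>)"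
    proof (intro sum_mono, clarify)
      fix h n h' n' assume u: "((h, n), (h', n')) \<in> R D2"
      show "G (h, n) (h', n') \<le> (if ((h, n), h', n') \<in> R D1 then B\<^sup>2 * (4 * M) else 0) + B\<^sup>2 * \<Theta>"
      proof (cases "((h, n), h', n') \<in> R D1")
        case True
        hence "G (h, n) (h', n') \<le> B\<^sup>2 * (4 * M)" by (intro G_triv) (auto simp: R_def)
        thus ?thesis using True \<Theta> by (simp add: add_increasing2)
      next
        case False
        have "G (h, n) (h', n') \<le> B\<^sup>2 * \<Theta>"
          using u False D1 D2 by (intro G_far) (auto simp: R_def)
        thus ?thesis using False by simp
      qed
    qed
    also have "\<dots> = (\<Sum>u\<in>R D2. if u \<in> R D1 then B\<^sup>2 * (4 * M) else 0) + real (card (R D2)) * (B\<^sup>2 * \<Theta>)"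
      by (simp add: case_prod_beta sum.distrib)
    also have "(\<Sum>u\<in>R D2. if u \<in> R D1 then B\<^sup>2 * (4 * M) else 0) = real (card (R D2 \<inter> R D1)) * (B\<^sup>2 * (4 * M))"
      by (simp add: sum.If_cases finR Int_def)
    also have "real (card (R D2 \<inter> R D1)) * (B\<^sup>2 * (4 * M)) \<le> (64 / \<gamma> * \<L> * (2 * (H * N))) * (B\<^sup>2 * (4 * M))"
    proof (intro mult_right_mono)
      have "card (R D2 \<inter> R D1) \<le> card (R D1)" by (intro card_mono finR) auto
      hence "real (card (R D2 \<inter> R D1)) \<le> real (card (R D1))" by simp
      also have "\<dots> \<le> 64 / \<gamma> * (1 + ln (2 * N)) * (1 + ln (2 * H)) * (H * N + D1 * H\<^sup>2 * N\<^sup>2)"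
        using MNHK by (intro cardR) (auto simp: D1_def)
      also have "D1 * H\<^sup>2 * N\<^sup>2 = H * N" using MNHK by (simp add: D1_def power2_eq_square)
      finally show "real (card (R D2 \<inter> R D1)) \<le> 64 / \<gamma> * \<L> * (2 * (H * N))" by (simp only: \<L>_def mult.assoc mult_2)
    qed (use MNHK in auto)
    also have "real (card (R D2)) * (B\<^sup>2 * \<Theta>) \<le> (64 / \<gamma> * \<L> * (H * N + H\<^sup>2 * N\<^sup>2 / K)) * (B\<^sup>2 * \<Theta>)"
    proof (rule mult_right_mono)
      have e: "D2 * H\<^sup>2 * N\<^sup>2 = H\<^sup>2 * N\<^sup>2 / K" by (simp add: D2_def)
      have "D2 \<ge> 0" using MNHK by (simp add: D2_def)
      from cardR[OF this, unfolded e] show "real (card (R D2)) \<le> 64 / \<gamma> * \<L> * (H * N + H\<^sup>2 * N\<^sup>2 / K)"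
        by (simp only: \<L>_def mult.assoc)
    qed (use \<Theta> in simp)
    finally have Zb: "(\<Sum>m\<in>Ms. (norm (\<Sum>p\<in>S. z p m))\<^sup>2) \<le> 5 * K * ((64 / \<gamma> * \<L> * (2 * (H * N))) * (B\<^sup>2 * (4 * M)) + (64 / \<gamma> * \<L> * (H * N + H\<^sup>2 * N\<^sup>2 / K)) * (B\<^sup>2 * \<Theta>))"
      using MNHK by (simp add: mult_left_mono)
    define Y where "Y = sqrt W * M powr (\<gamma>/2) + M powr (1 - \<gamma>/2) * N powr ((1 - \<gamma>) / 2)"
    have Y: "Y \<ge> 0" using W by (simp add: Y_def)
    have "norm (\<Sum>m\<in>Ms. a m * (\<Sum>p\<in>S. z p m)) \<le> (\<Sum>m\<in>Ms. A * norm (\<Sum>p\<in>S. z p m))"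
      using a by (intro sum_norm_le) (auto simp: norm_mult Ms_def intro!: mult_right_mono)
    also have "\<dots> = A * (\<Sum>m\<in>Ms. norm (\<Sum>p\<in>S. z p m))" by (simp add: sum_distrib_left)
    finally have "(norm (\<Sum>m\<in>Ms. a m * (\<Sum>p\<in>S. z p m)))\<^sup>2 \<le> (A * (\<Sum>m\<in>Ms. norm (\<Sum>p\<in>S. z p m)))\<^sup>2"
      by (intro power_mono) auto
    also have "\<dots> = A\<^sup>2 * (\<Sum>m\<in>Ms. norm (\<Sum>p\<in>S. z p m))\<^sup>2" by (simp add: power_mult_distrib)
    also have "\<dots> \<le> A\<^sup>2 * ((\<Sum>m\<in>Ms. (norm (\<Sum>p\<in>S. z p m))\<^sup>2) * card Ms)"
      by (intro mult_left_mono sum_squared_le_sum_of_squares) auto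
    also have "\<dots> \<le> A\<^sup>2 * ((5 * K * ((64 / \<gamma> * \<L> * (2 * (H * N))) * (B\<^sup>2 * (4 * M)) + (64 / \<gamma> * \<L> * (H * N + H\<^sup>2 * N\<^sup>2 / K)) * (B\<^sup>2 * \<Theta>))) * (4 * M))"
    proof (rule mult_left_mono, rule mult_mono[OF Zb cardM order.trans[OF sum_nonneg Zb]])
    qed auto
    also have "\<dots> = (20 * (512 / \<gamma>)) * A\<^sup>2 * B\<^sup>2 * \<L> * M * K * (H * N * M) + (20 * (C1 * (64 / \<gamma>))) * A\<^sup>2 * B\<^sup>2 * \<L> * M * K * ((H * N + H\<^sup>2 * N\<^sup>2 / K) * Y)"
      unfolding \<Theta>_def Y_def[symmetric] using \<gamma> by (simp add: add_divide_distrib algebra_simps)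
    also have "\<dots> \<le> C * A\<^sup>2 * B\<^sup>2 * \<L> * M * K * (H * N * M) + C * A\<^sup>2 * B\<^sup>2 * \<L> * M * K * ((H * N + H\<^sup>2 * N\<^sup>2 / K) * Y)"
      using \<gamma> C1 \<L> MNHK Y unfolding C_def by (intro add_mono mult_right_mono) auto
    also have "\<dots> = C * A\<^sup>2 * B\<^sup>2 * \<L> * M * K * (H * N * M + (H * N + H\<^sup>2 * N\<^sup>2 / K) * Y)"
      by (simp only: distrib_left)
    finally have fin: "(norm (\<Sum>m\<in>Ms. a m * (\<Sum>p\<in>S. z p m)))\<^sup>2 \<le> C * A\<^sup>2 * B\<^sup>2 * \<L> * M * K * (H * N * M + (H * N + H\<^sup>2 * N\<^sup>2 / K) * Y)" .
    show "(norm (\<Sum>h | H < real h \<and> real h \<le> 2 * H. c h * (\<Sum>m | M \<le> real m \<and> real m \<le> 4 * M.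
        \<Sum>n | N < real n \<and> real n \<le> 2 * N \<and> real (m * n) \<in> J h.
          a m * b n * expi (\<alpha> * real (m * n) + real h * real (m * n) powr \<gamma>))))\<^sup>2
    \<le> C * A\<^sup>2 * B\<^sup>2 * (1 + ln (2 * N)) * (1 + ln (2 * H)) * M * K * (H * N * M + (H * N + H\<^sup>2 * N\<^sup>2 / K) *
        (sqrt (H * N powr \<gamma> / K) * M powr (\<gamma>/2) + M powr (1 - \<gamma>/2) * N powr ((1 - \<gamma>) / 2)))"
      using fin unfolding T_eq[symmetric] unfolding Hs_def Ms_def \<L>_def Y_def W_def by (simp only: mult.assoc)
  qed
qed

section \<open>The differenced power (t + q)^gamma - t^gamma as a van der Corput phase\<close>

section \<open>Exponent pairs for differenced powers\<close>

text \<open>The mean value theorem gives \<open>\<gamma> * q * z powr (\<gamma> - 1)\<close> for the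
  difference, with \<open>z\<close> between \<open>t\<close> and \<open>t + q\<close>; the power
  \<open>1 / (1 - \<gamma>)\<close> turns \<open>z powr (\<gamma> - 1)\<close> into
  \<open>1 / z\<close>. The value is thus \<open>N / t\<close> up to a relative error of order
  \<open>q / t\<close>.\<close>

definition shift_ratio :: "real \<Rightarrow> real \<Rightarrow> real \<Rightarrow> real \<Rightarrow> real" where
  "shift_ratio \<gamma> q N t = N * (((t + q) powr \<gamma> - t powr \<gamma>) / (\<gamma> * q)) powr (1 / (1 - \<gamma>))"

lemma shift_ratio_eq_divide:
  assumes \<gamma>: "0 < \<gamma>" "\<gamma> < 1" and q: "0 < q" and t: "0 < t"
  shows "\<exists>z. t < z \<and> z < t + q \<and> shift_ratio \<gamma> q N t = N / z"
proof -
  have "\<exists>z. t < z \<and> z < t + q \<and> (t + q) powr \<gamma> - t powr \<gamma> = (t + q - t) * (\<gamma> * z powr (\<gamma> - 1))"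
    using q t by (intro MVT2) (auto intro!: derivative_eq_intros)
  then obtain z where z: "t < z" "z < t + q" "(t + q) powr \<gamma> - t powr \<gamma> = q * (\<gamma> * z powr (\<gamma> - 1))" by auto
  have e1: "((t + q) powr \<gamma> - t powr \<gamma>) / (\<gamma> * q) = z powr (\<gamma> - 1)" unfolding z(3) using \<gamma> q by simp
  have e2: "(z powr (\<gamma> - 1)) powr (1 / (1 - \<gamma>)) = z powr (-1)"
  proof -
    have "(\<gamma> - 1) * (1 / (1 - \<gamma>)) = -1" using \<gamma> by (simp add: field_simps)
    thus ?thesis by (simp only: powr_powr)
  qed
  have "shift_ratio \<gamma> q N t = N * z powr (-1)" by (simp only: shift_ratio_def e1 e2)
  hence "shift_ratio \<gamma> q N t = N / z" using z t by (simp add: powr_minus divide_inverse)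
  thus ?thesis using z by blast
qed

text \<open>The derivative of \<open>t powr \<gamma>\<close> decreases, hence so does the
  difference; monotonicity is what partial summation over weights in \<open>\<rho> n\<close> relies
  on.\<close>

lemma shift_ratio_antimono:
  assumes \<gamma>: "0 < \<gamma>" "\<gamma> < 1" and q: "0 < q" and st: "0 < s" "s \<le> t" and N: "0 \<le> N"
  shows "shift_ratio \<gamma> q N t \<le> shift_ratio \<gamma> q N s"
proof -
  have "(t + q) powr \<gamma> - t powr \<gamma> \<le> (s + q) powr \<gamma> - s powr \<gamma>"
  proof (rule DERIV_nonpos_imp_nonincreasing[OF st(2)])
    fix x assume x: "s \<le> x" "x \<le> t"
    have "((\<lambda>t. (t + q) powr \<gamma> - t powr \<gamma>) has_real_derivative \<gamma> * (x + q) powr (\<gamma> - 1) - \<gamma> * x powr (\<gamma> - 1)) (at x)"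
      using x st q by (auto intro!: derivative_eq_intros)
    moreover have "(x + q) powr (\<gamma> - 1) \<le> x powr (\<gamma> - 1)" using x st q \<gamma> by (intro powr_mono2') auto
    hence "\<gamma> * (x + q) powr (\<gamma> - 1) - \<gamma> * x powr (\<gamma> - 1) \<le> 0" using \<gamma> by simp
    ultimately show "\<exists>y. ((\<lambda>t. (t + q) powr \<gamma> - t powr \<gamma>) has_real_derivative y) (at x) \<and> y \<le> 0" by blast
  qed
  moreover have "0 \<le> (t + q) powr \<gamma> - t powr \<gamma>" using st q \<gamma> by (simp add: powr_mono2)
  ultimately show ?thesis unfolding shift_ratio_def using \<gamma> q N
    by (intro mult_left_mono powr_mono2 divide_right_mono divide_nonneg_nonneg) auto
qed

text \<open>Base of the factor by which \<open>shift_ratio\<close> deviates from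
  \<open>N / t\<close>, as a function of the complex variable \<open>w = q / t\<close>. Complex
  arguments give all derivatives at once through Cauchy's inequality.\<close>

definition shift_unit :: "real \<Rightarrow> complex \<Rightarrow> complex" where
  "shift_unit \<gamma> w = ((1 + w) powr of_real \<gamma> - 1) / (of_real \<gamma> * w)"

lemma shift_unit_tendsto:
  assumes "0 < \<gamma>"
  shows "(shift_unit \<gamma> \<longlongrightarrow> 1) (at 0)"
proof -
  have "((\<lambda>w. (1 + w) powr complex_of_real \<gamma>) has_field_derivative of_real \<gamma>) (at 0)"
    by (auto intro!: derivative_eq_intros)
  hence "((\<lambda>h. ((1 + (0 + h)) powr complex_of_real \<gamma> - (1 + 0) powr complex_of_real \<gamma>) / h) \<longlongrightarrow> of_real \<gamma>) (at 0)"
    by (simp only: DERIV_def)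
  hence "((\<lambda>h. ((1 + h) powr complex_of_real \<gamma> - 1) / h / of_real \<gamma>) \<longlongrightarrow> of_real \<gamma> / of_real \<gamma>) (at 0)"
    using assms by (intro tendsto_divide tendsto_const) auto
  moreover have "(\<lambda>h. ((1 + h) powr complex_of_real \<gamma> - 1) / h / of_real \<gamma>) = shift_unit \<gamma>"
    by (auto simp: shift_unit_def fun_eq_iff mult.commute)
  ultimately show ?thesis using assms by simp
qed

lemma shift_unit_approx:
  assumes "0 < \<gamma>" "0 < \<epsilon>"
  shows "\<exists>d>0. d \<le> 1/2 \<and> (\<forall>w. w \<noteq> 0 \<and> norm w < d \<longrightarrow> norm (shift_unit \<gamma> w - 1) < 1/2 \<and> norm (shift_unit \<gamma> w powr of_real s - 1) < \<epsilon>)"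
proof -
  have "((\<lambda>w. shift_unit \<gamma> w powr of_real s) \<longlongrightarrow> 1 powr of_real s) (at 0)"
    by (intro tendsto_powr_complex shift_unit_tendsto assms tendsto_const) auto
  hence "eventually (\<lambda>w. dist (shift_unit \<gamma> w powr of_real s) 1 < \<epsilon>) (at 0)" using assms(2) by (auto dest: tendstoD)
  moreover have "eventually (\<lambda>w. dist (shift_unit \<gamma> w) 1 < 1/2) (at 0)"
    using tendstoD[OF shift_unit_tendsto[OF assms(1)], of "1/2"] by simp
  ultimately have "eventually (\<lambda>w. dist (shift_unit \<gamma> w) 1 < 1/2 \<and> dist (shift_unit \<gamma> w powr of_real s) 1 < \<epsilon>) (at 0)"
    by eventually_elim auto
  then obtain d where d: "d > 0" "\<And>w. w \<noteq> 0 \<Longrightarrow> dist w 0 < d \<Longrightarrow> dist (shift_unit \<gamma> w) 1 < 1/2 \<and> dist (shift_unit \<gamma> w powr of_real s) 1 < \<epsilon>"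
    unfolding eventually_at by auto
  show ?thesis using d by (intro exI[of _ "min d (1/2)"]) (auto simp: dist_norm)
qed

lemma shift_unit_of_real:
  assumes \<gamma>: "0 < \<gamma>" "\<gamma> < 1" and q: "0 < q" and t: "0 < t"
  shows "of_real (N / t) * shift_unit \<gamma> (of_real (q / t)) powr of_real (1 / (1 - \<gamma>)) = of_real (shift_ratio \<gamma> q N t)"
proof -
  define U where "U = ((1 + q / t) powr \<gamma> - 1) / (\<gamma> * (q / t))"
  have U0: "U \<ge> 0" unfolding U_def using q t \<gamma> by (intro divide_nonneg_nonneg) (auto simp: ge_one_powr_ge_zero)
  have "(1 + complex_of_real (q / t)) powr of_real \<gamma> = of_real ((1 + q / t) powr \<gamma>)"
    using powr_of_real[of "1 + q / t" \<gamma>] q t by simp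
  hence "shift_unit \<gamma> (of_real (q / t)) = of_real U" by (simp add: shift_unit_def U_def)
  hence "shift_unit \<gamma> (of_real (q / t)) powr of_real (1 / (1 - \<gamma>)) = of_real (U powr (1 / (1 - \<gamma>)))"
    using U0 by (simp only: powr_of_real)
  moreover have "((t + q) powr \<gamma> - t powr \<gamma>) / (\<gamma> * q) = t powr (\<gamma> - 1) * U"
  proof -
    have "(t + q) powr \<gamma> = t powr \<gamma> * (1 + q / t) powr \<gamma>"
    proof -
      have "t + q = t * (1 + q / t)" using t by (simp add: field_simps)
      thus ?thesis using t q powr_mult[of t "1 + q / t" \<gamma>] by simp
    qed
    hence "(t + q) powr \<gamma> - t powr \<gamma> = t powr \<gamma> * ((1 + q / t) powr \<gamma> - 1)" by (simp add: algebra_simps)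
    moreover have "t powr \<gamma> = t powr (\<gamma> - 1) * t" using t by (simp add: powr_diff)
    ultimately show ?thesis using t q \<gamma> by (simp add: U_def field_simps)
  qed
  moreover have "(t powr (\<gamma> - 1) * U) powr (1 / (1 - \<gamma>)) = (1 / t) * U powr (1 / (1 - \<gamma>))"
  proof -
    have "(\<gamma> - 1) * (1 / (1 - \<gamma>)) = -1" using \<gamma> by (simp add: field_simps)
    hence "(t powr (\<gamma> - 1)) powr (1 / (1 - \<gamma>)) = 1 / t" using t by (simp only: powr_powr) (simp add: powr_minus divide_inverse)
    thus ?thesis using U0 t by (simp add: powr_mult)
  qed
  ultimately show ?thesis unfolding shift_ratio_def by simp
qed

lemma pochhammer_two: "pochhammer (2::real) p = fact (Suc p)"
  by (induction p) (simp_all add: pochhammer_Suc algebra_simps)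

text \<open>The function is \<open>- y * N / t\<close> plus a remainder. The first part has
  derivative \<open>y * N * t powr (- 2)\<close>, the model of the class for \<open>s = 2\<close>;
  the minus sign makes it positive, as the class demands. The remainder extends holomorphically to a
  half plane, where it is small when \<open>q / N\<close> is, and Cauchy's inequality on circles of
  radius \<open>t / 4\<close> carries the smallness to its derivatives.\<close>

lemma shift_ratio_vdc_class:
  assumes \<gamma>: "0 < \<gamma>" "\<gamma> < 1" and \<epsilon>: "0 < \<epsilon>"
  obtains d where "d > 0" "\<And>N q y a b. N > 0 \<Longrightarrow> q > 0 \<Longrightarrow> y > 0 \<Longrightarrow> q \<le> d * N \<Longrightarrow> N \<le> a \<Longrightarrow> a < b \<Longrightarrow> b \<le> 2 * N \<Longrightarrow>
     (\<lambda>t. - y * shift_ratio \<gamma> q N t) \<in> vdc_class N P 2 (y * N) \<epsilon> a b"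
proof -
  define s where "s = 1 / (1 - \<gamma>)"
  \<comment> \<open>The factor \<open>4 ^ (P + 1)\<close> pays for the powers of the radius
    \<open>t / 4\<close>, the factor 2 for \<open>norm \<zeta> \<ge> t / 2\<close> on the
    circle.\<close>
  define \<epsilon>' where "\<epsilon>' = \<epsilon> / (2 * 4 ^ (P + 1))"
  have \<epsilon>': "\<epsilon>' > 0" using \<epsilon> by (simp add: \<epsilon>'_def)
  obtain d where d: "d > 0" "d \<le> 1/2" and dU: "\<And>w. w \<noteq> 0 \<Longrightarrow> norm w < d \<Longrightarrow> norm (shift_unit \<gamma> w - 1) < 1/2 \<and> norm (shift_unit \<gamma> w powr of_real s - 1) < \<epsilon>'"
    using shift_unit_approx[OF \<gamma>(1) \<epsilon>', of s] by blast
  have main: "(\<lambda>t. - y * shift_ratio \<gamma> q N t) \<in> vdc_class N P 2 (y * N) \<epsilon> a b"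
    if N: "N > 0" and q: "q > 0" and y: "y > 0" and qN: "q \<le> d / 3 * N" and ab: "N \<le> a" "a < b" "b \<le> 2 * N" for N q y a b
  proof -
    define S where "S = {\<zeta>. Re \<zeta> > N / 2}"
    have openS: "open S" unfolding S_def by (rule open_halfspace_Re_gt)
    \<comment> \<open>On \<open>S\<close> the modulus of \<zeta> exceeds \<open>N / 2\<close>;
      together with \<open>q \<le> d / 3 * N\<close> this keeps \<open>q / \<zeta>\<close> inside
      the disc where \<open>dU\<close> holds.\<close>
    have Sw: "\<zeta> \<noteq> 0 \<and> of_real q / \<zeta> \<noteq> 0 \<and> norm (of_real q / \<zeta>) < d" if "\<zeta> \<in> S" for \<zeta>
    proof -
      have nz: "norm \<zeta> > N / 2" using that complex_Re_le_cmod[of \<zeta>] by (auto simp: S_def)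
      hence "d * (N / 2) < d * norm \<zeta>" using d by (intro mult_strict_left_mono) auto
      moreover have "d / 3 * N < d * (N / 2)" using d N by simp
      ultimately have "q < d * norm \<zeta>" using qN by linarith
      moreover have "norm \<zeta> > 0" using nz N by linarith
      ultimately have "q / norm \<zeta> < d" by (simp add: pos_divide_less_eq)
      moreover have "\<zeta> \<noteq> 0" using that N by (auto simp: S_def)
      ultimately show ?thesis using q by (simp add: norm_divide)
    qed
    define R where "R \<zeta> = of_real N / \<zeta> * (shift_unit \<gamma> (of_real q / \<zeta>) powr of_real s - 1)" for \<zeta>
    have holR: "R holomorphic_on S"
    proof -
      have "1 + of_real q / \<zeta> \<notin> \<real>\<^sub>\<le>\<^sub>0" if "\<zeta> \<in> S" for \<zeta>
      proof -
        have "\<bar>Re (of_real q / \<zeta>)\<bar> < 1/2" using Sw[OF that] d abs_Re_le_cmod[of "of_real q / \<zeta>"] by linarith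
        thus ?thesis by (auto simp: complex_nonpos_Reals_iff)
      qed
      moreover have "shift_unit \<gamma> (of_real q / \<zeta>) \<notin> \<real>\<^sub>\<le>\<^sub>0" if "\<zeta> \<in> S" for \<zeta>
      proof -
        have "norm (shift_unit \<gamma> (of_real q / \<zeta>) - 1) < 1/2" using dU Sw[OF that] by blast
        hence "\<bar>Re (shift_unit \<gamma> (of_real q / \<zeta>) - 1)\<bar> < 1/2" using abs_Re_le_cmod[of "shift_unit \<gamma> (of_real q / \<zeta>) - 1"] by linarith
        thus ?thesis by (auto simp: complex_nonpos_Reals_iff)
      qed
      moreover have "(\<lambda>\<zeta>. shift_unit \<gamma> (of_real q / \<zeta>)) holomorphic_on S"
        unfolding shift_unit_def using calculation(1) Sw \<gamma> by (intro holomorphic_intros) auto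
      ultimately show ?thesis unfolding R_def using Sw by (intro holomorphic_intros) auto
    qed
    have holRn: "(deriv ^^ n) R holomorphic_on S" for n using holR openS by (rule holomorphic_higher_deriv)
    have inS: "of_real t \<in> S" "t > 0" if "t \<in> {a..b}" for t using that ab N by (auto simp: S_def)
    have Rbound: "norm ((deriv ^^ n) R (of_real t)) \<le> fact n * (2 * N * \<epsilon>' / t) / (t / 4) ^ n" if t: "t \<in> {a..b}" for n t
    proof (rule Cauchy_inequality)
      have sub: "cball (of_real t) (t / 4) \<subseteq> S"
      proof
        fix \<zeta> assume "\<zeta> \<in> cball (complex_of_real t) (t / 4)"
        hence "\<bar>Re (of_real t - \<zeta>)\<bar> \<le> t / 4" using abs_Re_le_cmod[of "of_real t - \<zeta>"] by (auto simp: dist_norm)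
        hence "\<bar>t - Re \<zeta>\<bar> \<le> t / 4" by simp
        hence "Re \<zeta> \<ge> 3 * t / 4" by linarith
        moreover have "N \<le> t" using t ab by simp
        ultimately have "Re \<zeta> > N / 2" using N by linarith
        thus "\<zeta> \<in> S" by (simp add: S_def)
      qed
      show "R holomorphic_on ball (complex_of_real t) (t / 4)" by (rule holomorphic_on_subset[OF holR order.trans[OF ball_subset_cball sub]])
      show "continuous_on (cball (complex_of_real t) (t / 4)) R"
        by (rule continuous_on_subset[OF holomorphic_on_imp_continuous_on[OF holR] sub])
      show "0 < t / 4" using inS[OF t] by simp
      fix \<zeta> assume \<zeta>: "norm (complex_of_real t - \<zeta>) = t / 4"
      hence "\<zeta> \<in> S" using sub by (auto simp: dist_norm)
      have "t \<le> norm \<zeta> + t / 4" using \<zeta> norm_triangle_ineq[of \<zeta> "of_real t - \<zeta>"] inS[OF t] by simp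
      hence z: "norm \<zeta> \<ge> t / 2" using inS[OF t] by simp
      have "norm (R \<zeta>) = N / norm \<zeta> * norm (shift_unit \<gamma> (of_real q / \<zeta>) powr of_real s - 1)"
        using N by (simp add: R_def norm_mult norm_divide)
      also have "\<dots> \<le> N / (t / 2) * \<epsilon>'"
        using z N inS[OF t] dU[of "of_real q / \<zeta>"] Sw[OF \<open>\<zeta> \<in> S\<close>] \<epsilon>' by (intro mult_mono divide_left_mono) auto
      finally show "norm (R \<zeta>) \<le> 2 * N * \<epsilon>' / t" by (simp add: mult_ac)
    qed
    \<comment> \<open>Explicit derivative of order \<open>p\<close>: the first part by the power
      rule, the remainder as the real part of a complex derivative along the real axis.\<close>
    define D where "D p t = y * N * ((-1) ^ (p + 1) * fact p * t powr (- 1 - real p)) - y * Re ((deriv ^^ p) R (of_real t))" for p t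
    have D0: "D 0 t = - y * shift_ratio \<gamma> q N t" if t: "t \<in> {a..b}" for t
    proof -
      have "of_real (N / t) + R (of_real t) = of_real (shift_ratio \<gamma> q N t)"
        using shift_unit_of_real[OF \<gamma> q, of t N] inS[OF t] unfolding R_def s_def by (simp add: algebra_simps)
      hence "N / t + Re (R (of_real t)) = shift_ratio \<gamma> q N t" by (metis Re_complex_of_real plus_complex.sel(1))
      moreover have "t powr (- 1 - real 0) = 1 / t" using inS[OF t] by (simp add: powr_minus divide_inverse)
      hence "D 0 t = - y * (N / t + Re (R (of_real t)))" by (simp add: D_def algebra_simps)
      ultimately show ?thesis by simp
    qed
    have DD: "(D p has_real_derivative D (Suc p) t) (at t within {a..b})" if t: "t \<in> {a..b}" for p t
    proof -
      have "((deriv ^^ p) R has_field_derivative deriv ((deriv ^^ p) R) (of_real t)) (at (of_real t))"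
        using holRn openS inS[OF t] by (intro holomorphic_derivI) auto
      hence "((\<lambda>t. (deriv ^^ p) R (complex_of_real t)) has_vector_derivative (deriv ^^ Suc p) R (of_real t)) (at t within {a..b})"
        using has_vector_derivative_real_field by fastforce
      from bounded_linear.has_vector_derivative[OF bounded_linear_Re this]
      have "((\<lambda>t. Re ((deriv ^^ p) R (complex_of_real t))) has_real_derivative Re ((deriv ^^ Suc p) R (of_real t))) (at t within {a..b})"
        by (simp add: has_real_derivative_iff_has_vector_derivative)
      moreover have "((\<lambda>t. t powr (- 1 - real p)) has_real_derivative (- 1 - real p) * t powr (- 1 - real p - 1)) (at t within {a..b})"
        using inS[OF t] by (auto intro!: derivative_eq_intros)
      ultimately have "(D p has_real_derivative y * N * ((-1) ^ (p + 1) * fact p * ((- 1 - real p) * t powr (- 1 - real p - 1))) - y * Re ((deriv ^^ Suc p) R (of_real t))) (at t within {a..b})"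
        unfolding D_def[abs_def] by (intro DERIV_diff DERIV_cmult)
      also have "y * N * ((-1) ^ (p + 1) * fact p * ((- 1 - real p) * t powr (- 1 - real p - 1))) = y * N * ((-1) ^ (Suc p + 1) * fact (Suc p) * t powr (- 1 - real (Suc p)))"
      proof -
        have "- 1 - real p - 1 = - 1 - real (Suc p)" "(fact (Suc p) :: real) = (1 + real p) * fact p" "(-1::real) ^ (Suc p + 1) = - ((-1) ^ (p + 1))" by simp_all
        moreover have "y * N * (e * f * ((- 1 - r) * T)) = y * N * (- e * ((1 + r) * f) * T)" for e f r T :: real
          by (simp add: algebra_simps)
        ultimately show ?thesis by metis
      qed
      finally show ?thesis by (simp only: D_def[abs_def])
    qed
    have "continuous_on {a..b} (D P)"
      by (rule DERIV_continuous_on[OF DD])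
    moreover have "\<bar>D (Suc p) t - (-1) ^ p * pochhammer 2 p * (y * N) * t powr (- 2 - real p)\<bar> < \<epsilon> * pochhammer 2 p * (y * N) * t powr (- 2 - real p)"
      if p: "p < P" and t: "t \<in> {a..b}" for p t
    proof -
      have t0: "t > 0" using inS[OF t] by simp
      have e1: "- 1 - real (Suc p) = - 2 - real p" by simp
      have tp: "t powr (- 2 - real p) = 1 / (t * t ^ Suc p)"
      proof -
        have "t powr (- 2 - real p) = t powr (- real (p + 2))" by simp
        also have "\<dots> = inverse (t ^ (p + 2))" using t0 by (simp only: powr_minus powr_realpow)
        finally show ?thesis by (simp add: divide_inverse mult_ac)
      qed
      have "D (Suc p) t - (-1) ^ p * pochhammer 2 p * (y * N) * t powr (- 2 - real p) = - y * Re ((deriv ^^ Suc p) R (of_real t))"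
      proof -
        have "(-1::real) ^ (Suc p + 1) = (-1) ^ p" by simp
        hence "D (Suc p) t = y * N * ((-1) ^ p * fact (Suc p) * t powr (- 2 - real p)) - y * Re ((deriv ^^ Suc p) R (of_real t))"
          by (simp only: D_def e1)
        moreover have "y * N * (s * F * T) - y * r - s * F * (y * N) * T = - y * r" for s F T r :: real by (simp add: algebra_simps)
        ultimately show ?thesis by (simp only: pochhammer_two)
      qed
      hence "\<bar>D (Suc p) t - (-1) ^ p * pochhammer 2 p * (y * N) * t powr (- 2 - real p)\<bar> = y * \<bar>Re ((deriv ^^ Suc p) R (of_real t))\<bar>"
        using y by (simp only: abs_mult abs_minus_cancel abs_of_pos)
      also have "\<dots> \<le> y * (fact (Suc p) * (2 * N * \<epsilon>' / t) / (t / 4) ^ Suc p)"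
        using Rbound[OF t, of "Suc p"] y order.trans[OF abs_Re_le_cmod] by (intro mult_left_mono) auto
      also have "\<dots> = (2 * \<epsilon>' * 4 ^ Suc p) * (fact (Suc p) * (y * N) * t powr (- 2 - real p))"
        using t0 unfolding tp by (simp add: power_divide)
      also have "\<dots> < \<epsilon> * (fact (Suc p) * (y * N) * t powr (- 2 - real p))"
      proof (rule mult_strict_right_mono)
        have "(4::real) ^ Suc p < 4 ^ (P + 1)" using p by (intro power_strict_increasing) auto
        thus "2 * \<epsilon>' * 4 ^ Suc p < \<epsilon>" using \<epsilon> by (simp add: \<epsilon>'_def field_simps)
        show "0 < fact (Suc p) * (y * N) * t powr (- 2 - real p)" using y N t0 by (intro mult_pos_pos) auto
      qed
      finally show ?thesis unfolding pochhammer_two by (simp only: mult.assoc)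
    qed
    ultimately show ?thesis unfolding vdc_class_def using ab D0 DD by (intro CollectI conjI exI[of _ D] ballI allI impI) simp_all
  qed
  show ?thesis
  proof (rule that[of "d / 3"])
    show "d / 3 > 0" using d by simp
  qed (rule main)
qed

text \<open>The parameter of the class is \<open>y * N\<close>, so that
  \<open>y * N * N powr (- 2)\<close> becomes \<open>y / N\<close>. The class contains increasing
  functions; the sum with the opposite sign is the complex conjugate. A single point lies outside
  the class, which has \<open>a < b\<close>.\<close>

theorem exponent_pair_shift_ratio:
  assumes ep: "exponent_pair k l" and \<gamma>: "0 < \<gamma>" "\<gamma> < 1"
  shows "\<exists>C>0. \<exists>d>0. \<forall>N\<ge>1. \<forall>q>0. \<forall>y>0. \<forall>a b::nat. q \<le> d * N \<longrightarrow> N \<le> real a \<longrightarrow> real b \<le> 2 * N \<longrightarrow>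
    norm (\<Sum>n\<in>{a..b}. expi (y * shift_ratio \<gamma> q N (real n))) \<le> C * ((y / N) powr k * N powr l + N / y)"
proof -
  have kl: "0 \<le> k" "0 \<le> l" using ep by (auto simp: exponent_pair_def)
  obtain P \<epsilon> C where \<epsilon>: "\<epsilon> > 0" and C: "\<And>N y a b f. N > 0 \<Longrightarrow> y > 0 \<Longrightarrow> f \<in> vdc_class N P 2 y \<epsilon> a b \<Longrightarrow>
      norm (\<Sum>n | a \<le> real n \<and> real n \<le> b. expi (f (real n))) \<le> C * ((y * N powr (- 2)) powr k * N powr l + inverse y * N powr 2)"
  proof -
    have "\<exists>P. \<exists>\<epsilon>>0. \<epsilon> < 1/2 \<and>
        (\<exists>C. \<forall>N>0. \<forall>y>0. \<forall>a b. \<forall>f\<in>vdc_class N P 2 y \<epsilon> a b.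
           norm (\<Sum>n | a \<le> real n \<and> real n \<le> b. expi (f (real n)))
             \<le> C * ((y * N powr (- 2)) powr k * N powr l + inverse y * N powr 2))"
      using ep unfolding exponent_pair_def by (elim conjE allE[of _ "2::real"]) auto
    thus ?thesis using that by (elim exE conjE) blast
  qed
  obtain d where d: "d > 0" and vdc: "\<And>N q y a b. N > 0 \<Longrightarrow> q > 0 \<Longrightarrow> y > 0 \<Longrightarrow> q \<le> d * N \<Longrightarrow> N \<le> a \<Longrightarrow> a < b \<Longrightarrow> b \<le> 2 * N \<Longrightarrow>
     (\<lambda>t. - y * shift_ratio \<gamma> q N t) \<in> vdc_class N P 2 (y * N) \<epsilon> a b"
  proof (rule shift_ratio_vdc_class[OF \<gamma> \<epsilon>, of P])
    fix d assume *: "d > 0" "\<And>N q y a b. N > 0 \<Longrightarrow> q > 0 \<Longrightarrow> y > 0 \<Longrightarrow> q \<le> d * N \<Longrightarrow> N \<le> a \<Longrightarrow> a < b \<Longrightarrow> b \<le> 2 * N \<Longrightarrow>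
       (\<lambda>t. - y * shift_ratio \<gamma> q N t) \<in> vdc_class N P 2 (y * N) \<epsilon> a b"
    show thesis by (rule that[OF *])
  qed
  have "norm (\<Sum>n\<in>{a..b}. expi (y * shift_ratio \<gamma> q N (real n))) \<le> max C 1 * ((y / N) powr k * N powr l + N / y)"
    if N: "N \<ge> 1" and q: "q > 0" and y: "y > 0" and qd: "q \<le> d * N" and ab: "N \<le> real a" "real b \<le> 2 * N" for N q y and a b :: nat
  proof -
    have Z: "(y / N) powr k * N powr l + N / y \<ge> 0" using N y by simp
    consider "b < a" | "a = b" | "a < b" by linarith
    thus ?thesis
    proof cases
      case 1 thus ?thesis using Z by simp
    next
      case 2
      \<comment> \<open>For \<open>a = b\<close> the right side is at least 1: if
        \<open>y \<le> N\<close> by the term \<open>N / y\<close>, otherwise by the product of the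
        two powers.\<close>
      have "1 \<le> (y / N) powr k * N powr l + N / y"
      proof (cases "y \<le> N")
        case True
        hence "1 \<le> N / y" using y by simp
        thus ?thesis using N y by (simp add: add_increasing)
      next
        case False
        hence "1 \<le> (y / N) powr k" "1 \<le> N powr l" using kl N by (auto intro!: ge_one_powr_ge_zero)
        hence "1 * 1 \<le> (y / N) powr k * N powr l" by (intro mult_mono) auto
        thus ?thesis using N y by (simp add: add_increasing2)
      qed
      hence "1 * 1 \<le> max C 1 * ((y / N) powr k * N powr l + N / y)" by (intro mult_mono) auto
      thus ?thesis using 2 by simp
    next
      case 3
      have "norm (\<Sum>n | real a \<le> real n \<and> real n \<le> real b. expi (- y * shift_ratio \<gamma> q N (real n)))
        \<le> C * ((y * N * N powr (- 2)) powr k * N powr l + inverse (y * N) * N powr 2)"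
        using N q y qd ab 3 by (intro C vdc) auto
      also have "{n. real a \<le> real n \<and> real n \<le> real b} = {a..b}" by auto
      also have "(\<Sum>n\<in>{a..b}. expi (- y * shift_ratio \<gamma> q N (real n))) = cnj (\<Sum>n\<in>{a..b}. expi (y * shift_ratio \<gamma> q N (real n)))"
        by (simp add: expi_minus)
      also have "y * N * N powr (- 2) = y / N" using N by (simp add: powr_minus power2_eq_square field_simps)
      also have "inverse (y * N) * N powr 2 = N / y" using N y by (simp add: power2_eq_square field_simps)
      also have "C * ((y / N) powr k * N powr l + N / y) \<le> max C 1 * ((y / N) powr k * N powr l + N / y)"
        using Z by (intro mult_right_mono) auto
      finally show ?thesis by (simp only: complex_mod_cnj)
    qed
  qed
  thus ?thesis using d by (intro exI[of _ "max C 1"] conjI exI[of _ d]) auto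
qed

section \<open>Finite Poisson summation with the Fejer kernel\<close>

section \<open>A smoothed Poisson summation\<close>

lemma continuous_on_lipschitz_complex:
  fixes F :: "real \<Rightarrow> complex"
  assumes "\<And>s t. norm (F s - F t) \<le> L * \<bar>s - t\<bar>"
  shows "continuous_on S F"
proof -
  have "L \<ge> 0" using assms[of 1 0] order.trans[OF norm_ge_zero] by fastforce
  hence "L-lipschitz_on S F" using assms by (intro lipschitz_onI) (auto simp: dist_norm dist_real_def)
  thus ?thesis by (rule lipschitz_on_continuous_on)
qed

text \<open>The Fejer kernel. For \<open>V > 0\<close> it is nonnegative with mass 1 on every
  period, and its Fourier coefficients lie in \<open>[0, 1]\<close> and vanish from \<open>V\<close>
  on. Poisson summation with it is a finite sum of integrals and asks only for Lipschitz
  continuity.\<close>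

definition fejer :: "nat \<Rightarrow> real \<Rightarrow> real" where
  "fejer V t = (norm (\<Sum>j<V. expi (real j * t)))\<^sup>2 / real V"

lemma fejer_nonneg: "fejer V t \<ge> 0"
  by (simp add: fejer_def)

lemma fejer_eq:
  "complex_of_real (fejer V t) = (\<Sum>i<V. \<Sum>j<V. expi ((real i - real j) * t)) / of_nat V"
proof -
  have "complex_of_real ((norm (\<Sum>j<V. expi (real j * t)))\<^sup>2) = (\<Sum>i<V. \<Sum>j<V. expi (real i * t) * cnj (expi (real j * t)))"
    by (simp only: complex_norm_square) (simp add: sum_product)
  also have "\<dots> = (\<Sum>i<V. \<Sum>j<V. expi ((real i - real j) * t))"
    by (simp add: expi_diff[symmetric] algebra_simps)
  finally show ?thesis by (simp add: fejer_def)
qed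

lemma continuous_on_fejer: "continuous_on S (fejer V)"
  unfolding fejer_def by (cases "V = 0") (auto intro!: continuous_intros)

lemma fejer_shift: "fejer V (t + of_nat m) = fejer V t"
proof -
  have "expi (real j * (t + of_nat m)) = expi (real j * t)" for j
    using expi_of_nat[of "j * m"] by (simp add: algebra_simps expi_add)
  thus ?thesis by (simp add: fejer_def)
qed

lemma fejer_le:
  assumes "\<bar>t\<bar> \<le> 1/2" "V > 0"
  shows "t\<^sup>2 * fejer V t \<le> 1 / (4 * real V)"
proof -
  have "(1 - expi t) * (\<Sum>j<V. expi (real j * t)) = 1 - expi t ^ V"
    using one_diff_power_eq[of "expi t" V] by (simp add: expi_power)
  hence "norm (1 - expi t) * norm (\<Sum>j<V. expi (real j * t)) = norm (1 - expi t ^ V)" by (metis norm_mult)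
  also have "\<dots> \<le> 2" using norm_triangle_ineq4[of 1 "expi t ^ V"] by (simp add: norm_power)
  finally have "norm (1 - expi t) * norm (\<Sum>j<V. expi (real j * t)) \<le> 2" .
  moreover have "4 * \<bar>t\<bar> * norm (\<Sum>j<V. expi (real j * t)) \<le> norm (1 - expi t) * norm (\<Sum>j<V. expi (real j * t))"
    using norm_one_minus_expi_ge[OF assms(1)] by (intro mult_right_mono) auto
  ultimately have "\<bar>t\<bar> * norm (\<Sum>j<V. expi (real j * t)) \<le> 1/2" by linarith
  hence "(\<bar>t\<bar> * norm (\<Sum>j<V. expi (real j * t)))\<^sup>2 \<le> (1/2)\<^sup>2" by (intro power_mono) auto
  hence "t\<^sup>2 * (norm (\<Sum>j<V. expi (real j * t)))\<^sup>2 \<le> (1/2)\<^sup>2" by (simp only: power_mult_distrib power2_abs)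
  hence "t\<^sup>2 * (norm (\<Sum>j<V. expi (real j * t)))\<^sup>2 / real V \<le> (1/2)\<^sup>2 / real V" by (rule divide_right_mono) simp
  thus ?thesis by (simp add: fejer_def power2_eq_square)
qed

lemma integral_expi_period:
  fixes m :: real and k :: int
  shows "((\<lambda>t. expi (of_int k * t)) has_integral (if k = 0 then 1 else 0)) {m - 1/2..m + 1/2}"
proof (cases "k = 0")
  case True
  thus ?thesis using has_integral_const_real[of "1::complex" "m - 1/2" "m + 1/2"] by simp
next
  case False
  have "((\<lambda>t. expi (of_int k * t)) has_integral
      (expi (of_int k * (m + 1/2)) / (2 * pi * \<i> * of_int k) - expi (of_int k * (m - 1/2)) / (2 * pi * \<i> * of_int k))) {m - 1/2..m + 1/2}"
  proof (rule fundamental_theorem_of_calculus)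
    fix t :: real
    have "((\<lambda>t. of_int k * t) has_real_derivative of_int k) (at t within {m - 1/2..m + 1/2})"
      by (auto intro!: derivative_eq_intros)
    from has_vector_derivative_divide[OF expi_chain[OF this], of "2 * pi * \<i> * of_int k"]
    show "((\<lambda>t. expi (of_int k * t) / (2 * pi * \<i> * of_int k)) has_vector_derivative expi (of_int k * t)) (at t within {m - 1/2..m + 1/2})"
      using False by simp
  qed simp
  moreover have "expi (of_int k * (m + 1/2)) = expi (of_int k * (m - 1/2))"
  proof -
    have "of_int k * (m + 1/2) = of_int k * (m - 1/2) + of_int k" by (simp add: algebra_simps)
    thus ?thesis by (simp only: expi_add expi_of_int mult_1_right)
  qed
  ultimately show ?thesis using False by simp
qed

lemma integral_fejer_period:
  assumes "V > 0"
  shows "(fejer V has_integral 1) {m - 1/2..m + 1/2}"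
proof -
  have "((\<lambda>t. (\<Sum>i<V. \<Sum>j<V. expi (of_int (int i - int j) * t)) / of_nat V) has_integral
      ((\<Sum>i<V. \<Sum>j<V. if int i - int j = 0 then 1 else 0) / of_nat V)) {m - 1/2..m + 1/2}"
    by (intro has_integral_divide has_integral_sum integral_expi_period) auto
  moreover have "(\<Sum>i<V. \<Sum>j<V. if int i - int j = 0 then 1 else 0) = (of_nat V :: complex)" by simp
  ultimately have "((\<lambda>t. complex_of_real (fejer V t)) has_integral 1) {m - 1/2..m + 1/2}"
    using assms by (simp add: fejer_eq)
  from has_integral_Re[OF this] show ?thesis by simp
qed

text \<open>With \<open>r = 1 / sqrt V\<close>, the inequality
  \<open>\<bar>s\<bar> \<le> r / 2 + s\<^sup>2 / (2 * r)\<close> splits the first moment of the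
  kernel into its mass and a second moment, which \<open>fejer_le\<close> bounds pointwise by a
  multiple of \<open>1 / V\<close>. The rate suffices, as \<open>V\<close> may be any power of the
  other parameters.\<close>

lemma fejer_convolution_error:
  fixes F :: "real \<Rightarrow> complex"
  assumes V: "V > 0" and lip: "\<And>s t. norm (F s - F t) \<le> L * \<bar>s - t\<bar>"
  shows "norm (F (real m) - integral {real m - 1/2..real m + 1/2} (\<lambda>t. F t * of_real (fejer V t))) \<le> L / sqrt (real V)"
proof -
  let ?I = "{real m - 1/2..real m + 1/2}"
  have L: "L \<ge> 0" using lip[of 1 0] order.trans[OF norm_ge_zero] by fastforce
  have contF: "continuous_on ?I F" by (rule continuous_on_lipschitz_complex[OF lip])
  define r where "r = 1 / sqrt (real V)"
  have r: "r > 0" using V by (simp add: r_def)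
  have fI: "((\<lambda>t. complex_of_real (fejer V t)) has_integral 1) ?I"
    using has_integral_of_real[OF integral_fejer_period[OF V, of "real m"]] by simp
  have i1: "((\<lambda>t. F (real m) * of_real (fejer V t)) has_integral F (real m)) ?I"
    using has_integral_mult_right[OF fI, of "F (real m)"] by simp
  have i2: "(\<lambda>t. F t * of_real (fejer V t)) integrable_on ?I"
    by (intro integrable_continuous_interval continuous_intros contF continuous_on_fejer)
  have "F (real m) - integral ?I (\<lambda>t. F t * of_real (fejer V t)) = integral ?I (\<lambda>t. (F (real m) - F t) * of_real (fejer V t))"
  proof -
    have "integral ?I (\<lambda>t. F (real m) * of_real (fejer V t) - F t * of_real (fejer V t)) = F (real m) - integral ?I (\<lambda>t. F t * of_real (fejer V t))"
      by (simp only: integral_diff[OF has_integral_integrable[OF i1] i2] integral_unique[OF i1])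
    thus ?thesis by (simp add: algebra_simps)
  qed
  also have "norm \<dots> \<le> integral ?I (\<lambda>t. L * (r / 2) * fejer V t + L / (8 * r * real V))"
  proof (rule integral_norm_bound_integral)
    show "(\<lambda>t. (F (real m) - F t) * of_real (fejer V t)) integrable_on ?I"
      by (intro integrable_continuous_interval continuous_intros contF continuous_on_fejer)
    show "(\<lambda>t. L * (r / 2) * fejer V t + L / (8 * r * real V)) integrable_on ?I"
      by (intro integrable_continuous_interval continuous_intros continuous_on_fejer)
    fix t assume t: "t \<in> ?I"
    define s where "s = t - real m"
    have s: "\<bar>s\<bar> \<le> 1/2" using t unfolding s_def abs_le_iff by auto
    have fs: "fejer V t = fejer V s" using fejer_shift[of V s m] by (simp add: s_def)
    have am: "\<bar>s\<bar> \<le> r / 2 + s\<^sup>2 / (2 * r)"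
    proof -
      have "0 \<le> (\<bar>s\<bar> - r)\<^sup>2" by simp
      hence "2 * r * \<bar>s\<bar> \<le> r\<^sup>2 + s\<^sup>2" by (simp add: power2_diff power2_abs algebra_simps)
      thus ?thesis using r by (simp add: field_simps power2_eq_square)
    qed
    have "norm ((F (real m) - F t) * of_real (fejer V t)) \<le> L * \<bar>s\<bar> * fejer V t"
      using lip[of "real m" t] fejer_nonneg[of V t] by (simp add: norm_mult s_def abs_minus_commute mult_right_mono)
    also have "\<dots> \<le> L * (r / 2 + s\<^sup>2 / (2 * r)) * fejer V t"
      using am L fejer_nonneg by (intro mult_right_mono mult_left_mono) auto
    also have "\<dots> = L * (r / 2) * fejer V t + L / (2 * r) * (s\<^sup>2 * fejer V t)" by (simp add: algebra_simps)
    also have "\<dots> \<le> L * (r / 2) * fejer V t + L / (2 * r) * (1 / (4 * real V))"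
      using fejer_le[OF s V] L r unfolding fs by (intro add_left_mono mult_left_mono) auto
    also have "\<dots> = L * (r / 2) * fejer V t + L / (8 * r * real V)" by simp
    finally show "norm ((F (real m) - F t) * of_real (fejer V t)) \<le> L * (r / 2) * fejer V t + L / (8 * r * real V)" .
  qed
  also have "integral ?I (\<lambda>t. L * (r / 2) * fejer V t + L / (8 * r * real V)) = L * (r / 2) * 1 + L / (8 * r * real V)"
  proof (rule integral_unique)
    have "((\<lambda>t. L / (8 * r * real V)) has_integral (L / (8 * r * real V))) ?I"
      using has_integral_const_real[of "L / (8 * r * real V)" "real m - 1/2" "real m + 1/2"] by simp
    thus "((\<lambda>t. L * (r / 2) * fejer V t + L / (8 * r * real V)) has_integral L * (r / 2) * 1 + L / (8 * r * real V)) ?I"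
      by (intro has_integral_add has_integral_mult_right integral_fejer_period V)
  qed
  also have "L / (8 * r * real V) = L * r / 8"
  proof -
    have "r * r * real V = 1" using V by (simp add: r_def)
    thus ?thesis using r V by (simp add: field_simps)
  qed
  also have "L * (r / 2) * 1 + L * r / 8 \<le> L * r" using L r by (simp add: field_simps)
  finally show ?thesis by (simp add: r_def)
qed

text \<open>The unit intervals around the integers tile the range of integration. For each
  \<open>i\<close> the frequencies \<open>int i - int j\<close> are distinct, and the
  \<open>V\<close> values of \<open>i\<close> cancel the normalisation, so every frequency is
  counted at most once.\<close>

theorem fejer_poisson:
  fixes F :: "real \<Rightarrow> complex"
  assumes V: "V > 0" and lip: "\<And>s t. norm (F s - F t) \<le> L * \<bar>s - t\<bar>"
  shows "norm (\<Sum>m\<in>{p..<p + n}. F (real m)) \<le>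
     (\<Sum>\<nu>\<in>{- int V<..<int V}. norm (integral {real p - 1/2..real (p + n) - 1/2} (\<lambda>t. F t * expi (of_int \<nu> * t)))) + real n * L / sqrt (real V)"
proof -
  let ?I = "{real p - 1/2..real (p + n) - 1/2}"
  have contF: "continuous_on S F" for S by (rule continuous_on_lipschitz_complex[OF lip])
  have int: "(\<lambda>t. F t * of_real (fejer V t)) integrable_on {a..b}" for a b
    by (intro integrable_continuous_interval continuous_intros contF continuous_on_fejer)
  have comb: "(\<Sum>m\<in>{p..<p + n}. integral {real m - 1/2..real m + 1/2} (\<lambda>t. F t * of_real (fejer V t)))
     = integral {real p - 1/2..real (p + n) - 1/2} (\<lambda>t. F t * of_real (fejer V t))"
  proof (induction n)
    case (Suc n)
    have "integral {real p - 1/2..real (p + n) - 1/2} (\<lambda>t. F t * of_real (fejer V t)) + integral {real (p + n) - 1/2..real (p + Suc n) - 1/2} (\<lambda>t. F t * of_real (fejer V t))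
      = integral {real p - 1/2..real (p + Suc n) - 1/2} (\<lambda>t. F t * of_real (fejer V t))"
      by (rule Henstock_Kurzweil_Integration.integral_combine) (auto intro!: int)
    moreover have e: "real (p + n) + 1/2 = real (p + Suc n) - 1/2" by simp
    moreover have "(\<Sum>m\<in>{p..<p + Suc n}. integral {real m - 1/2..real m + 1/2} (\<lambda>t. F t * of_real (fejer V t)))
      = (\<Sum>m\<in>{p..<p + n}. integral {real m - 1/2..real m + 1/2} (\<lambda>t. F t * of_real (fejer V t)))
        + integral {real (p + n) - 1/2..real (p + n) + 1/2} (\<lambda>t. F t * of_real (fejer V t))"
      by (simp only: add_Suc_right sum.atLeastLessThan_Suc le_add1)
    ultimately show ?case by (simp only: Suc e)
  qed simp
  define \<Phi> where "\<Phi> \<nu> = integral ?I (\<lambda>t. F t * expi (of_int \<nu> * t))" for \<nu> :: int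
  have "integral ?I (\<lambda>t. F t * of_real (fejer V t)) = (\<Sum>i<V. \<Sum>j<V. \<Phi> (int i - int j)) / of_nat V"
  proof (rule integral_unique)
    have "((\<lambda>t. (\<Sum>i<V. \<Sum>j<V. F t * expi (of_int (int i - int j) * t)) / of_nat V) has_integral
        ((\<Sum>i<V. \<Sum>j<V. \<Phi> (int i - int j)) / of_nat V)) ?I"
      unfolding \<Phi>_def
      by (intro has_integral_divide has_integral_sum finite_lessThan integrable_integral integrable_continuous_interval continuous_intros contF)
    thus "((\<lambda>t. F t * of_real (fejer V t)) has_integral (\<Sum>i<V. \<Sum>j<V. \<Phi> (int i - int j)) / of_nat V) ?I"
      by (simp add: fejer_eq sum_distrib_left)
  qed
  also have "norm \<dots> \<le> (\<Sum>\<nu>\<in>{- int V<..<int V}. norm (\<Phi> \<nu>))"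
  proof -
    have "norm (\<Sum>i<V. \<Sum>j<V. \<Phi> (int i - int j)) \<le> (\<Sum>i<V. \<Sum>\<nu>\<in>{- int V<..<int V}. norm (\<Phi> \<nu>))"
    proof (rule sum_norm_le)
      fix i assume i: "i \<in> {..<V}"
      have "norm (\<Sum>j<V. \<Phi> (int i - int j)) \<le> (\<Sum>j<V. norm (\<Phi> (int i - int j)))" by (rule norm_sum)
      also have "\<dots> = (\<Sum>\<nu>\<in>(\<lambda>j. int i - int j) ` {..<V}. norm (\<Phi> \<nu>))"
        by (subst sum.reindex) (auto simp: inj_on_def)
      also have "\<dots> \<le> (\<Sum>\<nu>\<in>{- int V<..<int V}. norm (\<Phi> \<nu>))"
        using i by (intro sum_mono2) auto
      finally show "norm (\<Sum>j<V. \<Phi> (int i - int j)) \<le> (\<Sum>\<nu>\<in>{- int V<..<int V}. norm (\<Phi> \<nu>))" .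
    qed
    thus ?thesis using V by (simp add: norm_divide field_simps)
  qed
  finally have 1: "norm (integral ?I (\<lambda>t. F t * of_real (fejer V t))) \<le> (\<Sum>\<nu>\<in>{- int V<..<int V}. norm (\<Phi> \<nu>))" .
  have "(\<Sum>m\<in>{p..<p + n}. F (real m)) = (\<Sum>m\<in>{p..<p + n}. F (real m) - integral {real m - 1/2..real m + 1/2} (\<lambda>t. F t * of_real (fejer V t)))
     + integral ?I (\<lambda>t. F t * of_real (fejer V t))"
    unfolding comb[symmetric] by (simp add: sum_subtractf)
  also have "norm \<dots> \<le> (\<Sum>m\<in>{p..<p + n}. L / sqrt (real V)) + (\<Sum>\<nu>\<in>{- int V<..<int V}. norm (\<Phi> \<nu>))"
    by (intro order.trans[OF norm_triangle_ineq] add_mono 1 sum_norm_le fejer_convolution_error V lip)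
  finally show ?thesis by (simp add: \<Phi>_def)
qed

section \<open>First derivative estimates for a family with a common stationary point\<close>

section \<open>An oscillatory integral of exponential sums\<close>

text \<open>Supported on \<open>[1/2, 5]\<close> and at least 1 on \<open>[1, 4]\<close>. The square
  of a positive part is continuously differentiable, which is the smoothness that one integration by
  parts consumes.\<close>

definition bump :: "real \<Rightarrow> real" where
  "bump t = (max 0 ((t - 1/2) * (5 - t)))\<^sup>2"

definition bump_deriv :: "real \<Rightarrow> real" where
  "bump_deriv t = 2 * max 0 ((t - 1/2) * (5 - t)) * (11/2 - 2 * t)"

lemma bump_nonneg: "0 \<le> bump t"
  by (simp add: bump_def)

lemma bump_ge_one:
  assumes "1 \<le> t" "t \<le> 4"
  shows "1 \<le> bump t"
proof -
  have "(1/2) * 1 \<le> (t - 1/2) * (5 - t)" using assms by (intro mult_mono) auto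
  moreover have "1 \<le> (t - 1/2) * (5 - t)"
  proof -
    have "0 \<le> (t - 1) * (4 - t)" using assms by simp
    hence "t * t + 4 \<le> 5 * t" by (simp add: algebra_simps)
    moreover have "(t - 1/2) * (5 - t) = 11/2 * t - t * t - 5/2" by (simp add: field_simps)
    ultimately show ?thesis using assms by linarith
  qed
  ultimately have "1\<^sup>2 \<le> (max 0 ((t - 1/2) * (5 - t)))\<^sup>2" by (intro power_mono max.coboundedI2) auto
  thus ?thesis by (simp add: bump_def)
qed

lemma bump_eq_0: "t \<le> 1/2 \<or> 5 \<le> t \<Longrightarrow> bump t = 0"
  by (auto simp: bump_def max_def mult_le_0_iff zero_le_mult_iff)

lemma square_max_0_deriv: "((\<lambda>u. (max 0 u)\<^sup>2) has_real_derivative 2 * max 0 u) (at (u::real))"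
proof (cases u "0::real" rule: linorder_cases)
  case less
  have "((\<lambda>_. 0) has_real_derivative 2 * max 0 u) (at u)" using less by (auto intro!: derivative_eq_intros)
  thus ?thesis
    by (rule has_field_derivative_transform_within_open[of _ _ _ "{..<0}"]) (use less in auto)
next
  case greater
  have "((\<lambda>u. u\<^sup>2) has_real_derivative 2 * max 0 u) (at u)" using greater by (auto intro!: derivative_eq_intros)
  thus ?thesis
    by (rule has_field_derivative_transform_within_open[of _ _ _ "{0<..}"]) (use greater in auto)
next
  case equal
  have "((\<lambda>h. (max 0 h)\<^sup>2 / h) \<longlongrightarrow> 0) (at (0::real))"
  proof (rule Lim_null_comparison)
    show "\<forall>\<^sub>F h in at 0. norm ((max 0 h)\<^sup>2 / h) \<le> \<bar>h\<bar>" for h :: real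
      by (rule always_eventually) (auto simp: max_def power2_eq_square)
    show "((\<lambda>h::real. \<bar>h\<bar>) \<longlongrightarrow> 0) (at 0)" by (intro tendsto_eq_intros refl | simp)+
  qed
  thus ?thesis using equal by (simp add: DERIV_def)
qed

lemma bump_has_deriv [derivative_intros]:
  assumes "(f has_real_derivative f') (at x within S)"
  shows "((\<lambda>x. bump (f x)) has_real_derivative bump_deriv (f x) * f') (at x within S)"
proof -
  have "((\<lambda>x. (f x - 1/2) * (5 - f x)) has_real_derivative (11/2 - 2 * f x) * f') (at x within S)"
    using assms by (auto intro!: derivative_eq_intros simp: algebra_simps)
  from DERIV_chain2[OF square_max_0_deriv this]
  show ?thesis unfolding bump_def bump_deriv_def by (simp add: mult_ac)
qed

lemma continuous_on_bump [continuous_intros]: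
  assumes "continuous_on S f"
  shows "continuous_on S (\<lambda>x. bump (f x))" "continuous_on S (\<lambda>x. bump_deriv (f x))"
  unfolding bump_def bump_deriv_def by (intro continuous_intros assms)+

text \<open>The 15 is \<open>5 / (1/3)\<close>: the arguments are \<open>\<rho> * \<sigma>\<close>
  with \<open>\<rho> \<le> 1\<close> and \<open>\<sigma> \<le> 15\<close>, and as \<rho> will be at
  least \<open>1/3\<close>, the support of \<open>bump (\<rho> * \<sigma>)\<close> as a function of
  \<sigma> does not pass 15.\<close>

definition lipschitz_bound :: "real \<Rightarrow> (real \<Rightarrow> real) \<Rightarrow> bool" where
  "lipschitz_bound A f \<longleftrightarrow> (\<forall>s\<in>{0..15}. \<forall>t\<in>{0..15}. \<bar>f s\<bar> \<le> A \<and> \<bar>f s - f t\<bar> \<le> A * \<bar>s - t\<bar>)"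

lemma lipschitz_bound_mult:
  assumes "lipschitz_bound A f" "lipschitz_bound B g"
  shows "lipschitz_bound (2 * A * B + A * B) (\<lambda>t. f t * g t)"
  unfolding lipschitz_bound_def
proof (intro ballI)
  fix s t :: real assume st: "s \<in> {0..15}" "t \<in> {0..15}"
  have f: "\<bar>f s\<bar> \<le> A" "\<bar>f s - f t\<bar> \<le> A * \<bar>s - t\<bar>" and g: "\<bar>g s\<bar> \<le> B" "\<bar>g t\<bar> \<le> B" "\<bar>g s - g t\<bar> \<le> B * \<bar>s - t\<bar>"
    using assms st unfolding lipschitz_bound_def by blast+
  have A: "0 \<le> A" "0 \<le> B" using f(1) g(1) abs_ge_zero order.trans by blast+
  have "f s * g s - f t * g t = f s * (g s - g t) + (f s - f t) * g t" by (simp add: algebra_simps)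
  hence "\<bar>f s * g s - f t * g t\<bar> \<le> \<bar>f s\<bar> * \<bar>g s - g t\<bar> + \<bar>f s - f t\<bar> * \<bar>g t\<bar>"
    by (metis abs_mult abs_triangle_ineq)
  also have "\<dots> \<le> A * (B * \<bar>s - t\<bar>) + (A * \<bar>s - t\<bar>) * B" using f g A by (intro add_mono mult_mono) auto
  also have "\<dots> \<le> (2 * A * B + A * B) * \<bar>s - t\<bar>" using A by (simp add: algebra_simps)
  finally have 1: "\<bar>f s * g s - f t * g t\<bar> \<le> (2 * A * B + A * B) * \<bar>s - t\<bar>" .
  have "\<bar>f s * g s\<bar> \<le> A * B" unfolding abs_mult using f g A by (intro mult_mono) auto
  moreover have "0 \<le> 2 * A * B" using A by simp
  ultimately show "\<bar>f s * g s\<bar> \<le> 2 * A * B + A * B \<and> \<bar>f s * g s - f t * g t\<bar> \<le> (2 * A * B + A * B) * \<bar>s - t\<bar>" using 1 by simp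
qed

lemma lipschitz_bound_mono:
  assumes "lipschitz_bound A f" "A \<le> B"
  shows "lipschitz_bound B f"
  using assms unfolding lipschitz_bound_def by (meson abs_ge_zero mult_right_mono order.trans)

lemma lipschitz_bound_bump:
  "\<exists>A>0. lipschitz_bound A bump \<and> lipschitz_bound A (\<lambda>t. t * bump t) \<and> lipschitz_bound A (\<lambda>t. t * bump_deriv t)"
proof -
  define m where "m t = max 0 ((t - 1/2) * (5 - t))" for t :: real
  have m: "lipschitz_bound 150 m"
    unfolding lipschitz_bound_def
  proof (intro ballI)
    fix s t :: real assume st: "s \<in> {0..15}" "t \<in> {0..15}"
    have "\<bar>(s - 1/2) * (5 - s)\<bar> \<le> 15 * 10" unfolding abs_mult using st by (intro mult_mono) (auto simp: abs_if)
    hence 1: "\<bar>m s\<bar> \<le> 150" by (auto simp: m_def max_def)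
    have "(s - 1/2) * (5 - s) - (t - 1/2) * (5 - t) = (11/2 - (s + t)) * (s - t)" by (simp add: field_simps)
    hence "\<bar>(s - 1/2) * (5 - s) - (t - 1/2) * (5 - t)\<bar> = \<bar>11/2 - (s + t)\<bar> * \<bar>s - t\<bar>" by (simp add: abs_mult)
    also have "\<dots> \<le> 150 * \<bar>s - t\<bar>" using st by (intro mult_right_mono) (auto simp: abs_if)
    finally have "\<bar>m s - m t\<bar> \<le> 150 * \<bar>s - t\<bar>" by (auto simp: m_def max_def abs_if split: if_splits)
    thus "\<bar>m s\<bar> \<le> 150 \<and> \<bar>m s - m t\<bar> \<le> 150 * \<bar>s - t\<bar>" using 1 by simp
  qed
  have i: "lipschitz_bound 15 (\<lambda>t. t)" by (auto simp: lipschitz_bound_def)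
  have l: "lipschitz_bound 60 (\<lambda>t. 2 * (11/2 - 2 * t))" by (auto simp: lipschitz_bound_def abs_if)
  have mm: "lipschitz_bound (2 * 150 * 150 + 150 * 150) (\<lambda>t. m t * m t)" by (intro lipschitz_bound_mult m)
  have b: "bump = (\<lambda>t. m t * m t)" by (auto simp: bump_def m_def power2_eq_square)
  have bd: "bump_deriv = (\<lambda>t. m t * (2 * (11/2 - 2 * t)))" by (auto simp: bump_deriv_def m_def)
  note 1 = mm
  note 2 = lipschitz_bound_mult[OF i mm]
  note 3 = lipschitz_bound_mult[OF i lipschitz_bound_mult[OF m l]]
  show ?thesis
    using lipschitz_bound_mono[OF 1, of 10000000] lipschitz_bound_mono[OF 2, of 10000000] lipschitz_bound_mono[OF 3, of 10000000]
    by (intro exI[of _ 10000000]) (simp add: b bd)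
qed

text \<open>Summation by parts: \<open>y\<close> decreases within \<open>{0..15}\<close>, so the
  total variation of \<open>f (y n)\<close> is at most \<open>15 * A\<close>, and one boundary value
  adds \<open>A\<close>.\<close>

lemma weighted_sum_bound:
  fixes z :: "nat \<Rightarrow> complex"
  assumes f: "lipschitz_bound A f" and A: "0 \<le> A" and E0: "0 \<le> E"
    and y: "\<And>n. a \<le> n \<Longrightarrow> n \<le> b \<Longrightarrow> 0 \<le> y n \<and> y n \<le> 15" "\<And>n. a \<le> n \<Longrightarrow> n < b \<Longrightarrow> y (Suc n) \<le> y n"
    and E: "\<And>n. a \<le> n \<Longrightarrow> n \<le> b \<Longrightarrow> norm (\<Sum>i\<in>{a..n}. z i) \<le> E"
  shows "norm (\<Sum>n\<in>{a..b}. of_real (f (y n)) * z n) \<le> 16 * A * E"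
proof (cases "a \<le> b")
  case False thus ?thesis using A E0 by simp
next
  case True
  have fy: "\<bar>f (y n)\<bar> \<le> A" if "a \<le> n" "n \<le> b" for n
    using f y(1)[OF that] unfolding lipschitz_bound_def by auto
  have d: "\<bar>f (y n) - f (y (Suc n))\<bar> \<le> A * (y n - y (Suc n))" if "a \<le> n" "n < b" for n
  proof -
    have "\<bar>f (y n) - f (y (Suc n))\<bar> \<le> A * \<bar>y n - y (Suc n)\<bar>"
      using f y(1)[of n] y(1)[of "Suc n"] that unfolding lipschitz_bound_def by auto
    thus ?thesis using y(2)[OF that] by simp
  qed
  have "norm (\<Sum>n\<in>{a..b}. of_real (f (y n)) * z n) \<le> E * (norm (complex_of_real (f (y b))) + (\<Sum>i\<in>{a..<b}. norm (complex_of_real (f (y i)) - of_real (f (y (Suc i))))))"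
    by (rule norm_sum_abel_le) (use E True in auto)
  also have "\<dots> \<le> E * (A + (\<Sum>i\<in>{a..<b}. A * (y i - y (Suc i))))"
  proof (intro mult_left_mono add_mono sum_mono E0)
    show "norm (complex_of_real (f (y b))) \<le> A" using fy[of b] True by simp
    fix i assume "i \<in> {a..<b}"
    thus "norm (complex_of_real (f (y i)) - of_real (f (y (Suc i)))) \<le> A * (y i - y (Suc i))"
      using d[of i] by (simp flip: of_real_diff)
  qed
  also have "(\<Sum>i\<in>{a..<b}. A * (y i - y (Suc i))) = A * (y a - y b)"
  proof -
    have "(\<Sum>i\<in>{a..<b}. y (Suc i) - y i) = y b - y a" by (rule sum_Suc_diff'[OF True])
    hence "(\<Sum>i\<in>{a..<b}. y i - y (Suc i)) = y a - y b" by (simp add: sum_subtractf)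
    thus ?thesis by (simp add: sum_distrib_left[symmetric])
  qed
  also have "E * (A + A * (y a - y b)) \<le> E * (A + A * 15)"
    using E0 A y(1)[of a] y(1)[of b] True by (intro mult_left_mono add_left_mono) auto
  finally show ?thesis by (simp add: algebra_simps)
qed

text \<open>When the level \<open>v\<close> is not attained, \<open>s\<close> is an end point and
  one of the two pieces is degenerate; the disjunctions let that piece go without any
  estimate.\<close>

lemma antimono_cut:
  fixes f :: "real \<Rightarrow> real"
  assumes ab: "a \<le> b" and c: "continuous_on {a..b} f"
    and mono: "\<And>x y. a \<le> x \<Longrightarrow> x \<le> y \<Longrightarrow> y \<le> b \<Longrightarrow> f y \<le> f x"
  shows "\<exists>s. a \<le> s \<and> s \<le> b \<and> (s = a \<or> (\<forall>x\<in>{a..s}. v \<le> f x)) \<and> (s = b \<or> (\<forall>x\<in>{s..b}. f x \<le> v))"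
proof -
  consider "f a \<le> v" | "v \<le> f b" | "f b \<le> v" "v \<le> f a" by linarith
  thus ?thesis
  proof cases
    case 1
    thus ?thesis using ab mono[of a] by (intro exI[of _ a]) force
  next
    case 2
    have "\<forall>x\<in>{a..b}. v \<le> f x" using 2 mono[of _ b] by force
    thus ?thesis using ab by (intro exI[of _ b]) auto
  next
    case 3
    obtain s where s: "a \<le> s" "s \<le> b" "f s = v" using IVT2'[OF 3 ab c] by blast
    have "\<forall>x\<in>{a..s}. v \<le> f x" using s mono[of _ s] by force
    moreover have "\<forall>x\<in>{s..b}. f x \<le> v" using s mono[of s] by force
    ultimately show ?thesis using s by (intro exI[of _ s]) auto
  qed
qed

text \<open>The factor \<open>\<rho> n\<close> is the Jacobian of
  \<open>m = M * \<rho> n * \<sigma>\<close>; \<mu> carries the linear phase, that is the twist and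
  the frequency of the Poisson sum.\<close>

definition osc_sum :: "real \<Rightarrow> real \<Rightarrow> real \<Rightarrow> (nat \<Rightarrow> real) \<Rightarrow> nat set \<Rightarrow> real \<Rightarrow> complex" where
  "osc_sum \<gamma> \<mu> X \<rho> A \<sigma> = (\<Sum>n\<in>A. of_real (\<rho> n * bump (\<rho> n * \<sigma>)) * expi (X * \<rho> n * (\<sigma> powr \<gamma> - \<mu> * \<sigma>)))"

lemma continuous_on_osc_sum:
  assumes "\<And>\<sigma>. \<sigma> \<in> S \<Longrightarrow> \<sigma> > 0"
  shows "continuous_on S (osc_sum \<gamma> \<mu> X \<rho> A)"
  unfolding osc_sum_def by (intro continuous_intros) (use assms in force)+

text \<open>Integration by parts in \<open>\<sigma>\<close>; the phases \<open>X \<rho>\<^sub>n (\<sigma>\<^sup>\<gamma> - \<mu> \<sigma>)\<close> share the factor that is differentiated, so the sum over \<open>n\<close> stays intact.\<close>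
lemma osc_integral_by_parts:
  fixes A :: "nat set"
  assumes \<gamma>: "0 < \<gamma>" "\<gamma> < 1" and cd: "1/2 \<le> c" "c \<le> d" "d \<le> 15" and X: "0 < X" and p: "0 < p" and B: "0 \<le> B"
    and fp: "\<And>\<sigma>. c \<le> \<sigma> \<Longrightarrow> \<sigma> \<le> d \<Longrightarrow> p \<le> \<bar>\<gamma> * \<sigma> powr (\<gamma> - 1) - \<mu>\<bar>"
    and S1: "\<And>\<sigma>. c \<le> \<sigma> \<Longrightarrow> \<sigma> \<le> d \<Longrightarrow> norm (\<Sum>n\<in>A. of_real (bump (\<rho> n * \<sigma>)) * expi (X * \<rho> n * (\<sigma> powr \<gamma> - \<mu> * \<sigma>))) \<le> B"
    and S2: "\<And>\<sigma>. c \<le> \<sigma> \<Longrightarrow> \<sigma> \<le> d \<Longrightarrow> norm (\<Sum>n\<in>A. of_real (\<rho> n * bump_deriv (\<rho> n * \<sigma>)) * expi (X * \<rho> n * (\<sigma> powr \<gamma> - \<mu> * \<sigma>))) \<le> B"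
  shows "norm (integral {c..d} (osc_sum \<gamma> \<mu> X \<rho> A)) \<le> 4 * B / (X * p)"
proof -
  define f f' where "f \<sigma> = \<gamma> * \<sigma> powr (\<gamma> - 1) - \<mu>" and "f' \<sigma> = \<gamma> * ((\<gamma> - 1) * \<sigma> powr (\<gamma> - 2))" for \<sigma> :: real
  define e where "e n \<sigma> = expi (X * \<rho> n * (\<sigma> powr \<gamma> - \<mu> * \<sigma>))" for n \<sigma>
  \<comment> \<open>\<open>T1' = T2 + 2 * pi * i * X * f * T0\<close>, so \<open>T0\<close> is a
    derivative divided by \<open>f\<close> up to the term \<open>T2\<close>; the bounds
    \<open>S1\<close> and \<open>S2\<close> are for these sums as a whole.\<close>
  define T1 T2 where "T1 \<sigma> = (\<Sum>n\<in>A. of_real (bump (\<rho> n * \<sigma>)) * e n \<sigma>)" and "T2 \<sigma> = (\<Sum>n\<in>A. of_real (\<rho> n * bump_deriv (\<rho> n * \<sigma>)) * e n \<sigma>)" for \<sigma>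
  define T0 where "T0 = osc_sum \<gamma> \<mu> X \<rho> A"
  have T0: "T0 \<sigma> = (\<Sum>n\<in>A. of_real (\<rho> n * bump (\<rho> n * \<sigma>)) * e n \<sigma>)" for \<sigma> by (simp add: T0_def osc_sum_def e_def)
  have pos: "\<sigma> > 0" if "\<sigma> \<in> {c..d}" for \<sigma> using that cd by auto
  have f0: "f \<sigma> \<noteq> 0" "p \<le> \<bar>f \<sigma>\<bar>" if "\<sigma> \<in> {c..d}" for \<sigma> using fp[of \<sigma>] that p by (auto simp: f_def)
  have df: "(f has_real_derivative f' \<sigma>) (at \<sigma> within {c..d})" if "\<sigma> \<in> {c..d}" for \<sigma>
    unfolding f_def f'_def using pos[OF that] by (auto intro!: derivative_eq_intros)
  have dT1: "(T1 has_vector_derivative (T2 \<sigma> + (2 * pi * \<i> * X * f \<sigma>) * T0 \<sigma>)) (at \<sigma> within {c..d})" if s: "\<sigma> \<in> {c..d}" for \<sigma>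
  proof -
    have "((\<lambda>\<sigma>. of_real (bump (\<rho> n * \<sigma>)) * e n \<sigma>) has_vector_derivative
       of_real (bump (\<rho> n * \<sigma>)) * (2 * pi * \<i> * of_real (X * \<rho> n * f \<sigma>) * e n \<sigma>) + of_real (bump_deriv (\<rho> n * \<sigma>) * \<rho> n) * e n \<sigma>) (at \<sigma> within {c..d})" for n
    proof (rule has_vector_derivative_mult)
      show "((\<lambda>\<sigma>. complex_of_real (bump (\<rho> n * \<sigma>))) has_vector_derivative of_real (bump_deriv (\<rho> n * \<sigma>) * \<rho> n)) (at \<sigma> within {c..d})"
        by (intro has_vector_derivative_of_real) (auto intro!: derivative_eq_intros simp: has_real_derivative_iff_has_vector_derivative[symmetric])
      have "((\<lambda>\<sigma>. X * \<rho> n * (\<sigma> powr \<gamma> - \<mu> * \<sigma>)) has_real_derivative X * \<rho> n * f \<sigma>) (at \<sigma> within {c..d})"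
        using pos[OF s] by (auto intro!: derivative_eq_intros simp: f_def)
      from expi_chain[OF this] show "(e n has_vector_derivative 2 * pi * \<i> * of_real (X * \<rho> n * f \<sigma>) * e n \<sigma>) (at \<sigma> within {c..d})"
        unfolding e_def by simp
    qed
    hence "(T1 has_vector_derivative (\<Sum>n\<in>A. of_real (bump (\<rho> n * \<sigma>)) * (2 * pi * \<i> * of_real (X * \<rho> n * f \<sigma>) * e n \<sigma>) + of_real (bump_deriv (\<rho> n * \<sigma>) * \<rho> n) * e n \<sigma>)) (at \<sigma> within {c..d})"
      unfolding T1_def by (intro has_vector_derivative_sum)
    also have "(\<Sum>n\<in>A. of_real (bump (\<rho> n * \<sigma>)) * (2 * pi * \<i> * of_real (X * \<rho> n * f \<sigma>) * e n \<sigma>) + of_real (bump_deriv (\<rho> n * \<sigma>) * \<rho> n) * e n \<sigma>)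
       = T2 \<sigma> + (2 * pi * \<i> * X * f \<sigma>) * T0 \<sigma>"
      unfolding T2_def T0 sum_distrib_left sum.distrib[symmetric] by (intro sum.cong refl) (simp add: algebra_simps)
    finally show ?thesis .
  qed
  have dinv: "((\<lambda>\<sigma>. 1 / f \<sigma>) has_real_derivative (- f' \<sigma> / (f \<sigma>)\<^sup>2)) (at \<sigma> within {c..d})" if s: "\<sigma> \<in> {c..d}" for \<sigma>
    using df[OF s] f0[OF s] by (auto intro!: derivative_eq_intros simp: power2_eq_square)
  have cont: "continuous_on {c..d} f" "continuous_on {c..d} f'" "continuous_on {c..d} T1" "continuous_on {c..d} T2" "continuous_on {c..d} T0"
    unfolding f_def f'_def T1_def T2_def T0_def e_def using pos
    by (auto intro!: continuous_intros continuous_on_osc_sum dest: pos)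
  have FTC: "((\<lambda>\<sigma>. of_real (1 / f \<sigma>) * (T2 \<sigma> + (2 * pi * \<i> * X * f \<sigma>) * T0 \<sigma>) + of_real (- f' \<sigma> / (f \<sigma>)\<^sup>2) * T1 \<sigma>) has_integral
      (of_real (1 / f d) * T1 d - of_real (1 / f c) * T1 c)) {c..d}"
  proof (rule fundamental_theorem_of_calculus[OF cd(2)])
    fix \<sigma> assume s: "\<sigma> \<in> {c..d}"
    show "((\<lambda>\<sigma>. of_real (1 / f \<sigma>) * T1 \<sigma>) has_vector_derivative of_real (1 / f \<sigma>) * (T2 \<sigma> + (2 * pi * \<i> * X * f \<sigma>) * T0 \<sigma>) + of_real (- f' \<sigma> / (f \<sigma>)\<^sup>2) * T1 \<sigma>) (at \<sigma> within {c..d})"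
    proof (rule has_vector_derivative_mult[OF _ dT1[OF s]])
      show "((\<lambda>\<sigma>. complex_of_real (1 / f \<sigma>)) has_vector_derivative of_real (- f' \<sigma> / (f \<sigma>)\<^sup>2)) (at \<sigma> within {c..d})"
        by (rule has_vector_derivative_of_real) (use dinv[OF s] in \<open>simp add: has_real_derivative_iff_has_vector_derivative\<close>)
    qed
  qed
  define I1 I2 where "I1 = integral {c..d} (\<lambda>\<sigma>. of_real (1 / f \<sigma>) * T2 \<sigma>)" and "I2 = integral {c..d} (\<lambda>\<sigma>. of_real (- f' \<sigma> / (f \<sigma>)\<^sup>2) * T1 \<sigma>)"
  have i1: "(\<lambda>\<sigma>. of_real (1 / f \<sigma>) * T2 \<sigma>) integrable_on {c..d}"
    by (intro integrable_continuous_interval continuous_intros cont) (use f0 in auto)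
  have i2: "(\<lambda>\<sigma>. of_real (- f' \<sigma> / (f \<sigma>)\<^sup>2) * T1 \<sigma>) integrable_on {c..d}"
    by (intro integrable_continuous_interval continuous_intros cont) (use f0 in auto)
  have "((\<lambda>\<sigma>. 2 * pi * \<i> * X * T0 \<sigma>) has_integral (of_real (1 / f d) * T1 d - of_real (1 / f c) * T1 c) - I1 - I2) {c..d}"
  proof (rule has_integral_eq[rotated])
    show "((\<lambda>\<sigma>. (of_real (1 / f \<sigma>) * (T2 \<sigma> + (2 * pi * \<i> * X * f \<sigma>) * T0 \<sigma>) + of_real (- f' \<sigma> / (f \<sigma>)\<^sup>2) * T1 \<sigma>)
        - of_real (1 / f \<sigma>) * T2 \<sigma> - of_real (- f' \<sigma> / (f \<sigma>)\<^sup>2) * T1 \<sigma>) has_integral (of_real (1 / f d) * T1 d - of_real (1 / f c) * T1 c) - I1 - I2) {c..d}"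
      unfolding I1_def I2_def by (intro has_integral_diff FTC integrable_integral i1 i2)
    fix \<sigma> assume "\<sigma> \<in> {c..d}"
    thus "of_real (1 / f \<sigma>) * (T2 \<sigma> + (2 * pi * \<i> * X * f \<sigma>) * T0 \<sigma>) + of_real (- f' \<sigma> / (f \<sigma>)\<^sup>2) * T1 \<sigma>
        - of_real (1 / f \<sigma>) * T2 \<sigma> - of_real (- f' \<sigma> / (f \<sigma>)\<^sup>2) * T1 \<sigma> = 2 * pi * \<i> * X * T0 \<sigma>"
      using f0[of \<sigma>] by (simp add: distrib_left)
  qed
  moreover have "((\<lambda>\<sigma>. 2 * pi * \<i> * X * T0 \<sigma>) has_integral (2 * pi * \<i> * X * integral {c..d} T0)) {c..d}"
    by (intro has_integral_mult_right integrable_integral integrable_continuous_interval cont)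
  ultimately have key: "2 * pi * \<i> * X * integral {c..d} T0 = (of_real (1 / f d) * T1 d - of_real (1 / f c) * T1 c) - I1 - I2"
    by (rule has_integral_unique[rotated])
  have T1b: "norm (T1 \<sigma>) \<le> B" and T2b: "norm (T2 \<sigma>) \<le> B" if "\<sigma> \<in> {c..d}" for \<sigma>
    using S1[of \<sigma>] S2[of \<sigma>] that by (auto simp: T1_def T2_def e_def)
  have finv: "\<bar>1 / f \<sigma>\<bar> \<le> 1 / p" if "\<sigma> \<in> {c..d}" for \<sigma>
    using f0[OF that] p by (auto simp: abs_divide intro!: divide_left_mono)
  have bT: "norm (of_real (1 / f \<sigma>) * T1 \<sigma>) \<le> B / p" if "\<sigma> \<in> {c..d}" for \<sigma>
  proof -
    have "norm (of_real (1 / f \<sigma>) * T1 \<sigma>) = \<bar>1 / f \<sigma>\<bar> * norm (T1 \<sigma>)" by (simp only: norm_mult norm_of_real)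
    also have "\<dots> \<le> 1 / p * B" using finv[OF that] T1b[OF that] p by (intro mult_mono) auto
    finally show ?thesis by simp
  qed
  have I1b: "norm I1 \<le> 15 * B / p"
  proof -
    have "norm I1 \<le> integral {c..d} (\<lambda>\<sigma>. B / p)" unfolding I1_def
    proof (rule integral_norm_bound_integral[OF i1])
      fix \<sigma> assume s: "\<sigma> \<in> {c..d}"
      have "norm (of_real (1 / f \<sigma>) * T2 \<sigma>) = \<bar>1 / f \<sigma>\<bar> * norm (T2 \<sigma>)" by (simp only: norm_mult norm_of_real)
      also have "\<dots> \<le> 1 / p * B" using finv[OF s] T2b[OF s] p by (intro mult_mono) auto
      finally show "norm (of_real (1 / f \<sigma>) * T2 \<sigma>) \<le> B / p" by simp
    qed (auto intro!: integrable_continuous_interval continuous_intros)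
    also have "\<dots> = (d - c) * (B / p)" using cd by simp
    also have "\<dots> \<le> 15 * (B / p)" using cd B p by (intro mult_right_mono) auto
    finally show ?thesis by simp
  qed
  have I2b: "norm I2 \<le> 2 * B / p"
  proof -
    \<comment> \<open>\<open>- f'\<close> is nonnegative, so the integral of
      \<open>\<bar>f'\<bar> / f\<^sup>2\<close> is the difference of \<open>1 / f\<close> at the end
      points, and the length of the interval does not enter.\<close>
    have hi: "((\<lambda>\<sigma>. B * (- f' \<sigma> / (f \<sigma>)\<^sup>2)) has_integral B * (1 / f d - 1 / f c)) {c..d}"
      by (intro has_integral_mult_right fundamental_theorem_of_calculus cd)
         (use dinv in \<open>simp add: has_real_derivative_iff_has_vector_derivative\<close>)
    have "norm I2 \<le> integral {c..d} (\<lambda>\<sigma>. B * (- f' \<sigma> / (f \<sigma>)\<^sup>2))" unfolding I2_def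
    proof (rule integral_norm_bound_integral[OF i2])
      show "(\<lambda>\<sigma>. B * (- f' \<sigma> / (f \<sigma>)\<^sup>2)) integrable_on {c..d}" using hi by blast
      fix \<sigma> assume s: "\<sigma> \<in> {c..d}"
      have "(\<gamma> - 1) * \<sigma> powr (\<gamma> - 2) \<le> 0" using \<gamma> by (intro mult_nonpos_nonneg) auto
      hence "f' \<sigma> \<le> 0" unfolding f'_def using \<gamma> by (simp add: mult_nonneg_nonpos)
      hence n: "- f' \<sigma> / (f \<sigma>)\<^sup>2 \<ge> 0" by (intro divide_nonneg_nonneg) auto
      have "norm (of_real (- f' \<sigma> / (f \<sigma>)\<^sup>2) * T1 \<sigma>) = \<bar>- f' \<sigma> / (f \<sigma>)\<^sup>2\<bar> * norm (T1 \<sigma>)" by (simp only: norm_mult norm_of_real)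
      also have "\<dots> = (- f' \<sigma> / (f \<sigma>)\<^sup>2) * norm (T1 \<sigma>)" using n by (simp only: abs_of_nonneg)
      also have "\<dots> \<le> (- f' \<sigma> / (f \<sigma>)\<^sup>2) * B" using T1b[OF s] n by (intro mult_left_mono) auto
      finally show "norm (of_real (- f' \<sigma> / (f \<sigma>)\<^sup>2) * T1 \<sigma>) \<le> B * (- f' \<sigma> / (f \<sigma>)\<^sup>2)" by (simp only: mult.commute)
    qed
    also have "\<dots> = B * (1 / f d - 1 / f c)" by (rule integral_unique[OF hi])
    also have "\<dots> \<le> B * (1 / p + 1 / p)"
    proof (rule mult_left_mono[OF _ B])
      have "c \<in> {c..d}" "d \<in> {c..d}" using cd by auto
      from finv[OF this(1)] finv[OF this(2)] show "1 / f d - 1 / f c \<le> 1 / p + 1 / p" by linarith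
    qed
    finally show ?thesis by (simp add: mult.commute)
  qed
  \<comment> \<open>In units of \<open>B / p\<close>: the boundary terms give 2, \<open>I1\<close>
    gives 15 from the length of the interval, \<open>I2\<close> gives 2. The total is 19, and
    \<open>19 / (2 * pi) < 4\<close>.\<close>
  have "norm (2 * pi * \<i> * X * integral {c..d} T0) \<le> ((B / p + B / p) + 15 * B / p) + 2 * B / p"
    unfolding key using bT[of c] bT[of d] I1b I2b cd
    by (intro order.trans[OF norm_triangle_ineq4] add_mono) auto
  also have "\<dots> = 19 * (B / p)" by simp
  finally have "2 * pi * X * norm (integral {c..d} T0) \<le> 19 * (B / p)" using X by (simp add: norm_mult)
  moreover have "6 * X * norm (integral {c..d} T0) \<le> 2 * pi * X * norm (integral {c..d} T0)"
    using pi_gt3 X by (intro mult_right_mono) auto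
  ultimately have "6 * (X * norm (integral {c..d} T0)) \<le> 19 * (B / p)" by linarith
  moreover have "0 \<le> B / p" using B p by simp
  ultimately have "X * norm (integral {c..d} T0) \<le> 4 * (B / p)" by linarith
  thus ?thesis using X p unfolding T0_def by (simp add: field_simps)
qed

text \<open>The weights are Lipschitz functions of the decreasing quantity
  \<open>\<rho> n * \<sigma>\<close>, so \<open>weighted_sum_bound\<close> applies. A separate
  factor \<open>\<rho> n\<close> becomes \<open>\<rho> n * \<sigma>\<close> at the cost of
  \<open>1 / \<sigma> \<le> 2\<close>, whence 32 for 16.\<close>

lemma osc_sums_bound:
  assumes A: "A > 0" "lipschitz_bound A bump" "lipschitz_bound A (\<lambda>t. t * bump t)" "lipschitz_bound A (\<lambda>t. t * bump_deriv t)"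
    and \<sigma>: "1/2 \<le> \<sigma>" "\<sigma> \<le> 15" and E: "0 \<le> E"
    and \<rho>: "\<And>n. a \<le> n \<Longrightarrow> n \<le> b \<Longrightarrow> 0 \<le> \<rho> n \<and> \<rho> n \<le> 1" "\<And>n. a \<le> n \<Longrightarrow> n < b \<Longrightarrow> \<rho> (Suc n) \<le> \<rho> n"
    and S: "\<And>n. a \<le> n \<Longrightarrow> n \<le> b \<Longrightarrow> norm (\<Sum>i\<in>{a..n}. expi (X * \<rho> i * (\<sigma> powr \<gamma> - \<mu> * \<sigma>))) \<le> E"
  shows "norm (\<Sum>n\<in>{a..b}. of_real (bump (\<rho> n * \<sigma>)) * expi (X * \<rho> n * (\<sigma> powr \<gamma> - \<mu> * \<sigma>))) \<le> 32 * A * E \<and>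
      norm (\<Sum>n\<in>{a..b}. of_real (\<rho> n * bump_deriv (\<rho> n * \<sigma>)) * expi (X * \<rho> n * (\<sigma> powr \<gamma> - \<mu> * \<sigma>))) \<le> 32 * A * E \<and>
      norm (osc_sum \<gamma> \<mu> X \<rho> {a..b} \<sigma>) \<le> 32 * A * E"
proof -
  define e where "e n = expi (X * \<rho> n * (\<sigma> powr \<gamma> - \<mu> * \<sigma>))" for n
  have S': "\<And>n. a \<le> n \<Longrightarrow> n \<le> b \<Longrightarrow> norm (\<Sum>i\<in>{a..n}. e i) \<le> E" using S by (simp add: e_def)
  have y: "0 \<le> \<rho> n * \<sigma> \<and> \<rho> n * \<sigma> \<le> 15" if "a \<le> n" "n \<le> b" for n
    using \<rho>(1)[OF that] \<sigma> mult_mono[of "\<rho> n" 1 \<sigma> 15] by auto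
  have y2: "\<rho> (Suc n) * \<sigma> \<le> \<rho> n * \<sigma>" if "a \<le> n" "n < b" for n
    using \<rho>(2)[OF that] \<sigma> by (intro mult_right_mono) auto
  have W: "norm (\<Sum>n\<in>{a..b}. of_real (f (\<rho> n * \<sigma>)) * e n) \<le> 16 * A * E" if "lipschitz_bound A f" for f
    by (rule weighted_sum_bound[OF that, where y = "\<lambda>n. \<rho> n * \<sigma>"]) (use A E y y2 S' in auto)
  have div: "norm (\<Sum>n\<in>{a..b}. of_real (\<rho> n * g (\<rho> n * \<sigma>)) * e n) \<le> 32 * A * E" if "lipschitz_bound A (\<lambda>t. t * g t)" for g
  proof -
    have "(\<Sum>n\<in>{a..b}. of_real (\<rho> n * g (\<rho> n * \<sigma>)) * e n) = of_real (1 / \<sigma>) * (\<Sum>n\<in>{a..b}. of_real (\<rho> n * \<sigma> * g (\<rho> n * \<sigma>)) * e n)"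
      unfolding sum_distrib_left using \<sigma> by (intro sum.cong refl) simp
    hence "norm (\<Sum>n\<in>{a..b}. of_real (\<rho> n * g (\<rho> n * \<sigma>)) * e n) = \<bar>1 / \<sigma>\<bar> * norm (\<Sum>n\<in>{a..b}. of_real (\<rho> n * \<sigma> * g (\<rho> n * \<sigma>)) * e n)"
      by (simp only: norm_mult norm_of_real)
    also have "\<dots> \<le> 2 * (16 * A * E)"
    proof (intro mult_mono)
      show "\<bar>1 / \<sigma>\<bar> \<le> 2" using \<sigma> by (simp add: field_simps)
      show "norm (\<Sum>n\<in>{a..b}. of_real (\<rho> n * \<sigma> * g (\<rho> n * \<sigma>)) * e n) \<le> 16 * A * E" using W[OF that] by simp
    qed auto
    finally show ?thesis by simp
  qed
  have "0 \<le> A * E" using A E by simp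
  hence "norm (\<Sum>n\<in>{a..b}. of_real (bump (\<rho> n * \<sigma>)) * e n) \<le> 32 * A * E" using W[OF A(2)] by linarith
  thus ?thesis
    using div[OF A(3)] div[OF A(4)] unfolding osc_sum_def e_def by blast
qed

text \<open>The derivative \<open>f\<close> of the common phase decreases in \<sigma> and is cut at
  the levels \<open>c3\<close>, \<open>r\<close>, \<open>- r\<close>, \<open>- c3\<close> with
  \<open>r = 1 / sqrt X\<close>. For \<open>\<bar>f\<bar> \<ge> c3\<close> integration by parts
  saves \<open>X\<close> over the trivial bound for the sum over \<open>n\<close>. For smaller
  \<open>\<bar>f\<bar>\<close> the phase \<open>\<sigma> powr \<gamma> - \<mu> * \<sigma>\<close> is
  bounded away from 0, so the assumption with \<open>E\<close> applies; there integration by parts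
  saves \<open>X * r\<close>, and the innermost piece has length of order \<open>r\<close>. Both
  savings are \<open>sqrt X\<close>.\<close>

theorem osc_integral_bound:
  fixes \<gamma> :: real
  assumes \<gamma>: "0 < \<gamma>" "\<gamma> < 1"
  obtains C c where "C > 0" "c > 0" and "\<And>\<mu> X \<rho> a b E. X \<ge> 1 \<Longrightarrow> 0 \<le> E \<Longrightarrow>
      (\<And>n. a \<le> n \<Longrightarrow> n \<le> b \<Longrightarrow> 0 \<le> \<rho> n \<and> \<rho> n \<le> 1) \<Longrightarrow> (\<And>n. a \<le> n \<Longrightarrow> n < b \<Longrightarrow> \<rho> (Suc n) \<le> \<rho> n) \<Longrightarrow>
      (\<And>P n. c * X \<le> P \<Longrightarrow> P \<le> 16 * X \<Longrightarrow> a \<le> n \<Longrightarrow> n \<le> b \<Longrightarrow> norm (\<Sum>i\<in>{a..n}. expi (P * \<rho> i)) \<le> E) \<Longrightarrow>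
      norm (integral {1/2..15} (osc_sum \<gamma> \<mu> X \<rho> {a..b})) \<le> C * (E / sqrt X + real (b + 1 - a) / X)"
    and "\<And>\<mu> X \<rho> a b. X \<ge> 1 \<Longrightarrow> \<bar>\<mu>\<bar> \<ge> 4 \<Longrightarrow>
      (\<And>n. a \<le> n \<Longrightarrow> n \<le> b \<Longrightarrow> 0 \<le> \<rho> n \<and> \<rho> n \<le> 1) \<Longrightarrow> (\<And>n. a \<le> n \<Longrightarrow> n < b \<Longrightarrow> \<rho> (Suc n) \<le> \<rho> n) \<Longrightarrow>
      norm (integral {1/2..15} (osc_sum \<gamma> \<mu> X \<rho> {a..b})) \<le> C * real (b + 1 - a) / (X * \<bar>\<mu>\<bar>)"
proof -
  obtain A where A: "A > 0" "lipschitz_bound A bump" "lipschitz_bound A (\<lambda>t. t * bump t)" "lipschitz_bound A (\<lambda>t. t * bump_deriv t)"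
    using lipschitz_bound_bump by blast
  define D where "D = 32 * A"
  have D: "D > 0" using A by (simp add: D_def)
  note sums = osc_sums_bound[OF A, folded D_def]
  define c1 where "c1 = \<gamma> * (1 - \<gamma>) * 15 powr (\<gamma> - 2)"
  \<comment> \<open>Chosen so that \<open>15 * c3 = (1 - \<gamma>) / 4\<close>: the term
    \<open>\<sigma> * f \<mu> \<sigma>\<close> then takes away at most half of \<open>(1 - \<gamma>)
    * \<sigma> powr \<gamma> \<ge> (1 - \<gamma>) / 2\<close>.\<close>
  define c3 where "c3 = (1 - \<gamma>) / 60"
  have c13: "c1 > 0" "c3 > 0" using \<gamma> by (auto simp: c1_def c3_def)
  define C where "C = 8 * D / c3 + 8 * D + 2 * D / c1 + 15 * D / c3\<^sup>2"
  have Cge: "8 * D / c3 \<le> C" "8 * D + 2 * D / c1 \<le> C" "15 * D / c3\<^sup>2 \<le> C" "8 * D \<le> C" "C > 0"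
    using D c13 by (simp_all add: C_def add_pos_pos)
  define f where "f \<mu> \<sigma> = \<gamma> * \<sigma> powr (\<gamma> - 1) - \<mu>" for \<mu> \<sigma> :: real
  have far: "norm (integral {c..d} (osc_sum \<gamma> \<mu> X \<rho> {a..b})) \<le> 4 * (D * real (b + 1 - a)) / (X * p)"
    if X: "X \<ge> 1" and p: "p > 0" and cd: "1/2 \<le> c" "c \<le> d" "d \<le> 15" "c = d \<or> (\<forall>\<sigma>\<in>{c..d}. p \<le> \<bar>f \<mu> \<sigma>\<bar>)"
      and \<rho>: "\<And>n. a \<le> n \<Longrightarrow> n \<le> b \<Longrightarrow> 0 \<le> \<rho> n \<and> \<rho> n \<le> 1" "\<And>n. a \<le> n \<Longrightarrow> n < b \<Longrightarrow> \<rho> (Suc n) \<le> \<rho> n"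
    for X p c d \<mu> \<rho> a b
  proof (cases "c = d")
    case True thus ?thesis using D X p by simp
  next
    case False
    have triv: "norm (\<Sum>i\<in>{a..n}. expi (X * \<rho> i * (\<sigma> powr \<gamma> - \<mu> * \<sigma>))) \<le> real (b + 1 - a)" if "a \<le> n" "n \<le> b" for n \<sigma>
    proof -
      have "norm (\<Sum>i\<in>{a..n}. expi (X * \<rho> i * (\<sigma> powr \<gamma> - \<mu> * \<sigma>))) \<le> (\<Sum>i\<in>{a..n}. 1)" by (rule sum_norm_le) simp
      also have "\<dots> \<le> real (b + 1 - a)" using that by simp
      finally show ?thesis .
    qed
    show ?thesis
    proof (rule osc_integral_by_parts[OF \<gamma> cd(1-3)])
      fix \<sigma> assume "c \<le> \<sigma>" "\<sigma> \<le> d"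
      hence s: "1/2 \<le> \<sigma>" "\<sigma> \<le> 15" using cd by auto
      show "p \<le> \<bar>\<gamma> * \<sigma> powr (\<gamma> - 1) - \<mu>\<bar>" using cd(4) False \<open>c \<le> \<sigma>\<close> \<open>\<sigma> \<le> d\<close> by (auto simp: f_def)
      show "norm (\<Sum>n\<in>{a..b}. of_real (bump (\<rho> n * \<sigma>)) * expi (X * \<rho> n * (\<sigma> powr \<gamma> - \<mu> * \<sigma>))) \<le> D * real (b + 1 - a)"
        using sums[of \<sigma> "real (b + 1 - a)" a b \<rho> X \<gamma> \<mu>] s \<rho> triv by simp
      show "norm (\<Sum>n\<in>{a..b}. of_real (\<rho> n * bump_deriv (\<rho> n * \<sigma>)) * expi (X * \<rho> n * (\<sigma> powr \<gamma> - \<mu> * \<sigma>))) \<le> D * real (b + 1 - a)"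
        using sums[of \<sigma> "real (b + 1 - a)" a b \<rho> X \<gamma> \<mu>] s \<rho> triv by simp
    qed (use X p D in auto)
  qed
  have int: "osc_sum \<gamma> \<mu> X \<rho> A integrable_on {c..d}" if "1/2 \<le> c" for \<mu> X \<rho> A c d
    using that by (intro integrable_continuous_interval continuous_on_osc_sum) auto
  show ?thesis
  proof (rule that[of C "(1 - \<gamma>) / 4"])
    show "C > 0" by (rule Cge)
    show "(1 - \<gamma>) / 4 > 0" using \<gamma> by simp
  next
    fix \<mu> X :: real and \<rho> :: "nat \<Rightarrow> real" and a b :: nat
    assume X: "X \<ge> 1" and \<mu>: "\<bar>\<mu>\<bar> \<ge> 4" and \<rho>: "\<And>n. a \<le> n \<Longrightarrow> n \<le> b \<Longrightarrow> 0 \<le> \<rho> n \<and> \<rho> n \<le> 1" "\<And>n. a \<le> n \<Longrightarrow> n < b \<Longrightarrow> \<rho> (Suc n) \<le> \<rho> n"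
    have "norm (integral {1/2..15} (osc_sum \<gamma> \<mu> X \<rho> {a..b})) \<le> 4 * (D * real (b + 1 - a)) / (X * (\<bar>\<mu>\<bar> / 2))"
    proof (rule far[where \<mu> = \<mu> and a = a and b = b and \<rho> = \<rho>, OF X])
      \<comment> \<open>\<open>\<gamma> * \<sigma> powr (\<gamma> - 1)\<close> is at most 2 here,
        hence at most half of \<open>\<bar>\<mu>\<bar>\<close>; there is no stationary
        point.\<close>
      show "(1/2::real) = 15 \<or> (\<forall>\<sigma>\<in>{1/2..15}. \<bar>\<mu>\<bar> / 2 \<le> \<bar>f \<mu> \<sigma>\<bar>)"
      proof (intro disjI2 ballI)
        fix \<sigma> :: real assume s: "\<sigma> \<in> {1/2..15}"
        have "\<sigma> powr (\<gamma> - 1) \<le> (1/2) powr (\<gamma> - 1)" using s \<gamma> by (intro powr_mono2') auto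
        also have "\<dots> \<le> (1/2) powr (-1)" using \<gamma> by (intro powr_mono') auto
        also have "\<dots> = 2" by (simp add: powr_minus)
        finally have "\<gamma> * \<sigma> powr (\<gamma> - 1) \<le> 1 * 2" using \<gamma> by (intro mult_mono) auto
        moreover have "0 \<le> \<gamma> * \<sigma> powr (\<gamma> - 1)" using \<gamma> by simp
        ultimately show "\<bar>\<mu>\<bar> / 2 \<le> \<bar>f \<mu> \<sigma>\<bar>" using \<mu> unfolding f_def by linarith
      qed
    qed (use \<mu> \<rho> in auto)
    also have "\<dots> = 8 * D * (real (b + 1 - a) / (X * \<bar>\<mu>\<bar>))" by simp
    also have "\<dots> \<le> C * (real (b + 1 - a) / (X * \<bar>\<mu>\<bar>))" using X Cge by (intro mult_right_mono) auto
    finally show "norm (integral {1/2..15} (osc_sum \<gamma> \<mu> X \<rho> {a..b})) \<le> C * real (b + 1 - a) / (X * \<bar>\<mu>\<bar>)" by simp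
  next
    fix \<mu> X :: real and \<rho> :: "nat \<Rightarrow> real" and a b :: nat and E :: real
    assume X: "X \<ge> 1" and E: "0 \<le> E" and \<rho>: "\<And>n. a \<le> n \<Longrightarrow> n \<le> b \<Longrightarrow> 0 \<le> \<rho> n \<and> \<rho> n \<le> 1" "\<And>n. a \<le> n \<Longrightarrow> n < b \<Longrightarrow> \<rho> (Suc n) \<le> \<rho> n"
      and S: "\<And>P n. (1 - \<gamma>) / 4 * X \<le> P \<Longrightarrow> P \<le> 16 * X \<Longrightarrow> a \<le> n \<Longrightarrow> n \<le> b \<Longrightarrow> norm (\<Sum>i\<in>{a..n}. expi (P * \<rho> i)) \<le> E"
    define \<nu> where "\<nu> = real (b + 1 - a)"
    have \<nu>: "\<nu> \<ge> 0" by (simp add: \<nu>_def)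
    define T where "T = osc_sum \<gamma> \<mu> X \<rho> {a..b}"
    define r where "r = 1 / sqrt X"
    have r: "r > 0" "X * r = sqrt X" using X by (auto simp: r_def real_div_sqrt)
    have intT: "T integrable_on {c..d}" if "1/2 \<le> c" for c d unfolding T_def by (rule int[OF that])
    have near: "norm (\<Sum>n\<in>{a..b}. of_real (bump (\<rho> n * \<sigma>)) * expi (X * \<rho> n * (\<sigma> powr \<gamma> - \<mu> * \<sigma>))) \<le> D * E \<and>
      norm (\<Sum>n\<in>{a..b}. of_real (\<rho> n * bump_deriv (\<rho> n * \<sigma>)) * expi (X * \<rho> n * (\<sigma> powr \<gamma> - \<mu> * \<sigma>))) \<le> D * E \<and>
      norm (T \<sigma>) \<le> D * E" if s: "1/2 \<le> \<sigma>" "\<sigma> \<le> 15" and f: "\<bar>f \<mu> \<sigma>\<bar> \<le> c3" for \<sigma>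
      unfolding T_def
    proof (rule sums[of \<sigma> E a b \<rho> X \<gamma> \<mu>, OF s E \<rho>])
      fix n assume n: "a \<le> n" "n \<le> b"
      define p where "p = \<sigma> powr \<gamma> - \<mu> * \<sigma>"
      \<comment> \<open>Near a zero of the derivative the phase itself is about
        \<open>(1 - \<gamma>) * \<sigma> powr \<gamma>\<close>; this is why the range of
        \<open>P\<close> in the assumption starts at a positive multiple of
        \<open>X\<close>.\<close>
      have peq: "p = (1 - \<gamma>) * \<sigma> powr \<gamma> + \<sigma> * f \<mu> \<sigma>"
      proof -
        have "\<sigma> * \<sigma> powr (\<gamma> - 1) = \<sigma> powr \<gamma>" using s powr_mult_base[of \<sigma> "\<gamma> - 1"] by simp
        hence "\<sigma> * f \<mu> \<sigma> = \<gamma> * \<sigma> powr \<gamma> - \<mu> * \<sigma>" unfolding f_def by (simp add: algebra_simps)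
        thus ?thesis by (simp add: p_def algebra_simps)
      qed
      have "\<bar>\<sigma> * f \<mu> \<sigma>\<bar> \<le> 15 * c3" unfolding abs_mult using s f by (intro mult_mono) auto
      hence sf: "\<bar>\<sigma> * f \<mu> \<sigma>\<bar> \<le> (1 - \<gamma>) / 4" by (simp add: c3_def)
      have "1/2 = (1/2::real) powr 1" by simp
      also have "\<dots> \<le> (1/2) powr \<gamma>" using \<gamma> by (intro powr_mono') auto
      also have "\<dots> \<le> \<sigma> powr \<gamma>" using s \<gamma> by (intro powr_mono2) auto
      finally have "(1 - \<gamma>) * (1/2) \<le> (1 - \<gamma>) * \<sigma> powr \<gamma>" using \<gamma> by (intro mult_left_mono) auto
      hence lo: "(1 - \<gamma>) / 4 \<le> p" using sf unfolding peq by linarith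
      have "\<sigma> powr \<gamma> \<le> 15 powr \<gamma>" using s \<gamma> by (intro powr_mono2) auto
      also have "\<dots> \<le> 15 powr 1" using \<gamma> by (intro powr_mono) auto
      finally have "(1 - \<gamma>) * \<sigma> powr \<gamma> \<le> 1 * 15" using \<gamma> by (intro mult_mono) auto
      moreover have "\<sigma> * f \<mu> \<sigma> \<le> 1" using sf \<gamma> by (simp add: abs_le_iff)
      ultimately have hi: "p \<le> 16" using add_mono[of "(1 - \<gamma>) * \<sigma> powr \<gamma>" "1 * 15" "\<sigma> * f \<mu> \<sigma>" 1] unfolding peq by simp
      have "norm (\<Sum>i\<in>{a..n}. expi ((X * p) * \<rho> i)) \<le> E"
        using lo hi X by (intro S n) (auto simp: mult.commute[of X])
      thus "norm (\<Sum>i\<in>{a..n}. expi (X * \<rho> i * (\<sigma> powr \<gamma> - \<mu> * \<sigma>))) \<le> E" by (simp add: p_def mult_ac)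
    qed
    have mid: "norm (integral {c..d} T) \<le> 4 * (D * E) / sqrt X"
      if cd: "1/2 \<le> c" "c \<le> d" "d \<le> 15" "c = d \<or> (\<forall>\<sigma>\<in>{c..d}. r \<le> \<bar>f \<mu> \<sigma>\<bar> \<and> \<bar>f \<mu> \<sigma>\<bar> \<le> c3)" for c d
    proof (cases "c = d")
      case True thus ?thesis using D E X by simp
    next
      case False
      have "norm (integral {c..d} T) \<le> 4 * (D * E) / (X * r)" unfolding T_def
      proof (rule osc_integral_by_parts[OF \<gamma> cd(1-3)])
        fix \<sigma> assume s: "c \<le> \<sigma>" "\<sigma> \<le> d"
        show "r \<le> \<bar>\<gamma> * \<sigma> powr (\<gamma> - 1) - \<mu>\<bar>" using cd(4) False s by (auto simp: f_def)
        have "\<bar>f \<mu> \<sigma>\<bar> \<le> c3" using cd(4) False s by auto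
        thus "norm (\<Sum>n\<in>{a..b}. of_real (bump (\<rho> n * \<sigma>)) * expi (X * \<rho> n * (\<sigma> powr \<gamma> - \<mu> * \<sigma>))) \<le> D * E"
          "norm (\<Sum>n\<in>{a..b}. of_real (\<rho> n * bump_deriv (\<rho> n * \<sigma>)) * expi (X * \<rho> n * (\<sigma> powr \<gamma> - \<mu> * \<sigma>))) \<le> D * E"
          using near[of \<sigma>] s cd by auto
      qed (use X r D E in auto)
      thus ?thesis by (simp only: r)
    qed
    have "norm (integral {1/2..15} T) \<le> C * (E / sqrt X + \<nu> / X)"
    proof (cases "r \<le> c3")
      case False
      \<comment> \<open>Here \<open>sqrt X < 1 / c3\<close>, so \<open>X\<close> is bounded and the
        trivial estimate already has the shape \<open>\<nu> / X\<close>.\<close>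
      have Xc: "X * c3\<^sup>2 \<le> 1"
      proof -
        have "c3\<^sup>2 \<le> r\<^sup>2" using False c13 by (intro power_mono) auto
        also have "r\<^sup>2 = 1 / X" using X by (simp add: r_def power_divide)
        finally show ?thesis using X by (simp add: field_simps)
      qed
      have "norm (integral {1/2..15} T) \<le> integral {1/2..15} (\<lambda>\<sigma>::real. D * \<nu>)"
      proof (rule integral_norm_bound_integral[OF intT])
        fix \<sigma> :: real assume s: "\<sigma> \<in> {1/2..15}"
        have "norm (\<Sum>i\<in>{a..n}. expi (X * \<rho> i * (\<sigma> powr \<gamma> - \<mu> * \<sigma>))) \<le> \<nu>" if "a \<le> n" "n \<le> b" for n
        proof -
          have "norm (\<Sum>i\<in>{a..n}. expi (X * \<rho> i * (\<sigma> powr \<gamma> - \<mu> * \<sigma>))) \<le> (\<Sum>i\<in>{a..n}. 1)" by (rule sum_norm_le) simp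
          also have "\<dots> \<le> \<nu>" using that by (simp add: \<nu>_def)
          finally show ?thesis .
        qed
        thus "norm (T \<sigma>) \<le> D * \<nu>" unfolding T_def using sums[of \<sigma> \<nu> a b \<rho> X \<gamma> \<mu>] s \<nu> \<rho> by auto
      qed auto
      also have "\<dots> = 29/2 * (D * \<nu>)" by simp
      also have "\<dots> \<le> 15 * (D * \<nu>) * (1 / (X * c3\<^sup>2))"
      proof -
        have "1 \<le> 1 / (X * c3\<^sup>2)" using Xc X c13 by simp
        hence "15 * (D * \<nu>) * 1 \<le> 15 * (D * \<nu>) * (1 / (X * c3\<^sup>2))" using D \<nu> by (intro mult_left_mono) auto
        moreover have "0 \<le> D * \<nu>" using D \<nu> by simp
        ultimately show ?thesis by linarith
      qed
      also have "\<dots> = (15 * D / c3\<^sup>2) * (\<nu> / X)" by (simp add: mult.commute)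
      also have "\<dots> \<le> C * (\<nu> / X)" using Cge \<nu> X by (intro mult_right_mono) auto
      also have "\<dots> \<le> C * (E / sqrt X + \<nu> / X)" using Cge E X by (intro mult_left_mono) auto
      finally show ?thesis .
    next
      case True
      have cont: "continuous_on {c..15} (f \<mu>)" if "1/2 \<le> c" for c
        unfolding f_def using that by (intro continuous_intros) auto
      have mono: "f \<mu> y \<le> f \<mu> x" if "1/2 \<le> x" "x \<le> y" for x y
        unfolding f_def using that \<gamma> by (intro diff_right_mono mult_left_mono powr_mono2') auto
      obtain s1 where s1: "1/2 \<le> s1" "s1 \<le> 15" "s1 = 1/2 \<or> (\<forall>x\<in>{1/2..s1}. c3 \<le> f \<mu> x)" "s1 = 15 \<or> (\<forall>x\<in>{s1..15}. f \<mu> x \<le> c3)"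
        using antimono_cut[of "1/2" 15 "f \<mu>" c3] cont mono by auto
      obtain s2 where s2: "s1 \<le> s2" "s2 \<le> 15" "s2 = s1 \<or> (\<forall>x\<in>{s1..s2}. r \<le> f \<mu> x)" "s2 = 15 \<or> (\<forall>x\<in>{s2..15}. f \<mu> x \<le> r)"
        using antimono_cut[of s1 15 "f \<mu>" r] cont mono s1 by auto
      obtain s3 where s3: "s2 \<le> s3" "s3 \<le> 15" "s3 = s2 \<or> (\<forall>x\<in>{s2..s3}. - r \<le> f \<mu> x)" "s3 = 15 \<or> (\<forall>x\<in>{s3..15}. f \<mu> x \<le> - r)"
        using antimono_cut[of s2 15 "f \<mu>" "-r"] cont mono s1 s2 by auto
      obtain s4 where s4: "s3 \<le> s4" "s4 \<le> 15" "s4 = s3 \<or> (\<forall>x\<in>{s3..s4}. - c3 \<le> f \<mu> x)" "s4 = 15 \<or> (\<forall>x\<in>{s4..15}. f \<mu> x \<le> - c3)"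
        using antimono_cut[of s3 15 "f \<mu>" "-c3"] cont mono s1 s2 s3 by auto
      have q1: "1/2 = s1 \<or> (\<forall>\<sigma>\<in>{1/2..s1}. c3 \<le> \<bar>f \<mu> \<sigma>\<bar>)"
      proof (cases "1/2 = s1")
        case False
        hence "c3 \<le> f \<mu> x" if "x \<in> {1/2..s1}" for x using s1(3) that by metis
        thus ?thesis by (meson abs_ge_self order.trans)
      qed simp
      have q5: "s4 = 15 \<or> (\<forall>\<sigma>\<in>{s4..15}. c3 \<le> \<bar>f \<mu> \<sigma>\<bar>)"
      proof (cases "s4 = 15")
        case False
        hence "c3 \<le> \<bar>f \<mu> x\<bar>" if "x \<in> {s4..15}" for x using bspec[of "{s4..15}" "\<lambda>x. f \<mu> x \<le> - c3" x] s4(4) that by linarith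
        thus ?thesis by blast
      qed simp
      have q2: "s1 = s2 \<or> (\<forall>\<sigma>\<in>{s1..s2}. r \<le> \<bar>f \<mu> \<sigma>\<bar> \<and> \<bar>f \<mu> \<sigma>\<bar> \<le> c3)"
      proof (cases "s1 = s2")
        case False
        have "r \<le> \<bar>f \<mu> x\<bar> \<and> \<bar>f \<mu> x\<bar> \<le> c3" if x: "x \<in> {s1..s2}" for x
        proof -
          have "r \<le> f \<mu> x" using s2(3) False x by metis
          moreover have "s1 \<noteq> 15" using False s2 by linarith
          hence "f \<mu> x \<le> c3" using s1(4) x s2(2) by (meson atLeastAtMost_iff order.trans)
          ultimately show ?thesis using r by linarith
        qed
        thus ?thesis by blast
      qed simp
      have q4: "s3 = s4 \<or> (\<forall>\<sigma>\<in>{s3..s4}. r \<le> \<bar>f \<mu> \<sigma>\<bar> \<and> \<bar>f \<mu> \<sigma>\<bar> \<le> c3)"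
      proof (cases "s3 = s4")
        case False
        have "r \<le> \<bar>f \<mu> x\<bar> \<and> \<bar>f \<mu> x\<bar> \<le> c3" if x: "x \<in> {s3..s4}" for x
        proof -
          have "- c3 \<le> f \<mu> x" using s4(3) False x by metis
          moreover have "s3 \<noteq> 15" using False s4 by linarith
          hence "f \<mu> x \<le> - r" using s3(4) x s4(2) by (meson atLeastAtMost_iff order.trans)
          ultimately show ?thesis using r by linarith
        qed
        thus ?thesis by blast
      qed simp
      have ord: "1/2 \<le> s2" "1/2 \<le> s3" "1/2 \<le> s4" using s1 s2 s3 s4 by linarith+
      have F1: "norm (integral {1/2..s1} T) \<le> 4 * (D * \<nu>) / (X * c3)" unfolding T_def \<nu>_def
        by (rule far[where \<mu> = \<mu> and a = a and b = b and \<rho> = \<rho>, OF X c13(2) order.refl s1(1,2) q1 \<rho>])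
      have F5: "norm (integral {s4..15} T) \<le> 4 * (D * \<nu>) / (X * c3)" unfolding T_def \<nu>_def
        by (rule far[where \<mu> = \<mu> and a = a and b = b and \<rho> = \<rho>, OF X c13(2) ord(3) s4(2) order.refl q5 \<rho>])
      have F2: "norm (integral {s1..s2} T) \<le> 4 * (D * E) / sqrt X"
        by (rule mid[OF s1(1) s2(1,2) q2])
      have F4: "norm (integral {s3..s4} T) \<le> 4 * (D * E) / sqrt X"
        by (rule mid[OF ord(2) s4(1,2) q4])
      have F3: "norm (integral {s2..s3} T) \<le> 2 * D / c1 * (E / sqrt X)"
      proof (cases "s2 = s3")
        case True thus ?thesis using D E X c13 by simp
      next
        case False
        hence lt: "s2 < s3" using s3 by simp
        have fr: "\<bar>f \<mu> x\<bar> \<le> r" if "x \<in> {s2..s3}" for x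
        proof -
          have "- r \<le> f \<mu> x" using s3(3) False that by metis
          moreover have "s2 \<noteq> 15" using lt s3 by linarith
          hence "f \<mu> x \<le> r" using s2(4) that s3(2) by (meson atLeastAtMost_iff order.trans)
          ultimately show ?thesis by linarith
        qed
        have "\<exists>z. s2 < z \<and> z < s3 \<and> f \<mu> s3 - f \<mu> s2 = (s3 - s2) * (\<gamma> * ((\<gamma> - 1) * z powr (\<gamma> - 1 - 1)))"
          using s1 s2 lt unfolding f_def by (intro MVT2) (auto intro!: derivative_eq_intros)
        then obtain z where z: "s2 < z" "z < s3" "f \<mu> s3 - f \<mu> s2 = (s3 - s2) * (\<gamma> * ((\<gamma> - 1) * z powr (\<gamma> - 2)))" by auto
        have "15 powr (\<gamma> - 2) \<le> z powr (\<gamma> - 2)" using z s1 s2 s3 \<gamma> by (intro powr_mono2') auto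
        hence "c1 \<le> \<gamma> * (1 - \<gamma>) * z powr (\<gamma> - 2)" unfolding c1_def using \<gamma> by (intro mult_left_mono) auto
        hence "(s3 - s2) * c1 \<le> (s3 - s2) * (\<gamma> * (1 - \<gamma>) * z powr (\<gamma> - 2))" using lt by (intro mult_left_mono) auto
        also have "\<dots> = f \<mu> s2 - f \<mu> s3" using z(3) by (simp add: algebra_simps)
        also have "\<dots> \<le> 2 * r" using fr[of s2] fr[of s3] lt by auto
        finally have len: "s3 - s2 \<le> 2 * r / c1" using c13 by (simp add: field_simps)
        have "norm (integral {s2..s3} T) \<le> integral {s2..s3} (\<lambda>\<sigma>. D * E)"
        proof (rule integral_norm_bound_integral[OF intT])
          fix \<sigma> assume s: "\<sigma> \<in> {s2..s3}"
          show "norm (T \<sigma>) \<le> D * E" using near[of \<sigma>] fr[OF s] \<open>r \<le> c3\<close> s s1 s2 s3 by auto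
        qed (use s1 s2 in auto)
        also have "\<dots> = (s3 - s2) * (D * E)" using lt by simp
        also have "\<dots> \<le> (2 * r / c1) * (D * E)" using len D E by (intro mult_right_mono) auto
        finally show ?thesis by (simp add: r_def mult_ac)
      qed
      have c12: "integral {1/2..15} T = integral {1/2..s1} T + integral {s1..15} T"
        using s1 intT by (intro Henstock_Kurzweil_Integration.integral_combine[symmetric]) auto
      have c23: "integral {s1..15} T = integral {s1..s2} T + integral {s2..15} T"
        using s1 s2 intT by (intro Henstock_Kurzweil_Integration.integral_combine[symmetric]) auto
      have c34: "integral {s2..15} T = integral {s2..s3} T + integral {s3..15} T"
        using s1 s2 s3 intT by (intro Henstock_Kurzweil_Integration.integral_combine[symmetric]) auto
      have c45: "integral {s3..15} T = integral {s3..s4} T + integral {s4..15} T"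
        using s1 s2 s3 s4 intT by (intro Henstock_Kurzweil_Integration.integral_combine[symmetric]) auto
      have "norm (integral {1/2..15} T) \<le> norm (integral {1/2..s1} T) + (norm (integral {s1..s2} T) + (norm (integral {s2..s3} T) + (norm (integral {s3..s4} T) + norm (integral {s4..15} T))))"
        unfolding c12 c23 c34 c45 by (intro order.trans[OF norm_triangle_ineq] add_left_mono order.refl)
      also have "\<dots> \<le> 4 * (D * \<nu>) / (X * c3) + (4 * (D * E) / sqrt X + (2 * D / c1 * (E / sqrt X) + (4 * (D * E) / sqrt X + 4 * (D * \<nu>) / (X * c3))))"
        by (intro add_mono F1 F2 F3 F4 F5)
      also have "\<dots> = (8 * D + 2 * D / c1) * (E / sqrt X) + (8 * D / c3) * (\<nu> / X)"
        by (simp add: add_divide_distrib algebra_simps)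
      also have "\<dots> \<le> C * (E / sqrt X) + C * (\<nu> / X)"
        using Cge E X \<nu> by (intro add_mono mult_right_mono) auto
      finally show ?thesis by (simp only: distrib_left)
    qed
    thus "norm (integral {1/2..15} (osc_sum \<gamma> \<mu> X \<rho> {a..b})) \<le> C * (E / sqrt X + real (b + 1 - a) / X)"
      by (simp only: T_def \<nu>_def)
  qed
qed

section \<open>From double sums over n and m to oscillatory integrals\<close>

lemma bump_deriv_eq_0: "t \<le> 1/2 \<or> 5 \<le> t \<Longrightarrow> bump_deriv t = 0"
  by (auto simp: bump_deriv_def max_def zero_le_mult_iff)

lemma bump_global_bound:
  obtains A where "A > 0" "\<And>t. \<bar>bump t\<bar> \<le> A" "\<And>t. \<bar>bump_deriv t\<bar> \<le> A"
proof -
  obtain A where A: "A > 0" "lipschitz_bound A bump" "lipschitz_bound A (\<lambda>t. t * bump_deriv t)"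
    using lipschitz_bound_bump by blast
  show ?thesis
  proof (rule that[of "2 * A"])
    show "2 * A > 0" using A by simp
    fix t :: real
    show "\<bar>bump t\<bar> \<le> 2 * A"
    proof (cases "t \<in> {0..15}")
      case True
      thus ?thesis using A unfolding lipschitz_bound_def by force
    next
      case False
      hence "bump t = 0" by (intro bump_eq_0) auto
      thus ?thesis using A by simp
    qed
    show "\<bar>bump_deriv t\<bar> \<le> 2 * A"
    proof (cases "t \<in> {1/2..15}")
      case True
      hence "\<bar>t * bump_deriv t\<bar> \<le> A" using A unfolding lipschitz_bound_def by force
      moreover have "1/2 * \<bar>bump_deriv t\<bar> \<le> \<bar>t * bump_deriv t\<bar>"
        unfolding abs_mult using True by (intro mult_right_mono) auto
      ultimately show ?thesis by linarith
    next
      case False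
      hence "bump_deriv t = 0" by (auto simp: bump_deriv_def max_def zero_le_mult_iff mult_le_0_iff)
      thus ?thesis using A by simp
    qed
  qed
qed

text \<open>The estimate is wanted on the whole line, while \<open>t powr \<gamma>\<close> is not
  differentiable at 0. There the bump vanishes: the derivative is set to 0 up to
  \<open>M / 4\<close>, to the left of the support, which begins at \<open>M / 2\<close>.\<close>

lemma bump_phase_lipschitz:
  fixes M \<beta> c \<gamma> Y :: real
  assumes A: "A > 0" "\<And>t. \<bar>bump t\<bar> \<le> A" "\<And>t. \<bar>bump_deriv t\<bar> \<le> A"
    and \<gamma>: "0 < \<gamma>" "\<gamma> < 1" and M: "M \<ge> 1" and \<beta>: "\<bar>\<beta>\<bar> \<le> 1/2" and c: "0 \<le> c" "c * M powr (\<gamma> - 1) \<le> Y"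
  shows "norm (of_real (bump (s / M)) * expi (\<beta> * s + c * s powr \<gamma>) - of_real (bump (t / M)) * expi (\<beta> * t + c * t powr \<gamma>))
    \<le> 20 * A * (1 + Y) * \<bar>s - t\<bar>"
proof -
  have Y: "0 \<le> Y" using c order.trans[OF _ c(2)] by simp
  define F where "F t = complex_of_real (bump (t / M)) * expi (\<beta> * t + c * t powr \<gamma>)" for t
  define F' where "F' t = (if t \<le> M / 4 then 0 else of_real (bump (t / M)) * (2 * pi * \<i> * of_real (\<beta> + c * (\<gamma> * t powr (\<gamma> - 1))) * expi (\<beta> * t + c * t powr \<gamma>))
     + of_real (bump_deriv (t / M) * (1 / M)) * expi (\<beta> * t + c * t powr \<gamma>))" for t
  have deriv: "(F has_vector_derivative F' t) (at t)" for t
  proof (cases "t \<le> M / 4")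
    case True
    have "((\<lambda>_. 0) has_vector_derivative (0::complex)) (at t)" by simp
    hence "(F has_vector_derivative 0) (at t)"
    proof (rule has_vector_derivative_transform_within_open[of _ _ _ "{..<M/2}"])
      fix x assume "x \<in> {..<M/2}"
      hence "x / M \<le> 1/2" using M by (simp add: field_simps)
      thus "0 = F x" by (simp add: F_def bump_eq_0)
    qed (use True M in auto)
    thus ?thesis using True by (simp add: F'_def)
  next
    case False
    hence t: "t > 0" using M by linarith
    have "(F has_vector_derivative of_real (bump (t / M)) * (2 * pi * \<i> * of_real (\<beta> + c * (\<gamma> * t powr (\<gamma> - 1))) * expi (\<beta> * t + c * t powr \<gamma>))
     + of_real (bump_deriv (t / M) * (1 / M)) * expi (\<beta> * t + c * t powr \<gamma>)) (at t)"
      unfolding F_def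
    proof (rule has_vector_derivative_mult)
      show "((\<lambda>t. complex_of_real (bump (t / M))) has_vector_derivative of_real (bump_deriv (t / M) * (1 / M))) (at t)"
        using M by (intro has_vector_derivative_of_real) (auto intro!: derivative_eq_intros simp: has_real_derivative_iff_has_vector_derivative[symmetric])
      have "((\<lambda>t. \<beta> * t + c * t powr \<gamma>) has_real_derivative \<beta> + c * (\<gamma> * t powr (\<gamma> - 1))) (at t)"
        using t by (auto intro!: derivative_eq_intros)
      from expi_chain[OF this] show "((\<lambda>t. expi (\<beta> * t + c * t powr \<gamma>)) has_vector_derivative
          2 * pi * \<i> * of_real (\<beta> + c * (\<gamma> * t powr (\<gamma> - 1))) * expi (\<beta> * t + c * t powr \<gamma>)) (at t)" by simp
    qed
    thus ?thesis using False by (simp add: F'_def)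
  qed
  have bound: "norm (F' t) \<le> 20 * A * (1 + Y)" for t
  proof (cases "t < M / 2 \<or> t \<le> M / 4")
    case True
    hence "t < M / 2" using M by linarith
    hence "t / M \<le> 1/2" using M by (simp add: field_simps)
    hence "bump (t / M) = 0" "bump_deriv (t / M) = 0"
      by (simp_all add: bump_eq_0 bump_deriv_eq_0)
    hence "F' t = 0" by (simp add: F'_def)
    thus ?thesis using A Y by simp
  next
    case False
    have "t powr (\<gamma> - 1) \<le> (M / 2) powr (\<gamma> - 1)" using False M \<gamma> by (intro powr_mono2') auto
    also have "\<dots> = M powr (\<gamma> - 1) * (1/2) powr (\<gamma> - 1)" using M by (simp add: powr_mult[symmetric])
    also have "\<dots> \<le> M powr (\<gamma> - 1) * (1/2) powr (-1)" using \<gamma> by (intro mult_left_mono powr_mono') auto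
    also have "\<dots> = 2 * M powr (\<gamma> - 1)" by (simp add: powr_minus)
    finally have "\<gamma> * t powr (\<gamma> - 1) \<le> 1 * (2 * M powr (\<gamma> - 1))" using \<gamma> by (intro mult_mono) auto
    hence "c * (\<gamma> * t powr (\<gamma> - 1)) \<le> c * (2 * M powr (\<gamma> - 1))" using c by (intro mult_left_mono) auto
    also have "\<dots> \<le> 2 * Y" using c by simp
    finally have ph: "c * (\<gamma> * t powr (\<gamma> - 1)) \<le> 2 * Y" .
    have "0 \<le> c * (\<gamma> * t powr (\<gamma> - 1))" using c \<gamma> by simp
    hence ph2: "\<bar>\<beta> + c * (\<gamma> * t powr (\<gamma> - 1))\<bar> \<le> 1/2 + 2 * Y" using ph \<beta> by linarith
    have "norm (F' t) \<le> \<bar>bump (t / M)\<bar> * (2 * pi * \<bar>\<beta> + c * (\<gamma> * t powr (\<gamma> - 1))\<bar>) + \<bar>bump_deriv (t / M) * (1 / M)\<bar>"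
      unfolding F'_def using False by (simp only: if_False de_Morgan_disj) (rule order.trans[OF norm_triangle_ineq], simp only: norm_mult norm_of_real norm_expi norm_ii norm_numeral mult_1_right, simp)
    also have "\<dots> \<le> A * (2 * 4 * (1/2 + 2 * Y)) + A * 1"
    proof (intro add_mono mult_mono A ph2)
      show "\<bar>bump_deriv (t / M) * (1 / M)\<bar> \<le> A * 1" unfolding abs_mult using M A by (intro mult_mono) auto
    qed (use pi_less_4 A Y in auto)
    also have "\<dots> \<le> 20 * A * (1 + Y)"
      using A Y by (simp add: algebra_simps)
    finally show ?thesis .
  qed
  have "norm (F s - F t) \<le> (20 * A * (1 + Y)) * norm (s - t)"
  proof (rule differentiable_bound[of UNIV F "\<lambda>x h. h *\<^sub>R F' x"])
    show "(F has_derivative (\<lambda>h. h *\<^sub>R F' x)) (at x within UNIV)" for x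
      using deriv[of x] by (simp add: has_vector_derivative_def)
    show "onorm (\<lambda>h. h *\<^sub>R F' x) \<le> 20 * A * (1 + Y)" for x
      by (rule onorm_le) (use bound[of x] in \<open>simp add: mult.commute mult_left_mono\<close>)
  qed auto
  thus ?thesis by (simp add: F_def)
qed

text \<open>The definition of \<open>shift_ratio\<close> solved for the difference of powers; the
  exponent \<open>1 - \<gamma>\<close> is the one that \<open>bump_phase_integral\<close> asks of
  the coefficients.\<close>

lemma shift_ratio_powr:
  assumes \<gamma>: "0 < \<gamma>" "\<gamma> < 1" and q: "q > 0" and t: "t > 0" and N: "N > 0"
  shows "(t + q) powr \<gamma> - t powr \<gamma> = \<gamma> * q * N powr (\<gamma> - 1) * shift_ratio \<gamma> q N t powr (1 - \<gamma>)"
proof -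
  have p: "0 \<le> ((t + q) powr \<gamma> - t powr \<gamma>) / (\<gamma> * q)" using \<gamma> q t by (simp add: powr_mono2)
  have "shift_ratio \<gamma> q N t powr (1 - \<gamma>) = N powr (1 - \<gamma>) * (((t + q) powr \<gamma> - t powr \<gamma>) / (\<gamma> * q)) powr (1 / (1 - \<gamma>) * (1 - \<gamma>))"
    unfolding shift_ratio_def using N by (subst powr_mult) (simp_all only: powr_powr powr_ge_zero less_imp_le)
  also have "1 / (1 - \<gamma>) * (1 - \<gamma>) = 1" using \<gamma> by simp
  also have "(((t + q) powr \<gamma> - t powr \<gamma>) / (\<gamma> * q)) powr 1 = ((t + q) powr \<gamma> - t powr \<gamma>) / (\<gamma> * q)" using p by (rule powr_one)
  finally have e: "shift_ratio \<gamma> q N t powr (1 - \<gamma>) = N powr (1 - \<gamma>) * (((t + q) powr \<gamma> - t powr \<gamma>) / (\<gamma> * q))" .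
  have "N powr (\<gamma> - 1) * N powr (1 - \<gamma>) = 1" using N by (simp flip: powr_add)
  thus ?thesis unfolding e using \<gamma> q by (simp add: field_simps)
qed

text \<open>Each \<open>n\<close> has its own substitution
  \<open>t = M * \<rho> n * \<sigma>\<close>, and all of them cover the support of the bump by the
  same range \<open>{1/2..15}\<close> of \<sigma>. The relation assumed for \<open>c n\<close> is
  exactly what makes \<open>c n * t powr \<gamma>\<close> equal to
  \<open>X * \<rho> n * \<sigma> powr \<gamma>\<close>, linear in \<open>\<rho> n\<close>.\<close>

lemma bump_phase_integral:
  fixes \<rho> :: "nat \<Rightarrow> real" and c :: "nat \<Rightarrow> real"
  assumes M: "M > 0" and X: "X > 0" and \<rho>: "\<And>n. n \<in> S \<Longrightarrow> 1/3 \<le> \<rho> n \<and> \<rho> n \<le> 1" and S: "finite S"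
    and c: "\<And>n. n \<in> S \<Longrightarrow> c n * M powr \<gamma> = X * \<rho> n powr (1 - \<gamma>)" and uv: "u \<le> M / 2" "5 * M \<le> v"
  shows "((\<lambda>t. \<Sum>n\<in>S. of_real (bump (t / M)) * expi (\<kappa> * t + c n * t powr \<gamma>)) has_integral
     of_real M * integral {1/2..15} (osc_sum \<gamma> (- \<kappa> * M / X) X \<rho> S)) {u..v}"
proof -
  define f where "f n t = complex_of_real (bump (t / M)) * expi (\<kappa> * t + c n * t powr \<gamma>)" for n t
  define I where "I n = integral {M/2..5*M} (f n)" for n
  have f0: "f n t = 0" if "t \<notin> {M/2..5*M}" for n t
  proof -
    have "t / M \<le> 1/2 \<or> 5 \<le> t / M" using that M by (auto simp: field_simps)
    thus ?thesis by (simp add: f_def bump_eq_0)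
  qed
  have I: "(f n has_integral I n) {M/2..5*M}" for n
    unfolding I_def f_def using M by (intro integrable_integral integrable_continuous_interval continuous_intros) auto
  have uvI: "(f n has_integral I n) {u..v}" for n
    by (rule has_integral_on_superset[OF I f0]) (use uv in auto)
  have stretch: "((\<lambda>\<sigma>. of_real (M * \<rho> n) * f n (M * \<rho> n * \<sigma>)) has_integral I n) {1/2..15}" if n: "n \<in> S" for n
  proof -
    have r: "M * \<rho> n > 0" using \<rho>[OF n] M by (intro mult_pos_pos) auto
    have "(f n has_integral I n) {M * \<rho> n * (1/2)..M * \<rho> n * 15}"
    proof (rule has_integral_on_superset[OF I f0])
      have "M * \<rho> n \<le> M * 1" "M * (1/3) \<le> M * \<rho> n" using \<rho>[OF n] M by (intro mult_left_mono; simp)+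
      thus "{M/2..5*M} \<subseteq> {M * \<rho> n * (1/2)..M * \<rho> n * 15}" by auto
    qed
    from has_integral_stretch_real[OF this, of "M * \<rho> n"] r less_imp_neq[OF r]
    have st: "((\<lambda>\<sigma>. f n (M * \<rho> n * \<sigma>)) has_integral (1 / (M * \<rho> n)) *\<^sub>R I n) {1/2..15}" by simp
    have "M \<noteq> 0" "\<rho> n \<noteq> 0" using M \<rho>[OF n] by auto
    from has_integral_cmul[OF st, of "M * \<rho> n"] \<open>M \<noteq> 0\<close> \<open>\<rho> n \<noteq> 0\<close> show ?thesis by (simp add: scaleR_conv_of_real)
  qed
  have eq: "of_real (M * \<rho> n) * f n (M * \<rho> n * \<sigma>) = of_real M * (of_real (\<rho> n * bump (\<rho> n * \<sigma>)) * expi (X * \<rho> n * (\<sigma> powr \<gamma> - (- \<kappa> * M / X) * \<sigma>)))"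
    if n: "n \<in> S" and s: "\<sigma> \<in> {1/2..15}" for n \<sigma>
  proof -
    have rp: "\<rho> n > 0" "\<sigma> > 0" using \<rho>[OF n] s by auto
    have "\<rho> n powr (1 - \<gamma>) * \<rho> n powr \<gamma> = \<rho> n" using rp by (simp flip: powr_add)
    hence "c n * (M * \<rho> n * \<sigma>) powr \<gamma> = X * \<rho> n * \<sigma> powr \<gamma>"
      using c[OF n] rp M by (simp add: powr_mult) (metis mult.assoc mult.commute)
    moreover have "\<kappa> * (M * \<rho> n * \<sigma>) = - (X * \<rho> n * ((- \<kappa> * M / X) * \<sigma>))" using X by simp
    ultimately have "\<kappa> * (M * \<rho> n * \<sigma>) + c n * (M * \<rho> n * \<sigma>) powr \<gamma> = X * \<rho> n * (\<sigma> powr \<gamma> - (- \<kappa> * M / X) * \<sigma>)"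
      by (simp only: right_diff_distrib)
    moreover have "M * \<rho> n * \<sigma> / M = \<rho> n * \<sigma>" using M by simp
    ultimately show ?thesis unfolding f_def by (simp only: of_real_mult mult.assoc)
  qed
  have "((\<lambda>\<sigma>. of_real M * osc_sum \<gamma> (- \<kappa> * M / X) X \<rho> S \<sigma>) has_integral (\<Sum>n\<in>S. I n)) {1/2..15}"
  proof (rule has_integral_eq[rotated])
    show "((\<lambda>\<sigma>. \<Sum>n\<in>S. of_real (M * \<rho> n) * f n (M * \<rho> n * \<sigma>)) has_integral (\<Sum>n\<in>S. I n)) {1/2..15}"
      by (intro has_integral_sum S stretch)
    fix \<sigma> :: real assume "\<sigma> \<in> {1/2..15}"
    thus "(\<Sum>n\<in>S. of_real (M * \<rho> n) * f n (M * \<rho> n * \<sigma>)) = of_real M * osc_sum \<gamma> (- \<kappa> * M / X) X \<rho> S \<sigma>"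
      unfolding osc_sum_def sum_distrib_left by (intro sum.cong refl eq)
  qed
  moreover have "((\<lambda>\<sigma>. of_real M * osc_sum \<gamma> (- \<kappa> * M / X) X \<rho> S \<sigma>) has_integral of_real M * integral {1/2..15} (osc_sum \<gamma> (- \<kappa> * M / X) X \<rho> S)) {1/2..15}"
    by (intro has_integral_mult_right integrable_integral integrable_continuous_interval continuous_on_osc_sum) auto
  ultimately have "(\<Sum>n\<in>S. I n) = of_real M * integral {1/2..15} (osc_sum \<gamma> (- \<kappa> * M / X) X \<rho> S)"
    by (rule has_integral_unique)
  moreover have "((\<lambda>t. \<Sum>n\<in>S. f n t) has_integral (\<Sum>n\<in>S. I n)) {u..v}"
    by (intro has_integral_sum S uvI)
  ultimately show ?thesis by (simp add: f_def)
qed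

text \<open>After Poisson summation only about \<open>X / M + 1\<close> frequencies allow a
  stationary point; each is estimated by the exponent pair. The others decay like
  \<open>1 / \<bar>\<nu>\<bar>\<close> and give the logarithm of \<open>V\<close>. The last term is
  the smoothing error of the Fejer kernel.\<close>

theorem shifted_sum_bound:
  fixes \<gamma> k l :: real
  assumes ep: "exponent_pair k l" and \<gamma>: "0 < \<gamma>" "\<gamma> < 1"
  obtains C d where "C > 0" "d > 0" and "\<And>N M h q \<beta> X a b V. N \<ge> 1 \<Longrightarrow> M \<ge> 1 \<Longrightarrow> h > 0 \<Longrightarrow> q > 0 \<Longrightarrow> q \<le> d * N \<Longrightarrow> q \<le> N \<Longrightarrow> \<bar>\<beta>\<bar> \<le> 1/2 \<Longrightarrow>
     N \<le> real a \<Longrightarrow> real b \<le> 2 * N \<Longrightarrow> V > 0 \<Longrightarrow> X = \<gamma> * h * q * M powr \<gamma> * N powr (\<gamma> - 1) \<Longrightarrow> X \<ge> 1 \<Longrightarrow>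
     norm (\<Sum>n\<in>{a..b}. \<Sum>m | real m \<le> 5 * M. of_real (bump (real m / M)) * expi (\<beta> * real m + h * ((real n + q) powr \<gamma> - real n powr \<gamma>) * real m powr \<gamma>))
      \<le> C * ((X / M + 1) * (M / sqrt X * ((X / N) powr k * N powr l + N / X) + N * M / X) + N * (1 + ln (real V)) + N * M * (1 + X) / sqrt (real V))"
proof -
  have kl: "0 \<le> k" "0 \<le> l" using ep by (auto simp: exponent_pair_def)
  obtain A where A: "A > 0" "\<And>t. \<bar>bump t\<bar> \<le> A" "\<And>t. \<bar>bump_deriv t\<bar> \<le> A" 
  proof (rule bump_global_bound)
    fix A :: real assume *: "A > 0" "\<And>t. \<bar>bump t\<bar> \<le> A" "\<And>t. \<bar>bump_deriv t\<bar> \<le> A"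
    show thesis by (rule that[OF *])
  qed
  obtain C4 d where C4: "C4 > 0" and d: "d > 0" and pair: "\<And>N q y a b. N \<ge> 1 \<Longrightarrow> q > 0 \<Longrightarrow> y > 0 \<Longrightarrow> q \<le> d * N \<Longrightarrow> N \<le> real a \<Longrightarrow> real b \<le> 2 * N \<Longrightarrow>
    norm (\<Sum>n\<in>{a..b}. expi (y * shift_ratio \<gamma> q N (real n))) \<le> C4 * ((y / N) powr k * N powr l + N / y)"
    using exponent_pair_shift_ratio[OF ep \<gamma>] by metis
  obtain C0 c where C0: "C0 > 0" and c: "c > 0" and osc: "\<And>\<mu> X \<rho> a b E. X \<ge> 1 \<Longrightarrow> 0 \<le> E \<Longrightarrow>
      (\<And>n. a \<le> n \<Longrightarrow> n \<le> b \<Longrightarrow> 0 \<le> \<rho> n \<and> \<rho> n \<le> 1) \<Longrightarrow> (\<And>n. a \<le> n \<Longrightarrow> n < b \<Longrightarrow> \<rho> (Suc n) \<le> \<rho> n) \<Longrightarrow>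
      (\<And>P n. c * X \<le> P \<Longrightarrow> P \<le> 16 * X \<Longrightarrow> a \<le> n \<Longrightarrow> n \<le> b \<Longrightarrow> norm (\<Sum>i\<in>{a..n}. expi (P * \<rho> i)) \<le> E) \<Longrightarrow>
      norm (integral {1/2..15} (osc_sum \<gamma> \<mu> X \<rho> {a..b})) \<le> C0 * (E / sqrt X + real (b + 1 - a) / X)"
    and osc_tail: "\<And>\<mu> X \<rho> a b. X \<ge> 1 \<Longrightarrow> \<bar>\<mu>\<bar> \<ge> 4 \<Longrightarrow>
      (\<And>n. a \<le> n \<Longrightarrow> n \<le> b \<Longrightarrow> 0 \<le> \<rho> n \<and> \<rho> n \<le> 1) \<Longrightarrow> (\<And>n. a \<le> n \<Longrightarrow> n < b \<Longrightarrow> \<rho> (Suc n) \<le> \<rho> n) \<Longrightarrow>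
      norm (integral {1/2..15} (osc_sum \<gamma> \<mu> X \<rho> {a..b})) \<le> C0 * real (b + 1 - a) / (X * \<bar>\<mu>\<bar>)"
  proof (rule osc_integral_bound[OF \<gamma>], goal_cases)
    case (1 C c) show ?case by (rule 1(1)[OF 1(2-5)])
  qed
  \<comment> \<open>\<open>P\<close> ranges over \<open>c * X \<le> P \<le> 16 * X\<close>: the
    upper end enters through the power \<open>k\<close>, the lower end through
    \<open>N / P\<close>.\<close>
  define C5 where "C5 = C4 * (16 powr k + 1 / c)"
  have C5: "C5 > 0" using C4 c by (simp add: C5_def add_pos_pos)
  define C where "C = 8 * C0 * (C5 + 2) + 16 * C0 + 280 * A"
  have C: "C > 0" using C0 C5 A by (simp add: C_def add_pos_pos)
  show ?thesis
  proof (rule that[OF C d])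
    fix N M h q \<beta> X :: real and a b V :: nat
    assume N: "N \<ge> 1" and M: "M \<ge> 1" and h: "h > 0" and q: "q > 0" "q \<le> d * N" "q \<le> N" and \<beta>: "\<bar>\<beta>\<bar> \<le> 1/2"
      and ab: "N \<le> real a" "real b \<le> 2 * N" and V: "V > 0" and X: "X = \<gamma> * h * q * M powr \<gamma> * N powr (\<gamma> - 1)" "X \<ge> 1"
    define Ex where "Ex = (X / N) powr k * N powr l + N / X"
    have Ex: "Ex \<ge> 0" using N X by (simp add: Ex_def)
    define \<rho> where "\<rho> n = shift_ratio \<gamma> q N (real n)" for n
    define g where "g n = h * ((real n + q) powr \<gamma> - real n powr \<gamma>)" for n :: nat
    have npos: "real n > 0" "N \<le> real n" "real n \<le> 2 * N" if "n \<in> {a..b}" for n using that ab N by (auto; linarith)+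
    have \<rho>: "1/3 \<le> \<rho> n \<and> \<rho> n \<le> 1" if n: "n \<in> {a..b}" for n
    proof -
      obtain z where z: "real n < z" "z < real n + q" "\<rho> n = N / z"
        using shift_ratio_eq_divide[OF \<gamma> q(1) npos(1)[OF n], of N] unfolding \<rho>_def by blast
      have "N \<le> z" "z \<le> 3 * N" "z > 0" using z npos[OF n] q N by linarith+
      thus ?thesis unfolding z(3) by (simp add: field_simps)
    qed
    have \<rho>1: "0 \<le> \<rho> n \<and> \<rho> n \<le> 1" if "a \<le> n" "n \<le> b" for n using \<rho>[of n] that by auto
    have \<rho>2: "\<rho> (Suc n) \<le> \<rho> n" if "a \<le> n" "n < b" for n
      unfolding \<rho>_def using that npos[of n] N by (intro shift_ratio_antimono \<gamma> q) auto
    have gX: "g n * M powr \<gamma> = X * \<rho> n powr (1 - \<gamma>)" if n: "n \<in> {a..b}" for n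
      unfolding g_def X \<rho>_def using N by (subst shift_ratio_powr[OF \<gamma> q(1) npos(1)[OF n], of N]) auto
    have g0: "0 \<le> g n" and gM: "g n * M powr (\<gamma> - 1) \<le> X" if n: "n \<in> {a..b}" for n
    proof -
      show "0 \<le> g n" unfolding g_def using h q \<gamma> npos[OF n] by (simp add: powr_mono2)
      have "g n * M powr (\<gamma> - 1) = X * \<rho> n powr (1 - \<gamma>) / M" using gX[OF n] M by (simp add: powr_diff)
      also have "\<dots> \<le> X * 1 / 1"
        using X M \<rho>[OF n] \<gamma> by (intro frac_le mult_left_mono) (auto intro: powr_le1)
      finally show "g n * M powr (\<gamma> - 1) \<le> X" by simp
    qed
    define \<nu>n where "\<nu>n = real (b + 1 - a)"
    have \<nu>n: "0 \<le> \<nu>n" "\<nu>n \<le> 2 * N"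
    proof -
      show "\<nu>n \<le> 2 * N"
      proof (cases "a \<le> b")
        case True
        hence "\<nu>n = real b + 1 - real a" by (simp add: \<nu>n_def of_nat_diff)
        thus ?thesis using ab N by linarith
      qed (use N in \<open>simp add: \<nu>n_def\<close>)
    qed (simp add: \<nu>n_def)
    define F where "F t = (\<Sum>n\<in>{a..b}. of_real (bump (t / M)) * expi (\<beta> * t + g n * t powr \<gamma>))" for t
    have lip: "norm (F s - F t) \<le> (2 * N * (20 * A * (1 + X))) * \<bar>s - t\<bar>" for s t
    proof -
      have "norm (F s - F t) \<le> (\<Sum>n\<in>{a..b}. 20 * A * (1 + X) * \<bar>s - t\<bar>)"
        unfolding F_def sum_subtractf[symmetric]
        by (intro sum_norm_le bump_phase_lipschitz[OF A \<gamma> M \<beta>] g0 gM)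
      also have "\<dots> = \<nu>n * (20 * A * (1 + X) * \<bar>s - t\<bar>)" by (simp add: \<nu>n_def)
      also have "\<dots> \<le> 2 * N * (20 * A * (1 + X) * \<bar>s - t\<bar>)" using \<nu>n A X by (intro mult_right_mono) auto
      finally show ?thesis by (simp only: mult.assoc)
    qed
    \<comment> \<open>Summation and integration go slightly past the support: the interval from
      \<open>- 1/2\<close> to \<open>p - 1/2\<close> contains \<open>{M/2..5*M}\<close>, and the
      additional terms vanish.\<close>
    define p where "p = nat \<lceil>5 * M\<rceil> + 1"
    have p: "5 * M + 1 \<le> real p" "real p \<le> 7 * M" using M unfolding p_def by linarith+
    have sum_eq: "(\<Sum>n\<in>{a..b}. \<Sum>m | real m \<le> 5 * M. of_real (bump (real m / M)) * expi (\<beta> * real m + h * ((real n + q) powr \<gamma> - real n powr \<gamma>) * real m powr \<gamma>))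
       = (\<Sum>m\<in>{0..<0 + p}. F (real m))"
    proof -
      have "(\<Sum>m\<in>{0..<0 + p}. F (real m)) = (\<Sum>m | real m \<le> 5 * M. F (real m))"
      proof (rule sum.mono_neutral_right)
        show "{m. real m \<le> 5 * M} \<subseteq> {0..<0 + p}" using p by auto
        show "\<forall>m\<in>{0..<0 + p} - {m. real m \<le> 5 * M}. F (real m) = 0"
          using M by (auto simp: F_def bump_eq_0 field_simps)
      qed auto
      also have "\<dots> = (\<Sum>n\<in>{a..b}. \<Sum>m | real m \<le> 5 * M. of_real (bump (real m / M)) * expi (\<beta> * real m + g n * real m powr \<gamma>))"
        unfolding F_def by (rule sum.swap)
      finally show ?thesis by (simp add: g_def)
    qed
    define \<Phi> where "\<Phi> \<nu> = norm (integral {real 0 - 1/2..real (0 + p) - 1/2} (\<lambda>t. F t * expi (of_int \<nu> * t)))" for \<nu> :: int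
    have \<Phi>: "\<Phi> \<nu> = M * norm (integral {1/2..15} (osc_sum \<gamma> (- (\<beta> + \<nu>) * M / X) X \<rho> {a..b}))" for \<nu>
    proof -
      have "(\<lambda>t. F t * expi (of_int \<nu> * t)) = (\<lambda>t. \<Sum>n\<in>{a..b}. of_real (bump (t / M)) * expi ((\<beta> + \<nu>) * t + g n * t powr \<gamma>))"
        unfolding F_def sum_distrib_right by (intro ext sum.cong refl) (simp add: expi_add[symmetric] algebra_simps)
      hence "((\<lambda>t. F t * expi (of_int \<nu> * t)) has_integral of_real M * integral {1/2..15} (osc_sum \<gamma> (- (\<beta> + \<nu>) * M / X) X \<rho> {a..b})) {real 0 - 1/2..real (0 + p) - 1/2}"
        using M X p \<rho> gX by (simp only:) (intro bump_phase_integral, auto)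
      thus ?thesis unfolding \<Phi>_def using M by (simp add: integral_unique norm_mult)
    qed
    have central: "\<Phi> \<nu> \<le> C0 * (C5 + 2) * (M / sqrt X * Ex + N * M / X)" for \<nu>
    proof -
      have "norm (integral {1/2..15} (osc_sum \<gamma> (- (\<beta> + \<nu>) * M / X) X \<rho> {a..b})) \<le> C0 * (C5 * Ex / sqrt X + real (b + 1 - a) / X)"
      proof (rule osc[where a = a and b = b and \<rho> = \<rho> and E = "C5 * Ex", OF X(2) _ \<rho>1 \<rho>2])
        show "0 \<le> C5 * Ex" using C5 Ex by simp
        fix P n assume P: "c * X \<le> P" "P \<le> 16 * X" and n: "a \<le> n" "n \<le> b"
        have P0: "P > 0" using P c X by (smt (verit) mult_pos_pos)
        have "norm (\<Sum>i\<in>{a..n}. expi (P * \<rho> i)) \<le> C4 * ((P / N) powr k * N powr l + N / P)"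
          unfolding \<rho>_def using n ab N by (intro pair q P0) auto
        also have "\<dots> \<le> C4 * (16 powr k * ((X / N) powr k * N powr l) + 1 / c * (N / X))"
        proof (intro mult_left_mono add_mono)
          have "(P / N) powr k \<le> (16 * X / N) powr k" using P P0 N kl by (intro powr_mono2 divide_right_mono) auto
          also have "\<dots> = 16 powr k * (X / N) powr k" using X N powr_mult[of 16 "X / N" k] by simp
          finally show "(P / N) powr k * N powr l \<le> 16 powr k * ((X / N) powr k * N powr l)"
            using mult_right_mono[of "(P / N) powr k" "16 powr k * (X / N) powr k" "N powr l"] by (simp add: mult.assoc)
          have "N / P \<le> N / (c * X)" using P P0 N c X by (intro divide_left_mono mult_pos_pos) auto
          thus "N / P \<le> 1 / c * (N / X)" by simp
        qed (use C4 in auto)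
        also have "\<dots> \<le> C4 * ((16 powr k + 1 / c) * ((X / N) powr k * N powr l) + (16 powr k + 1 / c) * (N / X))"
          using C4 c X N by (intro mult_left_mono add_mono mult_right_mono) auto
        also have "\<dots> = C5 * Ex" unfolding C5_def Ex_def by (subst distrib_left[symmetric]) (rule mult.assoc[symmetric])
        finally show "norm (\<Sum>i\<in>{a..n}. expi (P * \<rho> i)) \<le> C5 * Ex" .
      qed
      hence "\<Phi> \<nu> \<le> M * (C0 * (C5 * Ex / sqrt X + \<nu>n / X))" unfolding \<Phi> \<nu>n_def using M by (intro mult_left_mono) auto
      also have "\<dots> \<le> M * (C0 * (C5 * Ex / sqrt X + 2 * N / X))"
        using M C0 \<nu>n X by (intro mult_left_mono add_left_mono divide_right_mono) auto
      also have "\<dots> = C0 * (C5 * (M / sqrt X * Ex) + 2 * (N * M / X))" by (simp add: algebra_simps)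
      also have "\<dots> \<le> C0 * ((C5 + 2) * (M / sqrt X * Ex) + (C5 + 2) * (N * M / X))"
        using C0 C5 M X Ex N by (intro mult_left_mono add_mono mult_right_mono) auto
      finally show ?thesis unfolding distrib_left[symmetric] by (simp only: mult.assoc)
    qed
    have X0: "X > 0" using X(2) by linarith
    have abs\<mu>: "\<bar>- (\<beta> + \<nu>) * M / X\<bar> = \<bar>\<beta> + \<nu>\<bar> * M / X" for \<nu> :: int
    proof -
      have "\<bar>- (\<beta> + \<nu>) * M / X\<bar> = \<bar>\<beta> + \<nu>\<bar> * \<bar>M\<bar> / \<bar>X\<bar>" by (simp only: abs_divide abs_mult abs_minus_cancel)
      also have "\<bar>M\<bar> = M" using M by linarith
      also have "\<bar>X\<bar> = X" using X0 by linarith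
      finally show ?thesis .
    qed
    \<comment> \<open>\<open>\<bar>\<beta>\<bar> \<le> 1/2\<close> keeps
      \<open>\<bar>\<beta> + \<nu>\<bar>\<close> at least \<open>\<bar>\<nu>\<bar> / 2\<close> for
      nonzero \<nu>, which is the source of the harmonic sum.\<close>
    have tail: "\<Phi> \<nu> \<le> 4 * C0 * N / \<bar>\<nu>\<bar>" if \<nu>: "\<nu> \<noteq> 0" "\<bar>- (\<beta> + \<nu>) * M / X\<bar> \<ge> 4" for \<nu> :: int
    proof -
      have nz: "1 \<le> \<bar>real_of_int \<nu>\<bar>" using \<nu>(1) by linarith
      hence k2: "\<bar>real_of_int \<nu>\<bar> / 2 \<le> \<bar>\<beta> + \<nu>\<bar>" using \<beta> by linarith
      have "\<Phi> \<nu> \<le> M * (C0 * \<nu>n / (X * \<bar>- (\<beta> + \<nu>) * M / X\<bar>))" unfolding \<Phi> \<nu>n_def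
        using M by (intro mult_left_mono osc_tail X \<nu> \<rho>1 \<rho>2) auto
      also have "X * \<bar>- (\<beta> + \<nu>) * M / X\<bar> = \<bar>\<beta> + \<nu>\<bar> * M" unfolding abs\<mu> using X0 by simp
      also have "M * (C0 * \<nu>n / (\<bar>\<beta> + \<nu>\<bar> * M)) = C0 * \<nu>n / \<bar>\<beta> + \<nu>\<bar>" using M by simp
      also have "\<dots> \<le> C0 * (2 * N) / (\<bar>\<nu>\<bar> / 2)"
        using k2 nz C0 \<nu>n N by (intro frac_le mult_left_mono) auto
      finally show ?thesis by simp
    qed
    define B1 where "B1 = C0 * (C5 + 2) * (M / sqrt X * Ex + N * M / X)"
    have B1: "B1 \<ge> 0" unfolding B1_def using C0 C5 M X Ex N by (intro mult_nonneg_nonneg add_nonneg_nonneg) auto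
    \<comment> \<open>Frequencies that may have a stationary point; 0 is added because the tail
      bound divides by \<open>\<bar>\<nu>\<bar>\<close>.\<close>
    define Z where "Z = {\<nu>::int. \<nu> = 0 \<or> \<bar>- (\<beta> + \<nu>) * M / X\<bar> < 4}"
    have cardZ: "finite Z \<and> real (card Z) \<le> 8 * (X / M + 1)"
    proof -
      have sub: "Z \<subseteq> insert 0 {\<lceil>- \<beta> - 4 * X / M\<rceil>..\<lfloor>- \<beta> + 4 * X / M\<rfloor>}"
      proof
        fix \<nu> assume "\<nu> \<in> Z"
        hence "\<nu> = 0 \<or> \<bar>\<beta> + \<nu>\<bar> * M / X < 4" unfolding Z_def abs\<mu> by simp
        hence "\<nu> = 0 \<or> \<bar>\<beta> + \<nu>\<bar> < 4 * X / M" using M X0 by (simp add: field_simps)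
        thus "\<nu> \<in> insert 0 {\<lceil>- \<beta> - 4 * X / M\<rceil>..\<lfloor>- \<beta> + 4 * X / M\<rfloor>}" by (auto simp: abs_less_iff ceiling_le_iff le_floor_iff)
      qed
      have "card Z \<le> card (insert 0 {\<lceil>- \<beta> - 4 * X / M\<rceil>..\<lfloor>- \<beta> + 4 * X / M\<rfloor>})" by (rule card_mono[OF _ sub]) auto
      also have "\<dots> \<le> 1 + card {\<lceil>- \<beta> - 4 * X / M\<rceil>..\<lfloor>- \<beta> + 4 * X / M\<rfloor>}" by (metis card_insert_le_m1 card_insert_if finite_atLeastAtMost_int le_add2 order_refl plus_1_eq_Suc)
      also have "\<dots> = 1 + nat (\<lfloor>- \<beta> + 4 * X / M\<rfloor> - \<lceil>- \<beta> - 4 * X / M\<rceil> + 1)" by simp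
      finally have c1: "real (card Z) \<le> 1 + real (nat (\<lfloor>- \<beta> + 4 * X / M\<rfloor> - \<lceil>- \<beta> - 4 * X / M\<rceil> + 1))" by linarith
      have XM: "0 \<le> X / M" using X0 M by simp
      have "real (nat (\<lfloor>- \<beta> + 4 * X / M\<rfloor> - \<lceil>- \<beta> - 4 * X / M\<rceil> + 1)) \<le> 8 * (X / M) + 1"
        using XM by linarith
      hence "real (card Z) \<le> 1 + (8 * (X / M) + 1)" by (rule order.trans[OF c1 add_left_mono])
      hence "real (card Z) \<le> 8 * (X / M + 1)" by simp
      thus ?thesis using sub finite_subset by auto
    qed
    have "(\<Sum>\<nu>\<in>{- int V<..<int V}. \<Phi> \<nu>) \<le> (\<Sum>\<nu>\<in>{- int V<..<int V}. (if \<nu> \<in> Z then B1 else 0) + 4 * C0 * N * (if \<nu> = 0 then 0 else 1 / \<bar>real_of_int \<nu>\<bar>))"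
    proof (rule sum_mono)
      fix \<nu> :: int
      show "\<Phi> \<nu> \<le> (if \<nu> \<in> Z then B1 else 0) + 4 * C0 * N * (if \<nu> = 0 then 0 else 1 / \<bar>real_of_int \<nu>\<bar>)"
      proof (cases "\<nu> \<in> Z")
        case True
        thus ?thesis using central[of \<nu>] C0 N unfolding B1_def[symmetric] by (auto intro!: add_increasing2)
      next
        case False
        thus ?thesis using tail[of \<nu>] by (auto simp: Z_def)
      qed
    qed
    also have "\<dots> = (\<Sum>\<nu>\<in>{- int V<..<int V}. if \<nu> \<in> Z then B1 else 0) + 4 * C0 * N * (\<Sum>\<nu>\<in>{- int V<..<int V}. if \<nu> = 0 then 0 else 1 / \<bar>real_of_int \<nu>\<bar>)"
      by (simp add: sum.distrib sum_distrib_left)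
    also have "(\<Sum>\<nu>\<in>{- int V<..<int V}. if \<nu> \<in> Z then B1 else 0) = real (card ({- int V<..<int V} \<inter> Z)) * B1"
      by (simp add: sum.If_cases Int_def)
    also have "\<dots> \<le> 8 * (X / M + 1) * B1"
    proof (rule mult_right_mono[OF _ B1])
      have "card ({- int V<..<int V} \<inter> Z) \<le> card Z" by (intro card_mono) (use cardZ in auto)
      thus "real (card ({- int V<..<int V} \<inter> Z)) \<le> 8 * (X / M + 1)" using cardZ by linarith
    qed
    also have "(\<Sum>\<nu>\<in>{- int V<..<int V}. if \<nu> = 0 then 0 else 1 / \<bar>real_of_int \<nu>\<bar>) \<le> 2 * (1 + ln (real V))"
    proof -
      have "(\<Sum>\<nu>\<in>{- int V<..<int V}. if \<nu> = 0 then 0 else 1 / \<bar>real_of_int \<nu>\<bar>) \<le> (\<Sum>\<nu>\<in>int ` {1..V} \<union> (\<lambda>n. - int n) ` {1..V}. 1 / \<bar>real_of_int \<nu>\<bar>)"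
      proof -
        have "(\<Sum>\<nu>\<in>{- int V<..<int V}. if \<nu> = 0 then 0 else 1 / \<bar>real_of_int \<nu>\<bar>) = (\<Sum>\<nu>\<in>{- int V<..<int V} - {0}. 1 / \<bar>real_of_int \<nu>\<bar>)"
          by (rule sum.mono_neutral_cong_right) auto
        also have "\<dots> \<le> (\<Sum>\<nu>\<in>int ` {1..V} \<union> (\<lambda>n. - int n) ` {1..V}. 1 / \<bar>real_of_int \<nu>\<bar>)"
        proof (rule sum_mono2)
          show "{- int V<..<int V} - {0} \<subseteq> int ` {1..V} \<union> (\<lambda>n. - int n) ` {1..V}"
          proof
            fix \<nu> assume "\<nu> \<in> {- int V<..<int V} - {0}"
            hence "\<nu> = int (nat \<nu>) \<and> nat \<nu> \<in> {1..V} \<or> \<nu> = - int (nat (- \<nu>)) \<and> nat (- \<nu>) \<in> {1..V}" by auto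
            thus "\<nu> \<in> int ` {1..V} \<union> (\<lambda>n. - int n) ` {1..V}" by blast
          qed
        qed auto
        finally show ?thesis .
      qed
      also have "\<dots> \<le> (\<Sum>\<nu>\<in>int ` {1..V}. 1 / \<bar>real_of_int \<nu>\<bar>) + (\<Sum>\<nu>\<in>(\<lambda>n. - int n) ` {1..V}. 1 / \<bar>real_of_int \<nu>\<bar>)"
        by (subst sum.union_disjoint) auto
      also have "\<dots> = 2 * (\<Sum>n=1..V. 1 / real n)"
        by (subst (1 2) sum.reindex) (auto simp: inj_on_def o_def)
      also have "\<dots> \<le> 2 * (1 + ln (real V))" using V by (intro mult_left_mono sum_inverse_le_ln) auto
      finally show ?thesis .
    qed
    finally have S: "(\<Sum>\<nu>\<in>{- int V<..<int V}. \<Phi> \<nu>) \<le> 8 * (X / M + 1) * B1 + 4 * C0 * N * (2 * (1 + ln (real V)))"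
      using C0 N by (simp add: mult_left_mono)
    have "norm (\<Sum>m\<in>{0..<0 + p}. F (real m)) \<le> (\<Sum>\<nu>\<in>{- int V<..<int V}. \<Phi> \<nu>) + real p * (2 * N * (20 * A * (1 + X))) / sqrt (real V)"
      unfolding \<Phi>_def by (rule fejer_poisson[OF V lip])
    also have "\<dots> \<le> (8 * (X / M + 1) * B1 + 4 * C0 * N * (2 * (1 + ln (real V)))) + (7 * M) * (2 * N * (20 * A * (1 + X))) / sqrt (real V)"
      using S p N A X by (intro add_mono divide_right_mono mult_right_mono) auto
    also have "\<dots> = 8 * C0 * (C5 + 2) * ((X / M + 1) * (M / sqrt X * Ex + N * M / X)) + 8 * C0 * (N * (1 + ln (real V))) + 280 * A * (N * M * (1 + X) / sqrt (real V))"
    proof -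
      have "8 * u * (C0 * w * B) + 4 * C0 * N * (2 * l) + (7 * M) * (2 * N * (20 * A * y)) / s = 8 * C0 * w * (u * B) + 8 * C0 * (N * l) + 280 * A * (N * M * y / s)"
        for u w B l y s :: real by (simp add: mult_ac)
      thus ?thesis unfolding B1_def .
    qed
    also have "\<dots> \<le> C * ((X / M + 1) * (M / sqrt X * Ex + N * M / X)) + C * (N * (1 + ln (real V))) + C * (N * M * (1 + X) / sqrt (real V))"
    proof (intro add_mono mult_right_mono)
      have "0 \<le> C0 * (C5 + 2)" using C0 C5 by simp
      thus "8 * C0 * (C5 + 2) \<le> C" "8 * C0 \<le> C" "280 * A \<le> C" using C0 A by (simp_all add: C_def)
    qed (use X M N Ex V in \<open>auto intro!: mult_nonneg_nonneg add_nonneg_nonneg divide_nonneg_nonneg ln_ge_zero\<close>)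
    also have "\<dots> = C * ((X / M + 1) * (M / sqrt X * Ex + N * M / X) + N * (1 + ln (real V)) + N * M * (1 + X) / sqrt (real V))"
      by (simp only: distrib_left)
    finally show "norm (\<Sum>n\<in>{a..b}. \<Sum>m | real m \<le> 5 * M. of_real (bump (real m / M)) * expi (\<beta> * real m + h * ((real n + q) powr \<gamma> - real n powr \<gamma>) * real m powr \<gamma>))
      \<le> C * ((X / M + 1) * (M / sqrt X * ((X / N) powr k * N powr l + N / X) + N * M / X) + N * (1 + ln (real V)) + N * M * (1 + X) / sqrt (real V))"
      unfolding sum_eq Ex_def .
  qed
qed

section \<open>Additive characters modulo R and the Weyl-van der Corput inequality\<close>

section \<open>Completion and shifting\<close>

lemma norm_geometric_expi_le:
  assumes "expi \<theta> \<noteq> 1"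
  shows "norm (\<Sum>j\<in>{u..<v::nat}. expi (real j * \<theta>)) \<le> 2 / norm (1 - expi \<theta>)"
proof (cases "u \<le> v")
  case False thus ?thesis by simp
next
  case True
  have "(\<Sum>j\<in>{u..<v}. expi (real j * \<theta>)) = (\<Sum>j\<in>{u..<v}. expi \<theta> ^ j)" by (simp add: expi_power)
  moreover have "(1 - w) * (\<Sum>j\<in>{u..<v}. w ^ j) = w ^ u - w ^ v" for w :: complex
    using True
  proof (induction v rule: dec_induct)
    case (step n)
    have "(\<Sum>j\<in>{u..<Suc n}. w ^ j) = (\<Sum>j\<in>{u..<n}. w ^ j) + w ^ n" using step by simp
    thus ?case using step.IH by (simp only: distrib_left) (simp add: algebra_simps)
  qed simp
  ultimately have "(1 - expi \<theta>) * (\<Sum>j\<in>{u..<v}. expi (real j * \<theta>)) = expi \<theta> ^ u - expi \<theta> ^ v" by simp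
  hence "norm (1 - expi \<theta>) * norm (\<Sum>j\<in>{u..<v}. expi (real j * \<theta>)) = norm (expi \<theta> ^ u - expi \<theta> ^ v)" by (metis norm_mult)
  also have "\<dots> \<le> 2" using norm_triangle_ineq4[of "expi \<theta> ^ u" "expi \<theta> ^ v"] by (simp add: norm_power)
  finally show ?thesis using assms by (simp add: field_simps)
qed

lemma expi_eq_1_rat:
  assumes "0 < \<bar>d\<bar>" "\<bar>d\<bar> < int R"
  shows "expi (of_int d / real R) \<noteq> 1"
proof
  define t where "t = \<bar>real_of_int d / real R\<bar>"
  have t: "0 < t" "t < 1" using assms by (auto simp: t_def abs_divide field_simps)
  assume "expi (of_int d / real R) = 1"
  hence "norm (1 - expi (of_int d / real R)) = 0" by simp
  hence "sin (pi * (of_int d / real R)) = 0" by (simp add: norm_one_minus_expi)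
  hence "sin (pi * t) = 0" unfolding t_def by (cases "d \<ge> 0") auto
  moreover have "sin (pi * t) > 0" using t by (intro sin_gt_zero) auto
  ultimately show False by simp
qed

text \<open>Majorant of the normalised Fourier coefficients of an interval modulo \<open>R\<close>:
  \<open>1 / min \<theta> (1 - \<theta>)\<close> with \<open>\<theta> = r / R\<close> is replaced by
  a sum of two terms, each of which sums to a logarithm.\<close>

definition completion_weight :: "nat \<Rightarrow> nat \<Rightarrow> real" where
  "completion_weight R r = (if r = 0 then 1 else (1 / real r + 1 / real (R - r)) / 2)"

lemma sum_completion_weight_le:
  assumes "R \<ge> 1"
  shows "(\<Sum>r<R. completion_weight R r) \<le> 2 + ln (real R)"
proof -
  have "(\<Sum>r<R. completion_weight R r) = 1 + (\<Sum>r\<in>{1..<R}. (1 / real r + 1 / real (R - r)) / 2)"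
  proof -
    have "{..<R} = insert 0 {1..<R}" using assms by auto
    moreover have "(\<Sum>r\<in>{1..<R}. completion_weight R r) = (\<Sum>r\<in>{1..<R}. (1 / real r + 1 / real (R - r)) / 2)"
      by (intro sum.cong refl) (simp add: completion_weight_def)
    ultimately show ?thesis by (simp add: completion_weight_def)
  qed
  also have "(\<Sum>r\<in>{1..<R}. (1 / real r + 1 / real (R - r)) / 2) = ((\<Sum>r\<in>{1..<R}. 1 / real r) + (\<Sum>r\<in>{1..<R}. 1 / real (R - r))) / 2"
    by (simp add: sum_divide_distrib sum.distrib add_divide_distrib)
  also have "(\<Sum>r\<in>{1..<R}. 1 / real (R - r)) = (\<Sum>r\<in>{1..<R}. 1 / real r)"
    by (rule sum.reindex_bij_witness[of _ "\<lambda>r. R - r" "\<lambda>r. R - r"]) auto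
  also have "((\<Sum>r\<in>{1..<R}. 1 / real r) + (\<Sum>r\<in>{1..<R}. 1 / real r)) / 2 \<le> (\<Sum>r=1..R. 1 / real r)"
    by (simp, intro sum_mono2) auto
  also have "\<dots> \<le> 1 + ln (real R)" by (rule sum_inverse_le_ln[OF assms])
  finally show ?thesis by simp
qed

lemma completion_weight_nonneg: "0 \<le> completion_weight R r"
  by (simp add: completion_weight_def)

text \<open>The characters modulo \<open>R\<close>, the number of points in \<open>{a..b}\<close>,
  separate these points and so detect the subinterval. The price is a linear twist of
  \<open>z\<close>, harmless for estimates uniform in a linear phase, and a logarithm.\<close>

lemma completion_bound:
  fixes z :: "nat \<Rightarrow> complex"
  assumes uv: "a \<le> u" "v \<le> b + 1" and R: "R = b + 1 - a" "a \<le> b"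
  shows "norm (\<Sum>n\<in>{u..<v}. z n) \<le> (\<Sum>r<R. completion_weight R r * norm (\<Sum>n\<in>{a..b}. z n * expi (real r / real R * real n)))"
proof -
  have R0: "R > 0" using R by simp
  define K where "K r = (\<Sum>j\<in>{u..<v}. expi (- (real r / real R * real j))) / of_nat R" for r
  have orth: "(\<Sum>r<R. expi (real r / real R * real n) * expi (- (real r / real R * real j))) = (if n = j then of_nat R else 0)"
    if "n \<in> {a..b}" "j \<in> {a..b}" for n j
  proof (cases "n = j")
    case True
    thus ?thesis by (simp flip: expi_add)
  next
    case False
    define d where "d = int n - int j"
    have d: "0 < \<bar>d\<bar>" "\<bar>d\<bar> < int R" using False that R by (auto simp: d_def)
    define w where "w = expi (of_int d / real R)"
    have w: "w \<noteq> 1" unfolding w_def by (rule expi_eq_1_rat[OF d])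
    have "(\<Sum>r<R. expi (real r / real R * real n) * expi (- (real r / real R * real j))) = (\<Sum>r<R. w ^ r)"
      by (intro sum.cong refl) (simp add: w_def expi_power d_def field_simps flip: expi_add)
    also have "\<dots> = (1 - w ^ R) / (1 - w)" using w by (simp add: sum_gp_strict)
    also have "w ^ R = 1" using R0 by (simp add: w_def expi_power)
    finally show ?thesis using False by simp
  qed
  have Kb: "norm (K r) \<le> completion_weight R r" if r: "r < R" for r
  proof (cases "r = 0")
    case True
    have "real (v - u) \<le> real R" using uv R by auto
    hence "real (v - u) / real R \<le> 1" using R0 by simp
    thus ?thesis using True by (simp add: K_def completion_weight_def norm_divide)
  next
    case False
    define \<theta> where "\<theta> = real r / real R"
    have \<theta>: "0 < \<theta>" "\<theta> < 1" using False r by (auto simp: \<theta>_def)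
    have ne: "expi (- \<theta>) \<noteq> 1"
      using expi_eq_1_rat[of "- int r" R] False r by (simp add: \<theta>_def)
    have ge: "4 * min \<theta> (1 - \<theta>) \<le> norm (1 - expi (- \<theta>))"
    proof (cases "\<theta> \<le> 1/2")
      case True
      thus ?thesis using norm_one_minus_expi_ge[of "- \<theta>"] \<theta> by (simp add: min_def)
    next
      case F: False
      have "expi (1 - \<theta>) = expi (- \<theta>)" using expi_add[of 1 "- \<theta>"] expi_of_nat[of 1] by simp
      thus ?thesis using norm_one_minus_expi_ge[of "1 - \<theta>"] \<theta> F by (simp add: min_def)
    qed
    have m0: "0 < min \<theta> (1 - \<theta>)" using \<theta> by simp
    have "norm (\<Sum>j\<in>{u..<v}. expi (- (real r / real R * real j))) = norm (\<Sum>j\<in>{u..<v}. expi (real j * (- \<theta>)))"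
      by (simp add: \<theta>_def mult.commute)
    also have "\<dots> \<le> 2 / norm (1 - expi (- \<theta>))" by (rule norm_geometric_expi_le[OF ne])
    also have "\<dots> \<le> 2 / (4 * min \<theta> (1 - \<theta>))" using ge m0 by (intro divide_left_mono mult_pos_pos) auto
    also have "\<dots> = (1 / min \<theta> (1 - \<theta>)) / 2" by simp
    also have "\<dots> \<le> (1 / \<theta> + 1 / (1 - \<theta>)) / 2" using \<theta> by (intro divide_right_mono) (auto simp: min_def)
    finally have "norm (\<Sum>j\<in>{u..<v}. expi (- (real r / real R * real j))) \<le> (1 / \<theta> + 1 / (1 - \<theta>)) / 2" .
    hence "norm (K r) \<le> (1 / \<theta> + 1 / (1 - \<theta>)) / 2 / real R"
      unfolding K_def norm_divide norm_of_nat by (rule divide_right_mono) simp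
    also have "(1 / \<theta> + 1 / (1 - \<theta>)) / 2 / real R = completion_weight R r"
    proof -
      have "1 - \<theta> = real (R - r) / real R" using r by (simp add: \<theta>_def of_nat_diff field_simps)
      thus ?thesis using False r R0 by (simp add: completion_weight_def \<theta>_def add_divide_distrib)
    qed
    finally show ?thesis .
  qed
  have "(\<Sum>r<R. K r * (\<Sum>n\<in>{a..b}. z n * expi (real r / real R * real n)))
      = (\<Sum>r<R. \<Sum>n\<in>{a..b}. \<Sum>j\<in>{u..<v}. z n * (expi (real r / real R * real n) * expi (- (real r / real R * real j))) / of_nat R)"
    unfolding K_def sum_divide_distrib sum_product sum_distrib_left sum_distrib_right
    by (intro sum.cong refl) (simp add: mult_ac)
  also have "\<dots> = (\<Sum>n\<in>{a..b}. \<Sum>j\<in>{u..<v}. \<Sum>r<R. z n * (expi (real r / real R * real n) * expi (- (real r / real R * real j))) / of_nat R)"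
    by (rule trans[OF sum.swap sum.cong[OF refl sum.swap]])
  also have "\<dots> = (\<Sum>n\<in>{a..b}. \<Sum>j\<in>{u..<v}. if n = j then z n else 0)"
  proof (intro sum.cong refl)
    fix n j assume nj: "n \<in> {a..b}" "j \<in> {u..<v}"
    have "(\<Sum>r<R. z n * (expi (real r / real R * real n) * expi (- (real r / real R * real j))) / of_nat R)
       = z n * (\<Sum>r<R. expi (real r / real R * real n) * expi (- (real r / real R * real j))) / of_nat R"
      by (simp only: sum_distrib_left sum_divide_distrib)
    also have "\<dots> = (if n = j then z n else 0)" using orth[of n j] nj uv R0 by auto
    finally show "(\<Sum>r<R. z n * (expi (real r / real R * real n) * expi (- (real r / real R * real j))) / of_nat R) = (if n = j then z n else 0)" .
  qed
  also have "\<dots> = (\<Sum>j\<in>{u..<v}. \<Sum>n\<in>{a..b}. if n = j then z n else 0)" by (rule sum.swap)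
  also have "\<dots> = (\<Sum>j\<in>{u..<v}. z j)" using uv by (intro sum.cong refl) (auto simp: sum.delta)
  finally have "(\<Sum>j\<in>{u..<v}. z j) = (\<Sum>r<R. K r * (\<Sum>n\<in>{a..b}. z n * expi (real r / real R * real n)))" by simp
  also have "norm \<dots> \<le> (\<Sum>r<R. completion_weight R r * norm (\<Sum>n\<in>{a..b}. z n * expi (real r / real R * real n)))"
    using Kb by (intro sum_norm_le) (auto simp: norm_mult intro!: mult_right_mono)
  finally show ?thesis .
qed

text \<open>A nondecreasing weight with values in \<open>[0, L]\<close> has last value and total
  variation at most \<open>L\<close> each, whence the factor 2.\<close>

lemma norm_sum_monotone_weight_le:
  fixes z :: "nat \<Rightarrow> complex" and c :: "nat \<Rightarrow> real"
  assumes E: "\<And>v. v \<le> q \<Longrightarrow> norm (\<Sum>n\<in>{p..<v}. z n) \<le> E" and L: "0 \<le> L"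
    and c: "\<And>n. p \<le> n \<Longrightarrow> n < q \<Longrightarrow> 0 \<le> c n \<and> c n \<le> L" "\<And>n. p \<le> n \<Longrightarrow> Suc n < q \<Longrightarrow> c n \<le> c (Suc n)"
  shows "norm (\<Sum>n\<in>{p..<q}. of_real (c n) * z n) \<le> 2 * L * E"
proof -
  have E0: "0 \<le> E" using E[of 0] order.trans[OF norm_ge_zero] by fastforce
  show ?thesis
  proof (cases "p < q")
    case False thus ?thesis using E0 L by simp
  next
    case True
    have eq: "{p..<q} = {p..q-1}" using True by auto
    have "norm (\<Sum>n\<in>{p..q-1}. of_real (c n) * z n) \<le> E * (norm (complex_of_real (c (q-1))) + (\<Sum>i\<in>{p..<q-1}. norm (complex_of_real (c i) - of_real (c (Suc i)))))"
    proof (rule norm_sum_abel_le)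
      fix n assume "p \<le> n" "n \<le> q - 1"
      thus "norm (\<Sum>i\<in>{p..n}. z i) \<le> E" using E[of "Suc n"] True by (simp add: atLeastLessThanSuc_atLeastAtMost)
    qed (use True in auto)
    also have "(\<Sum>i\<in>{p..<q-1}. norm (complex_of_real (c i) - of_real (c (Suc i)))) = (\<Sum>i\<in>{p..<q-1}. c (Suc i) - c i)"
    proof (intro sum.cong refl)
      fix i assume i: "i \<in> {p..<q-1}"
      have "norm (complex_of_real (c i) - of_real (c (Suc i))) = \<bar>c i - c (Suc i)\<bar>" by (metis norm_of_real of_real_diff)
      thus "norm (complex_of_real (c i) - of_real (c (Suc i))) = c (Suc i) - c i" using c(2)[of i] i by auto
    qed
    also have "\<dots> = c (q-1) - c p" using True by (intro sum_Suc_diff') auto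
    also have "E * (norm (complex_of_real (c (q-1))) + (c (q-1) - c p)) \<le> E * (L + L)"
    proof (rule mult_left_mono[OF _ E0])
      have "p \<le> q - 1" "q - 1 < q" using True by auto
      from c(1)[OF this] c(1)[OF order.refl True] show "norm (complex_of_real (c (q-1))) + (c (q-1) - c p) \<le> L + L" by simp
    qed
    finally show ?thesis unfolding eq by (simp add: algebra_simps)
  qed
qed

definition correlation :: "nat \<Rightarrow> nat \<Rightarrow> 'm set \<Rightarrow> ('m \<Rightarrow> real) \<Rightarrow> ('m \<Rightarrow> nat \<Rightarrow> complex) \<Rightarrow> nat \<Rightarrow> complex" where
  "correlation a b A w z d = (\<Sum>m\<in>A. of_real (w m) * (\<Sum>n | n \<in> {a..b} \<and> n + d \<in> {a..b}. z m (n + d) * cnj (z m n)))"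

text \<open>The Weyl-van der Corput inequality with a weight. The sum over \<open>n\<close> is
  averaged over \<open>Q\<close> translates, Cauchy's inequality is applied over the positions
  \<open>t\<close>, and the square opens into correlations at the differences of two shifts; the
  factor 2 comes from the two signs of a difference.\<close>

lemma shift_inequality:
  fixes z :: "'m \<Rightarrow> nat \<Rightarrow> complex"
  assumes A: "finite A" and w: "\<And>m. m \<in> A \<Longrightarrow> 0 \<le> w m" and Q: "Q \<ge> 1" and ab: "a \<le> b"
  shows "(real Q)\<^sup>2 * (\<Sum>m\<in>A. w m * (norm (\<Sum>n\<in>{a..b}. z m n))\<^sup>2)
    \<le> real (b + Q - a) * (2 * real Q * (\<Sum>d<Q. norm (correlation a b A w z d)))"
proof -
  \<comment> \<open>Extension of \<open>z\<close> by 0: every translate then runs over the same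
    range \<open>{a..<b + Q}\<close>, and its sum over \<open>t\<close> is the same for each shift
    \<open>q\<close>.\<close>
  define y where "y m t q = (if q \<le> t \<and> t - q \<in> {a..b} then z m (t - q) else 0)" for m t q
  let ?T = "{a..<b + Q}"
  have shift: "(\<Sum>t\<in>?T. y m t q) = (\<Sum>n\<in>{a..b}. z m n)" if "q < Q" for m q
  proof -
    have "(\<Sum>t\<in>?T. y m t q) = (\<Sum>t\<in>{t\<in>?T. q \<le> t \<and> t - q \<in> {a..b}}. z m (t - q))"
      unfolding y_def by (rule sum.inter_filter[symmetric]) simp
    also have "\<dots> = (\<Sum>n\<in>{a..b}. z m n)"
      by (rule sum.reindex_bij_witness[of _ "\<lambda>n. n + q" "\<lambda>t. t - q"]) (use that in auto)
    finally show ?thesis .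
  qed
  have point: "(real Q)\<^sup>2 * (norm (\<Sum>n\<in>{a..b}. z m n))\<^sup>2 \<le> real (b + Q - a) * (\<Sum>t\<in>?T. (norm (\<Sum>q<Q. y m t q))\<^sup>2)" for m
  proof -
    have "of_nat Q * (\<Sum>n\<in>{a..b}. z m n) = (\<Sum>q<Q. \<Sum>t\<in>?T. y m t q)" using shift by simp
    also have "\<dots> = (\<Sum>t\<in>?T. \<Sum>q<Q. y m t q)" by (rule sum.swap)
    finally have "real Q * norm (\<Sum>n\<in>{a..b}. z m n) = norm (\<Sum>t\<in>?T. \<Sum>q<Q. y m t q)" by (metis norm_mult norm_of_nat)
    also have "\<dots> \<le> (\<Sum>t\<in>?T. norm (\<Sum>q<Q. y m t q))" by (rule norm_sum)
    finally have "(real Q * norm (\<Sum>n\<in>{a..b}. z m n))\<^sup>2 \<le> (\<Sum>t\<in>?T. norm (\<Sum>q<Q. y m t q))\<^sup>2" by (intro power_mono) auto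
    also have "\<dots> \<le> (\<Sum>t\<in>?T. (norm (\<Sum>q<Q. y m t q))\<^sup>2) * card ?T" by (rule sum_squared_le_sum_of_squares)
    finally show ?thesis by (simp add: power_mult_distrib mult.commute)
  qed
  \<comment> \<open>The square root of the weight goes into each factor, so that the square can be
    expanded over \<open>(m, t)\<close> jointly and the sum over \<open>m\<close> stays inside the
    absolute value.\<close>
  define g where "g q = (\<lambda>(m, t). of_real (sqrt (w m)) * y m t q)" for q
  have corr: "norm (\<Sum>p\<in>A \<times> ?T. g q p * cnj (g q' p)) = norm (correlation a b A w z (q' - q))" if qq: "q \<le> q'" "q' < Q" for q q'
  proof -
    have inner: "(\<Sum>t\<in>?T. y m t q * cnj (y m t q')) = (\<Sum>n | n \<in> {a..b} \<and> n + (q' - q) \<in> {a..b}. z m (n + (q' - q)) * cnj (z m n))" for m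
    proof -
      have "(\<Sum>t\<in>?T. y m t q * cnj (y m t q')) = (\<Sum>t\<in>{t\<in>?T. q' \<le> t \<and> t - q' \<in> {a..b} \<and> t - q \<in> {a..b}}. z m (t - q) * cnj (z m (t - q')))"
        by (subst sum.inter_filter, simp) (intro sum.cong refl, use qq in \<open>auto simp: y_def\<close>)
      also have "\<dots> = (\<Sum>n | n \<in> {a..b} \<and> n + (q' - q) \<in> {a..b}. z m (n + (q' - q)) * cnj (z m n))"
        by (rule sum.reindex_bij_witness[of _ "\<lambda>n. n + q'" "\<lambda>t. t - q'"]) (use qq in auto)
      finally show ?thesis .
    qed
    have "(\<Sum>p\<in>A \<times> ?T. g q p * cnj (g q' p)) = (\<Sum>m\<in>A. \<Sum>t\<in>?T. of_real (w m) * (y m t q * cnj (y m t q')))"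
      unfolding sum.cartesian_product g_def
    proof (intro sum.cong refl, clarify)
      fix m t assume "m \<in> A"
      hence "complex_of_real (sqrt (w m)) * of_real (sqrt (w m)) = of_real (w m)" using w by (simp flip: of_real_mult)
      thus "complex_of_real (sqrt (w m)) * y m t q * cnj (complex_of_real (sqrt (w m)) * y m t q') = of_real (w m) * (y m t q * cnj (y m t q'))"
        by (simp add: mult_ac)
    qed
    also have "\<dots> = correlation a b A w z (q' - q)"
      unfolding correlation_def inner[symmetric] by (simp add: sum_distrib_left)
    finally show ?thesis by simp
  qed
  have corr': "norm (\<Sum>p\<in>A \<times> ?T. g q p * cnj (g q' p)) \<le> (if q \<le> q' then norm (correlation a b A w z (q' - q)) else 0) + (if q' \<le> q then norm (correlation a b A w z (q - q')) else 0)"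
    if qq: "q < Q" "q' < Q" for q q'
  proof (cases "q \<le> q'")
    case True thus ?thesis using corr[of q q'] qq by simp
  next
    case False
    have "(\<Sum>p\<in>A \<times> ?T. g q p * cnj (g q' p)) = cnj (\<Sum>p\<in>A \<times> ?T. g q' p * cnj (g q p))" by (simp add: mult.commute)
    hence "norm (\<Sum>p\<in>A \<times> ?T. g q p * cnj (g q' p)) = norm (\<Sum>p\<in>A \<times> ?T. g q' p * cnj (g q p))" by (simp only: complex_mod_cnj)
    thus ?thesis using corr[of q' q] qq False by simp
  qed
  define f where "f d = norm (correlation a b A w z d)" for d
  have inner: "(\<Sum>q'<Q. (if q \<le> q' then f (q' - q) else 0) + (if q' \<le> q then f (q - q') else 0)) \<le> 2 * (\<Sum>d<Q. f d)" if "q < Q" for q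
  proof -
    have "(\<Sum>q'<Q. if q \<le> q' then f (q' - q) else 0) = (\<Sum>q'\<in>{q'\<in>{..<Q}. q \<le> q'}. f (q' - q))"
      by (rule sum.inter_filter[symmetric]) simp
    also have "\<dots> = (\<Sum>d\<in>{..<Q - q}. f d)"
      by (rule sum.reindex_bij_witness[of _ "\<lambda>d. d + q" "\<lambda>q'. q' - q"]) auto
    also have "\<dots> \<le> (\<Sum>d<Q. f d)" by (intro sum_mono2) (auto simp: f_def)
    finally have 1: "(\<Sum>q'<Q. if q \<le> q' then f (q' - q) else 0) \<le> (\<Sum>d<Q. f d)" .
    have "(\<Sum>q'<Q. if q' \<le> q then f (q - q') else 0) = (\<Sum>q'\<in>{q'\<in>{..<Q}. q' \<le> q}. f (q - q'))"
      by (rule sum.inter_filter[symmetric]) simp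
    also have "\<dots> = (\<Sum>d\<in>{..q}. f d)"
      by (rule sum.reindex_bij_witness[of _ "\<lambda>d. q - d" "\<lambda>q'. q - q'"]) (use that in auto)
    also have "\<dots> \<le> (\<Sum>d<Q. f d)" using that by (intro sum_mono2) (auto simp: f_def)
    finally show ?thesis using 1 by (simp add: sum.distrib)
  qed
  have "(real Q)\<^sup>2 * (\<Sum>m\<in>A. w m * (norm (\<Sum>n\<in>{a..b}. z m n))\<^sup>2) = (\<Sum>m\<in>A. w m * ((real Q)\<^sup>2 * (norm (\<Sum>n\<in>{a..b}. z m n))\<^sup>2))"
    by (simp add: sum_distrib_left mult_ac)
  also have "\<dots> \<le> (\<Sum>m\<in>A. w m * (real (b + Q - a) * (\<Sum>t\<in>?T. (norm (\<Sum>q<Q. y m t q))\<^sup>2)))"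
    using point w by (intro sum_mono mult_left_mono) auto
  also have "\<dots> = real (b + Q - a) * (\<Sum>m\<in>A. \<Sum>t\<in>?T. w m * (norm (\<Sum>q<Q. y m t q))\<^sup>2)"
    by (simp add: sum_distrib_left mult_ac)
  also have "(\<Sum>m\<in>A. \<Sum>t\<in>?T. w m * (norm (\<Sum>q<Q. y m t q))\<^sup>2) = (\<Sum>p\<in>A \<times> ?T. (norm (\<Sum>q<Q. g q p))\<^sup>2)"
    unfolding sum.cartesian_product
  proof (intro sum.cong refl, clarify)
    fix m t assume "m \<in> A"
    hence "w m * (norm (\<Sum>q<Q. y m t q))\<^sup>2 = (sqrt (w m) * norm (\<Sum>q<Q. y m t q))\<^sup>2" using w by (simp add: power_mult_distrib)
    also have "sqrt (w m) * norm (\<Sum>q<Q. y m t q) = norm (\<Sum>q<Q. g q (m, t))"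
      using w \<open>m \<in> A\<close> by (simp add: g_def norm_mult flip: sum_distrib_left)
    finally show "w m * (norm (\<Sum>q<Q. y m t q))\<^sup>2 = (norm (\<Sum>q<Q. g q (m, t)))\<^sup>2" .
  qed
  also have "real (b + Q - a) * \<dots> \<le> real (b + Q - a) * (\<Sum>q<Q. \<Sum>q'<Q. norm (\<Sum>p\<in>A \<times> ?T. g q p * cnj (g q' p)))"
    by (intro mult_left_mono sum_norm_square_le_pairs) auto
  also have "\<dots> \<le> real (b + Q - a) * (\<Sum>q<Q. 2 * (\<Sum>d<Q. f d))"
  proof (intro mult_left_mono sum_mono)
    fix q assume "q \<in> {..<Q}"
    hence q: "q < Q" by simp
    have "(\<Sum>q'<Q. norm (\<Sum>p\<in>A \<times> ?T. g q p * cnj (g q' p))) \<le> (\<Sum>q'<Q. (if q \<le> q' then f (q' - q) else 0) + (if q' \<le> q then f (q - q') else 0))"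
      by (rule sum_mono) (use corr'[OF q] in \<open>simp only: f_def lessThan_iff\<close>)
    also have "\<dots> \<le> 2 * (\<Sum>d<Q. f d)" by (rule inner[OF q])
    finally show "(\<Sum>q'<Q. norm (\<Sum>p\<in>A \<times> ?T. g q p * cnj (g q' p))) \<le> 2 * (\<Sum>d<Q. f d)" .
  qed simp
  also have "(\<Sum>q<Q. 2 * (\<Sum>d<Q. f d)) = 2 * real Q * (\<Sum>d<Q. norm (correlation a b A w z d))" by (simp add: f_def)
  finally show ?thesis .
qed

section \<open>Type I sums: second derivative test and Weyl shift in the smooth variable\<close>

section \<open>Sums with a long smooth variable\<close>

text \<open>The absolute value stands inside the sum over \<open>m\<close>, which makes bounded
  coefficients on \<open>m\<close> and intervals depending on \<open>m\<close> admissible; \<theta>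
  is room for the twist produced by completion.\<close>

definition smooth_sum :: "real \<Rightarrow> real \<Rightarrow> real \<Rightarrow> real \<Rightarrow> real \<Rightarrow> real \<Rightarrow> real" where
  "smooth_sum \<gamma> \<alpha> \<theta> H M N = (\<Sum>h::nat | H < real h \<and> real h \<le> 2 * H. \<Sum>m::nat | M \<le> real m \<and> real m \<le> 4 * M.
     norm (\<Sum>n::nat | N < real n \<and> real n \<le> 2 * N. expi (\<alpha> * real (m * n) + real h * real (m * n) powr \<gamma> + \<theta> * real n)))"

lemma finite_nat_real_le [simp]: "finite {n::nat. P n \<and> real n \<le> x}" "finite {n::nat. real n \<le> x}"
  by (rule finite_subset[of _ "{..nat \<lfloor>x\<rfloor>}"]; auto simp: le_nat_floor)+

lemma card_nat_real_le:
  assumes "x \<ge> 0"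
  shows "real (card {n::nat. 0 < n \<and> P n \<and> real n \<le> x}) \<le> x"
proof -
  have "{n::nat. 0 < n \<and> P n \<and> real n \<le> x} \<subseteq> {1..nat \<lfloor>x\<rfloor>}" by (auto simp: le_nat_floor)
  hence "card {n::nat. 0 < n \<and> P n \<and> real n \<le> x} \<le> nat \<lfloor>x\<rfloor>" using card_mono[of "{1..nat \<lfloor>x\<rfloor>}"] by force
  thus ?thesis using assms by linarith
qed

lemma nat_block_eq:
  fixes N :: real
  assumes "N \<ge> 1"
  obtains a b :: nat where "{n. N < real n \<and> real n \<le> 2 * N} = {a..b}" "a \<le> b" "N < real a" "real b \<le> 2 * N" "real b - real a \<le> N" "a \<ge> 1"
proof (rule that[of "nat \<lfloor>N\<rfloor> + 1" "nat \<lfloor>2 * N\<rfloor>"])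
  show "{n. N < real n \<and> real n \<le> 2 * N} = {nat \<lfloor>N\<rfloor> + 1..nat \<lfloor>2 * N\<rfloor>}"
  proof (intro set_eqI iffI)
    fix n assume "n \<in> {n. N < real n \<and> real n \<le> 2 * N}"
    hence "\<lfloor>N\<rfloor> < int n" "int n \<le> \<lfloor>2 * N\<rfloor>" by (simp_all add: floor_less_iff le_floor_iff)
    hence "nat \<lfloor>N\<rfloor> + 1 \<le> n" "n \<le> nat \<lfloor>2 * N\<rfloor>" using assms by linarith+
    thus "n \<in> {nat \<lfloor>N\<rfloor> + 1..nat \<lfloor>2 * N\<rfloor>}" by simp
  next
    fix n assume "n \<in> {nat \<lfloor>N\<rfloor> + 1..nat \<lfloor>2 * N\<rfloor>}"
    hence "\<lfloor>N\<rfloor> < int n" "int n \<le> \<lfloor>2 * N\<rfloor>" using assms by auto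
    thus "n \<in> {n. N < real n \<and> real n \<le> 2 * N}" by (simp add: floor_less_iff le_floor_iff)
  qed
qed (use assms in linarith)+

lemma sum_inverse_sqrt_le: "(\<Sum>d=1..n. 1 / sqrt (real d)) \<le> 2 * sqrt (real n)"
proof (induction n)
  case (Suc n)
  define s t where "s = sqrt (real n)" and "t = sqrt (real (Suc n))"
  have t: "t > 0" "s \<ge> 0" "t * t = s * s + 1" by (auto simp: s_def t_def)
  have "0 \<le> (t - s)\<^sup>2" by simp
  hence "2 * s * t + 1 \<le> 2 * t * t" using t by (simp add: power2_eq_square algebra_simps)
  hence "2 * s + 1 / t \<le> 2 * t" using t by (simp add: field_simps)
  thus ?case using Suc by (simp add: s_def t_def)
qed simp

lemma sum_sum_squared_le:
  fixes f :: "'a \<Rightarrow> 'b \<Rightarrow> real"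
  shows "(\<Sum>x\<in>A. \<Sum>y\<in>B. f x y)\<^sup>2 \<le> real (card A) * real (card B) * (\<Sum>x\<in>A. \<Sum>y\<in>B. (f x y)\<^sup>2)"
proof -
  have "(\<Sum>x\<in>A. \<Sum>y\<in>B. f x y) = (\<Sum>p\<in>A \<times> B. f (fst p) (snd p))" by (simp add: sum.cartesian_product case_prod_beta)
  also have "\<dots>\<^sup>2 \<le> (\<Sum>p\<in>A \<times> B. (f (fst p) (snd p))\<^sup>2) * card (A \<times> B)" by (rule sum_squared_le_sum_of_squares)
  also have "(\<Sum>p\<in>A \<times> B. (f (fst p) (snd p))\<^sup>2) = (\<Sum>x\<in>A. \<Sum>y\<in>B. (f x y)\<^sup>2)" by (simp add: sum.cartesian_product case_prod_beta)
  finally show ?thesis by (simp add: card_cartesian_product mult_ac)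
qed

text \<open>Separates what grows with \<open>X\<close>, bounded by its value at \<open>Y\<close>,
  from what decays in \<open>X\<close>. The decaying terms keep \<open>X\<close> because they will
  be summed over the shifts.\<close>

lemma shifted_bound_simplify:
  fixes X Y M N P :: real
  assumes X: "1 \<le> X" "X \<le> Y" and M: "1 \<le> M" and N: "1 \<le> N" and P: "0 \<le> P'" "P' \<le> P"
  shows "(X / M + 1) * (M / sqrt X * (P' + N / X) + N * M / X) \<le> sqrt Y * P + M * P / sqrt X + 2 * N + 2 * (N * M / X)"
proof -
  have X0: "X > 0" "sqrt X > 0" "sqrt X \<ge> 1" using X by auto
  have e1: "(X / M + 1) * (M / sqrt X) = sqrt X + M / sqrt X"
  proof -
    have "X / sqrt X = sqrt X" using X0 by (simp add: real_div_sqrt)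
    thus ?thesis using M by (simp add: distrib_right add_divide_distrib)
  qed
  have "(X / M + 1) * (M / sqrt X * (P' + N / X) + N * M / X) = ((X / M + 1) * (M / sqrt X)) * P' + ((X / M + 1) * (M / sqrt X)) * (N / X) + (N + N * M / X)"
    using M X0 by (simp add: distrib_left distrib_right add_divide_distrib)
  also have "\<dots> = (sqrt X + M / sqrt X) * P' + (sqrt X / X * N + N * M / X * (1 / sqrt X)) + (N + N * M / X)"
    unfolding e1 by (simp add: distrib_left distrib_right add_divide_distrib mult_ac)
  also have "\<dots> \<le> (sqrt Y + M / sqrt X) * P + (1 * N + N * M / X * 1) + (N + N * M / X)"
  proof (intro add_mono mult_mono order.refl)
    have "sqrt X * 1 \<le> sqrt X * sqrt X" using X0 by (intro mult_left_mono) auto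
    thus "sqrt X / X \<le> 1" using X0 by simp
    show "1 / sqrt X \<le> 1" using X0 by simp
  qed (use X0 X M N P in auto)
  also have "\<dots> = sqrt Y * P + M * P / sqrt X + 2 * N + 2 * (N * M / X)" by (simp add: distrib_right)
  finally show ?thesis .
qed

theorem smooth_sum_large:
  fixes \<gamma> :: real
  assumes \<gamma>: "0 < \<gamma>" "\<gamma> < 1"
  obtains C where "C > 0" "\<And>N M H \<alpha> \<theta>. N \<ge> 1 \<Longrightarrow> M \<ge> 1 \<Longrightarrow> H \<ge> 1 \<Longrightarrow>
    smooth_sum \<gamma> \<alpha> \<theta> H M N \<le> C * H * M * (sqrt (H * (M * N) powr \<gamma>) + N / sqrt (H * (M * N) powr \<gamma>))"
proof -
  obtain C1 where C1: "C1 > 0" and monomial: "\<And>M \<alpha> \<beta> (a::nat) b. M \<ge> 1 \<Longrightarrow> \<beta> \<noteq> 0 \<Longrightarrow> M \<le> real a \<Longrightarrow> real b \<le> 4 * M + 1 \<Longrightarrow>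
    norm (\<Sum>m\<in>{a..<b}. expi (\<alpha> * real m + \<beta> * real m powr \<gamma>))
      \<le> C1 * (sqrt \<bar>\<beta>\<bar> * M powr (\<gamma>/2) + M powr (1 - \<gamma>/2) / sqrt \<bar>\<beta>\<bar>)"
    using exp_sum_monomial[OF \<gamma>] by blast
  show ?thesis
  proof (rule that[of "24 * C1"])
    show "24 * C1 > 0" using C1 by simp
    fix N M H \<alpha> \<theta> :: real
    assume N: "N \<ge> 1" and M: "M \<ge> 1" and H: "H \<ge> 1"
    obtain a b where ab: "{n. N < real n \<and> real n \<le> 2 * N} = {a..b}" "a \<le> b" "N < real a" "real b \<le> 2 * N" "real b - real a \<le> N" "a \<ge> 1"
      by (rule nat_block_eq[OF N])
    define S where "S = sqrt (H * (M * N) powr \<gamma>)"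
    have S: "S > 0" using H M N by (simp add: S_def)
    have inner: "norm (\<Sum>n\<in>{a..b}. expi (\<alpha> * real (m * n) + real h * real (m * n) powr \<gamma> + \<theta> * real n)) \<le> C1 * (3 * (S + N / S))"
      if h: "H < real h" "real h \<le> 2 * H" and m: "M \<le> real m" "real m \<le> 4 * M" for h m :: nat
    proof -
      define \<beta> where "\<beta> = real h * real m powr \<gamma>"
      have \<beta>: "\<beta> > 0" using h m H M by (simp add: \<beta>_def)
      have "(\<Sum>n\<in>{a..b}. expi (\<alpha> * real (m * n) + real h * real (m * n) powr \<gamma> + \<theta> * real n)) = (\<Sum>n\<in>{a..<b+1}. expi ((\<alpha> * real m + \<theta>) * real n + \<beta> * real n powr \<gamma>))"
        by (intro sum.cong) (auto simp: \<beta>_def powr_mult algebra_simps)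
      also have "norm \<dots> \<le> C1 * (sqrt \<bar>\<beta>\<bar> * N powr (\<gamma>/2) + N powr (1 - \<gamma>/2) / sqrt \<bar>\<beta>\<bar>)"
        using \<beta> ab N by (intro monomial) auto
      also have "\<dots> \<le> C1 * (3 * S + 3 * (N / S))"
      proof (intro mult_left_mono add_mono)
        have Nh: "N powr (\<gamma>/2) = sqrt (N powr \<gamma>)" using N by (simp add: powr_half_sqrt[symmetric] powr_powr)
        have S_eq: "S = sqrt (H * M powr \<gamma>) * sqrt (N powr \<gamma>)" unfolding S_def using M N by (simp add: powr_mult real_sqrt_mult mult_ac)
        have "real m powr \<gamma> \<le> (4 * M) powr \<gamma>" using m M \<gamma> by (intro powr_mono2) auto
        also have "\<dots> = 4 powr \<gamma> * M powr \<gamma>" using M by (simp add: powr_mult)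
        also have "\<dots> \<le> 4 powr 1 * M powr \<gamma>" using \<gamma> by (intro mult_right_mono powr_mono) auto
        finally have "\<beta> \<le> (2 * H) * (4 * M powr \<gamma>)" unfolding \<beta>_def using h H by (intro mult_mono) auto
        also have "\<dots> \<le> 9 * (H * M powr \<gamma>)" using H by simp
        finally have "sqrt \<beta> \<le> sqrt (9 * (H * M powr \<gamma>))" by (rule real_sqrt_le_mono)
        hence "sqrt \<beta> \<le> 3 * sqrt (H * M powr \<gamma>)" by (simp add: real_sqrt_mult)
        hence "sqrt \<beta> * sqrt (N powr \<gamma>) \<le> (3 * sqrt (H * M powr \<gamma>)) * sqrt (N powr \<gamma>)" by (intro mult_right_mono) auto
        thus "sqrt \<bar>\<beta>\<bar> * N powr (\<gamma>/2) \<le> 3 * S" unfolding Nh S_eq using \<beta> by simp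
        have "H * M powr \<gamma> \<le> \<beta>" unfolding \<beta>_def using h m H M \<gamma> by (intro mult_mono powr_mono2) auto
        hence sb: "sqrt (H * M powr \<gamma>) \<le> sqrt \<beta>" by (rule real_sqrt_le_mono)
        have "N powr (1 - \<gamma>/2) = N / sqrt (N powr \<gamma>)" using N by (simp add: powr_diff Nh)
        hence "N powr (1 - \<gamma>/2) / sqrt \<bar>\<beta>\<bar> = N / (sqrt \<beta> * sqrt (N powr \<gamma>))" using \<beta> by (simp add: mult.commute)
        also have "\<dots> \<le> N / S" unfolding S_eq using sb H M N \<beta> by (intro divide_left_mono mult_right_mono mult_pos_pos) auto
        also have "\<dots> \<le> 3 * (N / S)"
        proof -
          have "0 \<le> N / S" using N S by simp
          thus ?thesis by linarith
        qed
        finally show "N powr (1 - \<gamma>/2) / sqrt \<bar>\<beta>\<bar> \<le> 3 * (N / S)" .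
      qed (use C1 in auto)
      finally show ?thesis by simp
    qed
    have cM: "real (card {m::nat. M \<le> real m \<and> real m \<le> 4 * M}) \<le> 4 * M"
    proof -
      have "{m::nat. M \<le> real m \<and> real m \<le> 4 * M} = {m. 0 < m \<and> M \<le> real m \<and> real m \<le> 4 * M}" using M by (auto intro!: gr0I)
      thus ?thesis using card_nat_real_le[of "4 * M" "\<lambda>m. M \<le> real m"] M by simp
    qed
    have cH: "real (card {h::nat. H < real h \<and> real h \<le> 2 * H}) \<le> 2 * H"
    proof -
      have "{h::nat. H < real h \<and> real h \<le> 2 * H} = {h. 0 < h \<and> H < real h \<and> real h \<le> 2 * H}" using H by (auto intro!: gr0I)
      thus ?thesis using card_nat_real_le[of "2 * H" "\<lambda>h. H < real h"] H by simp
    qed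
    have "smooth_sum \<gamma> \<alpha> \<theta> H M N \<le> (\<Sum>h::nat | H < real h \<and> real h \<le> 2 * H. \<Sum>m::nat | M \<le> real m \<and> real m \<le> 4 * M. C1 * (3 * (S + N / S)))"
      unfolding smooth_sum_def ab(1) by (intro sum_mono inner) auto
    also have "\<dots> = real (card {h::nat. H < real h \<and> real h \<le> 2 * H}) * (real (card {m::nat. M \<le> real m \<and> real m \<le> 4 * M}) * (C1 * (3 * (S + N / S))))"
      by simp
    also have "\<dots> \<le> 2 * H * (4 * M * (C1 * (3 * (S + N / S))))"
      using cM cH H M C1 S N by (intro mult_mono) auto
    finally show "smooth_sum \<gamma> \<alpha> \<theta> H M N \<le> 24 * C1 * H * M * (sqrt (H * (M * N) powr \<gamma>) + N / sqrt (H * (M * N) powr \<gamma>))"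
      unfolding S_def[symmetric] by (simp add: mult_ac)
  qed
qed

text \<open>The bump majorises the range \<open>M \<le> m \<le> 4 * M\<close>, so the sum over
  \<open>m\<close> is smooth when it enters the correlations. The correlation at \<open>e\<close> is
  a shifted sum with parameter \<open>X\<close> between \<open>e * U\<close> and \<open>Y\<close>;
  averaging \<open>1 / sqrt e\<close> and \<open>1 / e\<close> over \<open>e < Q\<close> turns the
  decaying terms into their values at \<open>Y\<close>, up to constants and a logarithm.\<close>

theorem smooth_sum_weyl:
  fixes \<gamma> k l :: real
  assumes ep: "exponent_pair k l" and \<gamma>: "0 < \<gamma>" "\<gamma> < 1"
  obtains C d where "C > 0" "d > 0" and "\<And>N M H \<alpha> \<theta> Q Y. N \<ge> 1 \<Longrightarrow> M \<ge> 1 \<Longrightarrow> H \<ge> 1 \<Longrightarrow> Q \<ge> 1 \<Longrightarrow> real Q \<le> d * N \<Longrightarrow> real Q \<le> N \<Longrightarrow>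
    \<gamma> * H * M powr \<gamma> * N powr (\<gamma> - 1) \<ge> 1 \<Longrightarrow> Y = 2 * \<gamma> * H * real Q * M powr \<gamma> * N powr (\<gamma> - 1) \<Longrightarrow>
    (smooth_sum \<gamma> \<alpha> \<theta> H M N)\<^sup>2 \<le> C * H\<^sup>2 * M * N * (M * N / real Q + (sqrt Y + M / sqrt Y) * ((Y / N) powr k * N powr l)
       + (N + N * M / Y) * (1 + ln (M * (1 + Y)) + ln (real Q)))"
proof -
  have kl: "0 \<le> k" "0 \<le> l" using ep by (auto simp: exponent_pair_def)
  obtain A where A: "A > 0" "\<And>t. \<bar>bump t\<bar> \<le> A" "\<And>t. \<bar>bump_deriv t\<bar> \<le> A"
  proof (rule bump_global_bound)
    fix A :: real assume *: "A > 0" "\<And>t. \<bar>bump t\<bar> \<le> A" "\<And>t. \<bar>bump_deriv t\<bar> \<le> A"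
    show thesis by (rule that[OF *])
  qed
  obtain C0 d where C0: "C0 > 0" and d: "d > 0" and shifted: "\<And>N M h q \<beta> X a b V. N \<ge> 1 \<Longrightarrow> M \<ge> 1 \<Longrightarrow> h > 0 \<Longrightarrow> q > 0 \<Longrightarrow> q \<le> d * N \<Longrightarrow> q \<le> N \<Longrightarrow> \<bar>\<beta>\<bar> \<le> 1/2 \<Longrightarrow>
     N \<le> real a \<Longrightarrow> real b \<le> 2 * N \<Longrightarrow> V > 0 \<Longrightarrow> X = \<gamma> * h * q * M powr \<gamma> * N powr (\<gamma> - 1) \<Longrightarrow> X \<ge> 1 \<Longrightarrow>
     norm (\<Sum>n\<in>{a..b}. \<Sum>m | real m \<le> 5 * M. of_real (bump (real m / M)) * expi (\<beta> * real m + h * ((real n + q) powr \<gamma> - real n powr \<gamma>) * real m powr \<gamma>))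
      \<le> C0 * ((X / M + 1) * (M / sqrt X * ((X / N) powr k * N powr l + N / X) + N * M / X) + N * (1 + ln (real V)) + N * M * (1 + X) / sqrt (real V))"
  proof (rule shifted_sum_bound[OF ep \<gamma>], goal_cases)
    case (1 C d) show ?case by (rule 1(1)[OF 1(2-4)])
  qed
  define C where "C = 64 * (12 * A + 6 * C0)"
  have C: "C > 0" using A C0 by (simp add: C_def add_pos_pos)
  show ?thesis
  proof (rule that[OF C d])
    fix N M H \<alpha> \<theta> Y :: real and Q :: nat
    assume N: "N \<ge> 1" and M: "M \<ge> 1" and H: "H \<ge> 1" and Q: "Q \<ge> 1" "real Q \<le> d * N" "real Q \<le> N"
      and X1: "\<gamma> * H * M powr \<gamma> * N powr (\<gamma> - 1) \<ge> 1" and Y_def: "Y = 2 * \<gamma> * H * real Q * M powr \<gamma> * N powr (\<gamma> - 1)"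
    obtain a b where ab: "{n. N < real n \<and> real n \<le> 2 * N} = {a..b}" "a \<le> b" "N < real a" "real b \<le> 2 * N" "real b - real a \<le> N" "a \<ge> 1"
      by (rule nat_block_eq[OF N])
    let ?Hs = "{h::nat. H < real h \<and> real h \<le> 2 * H}" and ?Ms = "{m::nat. M \<le> real m \<and> real m \<le> 4 * M}" and ?A = "{m::nat. real m \<le> 5 * M}"
    define U where "U = \<gamma> * H * M powr \<gamma> * N powr (\<gamma> - 1)"
    have U: "U \<ge> 1" "Y = 2 * real Q * U" using X1 by (simp_all add: U_def Y_def)
    have Y: "Y \<ge> 1" using U Q mult_mono[of 1 "2 * real Q" 1 U] by simp
    define P where "P = (Y / N) powr k * N powr l"
    have P: "P \<ge> 0" by (simp add: P_def)
    define L where "L = ln (M * (1 + Y))"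
    have MY: "M * (1 + Y) \<ge> 1" using M Y mult_mono[of 1 M 1 "1 + Y"] by simp
    have L: "L \<ge> 0" using MY by (simp add: L_def)
    define z where "z h m n = expi (\<alpha> * real (m * n) + real h * real (m * n) powr \<gamma> + \<theta> * real n)" for h m n :: nat
    define w where "w m = bump (real m / M)" for m :: nat
    define corr where "corr h e = correlation a b ?A w (z h) e" for h e
    have cM: "real (card ?Ms) \<le> 4 * M"
    proof -
      have "?Ms = {m. 0 < m \<and> M \<le> real m \<and> real m \<le> 4 * M}" using M by (auto intro!: gr0I)
      thus ?thesis using card_nat_real_le[of "4 * M" "\<lambda>m. M \<le> real m"] M by simp
    qed
    have cH: "real (card ?Hs) \<le> 2 * H"
    proof -
      have "?Hs = {h. 0 < h \<and> H < real h \<and> real h \<le> 2 * H}" using H by (auto intro!: gr0I)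
      thus ?thesis using card_nat_real_le[of "2 * H" "\<lambda>h. H < real h"] H by simp
    qed
    have cA: "real (card ?A) \<le> 6 * M"
    proof -
      have "?A \<subseteq> {..nat \<lfloor>5 * M\<rfloor>}" by (auto simp: le_nat_floor)
      hence "card ?A \<le> nat \<lfloor>5 * M\<rfloor> + 1" using card_mono[of "{..nat \<lfloor>5 * M\<rfloor>}" ?A] by simp
      thus ?thesis using M by linarith
    qed
    define B where "B e = C0 * (sqrt Y * P + M * P * sqrt (2 * real Q) / sqrt Y * (1 / sqrt (real e)) + N * (6 + 2 * L) + 4 * (N * M * real Q / Y) * (1 / real e))" for e :: nat
    have corr0: "norm (corr h 0) \<le> 12 * A * (M * N)" for h
    proof -
      have "norm (corr h 0) \<le> (\<Sum>m\<in>?A. A * (2 * N))"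
        unfolding corr_def correlation_def
      proof (intro sum_norm_le)
        fix m
        have "norm (\<Sum>n | n \<in> {a..b} \<and> n + 0 \<in> {a..b}. z h m (n + 0) * cnj (z h m n)) \<le> (\<Sum>n\<in>{a..b}. 1)"
        proof -
          have "{n. n \<in> {a..b} \<and> n + 0 \<in> {a..b}} = {a..b}" by auto
          thus ?thesis by (simp only:) (rule sum_norm_le, simp add: z_def norm_mult)
        qed
        also have "\<dots> \<le> 2 * N" using ab N by (simp add: of_nat_diff)
        finally show "norm (of_real (w m) * (\<Sum>n | n \<in> {a..b} \<and> n + 0 \<in> {a..b}. z h m (n + 0) * cnj (z h m n))) \<le> A * (2 * N)"
          unfolding norm_mult norm_of_real w_def using A by (intro mult_mono) auto
      qed
      also have "\<dots> = real (card ?A) * (A * (2 * N))" by simp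
      also have "\<dots> \<le> 6 * M * (A * (2 * N))" using cA A N by (intro mult_right_mono) auto
      finally show ?thesis by (simp add: mult_ac)
    qed
    have corre: "norm (corr h e) \<le> B e" if h: "h \<in> ?Hs" and e: "1 \<le> e" "e < Q" for h e
    proof -
      \<comment> \<open>\<open>m\<close> is an integer, so \<open>\<alpha> * e\<close> matters only
        modulo 1; subtracting the nearest integer gives the required
        \<open>\<bar>\<beta>\<bar> \<le> 1/2\<close>.\<close>
      define \<beta> where "\<beta> = \<alpha> * real e - of_int (round (\<alpha> * real e))"
      have \<beta>: "\<bar>\<beta>\<bar> \<le> 1/2" unfolding \<beta>_def using of_int_round_abs_le[of "\<alpha> * real e"] by (simp add: abs_minus_commute)
      define X where "X = \<gamma> * real h * real e * M powr \<gamma> * N powr (\<gamma> - 1)"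
      have XU: "real e * U \<le> X"
      proof -
        have "(\<gamma> * M powr \<gamma> * N powr (\<gamma> - 1) * real e) * H \<le> (\<gamma> * M powr \<gamma> * N powr (\<gamma> - 1) * real e) * real h"
          using h \<gamma> by (intro mult_left_mono) auto
        thus ?thesis by (simp add: U_def X_def mult_ac)
      qed
      have X: "X \<ge> 1" using XU U e mult_mono[of 1 "real e" 1 U] by simp
      have XY: "X \<le> Y"
      proof -
        have "(\<gamma> * M powr \<gamma> * N powr (\<gamma> - 1)) * (real h * real e) \<le> (\<gamma> * M powr \<gamma> * N powr (\<gamma> - 1)) * ((2 * H) * real Q)"
          using h e \<gamma> H by (intro mult_left_mono mult_mono) auto
        thus ?thesis by (simp add: X_def Y_def mult_ac)
      qed
      \<comment> \<open>About the square of \<open>M * (1 + Y)\<close>: the smoothing error is then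
        at most \<open>N\<close>, while \<open>ln V\<close> stays logarithmic.\<close>
      define V where "V = nat \<lceil>(M * (1 + Y))\<^sup>2\<rceil>"
      have V1: "(M * (1 + Y))\<^sup>2 \<le> real V" "real V \<le> (M * (1 + Y))\<^sup>2 + 1"
        using zero_le_power2[of "M * (1 + Y)"] unfolding V_def by linarith+
      have MY2: "1 \<le> (M * (1 + Y))\<^sup>2" using MY by simp
      have V0: "V > 0" using V1 MY2 by (intro gr0I) auto
      have lnV: "ln (real V) \<le> 1 + 2 * L"
      proof -
        have "real V \<le> exp 1 * (M * (1 + Y))\<^sup>2" using V1 MY2 exp_ge_add_one_self[of 1] mult_right_mono[of 2 "exp 1" "(M * (1 + Y))\<^sup>2"] by simp
        hence "ln (real V) \<le> ln (exp 1 * (M * (1 + Y))\<^sup>2)" using V0 by (subst ln_le_cancel_iff) (use MY2 in auto)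
        also have "\<dots> = 1 + 2 * L"
        proof -
          have "ln (exp 1 * t\<^sup>2) = 1 + 2 * ln t" if "t \<ge> 1" for t :: real using that by (simp add: ln_mult ln_realpow)
          from this[OF MY] show ?thesis by (simp only: L_def)
        qed
        finally show ?thesis .
      qed
      have sV: "N * M * (1 + X) / sqrt (real V) \<le> N"
      proof -
        have "M * (1 + X) \<le> M * (1 + Y)" using M XY by simp
        also have "\<dots> \<le> sqrt (real V)" using V1(1) by (rule real_le_rsqrt)
        finally have "N * (M * (1 + X)) \<le> N * sqrt (real V)" using N by (intro mult_left_mono) auto
        thus ?thesis using V0 by (simp add: field_simps)
      qed
      have set_eq: "{n. n \<in> {a..b} \<and> n + e \<in> {a..b}} = {a..b - e}" using ab(6) e by auto
      have "corr h e = (\<Sum>n\<in>{a..b - e}. \<Sum>m\<in>?A. of_real (w m) * (z h m (n + e) * cnj (z h m n)))"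
        unfolding corr_def correlation_def set_eq sum_distrib_left by (rule sum.swap)
      also have "\<dots> = (\<Sum>n\<in>{a..b - e}. \<Sum>m\<in>?A. expi (\<theta> * real e) * (of_real (bump (real m / M)) * expi (\<beta> * real m + real h * ((real n + real e) powr \<gamma> - real n powr \<gamma>) * real m powr \<gamma>)))"
      proof (intro sum.cong refl)
        fix n m :: nat
        have "z h m (n + e) * cnj (z h m n) = expi (\<theta> * real e + (\<beta> * real m + real h * ((real n + real e) powr \<gamma> - real n powr \<gamma>) * real m powr \<gamma>) + of_int (round (\<alpha> * real e) * int m))"
        proof -
          have p1: "real (m * (n + e)) powr \<gamma> = real m powr \<gamma> * (real n + real e) powr \<gamma>"
            unfolding of_nat_mult of_nat_add by (rule powr_mult)
          have p2: "real (m * n) powr \<gamma> = real m powr \<gamma> * real n powr \<gamma>"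
            unfolding of_nat_mult by (rule powr_mult)
          show ?thesis unfolding z_def expi_diff[symmetric] p1 p2 by (rule arg_cong[of _ _ expi]) (simp add: \<beta>_def algebra_simps)
        qed
        also have "\<dots> = expi (\<theta> * real e) * expi (\<beta> * real m + real h * ((real n + real e) powr \<gamma> - real n powr \<gamma>) * real m powr \<gamma>)"
          by (simp only: expi_add expi_of_int mult_1_right)
        finally show "of_real (w m) * (z h m (n + e) * cnj (z h m n)) = expi (\<theta> * real e) * (of_real (bump (real m / M)) * expi (\<beta> * real m + real h * ((real n + real e) powr \<gamma> - real n powr \<gamma>) * real m powr \<gamma>))"
          by (simp add: w_def mult_ac)
      qed
      also have "\<dots> = expi (\<theta> * real e) * (\<Sum>n\<in>{a..b - e}. \<Sum>m\<in>?A. of_real (bump (real m / M)) * expi (\<beta> * real m + real h * ((real n + real e) powr \<gamma> - real n powr \<gamma>) * real m powr \<gamma>))"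
        by (simp only: sum_distrib_left)
      finally have "norm (corr h e) = norm (\<Sum>n\<in>{a..b - e}. \<Sum>m\<in>?A. of_real (bump (real m / M)) * expi (\<beta> * real m + real h * ((real n + real e) powr \<gamma> - real n powr \<gamma>) * real m powr \<gamma>))"
        by (simp add: norm_mult)
      also have "\<dots> \<le> C0 * ((X / M + 1) * (M / sqrt X * ((X / N) powr k * N powr l + N / X) + N * M / X) + N * (1 + ln (real V)) + N * M * (1 + X) / sqrt (real V))"
        by (rule shifted) (use N M H h e Q \<beta> ab V0 X in \<open>auto simp: X_def\<close>)
      also have "\<dots> \<le> C0 * ((sqrt Y * P + M * P / sqrt X + 2 * N + 2 * (N * M / X)) + N * (1 + (1 + 2 * L)) + N)"
      proof (intro mult_left_mono add_mono sV shifted_bound_simplify X XY M N)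
        show "(X / N) powr k * N powr l \<le> P" unfolding P_def using XY X N kl by (intro mult_right_mono powr_mono2 divide_right_mono) auto
      qed (use C0 N lnV in auto)
      also have "\<dots> \<le> B e"
        unfolding B_def
      proof (intro mult_left_mono)
        have X0: "real e * (Y / (2 * real Q)) \<le> X" using XU U Q by simp
        have eY: "real e * (Y / (2 * real Q)) > 0" using e Y Q by simp
        have "sqrt (real e * (Y / (2 * real Q))) \<le> sqrt X" using X0 by simp
        hence "M * P / sqrt X \<le> M * P / sqrt (real e * (Y / (2 * real Q)))" using eY M P X by (intro divide_left_mono mult_pos_pos) auto
        also have "\<dots> = M * P * sqrt (2 * real Q) / sqrt Y * (1 / sqrt (real e))" by (simp add: real_sqrt_mult real_sqrt_divide)
        finally have 1: "M * P / sqrt X \<le> M * P * sqrt (2 * real Q) / sqrt Y * (1 / sqrt (real e))" .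
        have "N * M / X \<le> N * M / (real e * (Y / (2 * real Q)))"
          by (rule divide_left_mono[OF X0 _ mult_pos_pos[OF _ eY]]) (use N M X in auto)
        also have "\<dots> = 2 * (N * M * real Q / Y) * (1 / real e)" using e Q Y by (simp add: mult_ac)
        finally have 2: "2 * (N * M / X) \<le> 4 * (N * M * real Q / Y) * (1 / real e)" by simp
        have 3: "2 * N + N * (1 + (1 + 2 * L)) + N \<le> N * (6 + 2 * L)" using N by (simp add: algebra_simps)
        show "(sqrt Y * P + M * P / sqrt X + 2 * N + 2 * (N * M / X)) + N * (1 + (1 + 2 * L)) + N
          \<le> sqrt Y * P + M * P * sqrt (2 * real Q) / sqrt Y * (1 / sqrt (real e)) + N * (6 + 2 * L) + 4 * (N * M * real Q / Y) * (1 / real e)"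
          using 1 2 3 by linarith
      qed (use C0 in simp)
      finally show ?thesis .
    qed
    define Z where "Z = sqrt Y * P + 3 * (M * P / sqrt Y) + N * (6 + 2 * L) + 4 * (N * M / Y) * (1 + ln (real Q))"
    have sumB: "(\<Sum>e\<in>{1..<Q}. B e) \<le> C0 * (real Q * Z)"
    proof -
      have "(\<Sum>e\<in>{1..<Q}. B e) \<le> (\<Sum>e\<in>{1..Q}. B e)"
        by (intro sum_mono2) (use C0 Y P M N L in \<open>auto simp: B_def intro!: mult_nonneg_nonneg add_nonneg_nonneg\<close>)
      also have "\<dots> = C0 * (real Q * (sqrt Y * P) + M * P * sqrt (2 * real Q) / sqrt Y * (\<Sum>e=1..Q. 1 / sqrt (real e)) + real Q * (N * (6 + 2 * L)) + 4 * (N * M * real Q / Y) * (\<Sum>e=1..Q. 1 / real e))"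
        unfolding B_def sum_distrib_left[symmetric] sum.distrib by (simp add: algebra_simps)
      also have "\<dots> \<le> C0 * (real Q * (sqrt Y * P) + M * P * sqrt (2 * real Q) / sqrt Y * (2 * sqrt (real Q)) + real Q * (N * (6 + 2 * L)) + 4 * (N * M * real Q / Y) * (1 + ln (real Q)))"
        using C0 Y P M N Q by (intro mult_left_mono add_mono order.refl sum_inverse_sqrt_le sum_inverse_le_ln) auto
      also have "M * P * sqrt (2 * real Q) / sqrt Y * (2 * sqrt (real Q)) = real Q * (2 * sqrt 2 * (M * P / sqrt Y))"
        by (simp add: real_sqrt_mult)
      also have "C0 * (real Q * (sqrt Y * P) + real Q * (2 * sqrt 2 * (M * P / sqrt Y)) + real Q * (N * (6 + 2 * L)) + 4 * (N * M * real Q / Y) * (1 + ln (real Q)))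
         \<le> C0 * (real Q * (sqrt Y * P) + real Q * (3 * (M * P / sqrt Y)) + real Q * (N * (6 + 2 * L)) + 4 * (N * M * real Q / Y) * (1 + ln (real Q)))"
      proof -
        have "sqrt 2 \<le> 3/2" by (rule real_le_lsqrt) (auto simp: power2_eq_square)
        thus ?thesis using C0 M P Y by (intro mult_left_mono add_mono order.refl mult_right_mono) auto
      qed
      also have "\<dots> = C0 * (real Q * Z)" by (simp add: Z_def algebra_simps)
      finally show ?thesis .
    qed
    have weighted: "(\<Sum>m\<in>?A. w m * (norm (\<Sum>n\<in>{a..b}. z h m n))\<^sup>2) \<le> 4 * N / real Q * (12 * A * (M * N) + C0 * (real Q * Z))" if h: "h \<in> ?Hs" for h
    proof -
      have "(\<Sum>e<Q. norm (corr h e)) = norm (corr h 0) + (\<Sum>e\<in>{1..<Q}. norm (corr h e))"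
      proof -
        have "{..<Q} = insert 0 {1..<Q}" using Q by auto
        thus ?thesis by simp
      qed
      also have "\<dots> \<le> 12 * A * (M * N) + (\<Sum>e\<in>{1..<Q}. B e)" using h by (intro add_mono corr0 sum_mono corre) auto
      also have "\<dots> \<le> 12 * A * (M * N) + C0 * (real Q * Z)" using sumB by simp
      finally have cs: "(\<Sum>e<Q. norm (corr h e)) \<le> 12 * A * (M * N) + C0 * (real Q * Z)" .
      have cs0: "0 \<le> (\<Sum>e<Q. norm (corr h e))" by (intro sum_nonneg) auto
      have "(real Q)\<^sup>2 * (\<Sum>m\<in>?A. w m * (norm (\<Sum>n\<in>{a..b}. z h m n))\<^sup>2) \<le> real (b + Q - a) * (2 * real Q * (\<Sum>e<Q. norm (corr h e)))"
        unfolding corr_def using ab Q by (intro shift_inequality) (auto simp: w_def bump_nonneg)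
      also have "\<dots> \<le> (2 * N) * (2 * real Q * (12 * A * (M * N) + C0 * (real Q * Z)))"
        using ab Q cs cs0 N by (intro mult_mono) (auto simp: of_nat_diff)
      finally have "(real Q)\<^sup>2 * (\<Sum>m\<in>?A. w m * (norm (\<Sum>n\<in>{a..b}. z h m n))\<^sup>2) \<le> (real Q)\<^sup>2 * (4 * N / real Q * (12 * A * (M * N) + C0 * (real Q * Z)))"
        using Q by (simp add: power2_eq_square mult_ac)
      moreover have "0 < (real Q)\<^sup>2" using Q by simp
      ultimately show ?thesis by (rule mult_le_cancel_left_pos[THEN iffD1, rotated])
    qed
    have "(smooth_sum \<gamma> \<alpha> \<theta> H M N)\<^sup>2 = (\<Sum>h\<in>?Hs. \<Sum>m\<in>?Ms. norm (\<Sum>n\<in>{a..b}. z h m n))\<^sup>2"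
      unfolding smooth_sum_def ab(1) z_def ..
    also have "\<dots> \<le> real (card ?Hs) * real (card ?Ms) * (\<Sum>h\<in>?Hs. \<Sum>m\<in>?Ms. (norm (\<Sum>n\<in>{a..b}. z h m n))\<^sup>2)"
      by (rule sum_sum_squared_le)
    also have "\<dots> \<le> (2 * H) * (4 * M) * (\<Sum>h\<in>?Hs. 4 * N / real Q * (12 * A * (M * N) + C0 * (real Q * Z)))"
    proof (intro mult_mono sum_mono cH cM)
      fix h assume h: "h \<in> ?Hs"
      have "(\<Sum>m\<in>?Ms. (norm (\<Sum>n\<in>{a..b}. z h m n))\<^sup>2) \<le> (\<Sum>m\<in>?Ms. w m * (norm (\<Sum>n\<in>{a..b}. z h m n))\<^sup>2)"
      proof (rule sum_mono)
        fix m assume "m \<in> ?Ms"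
        hence "1 \<le> w m" unfolding w_def using M by (intro bump_ge_one) (auto simp: field_simps)
        thus "(norm (\<Sum>n\<in>{a..b}. z h m n))\<^sup>2 \<le> w m * (norm (\<Sum>n\<in>{a..b}. z h m n))\<^sup>2"
          using mult_right_mono[of 1 "w m" "(norm (\<Sum>n\<in>{a..b}. z h m n))\<^sup>2"] by simp
      qed
      also have "\<dots> \<le> (\<Sum>m\<in>?A. w m * (norm (\<Sum>n\<in>{a..b}. z h m n))\<^sup>2)"
        using M by (intro sum_mono2) (auto simp: w_def bump_nonneg)
      also have "\<dots> \<le> 4 * N / real Q * (12 * A * (M * N) + C0 * (real Q * Z))" by (rule weighted[OF h])
      finally show "(\<Sum>m\<in>?Ms. (norm (\<Sum>n\<in>{a..b}. z h m n))\<^sup>2) \<le> 4 * N / real Q * (12 * A * (M * N) + C0 * (real Q * Z))" .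
    qed (use H M in \<open>auto intro!: sum_nonneg\<close>)
    also have "\<dots> = (2 * H) * (4 * M) * (real (card ?Hs) * (4 * N / real Q * (12 * A * (M * N) + C0 * (real Q * Z))))" by simp
    also have "\<dots> \<le> (2 * H) * (4 * M) * ((2 * H) * (4 * N / real Q * (12 * A * (M * N) + C0 * (real Q * Z))))"
    proof (intro mult_left_mono mult_right_mono cH)
      have "0 \<le> Z" unfolding Z_def using Y P M N L Q by (intro add_nonneg_nonneg mult_nonneg_nonneg divide_nonneg_nonneg ln_ge_zero) auto
      thus "0 \<le> 4 * N / real Q * (12 * A * (M * N) + C0 * (real Q * Z))" using N M A C0
        by (intro mult_nonneg_nonneg add_nonneg_nonneg) auto
    qed (use H M in auto)
    also have "\<dots> = 64 * H\<^sup>2 * M * N * (12 * A * (M * N / real Q) + C0 * Z)"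
    proof -
      have "4 * N / real Q * (12 * A * (M * N) + C0 * (real Q * Z)) = 4 * N * (12 * A * (M * N / real Q) + C0 * Z)"
        using Q by (simp add: field_simps)
      thus ?thesis by (simp add: power2_eq_square)
    qed
    also have "\<dots> \<le> 64 * H\<^sup>2 * M * N * ((12 * A + 6 * C0) * (M * N / real Q + (sqrt Y + M / sqrt Y) * P + (N + N * M / Y) * (1 + L + ln (real Q))))"
    proof (intro mult_left_mono)
      define R where "R = M * N / real Q"
      define T where "T = (sqrt Y + M / sqrt Y) * P"
      define S where "S = (N + N * M / Y) * (1 + L + ln (real Q))"
      have lQ: "0 \<le> ln (real Q)" using Q by simp
      have pos: "0 \<le> R" "0 \<le> T" "0 \<le> S" unfolding R_def T_def S_def using M N Y P L lQ by auto
      have "Z \<le> 6 * (R + T + S)"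
      proof -
        have a1: "sqrt Y * P + 3 * (M * P / sqrt Y) \<le> 3 * T" unfolding T_def using Y P by (simp add: algebra_simps)
        have NY: "0 \<le> N * M / Y" using N M Y by simp
        have gen: "N * (6 + 2 * L) + 4 * E * (1 + l) \<le> 6 * ((N + E) * (1 + L + l))" if "0 \<le> E" "0 \<le> l" for E l :: real
        proof -
          have "6 * ((N + E) * (1 + L + l)) - (N * (6 + 2 * L) + 4 * E * (1 + l)) = 4 * (N * L) + 6 * (N * l) + 2 * (E * (1 + l)) + 6 * (E * L)"
            by (simp add: algebra_simps)
          moreover have "\<dots> \<ge> 0" using that N L by simp
          ultimately show ?thesis by linarith
        qed
        have a2: "N * (6 + 2 * L) + 4 * (N * M / Y) * (1 + ln (real Q)) \<le> 6 * S" unfolding S_def by (rule gen[OF NY lQ])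
        have "(sqrt Y * P + 3 * (M * P / sqrt Y)) + (N * (6 + 2 * L) + 4 * (N * M / Y) * (1 + ln (real Q))) \<le> 3 * T + 6 * S"
          by (rule add_mono[OF a1 a2])
        moreover have "3 * r + 6 * s \<le> 6 * (q + r + s)" if "0 \<le> q" "0 \<le> r" "0 \<le> s" for q r s :: real using that by simp
        from this[OF pos] have "3 * T + 6 * S \<le> 6 * (R + T + S)" .
        moreover have "Z = (sqrt Y * P + 3 * (M * P / sqrt Y)) + (N * (6 + 2 * L) + 4 * (N * M / Y) * (1 + ln (real Q)))"
          unfolding Z_def by (rule trans[OF add.assoc]) (rule refl)
        ultimately show ?thesis by (meson order.trans eq_refl)
      qed
      hence "C0 * Z \<le> C0 * (6 * (R + T + S))" using C0 by (intro mult_left_mono) auto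
      moreover have "12 * A * R \<le> 12 * A * (R + T + S)" using A pos by (intro mult_left_mono) auto
      ultimately have "12 * A * R + C0 * Z \<le> (12 * A + 6 * C0) * (R + T + S)" by (simp add: algebra_simps)
      thus "12 * A * (M * N / real Q) + C0 * Z \<le> (12 * A + 6 * C0) * (M * N / real Q + (sqrt Y + M / sqrt Y) * P + (N + N * M / Y) * (1 + L + ln (real Q)))"
        by (simp only: R_def T_def S_def)
    qed (use M N in auto)
    finally show "(smooth_sum \<gamma> \<alpha> \<theta> H M N)\<^sup>2 \<le> C * H\<^sup>2 * M * N * (M * N / real Q + (sqrt Y + M / sqrt Y) * ((Y / N) powr k * N powr l)
       + (N + N * M / Y) * (1 + ln (M * (1 + Y)) + ln (real Q)))"
      unfolding C_def P_def L_def by (simp only: mult_ac)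
  qed
qed

text \<open>The condition \<open>m * n \<in> J h\<close> cuts out an interval of \<open>n\<close>
  that depends on \<open>h\<close> and \<open>m\<close>. The monotone weight \<open>c\<close> is
  removed by partial summation, then completion replaces the intervals by the full block with a
  linear twist; hence \<open>W\<close> has to bound \<open>smooth_sum\<close> for every
  \<theta>.\<close>

theorem type1_block:
  fixes a c :: "nat \<Rightarrow> real"
  assumes N: "N \<ge> 1" and M: "M \<ge> 1" and A: "A \<ge> 0" "\<And>m. M \<le> real m \<Longrightarrow> real m \<le> 4 * M \<Longrightarrow> \<bar>a m\<bar> \<le> A"
    and L: "L \<ge> 0" and c: "\<And>n. N < real n \<Longrightarrow> real n \<le> 2 * N \<Longrightarrow> 0 \<le> c n \<and> c n \<le> L" "\<And>n. N < real n \<Longrightarrow> real (Suc n) \<le> 2 * N \<Longrightarrow> c n \<le> c (Suc n)"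
    and J: "\<And>h. is_interval (J h)" and W: "\<And>\<theta>. smooth_sum \<gamma> \<alpha> \<theta> H M N \<le> W"
  shows "(\<Sum>h::nat | H < real h \<and> real h \<le> 2 * H. norm (\<Sum>m::nat | M \<le> real m \<and> real m \<le> 4 * M. \<Sum>n::nat | N < real n \<and> real n \<le> 2 * N \<and> real (m * n) \<in> J h.
      of_real (a m * c n) * expi (\<alpha> * real (m * n) + real h * real (m * n) powr \<gamma>))) \<le> 2 * A * L * (2 + ln (2 * N)) * W"
proof -
  obtain p q where pq: "{n. N < real n \<and> real n \<le> 2 * N} = {p..q}" "p \<le> q" "N < real p" "real q \<le> 2 * N" "real q - real p \<le> N" "p \<ge> 1"
    by (rule nat_block_eq[OF N])
  define R where "R = q + 1 - p"
  have R: "R \<ge> 1" "real R \<le> 2 * N" using pq N unfolding R_def by (auto simp: of_nat_diff)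
  let ?Hs = "{h::nat. H < real h \<and> real h \<le> 2 * H}" and ?Ms = "{m::nat. M \<le> real m \<and> real m \<le> 4 * M}"
  define z where "z h m n = expi (\<alpha> * real (m * n) + real h * real (m * n) powr \<gamma>)" for h m n :: nat
  define E where "E h m = (\<Sum>r<R. completion_weight R r * norm (\<Sum>n\<in>{p..q}. z h m n * expi (real r / real R * real n)))" for h m
  have E0: "0 \<le> E h m" for h m unfolding E_def by (intro sum_nonneg mult_nonneg_nonneg completion_weight_nonneg) auto
  have W0: "W \<ge> 0" using W[of 0] unfolding smooth_sum_def by (rule order.trans[rotated]) (intro sum_nonneg norm_ge_zero)
  have one: "norm (\<Sum>n::nat | N < real n \<and> real n \<le> 2 * N \<and> real (m * n) \<in> J h. of_real (a m * c n) * z h m n) \<le> A * (2 * L * E h m)"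
    if m: "m \<in> ?Ms" for h m
  proof -
    define K where "K = {n. N < real n \<and> real n \<le> 2 * N \<and> real (m * n) \<in> J h}"
    have Kpq: "K \<subseteq> {p..q}" using pq(1) by (auto simp: K_def)
    have "\<exists>u v. K = {u..<v}"
    proof (rule convex_nat_set_eq_interval)
      show "finite K" using Kpq finite_subset by blast
      fix x y w assume *: "x \<in> K" "w \<in> K" "x \<le> y" "y \<le> w"
      have "real (m * x) \<le> real (m * y)" "real (m * y) \<le> real (m * w)" using * by (simp_all only: of_nat_le_iff mult_le_mono2)
      hence "real (m * y) \<in> J h" using J[of h] * unfolding is_interval_1 K_def by blast
      moreover have "N < real y" "real y \<le> 2 * N" using * unfolding K_def by auto
      ultimately show "y \<in> K" by (simp add: K_def)
    qed
    then obtain u v where uv: "K = {u..<v}" by blast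
    have "norm (\<Sum>n\<in>K. of_real (c n) * z h m n) \<le> 2 * L * E h m"
    proof (cases "u < v")
      case False thus ?thesis using L E0 by (simp add: uv)
    next
      case True
      have "u \<in> K" "v - 1 \<in> K" using True uv by auto
      hence "u \<in> {p..q}" "v - 1 \<in> {p..q}" using Kpq by blast+
      hence up: "p \<le> u" "v \<le> q + 1" using True by auto
      have inK: "N < real n \<and> real n \<le> 2 * N" if "u \<le> n" "n < v" for n
      proof -
        have "n \<in> K" using that uv by simp
        thus ?thesis by (simp add: K_def)
      qed
      show ?thesis unfolding uv
      proof (rule norm_sum_monotone_weight_le[OF _ L])
        fix w assume "w \<le> v"
        thus "norm (\<Sum>n\<in>{u..<w}. z h m n) \<le> E h m" unfolding E_def
          using up pq by (intro completion_bound) (auto simp: R_def)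
      next
        fix n assume "u \<le> n" "n < v"
        thus "0 \<le> c n \<and> c n \<le> L" using inK c(1) by blast
      next
        fix n assume n: "u \<le> n" "Suc n < v"
        thus "c n \<le> c (Suc n)" using inK[of n] inK[of "Suc n"] by (intro c(2)) auto
      qed
    qed
    moreover have "(\<Sum>n\<in>K. of_real (a m * c n) * z h m n) = of_real (a m) * (\<Sum>n\<in>K. of_real (c n) * z h m n)"
      by (simp add: sum_distrib_left mult.assoc)
    ultimately show ?thesis unfolding K_def[symmetric] using A m
      by (simp only: norm_mult norm_of_real) (intro mult_mono, auto)
  qed
  have "(\<Sum>h\<in>?Hs. norm (\<Sum>m\<in>?Ms. \<Sum>n::nat | N < real n \<and> real n \<le> 2 * N \<and> real (m * n) \<in> J h. of_real (a m * c n) * z h m n)) \<le> (\<Sum>h\<in>?Hs. \<Sum>m\<in>?Ms. A * (2 * L * E h m))"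
    by (intro sum_mono sum_norm_le one)
  also have "\<dots> = 2 * A * L * (\<Sum>h\<in>?Hs. \<Sum>m\<in>?Ms. E h m)" by (simp add: sum_distrib_left mult_ac)
  also have "(\<Sum>h\<in>?Hs. \<Sum>m\<in>?Ms. E h m) = (\<Sum>r<R. completion_weight R r * (\<Sum>h\<in>?Hs. \<Sum>m\<in>?Ms. norm (\<Sum>n\<in>{p..q}. z h m n * expi (real r / real R * real n))))"
  proof -
    have "(\<Sum>h\<in>?Hs. \<Sum>m\<in>?Ms. E h m) = (\<Sum>h\<in>?Hs. \<Sum>r<R. \<Sum>m\<in>?Ms. completion_weight R r * norm (\<Sum>n\<in>{p..q}. z h m n * expi (real r / real R * real n)))"
      unfolding E_def by (rule sum.cong[OF refl sum.swap])
    also have "\<dots> = (\<Sum>r<R. \<Sum>h\<in>?Hs. \<Sum>m\<in>?Ms. completion_weight R r * norm (\<Sum>n\<in>{p..q}. z h m n * expi (real r / real R * real n)))"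
      by (rule sum.swap)
    finally show ?thesis by (simp only: sum_distrib_left)
  qed
  also have "\<dots> \<le> (\<Sum>r<R. completion_weight R r * W)"
  proof (intro sum_mono mult_left_mono completion_weight_nonneg)
    fix r
    show "(\<Sum>h\<in>?Hs. \<Sum>m\<in>?Ms. norm (\<Sum>n\<in>{p..q}. z h m n * expi (real r / real R * real n))) \<le> W"
      using W[of "real r / real R"] unfolding smooth_sum_def pq(1) z_def expi_add .
  qed
  also have "\<dots> = (\<Sum>r<R. completion_weight R r) * W" by (simp add: sum_distrib_right)
  also have "\<dots> \<le> (2 + ln (real R)) * W" using sum_completion_weight_le[OF R(1)] W0 by (intro mult_right_mono) auto
  also have "\<dots> \<le> (2 + ln (2 * N)) * W" using R W0 N by (intro mult_right_mono add_left_mono) auto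
  also have "2 * A * L * ((2 + ln (2 * N)) * W) = 2 * A * L * (2 + ln (2 * N)) * W" by simp
  finally show ?thesis using A L unfolding z_def by (simp add: mult_left_mono)
qed

section \<open>The Dirichlet ring, Moebius inversion and Heath-Brown's identity\<close>

section \<open>Arithmetic functions under Dirichlet convolution\<close>

text \<open>A type of its own turns Dirichlet convolution into the product of a commutative ring, so
  that Heath-Brown's identity becomes ring algebra. The value at 0 is fixed because 0 has infinitely
  many factorisations; equality is then a statement about positive arguments.\<close>

typedef arith = "{f :: nat \<Rightarrow> real. f 0 = 0}" morphisms arith_fun Abs_arith
  by (intro exI[of _ "\<lambda>_. 0"]) simp

definition arith_of :: "(nat \<Rightarrow> real) \<Rightarrow> arith" where
  "arith_of f = Abs_arith (\<lambda>n. if n = 0 then 0 else f n)"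

lemma arith_fun_0 [simp]: "arith_fun f 0 = 0"
  using arith_fun[of f] by simp

lemma arith_fun_arith_of: "arith_fun (arith_of f) n = (if n = 0 then 0 else f n)"
  by (simp add: arith_of_def Abs_arith_inverse)

lemma arith_eqI: "(\<And>n. n > 0 \<Longrightarrow> arith_fun f n = arith_fun g n) \<Longrightarrow> f = g"
  by (metis arith_fun_0 arith_fun_inject ext neq0_conv)

definition factor_pairs :: "nat \<Rightarrow> (nat \<times> nat) set" where
  "factor_pairs n = {(a, b). a * b = n}"

lemma finite_factor_pairs [simp]: "n > 0 \<Longrightarrow> finite (factor_pairs n)"
  by (rule finite_subset[of _ "{..n} \<times> {..n}"]) (auto simp: factor_pairs_def)

instantiation arith :: comm_ring_1
begin

definition "0 = arith_of (\<lambda>_. 0)"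
definition "1 = arith_of (\<lambda>n. if n = 1 then 1 else 0)"
definition "f + g = arith_of (\<lambda>n. arith_fun f n + arith_fun g n)"
definition "f - g = arith_of (\<lambda>n. arith_fun f n - arith_fun g n)"
definition "- f = arith_of (\<lambda>n. - arith_fun f n)"
definition "f * g = arith_of (\<lambda>n. \<Sum>(a, b)\<in>factor_pairs n. arith_fun f a * arith_fun g b)"

lemma arith_fun_add: "arith_fun (f + g) n = arith_fun f n + arith_fun g n"
  by (simp add: plus_arith_def arith_fun_arith_of)

lemma arith_fun_diff: "arith_fun (f - g) n = arith_fun f n - arith_fun g n"
  by (simp add: minus_arith_def arith_fun_arith_of)

lemma arith_fun_uminus: "arith_fun (- f) n = - arith_fun f n"
  by (simp add: uminus_arith_def arith_fun_arith_of)

lemma arith_fun_zero: "arith_fun 0 n = 0"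
  by (simp add: zero_arith_def arith_fun_arith_of)

lemma arith_fun_one: "arith_fun 1 n = (if n = 1 then 1 else 0)"
  by (simp add: one_arith_def arith_fun_arith_of)

lemma arith_fun_mult: "n > 0 \<Longrightarrow> arith_fun (f * g) n = (\<Sum>(a, b)\<in>factor_pairs n. arith_fun f a * arith_fun g b)"
  by (simp add: times_arith_def arith_fun_arith_of)

instance
proof
  fix f g h :: arith
  show "f * g * h = f * (g * h)"
  proof (rule arith_eqI)
    fix n :: nat assume n: "n > 0"
    have pos: "a > 0" "b > 0" if "(a, b) \<in> factor_pairs n" for a b
      using that n by (auto simp: factor_pairs_def intro!: gr0I)
    have "arith_fun (f * g * h) n = (\<Sum>(x, c)\<in>factor_pairs n. \<Sum>(a, b)\<in>factor_pairs x. arith_fun f a * arith_fun g b * arith_fun h c)"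
      unfolding arith_fun_mult[OF n]
      by (intro sum.cong refl) (auto simp: arith_fun_mult pos sum_distrib_right case_prod_beta)
    also have "\<dots> = (\<Sum>((x, c), (a, b))\<in>(SIGMA p:factor_pairs n. factor_pairs (fst p)). arith_fun f a * arith_fun g b * arith_fun h c)"
      using n pos by (subst sum.Sigma[symmetric]) (auto simp: case_prod_beta)
    also have "\<dots> = (\<Sum>((a, y), (b, c))\<in>(SIGMA p:factor_pairs n. factor_pairs (snd p)). arith_fun f a * (arith_fun g b * arith_fun h c))"
      by (rule sum.reindex_bij_witness[of _ "\<lambda>((a, y), (b, c)). ((a * b, c), (a, b))" "\<lambda>((x, c), (a, b)). ((a, b * c), (b, c))"])
         (auto simp: factor_pairs_def)
    also have "\<dots> = (\<Sum>(a, y)\<in>factor_pairs n. \<Sum>(b, c)\<in>factor_pairs y. arith_fun f a * (arith_fun g b * arith_fun h c))"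
      using n pos by (subst sum.Sigma[symmetric]) (auto simp: case_prod_beta)
    also have "\<dots> = arith_fun (f * (g * h)) n"
      unfolding arith_fun_mult[OF n]
      by (intro sum.cong refl) (auto simp: arith_fun_mult pos sum_distrib_left case_prod_beta)
    finally show "arith_fun (f * g * h) n = arith_fun (f * (g * h)) n" .
  qed
  show "f * g = g * f"
  proof (rule arith_eqI)
    fix n :: nat assume n: "n > 0"
    show "arith_fun (f * g) n = arith_fun (g * f) n"
      unfolding arith_fun_mult[OF n]
      by (rule sum.reindex_bij_witness[of _ "\<lambda>(a, b). (b, a)" "\<lambda>(a, b). (b, a)"]) (auto simp: factor_pairs_def mult.commute)
  qed
  show "1 * f = f"
  proof (rule arith_eqI)
    fix n :: nat assume n: "n > 0"
    have "arith_fun (1 * f) n = (\<Sum>(a, b)\<in>{(1, n)}. arith_fun 1 a * arith_fun f b)"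
      unfolding arith_fun_mult[OF n]
    proof (rule sum.mono_neutral_right)
      show "finite (factor_pairs n)" using n by simp
      show "{(1, n)} \<subseteq> factor_pairs n" by (simp add: factor_pairs_def)
      show "\<forall>p\<in>factor_pairs n - {(1, n)}. (case p of (a, b) \<Rightarrow> arith_fun 1 a * arith_fun f b) = 0"
        by (auto simp: factor_pairs_def arith_fun_one split: if_splits)
    qed
    thus "arith_fun (1 * f) n = arith_fun f n" by (simp add: arith_fun_one)
  qed
  show "(f + g) * h = f * h + g * h"
    by (rule arith_eqI) (simp add: arith_fun_mult arith_fun_add case_prod_beta distrib_right sum.distrib)
  show "(0 :: arith) \<noteq> 1"
    by (metis arith_fun_one arith_fun_zero zero_neq_one)
qed (rule arith_eqI; simp add: arith_fun_add arith_fun_diff arith_fun_uminus arith_fun_zero)+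

end

definition arith_cut :: "(nat \<Rightarrow> bool) \<Rightarrow> arith \<Rightarrow> arith" where
  "arith_cut P f = arith_of (\<lambda>n. if P n then arith_fun f n else 0)"

lemma arith_fun_cut: "arith_fun (arith_cut P f) n = (if P n then arith_fun f n else 0)"
  by (simp add: arith_cut_def arith_fun_arith_of)

lemma arith_cut_split: "f = arith_cut P f + arith_cut (\<lambda>n. \<not> P n) f"
  by (rule arith_eqI) (simp add: arith_fun_add arith_fun_cut)

lemma arith_fun_mult_nonzero:
  assumes "arith_fun (f * g) n \<noteq> 0"
  obtains a b where "n = a * b" "arith_fun f a \<noteq> 0" "arith_fun g b \<noteq> 0" "a > 0" "b > 0"
proof -
  have n: "n > 0" using assms by (cases n) auto
  have "\<exists>p\<in>factor_pairs n. arith_fun f (fst p) * arith_fun g (snd p) \<noteq> 0"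
    using assms unfolding arith_fun_mult[OF n] case_prod_beta by (meson sum.neutral)
  then obtain a b where "(a, b) \<in> factor_pairs n" "arith_fun f a * arith_fun g b \<noteq> 0" by auto
  thus ?thesis using that[of a b] n by (auto simp: factor_pairs_def intro!: gr0I)
qed

definition moebius_fun :: "nat \<Rightarrow> real" where
  "moebius_fun n = (if squarefree n then (-1) ^ card (prime_factors n) else 0)"

lemma abs_moebius_fun_le: "\<bar>moebius_fun n\<bar> \<le> 1"
  by (simp add: moebius_fun_def)

lemma moebius_fun_mult_prime:
  assumes p: "prime p" "\<not> p dvd e" and e: "e > 0"
  shows "moebius_fun (p * e) = - moebius_fun e"
proof -
  have cop: "coprime p e" using p by (simp add: prime_imp_coprime)
  have sq: "squarefree (p * e) \<longleftrightarrow> squarefree e"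
    using squarefree_mult_coprime[OF cop] squarefree_multD[of p e] squarefree_prime[of p] p(1) by blast
  have "prime_factors (p * e) = insert p (prime_factors e)"
    using p(1) e by (simp add: prime_factors_product prime_prime_factors prime_gt_0_nat)
  moreover have "p \<notin> prime_factors e" using p(2) by (auto simp: in_prime_factors_iff)
  ultimately have "card (prime_factors (p * e)) = Suc (card (prime_factors e))" by simp
  thus ?thesis using sq by (simp add: moebius_fun_def)
qed

text \<open>With a prime \<open>p\<close> dividing \<open>n\<close>, the divisors prime to
  \<open>p\<close> cancel against their multiples by \<open>p\<close>; divisors that contain
  \<open>p\<close> more than once are not squarefree.\<close>

lemma sum_moebius_fun:
  assumes n: "n > 0"
  shows "(\<Sum>d | d dvd n. moebius_fun d) = (if n = 1 then 1 else 0)"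
proof (cases "n = 1")
  case True
  thus ?thesis by (simp add: moebius_fun_def)
next
  case False
  then obtain p where p: "prime p" "p dvd n" using prime_factor_nat by blast
  have fin: "finite {d. d dvd n}" using n by simp
  let ?A = "{d. d dvd n \<and> \<not> p dvd d}" and ?B = "{d. d dvd n \<and> p dvd d}"
  have "(\<Sum>d | d dvd n. moebius_fun d) = (\<Sum>d\<in>?A. moebius_fun d) + (\<Sum>d\<in>?B. moebius_fun d)"
    using fin by (subst sum.union_disjoint[symmetric]) (auto intro!: sum.cong intro: finite_subset[OF _ fin])
  also have "(\<Sum>d\<in>?B. moebius_fun d) = (\<Sum>d\<in>(\<lambda>e. p * e) ` ?A. moebius_fun d)"
  proof (rule sum.mono_neutral_right)
    show "finite ?B" using fin by simp
    show "(\<lambda>e. p * e) ` ?A \<subseteq> ?B"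
    proof
      fix d assume "d \<in> (\<lambda>e. p * e) ` ?A"
      then obtain e where e: "d = p * e" "e dvd n" "\<not> p dvd e" by auto
      have "p * e dvd n" using p e by (intro divides_mult) (auto simp: prime_imp_coprime)
      thus "d \<in> ?B" using e by simp
    qed
    show "\<forall>d\<in>?B - (\<lambda>e. p * e) ` ?A. moebius_fun d = 0"
    proof
      fix d assume d: "d \<in> ?B - (\<lambda>e. p * e) ` ?A"
      then obtain e where e: "d = p * e" by auto
      have "e dvd n" using d e by (auto dest: dvd_mult_right)
      hence "p dvd e" using d e by auto
      hence "p\<^sup>2 dvd d" using e by (simp add: power2_eq_square mult_dvd_mono)
      hence "\<not> squarefree d" using p(1) by (auto simp: squarefree_def)
      thus "moebius_fun d = 0" by (simp add: moebius_fun_def)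
    qed
  qed
  also have "\<dots> = (\<Sum>e\<in>?A. moebius_fun (p * e))"
    using p(1) by (subst sum.reindex) (auto simp: inj_on_def)
  also have "\<dots> = (\<Sum>e\<in>?A. - moebius_fun e)"
    using n by (intro sum.cong refl moebius_fun_mult_prime p) (auto intro!: gr0I)
  finally show ?thesis using False by (simp add: sum_negf)
qed

definition arith_zeta :: arith where "arith_zeta = arith_of (\<lambda>_. 1)"
definition arith_ln :: arith where "arith_ln = arith_of (\<lambda>n. ln (real n))"
definition arith_mangoldt :: arith where "arith_mangoldt = arith_of mangoldt"
definition arith_moebius :: "real \<Rightarrow> arith" where
  "arith_moebius U = arith_of (\<lambda>n. if real n \<le> U then moebius_fun n else 0)"

lemma arith_fun_mult_zeta:
  assumes "n > 0"
  shows "arith_fun (f * arith_zeta) n = (\<Sum>d | d dvd n. arith_fun f d)"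
  unfolding arith_fun_mult[OF assms]
  by (rule sum.reindex_bij_witness[of _ "\<lambda>d. (d, n div d)" fst])
     (use assms in \<open>auto simp: factor_pairs_def arith_zeta_def arith_fun_arith_of\<close>)

lemma mangoldt_mult_zeta: "arith_mangoldt * arith_zeta = arith_ln"
proof (rule arith_eqI)
  fix n :: nat assume n: "n > 0"
  have "(\<Sum>d | d dvd n. arith_fun arith_mangoldt d) = (\<Sum>d | d dvd n. mangoldt d)"
    using n by (intro sum.cong refl) (auto simp: arith_mangoldt_def arith_fun_arith_of)
  thus "arith_fun (arith_mangoldt * arith_zeta) n = arith_fun arith_ln n"
    using n mangoldt_sum[of n, where ?'a = real] by (simp add: arith_fun_mult_zeta arith_ln_def arith_fun_arith_of)
qed

text \<open>\<open>D = 1 - a * arith_zeta\<close> vanishes up to \<open>U\<close>, where the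
  truncation of the Moebius function is not felt. Hence
  \<open>D * (D * (D * arith_mangoldt))\<close> vanishes up to \<open>U ^ 3\<close>, and expanding
  it with \<open>arith_mangoldt * arith_zeta = arith_ln\<close> leaves \<open>arith_mangoldt\<close>
  in a single term.\<close>

theorem heath_brown_identity:
  assumes U: "U \<ge> 0" and n: "real n \<le> U ^ 3"
  defines "a \<equiv> arith_moebius U"
  shows "arith_fun arith_mangoldt n = arith_fun (3 * (a * arith_ln) - 3 * (a * (a * (arith_zeta * arith_ln)))
    + a * (a * (a * (arith_zeta * (arith_zeta * arith_ln))))) n"
proof -
  define D where "D = 1 - a * arith_zeta"
  have D0: "real m > U" if "arith_fun D m \<noteq> 0" for m
  proof (rule ccontr)
    assume m: "\<not> real m > U"
    have m0: "m > 0" using that by (cases m) auto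
    have "arith_fun (a * arith_zeta) m = (\<Sum>d | d dvd m. moebius_fun d)"
      unfolding arith_fun_mult_zeta[OF m0]
    proof (intro sum.cong refl)
      fix d assume "d \<in> {d. d dvd m}"
      hence "d \<le> m" "d > 0" using m0 by (auto dest: dvd_imp_le intro!: gr0I)
      thus "arith_fun a d = moebius_fun d" using m unfolding a_def by (simp add: arith_moebius_def arith_fun_arith_of)
    qed
    hence "arith_fun D m = 0" using sum_moebius_fun[OF m0] by (simp add: D_def arith_fun_diff arith_fun_one)
    thus False using that by simp
  qed
  have "arith_fun (D * (D * (D * arith_mangoldt))) n = 0"
  proof (rule ccontr)
    assume "arith_fun (D * (D * (D * arith_mangoldt))) n \<noteq> 0"
    then obtain a1 b1 where 1: "n = a1 * b1" "arith_fun D a1 \<noteq> 0" "arith_fun (D * (D * arith_mangoldt)) b1 \<noteq> 0" by (rule arith_fun_mult_nonzero)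
    from 1(3) obtain a2 b2 where 2: "b1 = a2 * b2" "arith_fun D a2 \<noteq> 0" "arith_fun (D * arith_mangoldt) b2 \<noteq> 0" by (rule arith_fun_mult_nonzero)
    from 2(3) obtain a3 b3 where 3: "b2 = a3 * b3" "arith_fun D a3 \<noteq> 0" "b3 > 0" by (rule arith_fun_mult_nonzero)
    have "U * (U * U) < real a1 * (real a2 * real a3)"
      using D0[OF 1(2)] D0[OF 2(2)] D0[OF 3(2)] U by (intro mult_strict_mono mult_strict_mono mult_nonneg_nonneg mult_pos_pos) auto
    also have "\<dots> \<le> real a1 * (real a2 * (real a3 * real b3))"
    proof (intro mult_left_mono)
      have "real a3 * 1 \<le> real a3 * real b3" using 3(3) by (intro mult_left_mono) auto
      thus "real a3 \<le> real a3 * real b3" by simp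
    qed auto
    also have "\<dots> = real n" by (simp add: 1 2 3)
    finally show False using n by (simp add: power3_eq_cube)
  qed
  moreover have "D * (D * (D * arith_mangoldt)) = arith_mangoldt - (3 * (a * arith_ln) - 3 * (a * (a * (arith_zeta * arith_ln)))
    + a * (a * (a * (arith_zeta * (arith_zeta * arith_ln)))))"
    unfolding D_def mangoldt_mult_zeta[symmetric] by (simp add: algebra_simps)
  ultimately show ?thesis by (simp add: arith_fun_diff)
qed

section \<open>Combinatorial sorting of the factors by size\<close>

section \<open>Decomposition of the von Mangoldt function\<close>

text \<open>An abstract subadditive \<open>T\<close> keeps the combinatorics apart from the
  exponential sums. A smooth factor above \<open>U\<close> and at least \<open>Y\<close> is type I,
  a factor in \<open>[z, U]\<close> is type II. What escapes are factors below \<open>z\<close> and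
  smooth factors between \<open>U\<close> and \<open>Y\<close>. Small ones are multiplied together
  until the product reaches \<open>z\<close>; it is then at most \<open>z\<^sup>2 \<le> U\<close>,
  hence again type II.\<close>

theorem mangoldt_decomposition:
  fixes T :: "arith \<Rightarrow> real" and x z U Y B R :: real
  assumes T_add: "\<And>f g. T (f + g) \<le> T f + T g" and T_uminus: "\<And>f. T (- f) = T f"
    and T_zero: "\<And>f. (\<And>n. x < real n \<Longrightarrow> real n \<le> 2 * x \<Longrightarrow> arith_fun f n = 0) \<Longrightarrow> T f \<le> 0"
    and params: "1 < z" "z\<^sup>2 \<le> U" "1 \<le> Y" "z * Y\<^sup>2 \<le> x" "2 * x \<le> U ^ 3" "1 \<le> B" "0 \<le> R"
    and tau: "\<And>n. 0 < n \<Longrightarrow> real n \<le> 2 * x \<Longrightarrow> real (card (factor_pairs n)) \<le> B"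
    and lnB: "ln (2 * x) \<le> B"
    and type2: "\<And>f g. (\<And>n. real n \<le> 2 * x \<Longrightarrow> \<bar>arith_fun f n\<bar> \<le> B ^ 20) \<Longrightarrow> (\<And>n. real n \<le> 2 * x \<Longrightarrow> \<bar>arith_fun g n\<bar> \<le> B ^ 20) \<Longrightarrow>
       (\<And>n. arith_fun g n \<noteq> 0 \<Longrightarrow> z \<le> real n \<and> real n \<le> U) \<Longrightarrow> T (f * g) \<le> R"
    and type1: "\<And>f g. (\<And>n. real n \<le> 2 * x \<Longrightarrow> \<bar>arith_fun f n\<bar> \<le> B ^ 20) \<Longrightarrow> g \<in> {arith_zeta, arith_ln} \<Longrightarrow>
       T (f * arith_cut (\<lambda>n. U < real n \<and> Y \<le> real n) g) \<le> R"
  shows "T arith_mangoldt \<le> 351 * R"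
proof -
  define a where "a = arith_moebius U"
  define bd where "bd e f \<longleftrightarrow> (\<forall>n. real n \<le> 2 * x \<longrightarrow> \<bar>arith_fun f n\<bar> \<le> B ^ e)" for e f
  have bd_mono: "bd e' f" if "bd e f" "e \<le> e'" for e e' f
    using that params(6) unfolding bd_def by (meson order.trans power_increasing)
  have bd_cut: "bd e (arith_cut P f)" if "bd e f" for e P f
    using that params(6) unfolding bd_def by (auto simp: arith_fun_cut)
  have bd_mult: "bd (e + e' + 1) (f * g)" if fg: "bd e f" "bd e' g" for e e' f g
    unfolding bd_def
  proof (intro allI impI)
    fix n :: nat assume n: "real n \<le> 2 * x"
    show "\<bar>arith_fun (f * g) n\<bar> \<le> B ^ (e + e' + 1)"
    proof (cases "n = 0")
      case True thus ?thesis using params(6) by simp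
    next
      case False
      hence n0: "n > 0" by simp
      have "\<bar>arith_fun (f * g) n\<bar> \<le> (\<Sum>p\<in>factor_pairs n. \<bar>arith_fun f (fst p) * arith_fun g (snd p)\<bar>)"
        unfolding arith_fun_mult[OF n0] case_prod_beta by (rule sum_abs)
      also have "\<dots> \<le> (\<Sum>p\<in>factor_pairs n. B ^ e * B ^ e')"
      proof (rule sum_mono)
        fix p assume "p \<in> factor_pairs n"
        then obtain u v where p: "p = (u, v)" "u * v = n" by (auto simp: factor_pairs_def)
        have "u \<le> n" "v \<le> n" using p n0 by (auto intro!: Nat.gr0I)
        hence "real u \<le> 2 * x" "real v \<le> 2 * x" using n by linarith+
        thus "\<bar>arith_fun f (fst p) * arith_fun g (snd p)\<bar> \<le> B ^ e * B ^ e'"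
          using fg params(6) unfolding p abs_mult bd_def by (intro mult_mono) auto
      qed
      also have "\<dots> = real (card (factor_pairs n)) * (B ^ e * B ^ e')" by simp
      also have "\<dots> \<le> B * (B ^ e * B ^ e')" using tau[OF n0 n] params(6) by (intro mult_right_mono) auto
      also have "\<dots> = B ^ (e + e' + 1)" by (simp add: power_add)
      finally show ?thesis .
    qed
  qed
  have bd_a: "bd 1 a" unfolding bd_def a_def using abs_moebius_fun_le params(6)
    by (auto simp: arith_moebius_def arith_fun_arith_of intro: order.trans)
  have bd_zeta: "bd 1 arith_zeta" unfolding bd_def using params(6) by (simp add: arith_zeta_def arith_fun_arith_of)
  have bd_ln: "bd 1 arith_ln" unfolding bd_def
  proof (intro allI impI)
    fix n :: nat assume n: "real n \<le> 2 * x"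
    show "\<bar>arith_fun arith_ln n\<bar> \<le> B ^ 1"
    proof (cases "n = 0")
      case False
      hence "ln (real n) \<le> ln (2 * x)" "0 \<le> ln (real n)" using n by (auto intro!: ln_mono)
      thus ?thesis using False lnB by (simp add: arith_ln_def arith_fun_arith_of)
    qed (use params(6) in simp)
  qed
  have bd_prod: "bd (2 * length fs) (prod_list fs)" if "set fs \<subseteq> {a, arith_zeta, arith_ln}" for fs
    using that
  proof (induction fs)
    case Nil
    thus ?case using params(6) by (simp add: bd_def arith_fun_one)
  next
    case (Cons f fs)
    hence "bd 1 f" using bd_a bd_zeta bd_ln by auto
    from bd_mult[OF this Cons.IH] Cons.prems show ?case by simp
  qed
  have U1: "1 < U"
  proof -
    have "1 < z\<^sup>2" using params(1) by simp
    thus ?thesis using params(2) by simp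
  qed
  have T2: "T (f * g) \<le> R" if "bd 20 f" "bd 20 g" "\<And>n. arith_fun g n \<noteq> 0 \<Longrightarrow> z \<le> real n \<and> real n \<le> U" for f g
    using that unfolding bd_def by (intro type2) auto
  \<comment> \<open>\<open>s\<close> collects the small factors met so far and has support below
    \<open>z\<close>; \<open>v\<close> collects the \<open>j\<close> smooth factors between
    \<open>U\<close> and \<open>Y\<close>. At most three factors differ from \<open>a\<close>,
    whence \<open>j \<le> 3\<close>. The exponents \<open>es\<close> and \<open>ev\<close> count the
    powers of \<open>B\<close> that bound \<open>s\<close> and \<open>v\<close>.\<close>
  have main: "T (s * v * prod_list fs) \<le> 3 * (2 ^ length fs - 1) * R"
    if "set fs \<subseteq> {a, arith_zeta, arith_ln}" "length (filter (\<lambda>f. f \<noteq> a) fs) + j \<le> 3" "bd es s" "bd ev v" "es + ev + 2 * length fs \<le> 14"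
      "\<And>n. arith_fun s n \<noteq> 0 \<Longrightarrow> real n < z"
      "\<And>n. arith_fun v n \<noteq> 0 \<Longrightarrow> real n \<le> Y ^ j \<and> U ^ j \<le> real n \<and> (j > 0 \<longrightarrow> U ^ j < real n)"
    for fs s v j es ev
    using that
  proof (induction fs arbitrary: s v j es ev)
    case Nil
    have "T (s * v) \<le> 0"
    proof (rule T_zero, rule ccontr)
      fix n assume n: "x < real n" "real n \<le> 2 * x" and nz: "arith_fun (s * v) n \<noteq> 0"
      from nz obtain u w where uw: "n = u * w" "arith_fun s u \<noteq> 0" "arith_fun v w \<noteq> 0" "u > 0" "w > 0" by (rule arith_fun_mult_nonzero)
      have u: "real u < z" and w: "real w \<le> Y ^ j" "U ^ j \<le> real w" "j > 0 \<longrightarrow> U ^ j < real w" using Nil uw by auto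
      have "j \<le> 3" using Nil by simp
      \<comment> \<open>No such product falls into the range: three factors above \<open>U\<close>
        exceed \<open>U ^ 3 \<ge> 2 * x\<close>, and with at most two the product is at most
        \<open>z * Y\<^sup>2 \<le> x\<close>.\<close>
      show False
      proof (cases "j = 3")
        case True
        have "2 * x < real w" using w True params(5) by simp
        also have "\<dots> \<le> real u * real w" using uw by simp
        finally show False using n uw by simp
      next
        case False
        hence "Y ^ j \<le> Y\<^sup>2" using \<open>j \<le> 3\<close> params(3) by (intro power_increasing) auto
        hence "real u * real w \<le> z * Y\<^sup>2" using u w params(1) by (intro mult_mono) auto
        also have "\<dots> \<le> x" by (rule params)
        finally show False using n uw by simp
      qed
    qed
    thus ?case by simp
  next
    case (Cons f fs)
    define G where "G = s * v * prod_list fs"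
    define f0 f1 where "f0 = arith_cut (\<lambda>n. real n < z) f" and "f1 = arith_cut (\<lambda>n. z \<le> real n \<and> real n \<le> U) f"
    define c where "c = 3 * (2 ^ length fs - 1) * R"
    have c: "c \<ge> 0" using params(7) by (simp add: c_def)
    have bdf: "bd 1 f" using Cons.prems(1) bd_a bd_zeta bd_ln by auto
    have fs: "set fs \<subseteq> {a, arith_zeta, arith_ln}" using Cons.prems(1) by auto
    have len: "es + ev + 2 * length fs \<le> 12" using Cons.prems(5) by simp
    have cnt: "length (filter (\<lambda>f. f \<noteq> a) fs) + j \<le> 3" using Cons.prems(2) by (simp split: if_splits)
    have bdG: "bd 20 G"
    proof -
      have "bd (es + ev + 1 + 2 * length fs + 1) G" unfolding G_def by (intro bd_mult bd_prod fs Cons.prems)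
      thus ?thesis by (rule bd_mono) (use len in simp)
    qed
    \<comment> \<open>Multiplying a factor below \<open>z\<close> into \<open>s\<close> either keeps
      the product below \<open>z\<close>, and the induction continues, or puts it into
      \<open>[z, z\<^sup>2]\<close>, where it serves as the short type II variable.\<close>
    have small: "T (s * f0 * v * prod_list fs) \<le> R + c"
    proof -
      define s' where "s' = arith_cut (\<lambda>n. real n < z) (s * f0)"
      define s'' where "s'' = arith_cut (\<lambda>n. \<not> real n < z) (s * f0)"
      have bdsf: "bd (es + 1 + 1) (s * f0)" unfolding f0_def by (intro bd_mult bd_cut Cons.prems bdf)
      have "s * f0 = s' + s''" unfolding s'_def s''_def by (rule arith_cut_split)
      hence "T (s * f0 * v * prod_list fs) = T (v * prod_list fs * s'' + s' * v * prod_list fs)" by (simp add: algebra_simps)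
      also have "\<dots> \<le> T (v * prod_list fs * s'') + T (s' * v * prod_list fs)" by (rule T_add)
      also have "\<dots> \<le> R + c"
      proof (rule add_mono)
        show "T (v * prod_list fs * s'') \<le> R"
        proof (rule T2)
          have "bd (ev + 2 * length fs + 1) (v * prod_list fs)" by (intro bd_mult bd_prod fs Cons.prems)
          thus "bd 20 (v * prod_list fs)" by (rule bd_mono) (use len in simp)
          show "bd 20 s''" unfolding s''_def by (rule bd_mono[OF bd_cut[OF bdsf]]) (use len in simp)
          fix n assume n: "arith_fun s'' n \<noteq> 0"
          hence "arith_fun (s * f0) n \<noteq> 0" "z \<le> real n" by (auto simp: s''_def arith_fun_cut split: if_splits)
          then obtain u w where uw: "n = u * w" "arith_fun s u \<noteq> 0" "arith_fun f0 w \<noteq> 0" by (elim arith_fun_mult_nonzero)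
          have "real u < z" "real w < z" using uw Cons.prems(6) by (auto simp: f0_def arith_fun_cut split: if_splits)
          hence "real u * real w \<le> z * z" using params(1) by (intro mult_mono) auto
          thus "z \<le> real n \<and> real n \<le> U" using uw(1) \<open>z \<le> real n\<close> params(2) by (simp add: power2_eq_square)
        qed
        show "T (s' * v * prod_list fs) \<le> c" unfolding c_def
        proof (rule Cons.IH[OF fs cnt _ Cons.prems(4) _ _ Cons.prems(7)])
          show "bd (es + 1 + 1) s'" unfolding s'_def by (rule bd_cut[OF bdsf])
          show "es + 1 + 1 + ev + 2 * length fs \<le> 14" using len by simp
          show "real n < z" if "arith_fun s' n \<noteq> 0" for n using that by (auto simp: s'_def arith_fun_cut split: if_splits)
        qed
      qed
      finally show ?thesis .
    qed
    have mid1: "T (G * f1) \<le> R"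
      by (rule T2[OF bdG]) (auto simp: f1_def arith_fun_cut split: if_splits intro!: bd_mono[OF bd_cut[OF bdf]])
    show ?case
    proof (cases "f = a")
      case True
      \<comment> \<open>\<open>a\<close> has its support up to \<open>U\<close>, so the ranges above
        \<open>U\<close> do not occur.\<close>
      have "f = f0 + f1"
        by (rule arith_eqI) (auto simp: f0_def f1_def arith_fun_add arith_fun_cut True a_def arith_moebius_def arith_fun_arith_of)
      hence "T (s * v * prod_list (f # fs)) = T (s * f0 * v * prod_list fs + G * f1)" by (simp add: G_def algebra_simps)
      also have "\<dots> \<le> T (s * f0 * v * prod_list fs) + T (G * f1)" by (rule T_add)
      also have "\<dots> \<le> (R + c) + R" by (intro add_mono small mid1)
      also have "\<dots> \<le> 3 * (2 ^ length (f # fs) - 1) * R" using c params(7) unfolding c_def by (simp add: algebra_simps)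
      finally show ?thesis .
    next
      case False
      define f2 where "f2 = arith_cut (\<lambda>n. U < real n \<and> real n < Y) f"
      define f3 where "f3 = arith_cut (\<lambda>n. U < real n \<and> Y \<le> real n) f"
      have zU: "z \<le> U" using params(1,2) self_le_power[of z 2] by simp
      have fz: "f \<in> {arith_zeta, arith_ln}" using Cons.prems(1) False by auto
      have "f = f0 + f1 + f2 + f3"
        by (rule arith_eqI) (use zU in \<open>auto simp: f0_def f1_def f2_def f3_def arith_fun_add arith_fun_cut\<close>)
      hence "T (s * v * prod_list (f # fs)) = T (s * f0 * v * prod_list fs + (G * f1 + (s * (v * f2) * prod_list fs + G * f3)))" by (simp add: G_def algebra_simps)
      also have "\<dots> \<le> T (s * f0 * v * prod_list fs) + (T (G * f1) + (T (s * (v * f2) * prod_list fs) + T (G * f3)))"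
        by (intro order.trans[OF T_add] add_left_mono order.refl)
      also have "\<dots> \<le> (R + c) + (R + (c + R))"
      proof (intro add_mono small mid1)
        show "T (G * f3) \<le> R" unfolding f3_def using bdG fz by (intro type1) (auto simp: bd_def)
        show "T (s * (v * f2) * prod_list fs) \<le> c" unfolding c_def
        proof (rule Cons.IH[OF fs])
          show "length (filter (\<lambda>f. f \<noteq> a) fs) + Suc j \<le> 3" using Cons.prems(2) False by simp
          show "bd es s" by (rule Cons.prems)
          show "bd (ev + 1 + 1) (v * f2)" unfolding f2_def by (intro bd_mult bd_cut Cons.prems bdf)
          show "es + (ev + 1 + 1) + 2 * length fs \<le> 14" using len by simp
          show "real n < z" if "arith_fun s n \<noteq> 0" for n by (rule Cons.prems(6)[OF that])
          fix n assume "arith_fun (v * f2) n \<noteq> 0"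
          then obtain u w where uw: "n = u * w" "arith_fun v u \<noteq> 0" "arith_fun f2 w \<noteq> 0" by (rule arith_fun_mult_nonzero)
          have u: "real u \<le> Y ^ j" "U ^ j \<le> real u" using Cons.prems(7)[OF uw(2)] by auto
          have w: "U < real w" "real w \<le> Y" using uw(3) by (auto simp: f2_def arith_fun_cut split: if_splits)
          have U0: "0 < U ^ j" using U1 by simp
          have "real u * real w \<le> Y ^ j * Y" using u w params(3) by (intro mult_mono) auto
          moreover have "U ^ j * U < real u * real w" using u w U1 U0 by (intro mult_le_less_imp_less) auto
          ultimately show "real n \<le> Y ^ Suc j \<and> U ^ Suc j \<le> real n \<and> (Suc j > 0 \<longrightarrow> U ^ Suc j < real n)"
            by (simp add: uw(1) mult.commute)
        qed
      qed
      \<comment> \<open>Three direct terms and two recursive ones: \<open>3 * R + 2 * c\<close> is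
        the recursion solved by \<open>3 * (2 ^ length - 1) * R\<close>.\<close>
      also have "\<dots> = 3 * (2 ^ length (f # fs) - 1) * R" unfolding c_def by (simp add: algebra_simps)
      finally show ?thesis .
    qed
  qed
  have start: "T (prod_list fs) \<le> 3 * (2 ^ length fs - 1) * R"
    if fs: "set fs \<subseteq> {a, arith_zeta, arith_ln}" "length (filter (\<lambda>f. f \<noteq> a) fs) \<le> 3" "length fs \<le> 6" for fs
  proof -
    have b1: "bd 0 1" unfolding bd_def by (simp add: arith_fun_one)
    \<comment> \<open>Empty products at the start: the unit has support at 1, which is below
      \<open>z\<close> and equals both \<open>Y ^ 0\<close> and \<open>U ^ 0\<close>.\<close>
    have "T (1 * 1 * prod_list fs) \<le> 3 * (2 ^ length fs - 1) * R"
    proof (rule main[OF fs(1) _ b1 b1, where j = 0])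
      show "real n < z" if "arith_fun 1 n \<noteq> 0" for n using that params(1) by (auto simp: arith_fun_one split: if_splits)
    qed (use fs in \<open>auto simp: arith_fun_one split: if_splits\<close>)
    thus ?thesis by simp
  qed
  have P1: "T (a * arith_ln) \<le> 9 * R" using start[of "[a, arith_ln]"] by simp
  have P2: "T (a * (a * (arith_zeta * arith_ln))) \<le> 45 * R" using start[of "[a, a, arith_zeta, arith_ln]"] by simp
  have P3: "T (a * (a * (a * (arith_zeta * (arith_zeta * arith_ln))))) \<le> 189 * R" using start[of "[a, a, a, arith_zeta, arith_zeta, arith_ln]"] by simp
  have T3: "T (3 * f) \<le> 3 * T f" for f
  proof -
    have "3 * f = f + (f + f)" by (simp add: algebra_simps)
    hence "T (3 * f) \<le> T f + T (f + f)" using T_add[of f "f + f"] by simp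
    thus ?thesis using T_add[of f f] by linarith
  qed
  define E where "E = 3 * (a * arith_ln) - 3 * (a * (a * (arith_zeta * arith_ln))) + a * (a * (a * (arith_zeta * (arith_zeta * arith_ln))))"
  have "T (arith_mangoldt - E) \<le> 0"
  proof (rule T_zero)
    fix n assume "x < real n" "real n \<le> 2 * x"
    thus "arith_fun (arith_mangoldt - E) n = 0"
      using heath_brown_identity[of U n] U1 params(5) unfolding E_def a_def by (simp add: arith_fun_diff)
  qed
  moreover have "T arith_mangoldt \<le> T (arith_mangoldt - E) + T E" using T_add[of "arith_mangoldt - E" E] by simp
  \<comment> \<open>Terms of 2, 4 and 6 factors with multiplicities 3, 3 and 1:
    \<open>27 + 135 + 189 = 351\<close>.\<close>
  moreover have "T E \<le> (3 * (9 * R) + 3 * (45 * R)) + 189 * R"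
  proof -
    have "T E \<le> T (3 * (a * arith_ln) + - (3 * (a * (a * (arith_zeta * arith_ln))))) + T (a * (a * (a * (arith_zeta * (arith_zeta * arith_ln)))))"
      unfolding E_def using T_add by simp
    also have "\<dots> \<le> (T (3 * (a * arith_ln)) + T (- (3 * (a * (a * (arith_zeta * arith_ln)))))) + 189 * R"
      by (intro add_mono T_add P3)
    also have "\<dots> \<le> (3 * (9 * R) + 3 * (45 * R)) + 189 * R"
      unfolding T_uminus using P1 P2 T3[of "a * arith_ln"] T3[of "a * (a * (arith_zeta * arith_ln))"] by linarith
    finally show ?thesis .
  qed
  ultimately show ?thesis by simp
qed

section \<open>The divisor bound\<close>

lemma card_factor_pairs_le_divisors:
  assumes "n > 0"
  shows "card (factor_pairs n) \<le> card {d. d dvd n}"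
proof -
  have "factor_pairs n \<subseteq> (\<lambda>d. (d, n div d)) ` {d. d dvd n}"
    using assms by (auto simp: factor_pairs_def image_iff)
  hence "card (factor_pairs n) \<le> card ((\<lambda>d. (d, n div d)) ` {d. d dvd n})"
    using assms by (intro card_mono) auto
  also have "\<dots> \<le> card {d. d dvd n}" using assms by (intro card_image_le) auto
  finally show ?thesis .
qed

lemma card_divisors_prime_power_mult_le:
  fixes p :: nat
  assumes p: "prime p" and m: "m > 0"
  shows "card {d. d dvd p ^ a * m} \<le> (a + 1) * card {d. d dvd m}"
proof -
  have "{d. d dvd p ^ a * m} \<subseteq> (\<lambda>(i, e). p ^ i * e) ` ({0..a} \<times> {d. d dvd m})"
  proof
    fix d assume "d \<in> {d. d dvd p ^ a * m}"
    then obtain u v where uv: "d = u * v" "u dvd p ^ a" "v dvd m" using division_decomp[of d "p ^ a" m] by auto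
    then obtain i where "i \<le> a" "u = p ^ i" using p by (auto simp: divides_primepow_nat)
    thus "d \<in> (\<lambda>(i, e). p ^ i * e) ` ({0..a} \<times> {d. d dvd m})" using uv by (intro image_eqI[of _ _ "(i, v)"]) auto
  qed
  hence "card {d. d dvd p ^ a * m} \<le> card ((\<lambda>(i, e). p ^ i * e) ` ({0..a} \<times> {d. d dvd m}))"
    using m by (intro card_mono) auto
  also have "\<dots> \<le> card ({0..a} \<times> {d. d dvd m})" using m by (intro card_image_le) auto
  finally show ?thesis by (simp add: card_cartesian_product)
qed

text \<open>The divisor count splits over prime powers, and for
  \<open>p \<ge> 2 powr (1 / \<eta>)\<close> the local factor \<open>a + 1\<close> is at most
  \<open>p powr (\<eta> * a)\<close>. Each of the boundedly many smaller primes costs one constant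
  \<open>C1\<close>.\<close>

theorem divisor_bound:
  assumes \<eta>: "\<eta> > 0"
  obtains C where "C > 0" "\<And>n. n > 0 \<Longrightarrow> real (card (factor_pairs n)) \<le> C * real n powr \<eta>"
proof -
  \<comment> \<open>Chosen so that \<open>c * (a + 1) \<le> 1 + \<eta> * ln 2 * a \<le> 2 powr
    (\<eta> * a)\<close>.\<close>
  define c where "c = min 1 (\<eta> * ln 2)"
  have c: "0 < c" "c \<le> 1" "c \<le> \<eta> * ln 2" using \<eta> by (auto simp: c_def)
  define C1 where "C1 = 1 / c"
  have C1: "C1 \<ge> 1" using c by (simp add: C1_def)
  define K where "K = nat \<lceil>2 powr (1 / \<eta>)\<rceil>"
  define S where "S n = {p. prime p \<and> p dvd n \<and> p < K}" for n :: nat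
  have finS: "finite (S n)" for n unfolding S_def by (rule finite_subset[of _ "{..<K}"]) auto
  have small: "real (a + 1) \<le> C1 * real p powr (\<eta> * real a)" if "prime p" for a p :: nat
  proof -
    have "c * (real a + 1) \<le> \<eta> * ln 2 * real a + 1" using c mult_right_mono[of c "\<eta> * ln 2" "real a"] by (simp add: algebra_simps)
    also have "\<dots> \<le> exp (\<eta> * ln 2 * real a)" using exp_ge_add_one_self[of "\<eta> * ln 2 * real a"] by linarith
    also have "\<dots> = 2 powr (\<eta> * real a)" by (simp add: powr_def mult_ac)
    also have "\<dots> \<le> real p powr (\<eta> * real a)" using prime_ge_2_nat[OF that] \<eta> by (intro powr_mono2) auto
    finally show ?thesis using c by (simp add: C1_def field_simps)
  qed
  have large: "real (a + 1) \<le> real p powr (\<eta> * real a)" if "p \<ge> K" "prime p" for a p :: nat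
  proof -
    have "2 powr (1 / \<eta>) \<le> real p" using that(1) unfolding K_def by linarith
    hence "(2 powr (1 / \<eta>)) powr (\<eta> * real a) \<le> real p powr (\<eta> * real a)" using \<eta> by (intro powr_mono2) auto
    moreover have "(2 powr (1 / \<eta>)) powr (\<eta> * real a) = 2 ^ a" using \<eta> by (simp add: powr_powr powr_realpow)
    moreover have "a + 1 \<le> 2 ^ a" by (induction a) auto
    hence "real (a + 1) \<le> 2 ^ a" by (metis of_nat_le_iff of_nat_numeral of_nat_power)
    ultimately show ?thesis by linarith
  qed
  have main: "n > 0 \<Longrightarrow> real (card {d. d dvd n}) \<le> C1 ^ card (S n) * real n powr \<eta>" for n
  proof (induction n rule: less_induct)
    case (less n)
    show ?case
    proof (cases "n = 1")
      case True
      have "S n = {}" using True by (auto simp: S_def)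
      thus ?thesis using True by simp
    next
      case False
      then obtain p where p: "prime p" "p dvd n" using prime_factor_nat by blast
      define a where "a = multiplicity p n"
      obtain m where m: "n = p ^ a * m" "\<not> p dvd m"
        using multiplicity_decompose'[of n p] less.prems prime_gt_1_nat[OF p(1)] unfolding a_def by (metis less_irrefl less_numeral_extra(3) not_prime_unit nat_dvd_1_iff_1 p(1))
      have m0: "m > 0" using m less.prems by (intro gr0I) auto
      have a: "a > 0" unfolding a_def using p less.prems by (simp add: prime_multiplicity_gt_zero_iff)
      have "1 < p ^ a" using prime_gt_1_nat[OF p(1)] a by (metis one_less_power)
      hence mn: "m < n" using m m0 by simp
      have pa: "real (p ^ a) powr \<eta> = real p powr (\<eta> * real a)"
        using prime_gt_0_nat[OF p(1)] by (simp add: powr_realpow[symmetric] powr_powr mult.commute)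
      have "real (card {d. d dvd n}) \<le> real ((a + 1) * card {d. d dvd m})"
        using card_divisors_prime_power_mult_le[OF p(1) m0, of a] m(1) by (simp only: of_nat_le_iff)
      also have "\<dots> = real (a + 1) * real (card {d. d dvd m})" by (rule of_nat_mult)
      also have "\<dots> \<le> real (a + 1) * (C1 ^ card (S m) * real m powr \<eta>)"
        by (intro mult_left_mono less.IH mn m0) auto
      also have "\<dots> \<le> C1 ^ card (S n) * real n powr \<eta>"
      proof (cases "p < K")
        case True
        have "S n = insert p (S m)"
        proof (intro set_eqI iffI)
          fix r assume r: "r \<in> S n"
          hence "r dvd p ^ a \<or> r dvd m" using m(1) by (auto simp: S_def prime_dvd_mult_iff)
          moreover have "r dvd p ^ a \<Longrightarrow> r = p" using r p(1) prime_dvd_power primes_dvd_imp_eq unfolding S_def by blast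
          ultimately show "r \<in> insert p (S m)" using r by (auto simp: S_def)
        next
          fix r assume "r \<in> insert p (S m)"
          thus "r \<in> S n" using p True m(1) by (auto simp: S_def)
        qed
        moreover have "p \<notin> S m" using m by (auto simp: S_def)
        ultimately have "card (S n) = Suc (card (S m))" using finS by simp
        moreover have "real (a + 1) * (C1 ^ card (S m) * real m powr \<eta>) \<le> (C1 * real p powr (\<eta> * real a)) * (C1 ^ card (S m) * real m powr \<eta>)"
          using small[OF p(1)] C1 by (intro mult_right_mono) auto
        moreover have "real n powr \<eta> = real p powr (\<eta> * real a) * real m powr \<eta>" unfolding m(1) of_nat_mult pa[symmetric] by (rule powr_mult)
        ultimately show ?thesis by (simp add: mult_ac)
      next
        case False
        have "S m \<subseteq> S n" using m by (auto simp: S_def)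
        hence "C1 ^ card (S m) \<le> C1 ^ card (S n)" using C1 finS by (intro power_increasing card_mono) auto
        hence "real (a + 1) * (C1 ^ card (S m) * real m powr \<eta>) \<le> real p powr (\<eta> * real a) * (C1 ^ card (S n) * real m powr \<eta>)"
          using large[of p a] p False C1 by (intro mult_mono) auto
        moreover have "real n powr \<eta> = real p powr (\<eta> * real a) * real m powr \<eta>" unfolding m(1) of_nat_mult pa[symmetric] by (rule powr_mult)
        ultimately show ?thesis by (simp add: mult_ac)
      qed
      finally show ?thesis .
    qed
  qed
  show ?thesis
  proof (rule that[of "C1 ^ K"])
    show "C1 ^ K > 0" using C1 by simp
    fix n :: nat assume n: "n > 0"
    have "card (S n) \<le> card {..<K}" by (intro card_mono) (auto simp: S_def)
    hence "C1 ^ card (S n) \<le> C1 ^ K" using C1 by (intro power_increasing) auto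
    hence "C1 ^ card (S n) * real n powr \<eta> \<le> C1 ^ K * real n powr \<eta>" by (intro mult_right_mono) auto
    thus "real (card (factor_pairs n)) \<le> C1 ^ K * real n powr \<eta>"
      using main[OF n] card_factor_pairs_le_divisors[OF n] by linarith
  qed
qed

section \<open>Reduction to dyadic blocks and removal of the shift u\<close>

section \<open>Twisted sums of arithmetic functions\<close>

text \<open>\<open>J\<close> depends on \<open>h\<close>: partial summation replaces the given
  interval by the one with the largest partial sum, and this varies with \<open>h\<close>.\<close>

definition twisted_sum :: "real \<Rightarrow> real \<Rightarrow> real \<Rightarrow> (nat \<Rightarrow> real set) \<Rightarrow> arith \<Rightarrow> real" where
  "twisted_sum \<gamma> \<alpha> H J F = (\<Sum>h::nat | H < real h \<and> real h \<le> 2 * H.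
     norm (\<Sum>n::nat | real n \<in> J h. of_real (arith_fun F n) * expi (\<alpha> * real n + real h * real n powr \<gamma>)))"

lemma finite_nat_real_in:
  assumes "S \<subseteq> {x<..2 * x}"
  shows "finite {n::nat. real n \<in> S}"
  by (rule finite_subset[of _ "{..nat \<lfloor>2 * x\<rfloor>}"]) (use assms in \<open>auto simp: le_nat_floor\<close>)

lemma twisted_sum_add_le: "twisted_sum \<gamma> \<alpha> H J (f + g) \<le> twisted_sum \<gamma> \<alpha> H J f + twisted_sum \<gamma> \<alpha> H J g"
  unfolding twisted_sum_def sum.distrib[symmetric]
  by (intro sum_mono) (simp add: arith_fun_add distrib_right sum.distrib norm_triangle_ineq)

lemma twisted_sum_uminus: "twisted_sum \<gamma> \<alpha> H J (- f) = twisted_sum \<gamma> \<alpha> H J f"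
  unfolding twisted_sum_def by (simp add: arith_fun_uminus sum_negf)

lemma twisted_sum_eq_0:
  assumes "\<And>h. J h \<subseteq> {x<..2 * x}" "\<And>n. x < real n \<Longrightarrow> real n \<le> 2 * x \<Longrightarrow> arith_fun f n = 0"
  shows "twisted_sum \<gamma> \<alpha> H J f = 0"
  unfolding twisted_sum_def
proof (intro sum.neutral ballI)
  fix h
  have "(\<Sum>n::nat | real n \<in> J h. of_real (arith_fun f n) * expi (\<alpha> * real n + real h * real n powr \<gamma>)) = 0"
    using assms by (intro sum.neutral) (force simp: subset_iff)
  thus "norm (\<Sum>n::nat | real n \<in> J h. of_real (arith_fun f n) * expi (\<alpha> * real n + real h * real n powr \<gamma>)) = 0" by simp
qed

text \<open>For \<open>n\<close> in \<open>(N, 2 N]\<close> and \<open>m * n\<close> in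
  \<open>(x, 2 x]\<close> the quotient \<open>m\<close> varies by a factor 4, which is the origin of
  the ranges \<open>M \<le> m \<le> 4 * M\<close> throughout.\<close>

lemma sum_mult_block_eq:
  fixes e :: "nat \<Rightarrow> complex"
  assumes J: "S \<subseteq> {x<..2 * x}" and x: "x \<ge> 0" and g: "\<And>n. arith_fun g n \<noteq> 0 \<Longrightarrow> N < real n \<and> real n \<le> 2 * N"
    and M: "\<And>m n::nat. N < real n \<Longrightarrow> real n \<le> 2 * N \<Longrightarrow> x < real (m * n) \<Longrightarrow> real (m * n) \<le> 2 * x \<Longrightarrow> M \<le> real m \<and> real m \<le> 4 * M"
  shows "(\<Sum>n::nat | real n \<in> S. of_real (arith_fun (f * g) n) * e n)
    = (\<Sum>m::nat | M \<le> real m \<and> real m \<le> 4 * M. \<Sum>n::nat | N < real n \<and> real n \<le> 2 * N \<and> real (m * n) \<in> S. of_real (arith_fun f m * arith_fun g n) * e (m * n))"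
proof -
  let ?S = "{n::nat. real n \<in> S}" and ?Ms = "{m::nat. M \<le> real m \<and> real m \<le> 4 * M}"
  have finS: "finite ?S" by (rule finite_nat_real_in[OF J])
  have finM: "finite ?Ms" by (rule finite_subset[of _ "{..nat \<lfloor>4 * M\<rfloor>}"]) (auto simp: le_nat_floor)
  have finN: "finite {n::nat. N < real n \<and> real n \<le> 2 * N \<and> P n}" for P
    by (rule finite_subset[of _ "{..nat \<lfloor>2 * N\<rfloor>}"]) (auto simp: le_nat_floor)
  have pos: "n > 0" if "n \<in> ?S" for n using that J x by (auto intro!: gr0I)
  have "(\<Sum>n\<in>?S. of_real (arith_fun (f * g) n) * e n) = (\<Sum>n\<in>?S. \<Sum>p\<in>{p\<in>factor_pairs n. N < real (snd p) \<and> real (snd p) \<le> 2 * N}. of_real (arith_fun f (fst p) * arith_fun g (snd p)) * e n)"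
  proof (intro sum.cong refl)
    fix n assume n: "n \<in> ?S"
    have "arith_fun (f * g) n = (\<Sum>p\<in>factor_pairs n. arith_fun f (fst p) * arith_fun g (snd p))"
      using pos[OF n] by (simp add: arith_fun_mult case_prod_beta)
    also have "\<dots> = (\<Sum>p\<in>{p\<in>factor_pairs n. N < real (snd p) \<and> real (snd p) \<le> 2 * N}. arith_fun f (fst p) * arith_fun g (snd p))"
      using pos[OF n] g by (intro sum.mono_neutral_right) auto
    finally show "of_real (arith_fun (f * g) n) * e n = (\<Sum>p\<in>{p\<in>factor_pairs n. N < real (snd p) \<and> real (snd p) \<le> 2 * N}. of_real (arith_fun f (fst p) * arith_fun g (snd p)) * e n)"
      by (simp only: of_real_sum sum_distrib_right)
  qed
  also have "\<dots> = (\<Sum>(n, p)\<in>(SIGMA n:?S. {p\<in>factor_pairs n. N < real (snd p) \<and> real (snd p) \<le> 2 * N}). of_real (arith_fun f (fst p) * arith_fun g (snd p)) * e n)"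
    by (rule sum.Sigma) (use finS pos in auto)
  also have "\<dots> = (\<Sum>(m, n)\<in>(SIGMA m:?Ms. {n::nat. N < real n \<and> real n \<le> 2 * N \<and> real (m * n) \<in> S}). of_real (arith_fun f m * arith_fun g n) * e (m * n))"
  proof (rule sum.reindex_bij_witness[of _ "\<lambda>(m, n). (m * n, (m, n))" snd])
    fix q assume q: "q \<in> (SIGMA n:?S. {p\<in>factor_pairs n. N < real (snd p) \<and> real (snd p) \<le> 2 * N})"
    obtain n u v where q': "q = (n, (u, v))" by (cases q) auto
    have uv: "u * v = n" "real n \<in> S" "N < real v" "real v \<le> 2 * N" using q by (auto simp: q' factor_pairs_def)
    have "x < real (u * v)" "real (u * v) \<le> 2 * x" using uv J by auto
    hence "M \<le> real u \<and> real u \<le> 4 * M" using M uv by blast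
    thus "snd q \<in> (SIGMA m:?Ms. {n::nat. N < real n \<and> real n \<le> 2 * N \<and> real (m * n) \<in> S})" using uv by (simp add: q' del: of_nat_mult)
    show "(case snd q of (m, n) \<Rightarrow> (m * n, (m, n))) = q" using uv by (simp add: q')
    show "(case snd q of (m, n) \<Rightarrow> of_real (arith_fun f m * arith_fun g n) * e (m * n)) = (case q of (n, p) \<Rightarrow> of_real (arith_fun f (fst p) * arith_fun g (snd p)) * e n)"
      using uv by (simp add: q')
  next
    fix q assume "q \<in> (SIGMA m:?Ms. {n::nat. N < real n \<and> real n \<le> 2 * N \<and> real (m * n) \<in> S})"
    thus "(case q of (m, n) \<Rightarrow> (m * n, m, n)) \<in> (SIGMA n:?S. {p\<in>factor_pairs n. N < real (snd p) \<and> real (snd p) \<le> 2 * N})"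
      by (auto simp: factor_pairs_def)
  qed auto
  also have "\<dots> = (\<Sum>m\<in>?Ms. \<Sum>n::nat | N < real n \<and> real n \<le> 2 * N \<and> real (m * n) \<in> S. of_real (arith_fun f m * arith_fun g n) * e (m * n))"
    by (rule sum.Sigma[symmetric]) (use finM finN in auto)
  finally show ?thesis .
qed

text \<open>The doublings stop when the lower end passes \<open>2 * x\<close>, since no positive
  multiple of such an \<open>n\<close> lies in the range; hence about \<open>log 2 x\<close> blocks,
  with a hypothesis only on blocks that start below \<open>2 * x\<close>.\<close>

lemma twisted_sum_dyadic:
  assumes J: "\<And>h. J h \<subseteq> {x<..2 * x}" and N0: "N0 \<ge> 1" and g: "\<And>n. arith_fun g n \<noteq> 0 \<Longrightarrow> N0 < real n"
    and x: "x \<ge> 1" and W0: "W \<ge> 0"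
    and W: "\<And>i::nat. 2 ^ i * N0 \<le> 2 * x \<Longrightarrow> twisted_sum \<gamma> \<alpha> H J (f * arith_cut (\<lambda>n. 2 ^ i * N0 < real n \<and> real n \<le> 2 * (2 ^ i * N0)) g) \<le> W"
  shows "twisted_sum \<gamma> \<alpha> H J (f * g) \<le> (2 + log 2 x) * W"
proof -
  let ?T = "twisted_sum \<gamma> \<alpha> H J"
  let ?g = "\<lambda>i. arith_cut (\<lambda>n. 2 ^ i * N0 < real n \<and> real n \<le> 2 * (2 ^ i * N0)) g"
  have vanish: "?T (f * arith_cut (\<lambda>n. c < real n \<and> P n) g) = 0" if c: "2 * x \<le> c" for c P
  proof (rule twisted_sum_eq_0[OF J], rule ccontr)
    fix n assume n: "real n \<le> 2 * x" and nz: "arith_fun (f * arith_cut (\<lambda>n. c < real n \<and> P n) g) n \<noteq> 0"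
    from nz obtain a b where ab: "n = a * b" "arith_fun (arith_cut (\<lambda>n. c < real n \<and> P n) g) b \<noteq> 0" "a > 0" by (rule arith_fun_mult_nonzero)
    have "c < real b" using ab by (auto simp: arith_fun_cut split: if_splits)
    moreover have "real b \<le> real n" using ab by (simp only: of_nat_le_iff) simp
    ultimately show False using n c by linarith
  qed
  have Wi: "?T (f * ?g i) \<le> W" for i
  proof (cases "2 ^ i * N0 \<le> 2 * x")
    case False
    thus ?thesis using vanish[of "2 ^ i * N0" "\<lambda>n. real n \<le> 2 * (2 ^ i * N0)"] W0 by simp
  qed (rule W)
  have split: "?T (f * g) \<le> (\<Sum>i<L. ?T (f * ?g i)) + ?T (f * arith_cut (\<lambda>n. 2 ^ L * N0 < real n) g)" for L
  proof (induction L)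
    case 0
    have "arith_cut (\<lambda>n. N0 < real n) g = g" using g by (intro arith_eqI) (auto simp: arith_fun_cut)
    thus ?case by simp
  next
    case (Suc L)
    have "2 ^ L * N0 \<le> 2 ^ Suc L * N0" using N0 by simp
    hence "arith_cut (\<lambda>n. 2 ^ L * N0 < real n) g = ?g L + arith_cut (\<lambda>n. 2 ^ Suc L * N0 < real n) g"
      by (intro arith_eqI) (auto simp: arith_fun_cut arith_fun_add)
    hence "?T (f * arith_cut (\<lambda>n. 2 ^ L * N0 < real n) g) = ?T (f * ?g L + f * arith_cut (\<lambda>n. 2 ^ Suc L * N0 < real n) g)"
      by (simp only: distrib_left)
    also have "\<dots> \<le> ?T (f * ?g L) + ?T (f * arith_cut (\<lambda>n. 2 ^ Suc L * N0 < real n) g)" by (rule twisted_sum_add_le)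
    finally show ?case using Suc by simp
  qed
  define L where "L = nat \<lceil>log 2 (2 * x)\<rceil>"
  have lx: "0 \<le> log 2 x" "log 2 (2 * x) = 1 + log 2 x" using x by (auto simp: log_mult)
  have L: "log 2 (2 * x) \<le> real L" "real L \<le> 2 + log 2 x" using lx unfolding L_def by linarith+
  have "2 * x = 2 powr (log 2 (2 * x))" using x by simp
  also have "\<dots> \<le> 2 powr real L" using L by (intro powr_mono) auto
  also have "\<dots> = 2 ^ L" by (simp add: powr_realpow)
  also have "\<dots> \<le> 2 ^ L * N0" using N0 by simp
  finally have "2 * x \<le> 2 ^ L * N0" .
  from vanish[OF this, of "\<lambda>_. True"] have "?T (f * g) \<le> (\<Sum>i<L. ?T (f * ?g i))" using split[of L] by simp
  also have "\<dots> \<le> (\<Sum>i<L. W)" by (intro sum_mono Wi)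
  also have "\<dots> = real L * W" by simp
  also have "\<dots> \<le> (2 + log 2 x) * W" using L W0 by (intro mult_right_mono) auto
  finally show ?thesis .
qed

text \<open>Partial summation: \<open>h (n + u)\<^sup>\<gamma> - h n\<^sup>\<gamma>\<close> is monotone in \<open>n\<close> and of size \<open>H x\<^sup>\<gamma>\<^sup>-\<^sup>1\<close>.\<close>
theorem shifted_mangoldt_sum_le:
  fixes \<gamma> \<alpha> H u x :: real and I J :: "real set"
  assumes \<gamma>: "0 < \<gamma>" "\<gamma> < 1" and x: "x \<ge> 1" and H: "H \<ge> 1" and u: "0 \<le> u" "u \<le> 1" and J: "is_interval J" "J \<subseteq> {x<..2 * x}" and I: "I \<subseteq> {H<..2 * H}"
    and T: "\<And>J. (\<And>h. is_interval (J h)) \<Longrightarrow> (\<And>h. J h \<subseteq> {x<..2 * x}) \<Longrightarrow> twisted_sum \<gamma> \<alpha> H J arith_mangoldt \<le> W"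
  shows "(\<Sum>h :: nat | real h \<in> I. norm (\<Sum>n :: nat | real n \<in> J. mangoldt n * expi (\<alpha> * real n + real h * (real n + u) powr \<gamma>)))
    \<le> (1 + 16 * H * x powr (\<gamma> - 1)) * W"
proof -
  define z where "z h n = complex_of_real (arith_fun arith_mangoldt n) * expi (\<alpha> * real n + real h * real n powr \<gamma>)" for h n :: nat
  define S where "S h = (\<Sum>n :: nat | real n \<in> J. mangoldt n * expi (\<alpha> * real n + real h * (real n + u) powr \<gamma>))" for h :: nat
  \<comment> \<open>\<open>V\<close> bounds the total variation of \<open>expi (h * d n)\<close>;
    the factor 16 is \<open>8 * 2\<close>, from \<open>2 * pi < 8\<close> and
    \<open>h \<le> 2 * H\<close>.\<close>
  define V where "V = 16 * H * x powr (\<gamma> - 1)"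
  have V: "V \<ge> 0" using H by (simp add: V_def)
  have ex: "\<exists>K. is_interval K \<and> K \<subseteq> {x<..2 * x} \<and> norm (S h) \<le> (1 + V) * norm (\<Sum>n::nat | real n \<in> K. z h n)" if h: "real h \<in> I" for h
  proof (cases "{n::nat. real n \<in> J} = {}")
    case True
    hence "S h = 0" unfolding S_def by simp
    thus ?thesis using V by (intro exI[of _ "{}"]) simp
  next
    case False
    have "\<exists>p q. {n::nat. real n \<in> J} = {p..<q}"
    proof (rule convex_nat_set_eq_interval[OF finite_nat_real_in[OF J(2)]])
      fix a b c assume "a \<in> {n::nat. real n \<in> J}" "c \<in> {n::nat. real n \<in> J}" "a \<le> b" "b \<le> c"
      thus "b \<in> {n::nat. real n \<in> J}" using J(1) unfolding is_interval_1 by (metis mem_Collect_eq of_nat_le_iff)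
    qed
    then obtain p q0 where pq0: "{n::nat. real n \<in> J} = {p..<q0}" by blast
    define q where "q = q0 - 1"
    have pq: "{n::nat. real n \<in> J} = {p..q}" "p \<le> q" using pq0 False by (auto simp: q_def)
    have inJ: "real n \<in> J" if "n \<in> {p..q}" for n using that pq by auto
    have pos: "real n > x" if "n \<in> {p..q}" for n using inJ[OF that] J by auto
    define d where "d n = (real n + u) powr \<gamma> - real n powr \<gamma>" for n :: nat
    define c where "c n = expi (real h * d n)" for n
    \<comment> \<open>One bound must serve all partial sums. The maximal one is taken, and
      \<open>{p..n0}\<close> becomes the new interval for this \<open>h\<close>.\<close>
    obtain n0 where n0: "n0 \<in> {p..q}" "\<And>n. n \<in> {p..q} \<Longrightarrow> norm (\<Sum>i\<in>{p..n}. z h i) \<le> norm (\<Sum>i\<in>{p..n0}. z h i)"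
    proof -
      have "finite ((\<lambda>n. norm (\<Sum>i\<in>{p..n}. z h i)) ` {p..q})" "(\<lambda>n. norm (\<Sum>i\<in>{p..n}. z h i)) ` {p..q} \<noteq> {}" using pq by auto
      from Max_in[OF this] obtain n0 where "n0 \<in> {p..q}" "Max ((\<lambda>n. norm (\<Sum>i\<in>{p..n}. z h i)) ` {p..q}) = norm (\<Sum>i\<in>{p..n0}. z h i)" by auto
      thus ?thesis using Max_ge[OF \<open>finite _\<close>] by (intro that[of n0]) auto
    qed
    have dmono: "d (Suc n) \<le> d n" if n: "n \<in> {p..q}" for n
    proof -
      have "((real n + 1) + u) powr \<gamma> - (real n + 1) powr \<gamma> \<le> (real n + u) powr \<gamma> - real n powr \<gamma>"
      proof (rule DERIV_nonpos_imp_nonincreasing[of "real n" "real n + 1" "\<lambda>t. (t + u) powr \<gamma> - t powr \<gamma>"])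
        fix t assume t: "real n \<le> t" "t \<le> real n + 1"
        hence t0: "t > 0" using pos[OF n] x by linarith
        have "((\<lambda>t. (t + u) powr \<gamma> - t powr \<gamma>) has_real_derivative \<gamma> * (t + u) powr (\<gamma> - 1) - \<gamma> * t powr (\<gamma> - 1)) (at t)"
          using t0 u by (auto intro!: derivative_eq_intros)
        moreover have "(t + u) powr (\<gamma> - 1) \<le> t powr (\<gamma> - 1)" using t0 u \<gamma> by (intro powr_mono2') auto
        hence "\<gamma> * (t + u) powr (\<gamma> - 1) - \<gamma> * t powr (\<gamma> - 1) \<le> 0" using \<gamma> by simp
        ultimately show "\<exists>y. ((\<lambda>t. (t + u) powr \<gamma> - t powr \<gamma>) has_real_derivative y) (at t) \<and> y \<le> 0" by blast
      qed simp
      thus ?thesis by (simp add: d_def add_ac)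
    qed
    have d0: "0 \<le> d n" for n unfolding d_def using u \<gamma> by (simp add: powr_mono2)
    have dp: "d p \<le> x powr (\<gamma> - 1)"
    proof (cases "u = 0")
      case True thus ?thesis by (simp add: d_def)
    next
      case False
      have px: "real p > x" using pos pq by simp
      have "\<exists>w. real p < w \<and> w < real p + u \<and> (real p + u) powr \<gamma> - real p powr \<gamma> = (real p + u - real p) * (\<gamma> * w powr (\<gamma> - 1))"
        using px x u False by (intro MVT2) (auto intro!: derivative_eq_intros)
      then obtain w where w: "real p < w" "d p = u * (\<gamma> * w powr (\<gamma> - 1))" by (auto simp: d_def)
      have "w powr (\<gamma> - 1) \<le> x powr (\<gamma> - 1)" using w px x \<gamma> by (intro powr_mono2') auto
      hence "u * (\<gamma> * w powr (\<gamma> - 1)) \<le> 1 * (1 * x powr (\<gamma> - 1))" using u \<gamma> by (intro mult_mono) auto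
      thus ?thesis using w by simp
    qed
    have "S h = (\<Sum>n\<in>{p..q}. c n * z h n)"
      unfolding S_def pq(1)
    proof (intro sum.cong refl)
      fix n assume n: "n \<in> {p..q}"
      have "n > 0" using pos[OF n] x by (intro gr0I) auto
      moreover have "expi (\<alpha> * real n + real h * (real n + u) powr \<gamma>) = c n * expi (\<alpha> * real n + real h * real n powr \<gamma>)"
        unfolding c_def d_def expi_add[symmetric] by (rule arg_cong[of _ _ expi]) (simp add: algebra_simps)
      ultimately show "mangoldt n * expi (\<alpha> * real n + real h * (real n + u) powr \<gamma>) = c n * z h n"
        by (simp add: z_def arith_mangoldt_def arith_fun_arith_of)
    qed
    also have "norm \<dots> \<le> norm (\<Sum>i\<in>{p..n0}. z h i) * (norm (c q) + (\<Sum>i\<in>{p..<q}. norm (c i - c (Suc i))))"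
      by (rule norm_sum_abel_le) (use n0 pq in auto)
    also have "\<dots> \<le> norm (\<Sum>i\<in>{p..n0}. z h i) * (1 + V)"
    proof (intro mult_left_mono add_mono)
      have "(\<Sum>i\<in>{p..<q}. norm (c i - c (Suc i))) \<le> (\<Sum>i\<in>{p..<q}. 8 * real h * (d i - d (Suc i)))"
      proof (rule sum_mono)
        fix i assume i: "i \<in> {p..<q}"
        have "norm (c i - c (Suc i)) \<le> 2 * pi * \<bar>real h * d i - real h * d (Suc i)\<bar>" unfolding c_def by (rule norm_expi_diff_le)
        also have "\<bar>real h * d i - real h * d (Suc i)\<bar> = real h * (d i - d (Suc i))" using dmono[of i] i
          by (simp add: right_diff_distrib[symmetric] abs_mult)
        also have "2 * pi * (real h * (d i - d (Suc i))) \<le> 8 * (real h * (d i - d (Suc i)))"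
          using pi_less_4 dmono[of i] i by (intro mult_right_mono) auto
        finally show "norm (c i - c (Suc i)) \<le> 8 * real h * (d i - d (Suc i))" by simp
      qed
      also have "\<dots> = 8 * real h * (d p - d q)"
      proof -
        have "(\<Sum>i\<in>{p..<q}. d (Suc i) - d i) = d q - d p" by (rule sum_Suc_diff'[OF pq(2)])
        hence "(\<Sum>i\<in>{p..<q}. d i - d (Suc i)) = d p - d q" by (simp add: sum_subtractf)
        thus ?thesis by (simp add: sum_distrib_left[symmetric])
      qed
      also have "\<dots> \<le> 8 * (2 * H) * x powr (\<gamma> - 1)"
      proof -
        have "d p - d q \<le> x powr (\<gamma> - 1)" using dp d0[of q] by linarith
        hence "8 * real h * (d p - d q) \<le> 8 * real h * x powr (\<gamma> - 1)" by (intro mult_left_mono) auto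
        also have "\<dots> \<le> 8 * (2 * H) * x powr (\<gamma> - 1)" using h I H by (intro mult_right_mono) auto
        finally show ?thesis .
      qed
      finally show "(\<Sum>i\<in>{p..<q}. norm (c i - c (Suc i))) \<le> V" by (simp add: V_def)
    qed (auto simp: c_def)
    finally have "norm (S h) \<le> (1 + V) * norm (\<Sum>i\<in>{p..n0}. z h i)" by (simp add: mult.commute)
    moreover have "{n::nat. real n \<in> {real p..real n0}} = {p..n0}" by auto
    moreover have "{real p..real n0} \<subseteq> {x<..2 * x}"
    proof -
      have "real p \<in> J" "real n0 \<in> J" using inJ n0 pq by auto
      thus ?thesis using J(2) by force
    qed
    ultimately show ?thesis by (intro exI[of _ "{real p..real n0}"]) (simp add: is_interval_cc)
  qed
  \<comment> \<open>Outside \<open>I\<close> the empty set keeps the family admissible, so that the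
    sum may be extended to the whole dyadic block.\<close>
  define Kh where "Kh h = (if real h \<in> I then SOME K. is_interval K \<and> K \<subseteq> {x<..2 * x} \<and> norm (S h) \<le> (1 + V) * norm (\<Sum>n::nat | real n \<in> K. z h n) else {})" for h
  have Kh: "is_interval (Kh h) \<and> Kh h \<subseteq> {x<..2 * x} \<and> norm (S h) \<le> (1 + V) * norm (\<Sum>n::nat | real n \<in> Kh h. z h n)" if "real h \<in> I" for h
    using someI_ex[OF ex[OF that]] that by (simp add: Kh_def)
  have Kh': "is_interval (Kh h)" "Kh h \<subseteq> {x<..2 * x}" for h
    by (cases "real h \<in> I"; use Kh in \<open>force simp: Kh_def is_interval_empty\<close>)+
  have finI: "finite {h::nat. H < real h \<and> real h \<le> 2 * H}"
    by (rule finite_subset[of _ "{..nat \<lfloor>2 * H\<rfloor>}"]) (auto simp: le_nat_floor)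
  have "(\<Sum>h :: nat | real h \<in> I. norm (S h)) \<le> (\<Sum>h :: nat | real h \<in> I. (1 + V) * norm (\<Sum>n::nat | real n \<in> Kh h. z h n))"
    using Kh by (intro sum_mono) auto
  also have "\<dots> \<le> (\<Sum>h :: nat | H < real h \<and> real h \<le> 2 * H. (1 + V) * norm (\<Sum>n::nat | real n \<in> Kh h. z h n))"
    using I V finI by (intro sum_mono2) auto
  also have "\<dots> = (1 + V) * twisted_sum \<gamma> \<alpha> H Kh arith_mangoldt"
    unfolding twisted_sum_def z_def by (simp only: sum_distrib_left)
  also have "\<dots> \<le> (1 + V) * W" using V Kh' by (intro mult_left_mono T) auto
  finally show ?thesis unfolding S_def V_def .
qed

section \<open>Comparison of exponents of x\<close>

section \<open>Optimisation of the parameters\<close>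

lemma sqrt_powr: "x > 0 \<Longrightarrow> sqrt (x powr a) = x powr (a / 2)"
  for x :: real
  by (simp add: powr_half_sqrt[symmetric] powr_powr)

lemma powr_squared: "(x powr a)\<^sup>2 = x powr (2 * a)"
  for x :: real
  by (cases "x = 0") (auto simp: powr_add[symmetric] power2_eq_square)

text \<open>Collects a product of powers of \<open>x\<close> into one power, after which an estimate
  is an inequality between exponents.\<close>

lemmas powr_collapse = powr_add[symmetric] powr_diff[symmetric] powr_powr powr_squared sqrt_powr

text \<open>The exponent of \<open>K\<close> makes the diagonal term
  \<open>M * K * (H * N * M)\<close> exactly \<open>x powr (2 - 12 * \<epsilon>)\<close> at the
  largest admissible \<open>M\<close>; every term is monotone in \<open>M\<close>, so that value may
  be inserted at once.\<close>

lemma type2_exponents: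
  fixes x \<gamma> \<epsilon> \<nu> \<theta> M :: real
  assumes x: "x \<ge> 1" and \<gamma>: "0 < \<gamma>" "\<gamma> < 1" and \<epsilon>: "\<epsilon> > 0" and \<theta>: "\<theta> \<le> 1 - \<gamma> + \<epsilon>" "0 \<le> \<theta>" and \<nu>: "\<nu> \<le> 1/3 + \<epsilon>"
    and M: "0 \<le> M" "M \<le> x powr (1 - \<nu>)" and small: "15 * (1 - \<gamma>) + 150 * \<epsilon> \<le> 2"
    and defs: "N = x powr \<nu>" "H = x powr \<theta>" "K = x powr (\<nu> - \<theta> - 12 * \<epsilon>)"
  shows "M * K * (H * N * M + (H * N + H\<^sup>2 * N\<^sup>2 / K) *
        (sqrt (H * N powr \<gamma> / K) * M powr (\<gamma>/2) + M powr (1 - \<gamma>/2) * N powr ((1 - \<gamma>) / 2))) \<le> 5 * x powr (2 - 12 * \<epsilon>)"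
proof -
  let ?m = "x powr (1 - \<nu>)"
  have x0: "x > 0" using x by simp
  have nn: "0 \<le> N" "0 \<le> H" "0 \<le> K" by (simp_all add: defs)
  have mono: "x powr a \<le> x powr (2 - 12 * \<epsilon>)" if "a \<le> 2 - 12 * \<epsilon>" for a using x that by (rule powr_mono[rotated])
  have "M * K * (H * N * M + (H * N + H\<^sup>2 * N\<^sup>2 / K) * (sqrt (H * N powr \<gamma> / K) * M powr (\<gamma>/2) + M powr (1 - \<gamma>/2) * N powr ((1 - \<gamma>) / 2)))
    \<le> ?m * K * (H * N * ?m + (H * N + H\<^sup>2 * N\<^sup>2 / K) * (sqrt (H * N powr \<gamma> / K) * ?m powr (\<gamma>/2) + ?m powr (1 - \<gamma>/2) * N powr ((1 - \<gamma>) / 2)))"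
    using M nn \<gamma> by (intro mult_mono add_mono mult_nonneg_nonneg add_nonneg_nonneg powr_mono2 order.refl real_sqrt_ge_zero divide_nonneg_nonneg) auto
  also have "\<dots> = (?m * K * (H * N * ?m))
     + (?m * K * (H * N) * (sqrt (H * N powr \<gamma> / K) * ?m powr (\<gamma>/2)))
     + (?m * K * (H * N) * (?m powr (1 - \<gamma>/2) * N powr ((1 - \<gamma>) / 2)))
     + (?m * K * (H\<^sup>2 * N\<^sup>2 / K) * (sqrt (H * N powr \<gamma> / K) * ?m powr (\<gamma>/2)))
     + (?m * K * (H\<^sup>2 * N\<^sup>2 / K) * (?m powr (1 - \<gamma>/2) * N powr ((1 - \<gamma>) / 2)))"
    by algebra
  also have "\<dots> \<le> 5 * x powr (2 - 12 * \<epsilon>)"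
  proof -
    have "?m * K * (H * N * ?m) \<le> x powr (2 - 12 * \<epsilon>)"
      unfolding defs powr_collapse by (rule mono) (simp add: field_simps)
    moreover have "?m * K * (H * N) * (sqrt (H * N powr \<gamma> / K) * ?m powr (\<gamma>/2)) \<le> x powr (2 - 12 * \<epsilon>)"
      unfolding defs powr_collapse sqrt_powr[OF x0] by (rule mono) (use \<theta> \<nu> small \<epsilon> \<gamma> in \<open>simp add: field_simps\<close>)
    moreover have "?m * K * (H * N) * (?m powr (1 - \<gamma>/2) * N powr ((1 - \<gamma>) / 2)) \<le> x powr (2 - 12 * \<epsilon>)"
      unfolding defs powr_collapse by (rule mono) (use \<theta> \<nu> small \<epsilon> \<gamma> in \<open>simp add: field_simps\<close>)
    \<comment> \<open>With \<open>\<theta> = 1 - \<gamma>\<close>, \<open>\<nu> = 1/3\<close> and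
      \<epsilon> neglected, this exponent and the next are both
      \<open>5/3 + 5/2 * (1 - \<gamma>)\<close>; \<open>small\<close> says that it stays below 2
      with room for \<epsilon>.\<close>
    moreover have "?m * K * (H\<^sup>2 * N\<^sup>2 / K) * (sqrt (H * N powr \<gamma> / K) * ?m powr (\<gamma>/2)) \<le> x powr (2 - 12 * \<epsilon>)"
      unfolding defs powr_collapse sqrt_powr[OF x0] by (rule mono) (use \<theta> \<nu> small \<epsilon> \<gamma> in \<open>simp add: field_simps\<close>)
    moreover have "?m * K * (H\<^sup>2 * N\<^sup>2 / K) * (?m powr (1 - \<gamma>/2) * N powr ((1 - \<gamma>) / 2)) \<le> x powr (2 - 12 * \<epsilon>)"
      unfolding defs powr_collapse by (rule mono) (use \<theta> \<nu> small \<epsilon> \<gamma> in \<open>simp add: field_simps\<close>)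
    ultimately show ?thesis by linarith
  qed
  finally show ?thesis .
qed

text \<open>\<open>M\<close> is allowed a factor 2 on both sides of \<open>x / N\<close>, since it
  will be a maximum with 1. The lower bound for \<nu> is read off from the first term, whose
  exponent at \<open>\<theta> = 1 - \<gamma>\<close> is
  \<open>3/2 + (1 - \<gamma>) - \<nu>\<close>.\<close>

lemma type1_exponents_large:
  fixes x \<gamma> \<epsilon> \<nu> \<theta> M :: real
  assumes x: "x \<ge> 1" and \<gamma>: "0 < \<gamma>" "\<gamma> < 1" and \<epsilon>: "\<epsilon> > 0" and \<theta>: "\<theta> \<le> 1 - \<gamma> + \<epsilon>" "0 \<le> \<theta>" and \<nu>: "1/2 + (1 - \<gamma>) + 10 * \<epsilon> \<le> \<nu>"
    and M: "x powr (1 - \<nu>) / 2 \<le> M" "M \<le> 2 * x powr (1 - \<nu>)" and small: "15 * (1 - \<gamma>) + 150 * \<epsilon> \<le> 2"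
    and defs: "N = x powr \<nu>" "H = x powr \<theta>"
  shows "H * M * (sqrt (H * (M * N) powr \<gamma>) + N / sqrt (H * (M * N) powr \<gamma>)) \<le> 8 * x powr (1 - 8 * \<epsilon>)"
proof -
  have x0: "x > 0" using x by simp
  have M0: "0 < M" using M(1) x0 by (smt (verit) divide_pos_pos powr_gt_zero)
  have nn: "0 < N" "0 < H" using x0 by (simp_all add: defs)
  have mono: "x powr a \<le> x powr (1 - 8 * \<epsilon>)" if "a \<le> 1 - 8 * \<epsilon>" for a using x that by (rule powr_mono[rotated])
  have MN: "x / 2 \<le> M * N" "M * N \<le> 2 * x"
  proof -
    have e: "x powr (1 - \<nu>) * N = x" using x0 by (simp add: defs powr_add[symmetric])
    have "x powr (1 - \<nu>) / 2 * N \<le> M * N" using M nn by (intro mult_right_mono) auto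
    thus "x / 2 \<le> M * N" using e by simp
    have "M * N \<le> 2 * x powr (1 - \<nu>) * N" using M nn by (intro mult_right_mono) auto
    thus "M * N \<le> 2 * x" using e by simp
  qed
  have up: "(M * N) powr \<gamma> \<le> 4 * x powr \<gamma>"
  proof -
    have "(M * N) powr \<gamma> \<le> (2 * x) powr \<gamma>" using MN M0 nn \<gamma> by (intro powr_mono2) auto
    also have "\<dots> = 2 powr \<gamma> * x powr \<gamma>" using x0 by (simp add: powr_mult)
    also have "\<dots> \<le> 4 * x powr \<gamma>" using powr_mono[of \<gamma> 1 "2::real"] \<gamma> by (intro mult_right_mono) auto
    finally show ?thesis .
  qed
  have low: "x powr \<gamma> / 4 \<le> (M * N) powr \<gamma>"
  proof -
    have "x powr \<gamma> / 4 \<le> x powr \<gamma> / 2 powr \<gamma>" using powr_mono[of \<gamma> 1 "2::real"] \<gamma> by (intro divide_left_mono) auto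
    also have "\<dots> = (x / 2) powr \<gamma>" using x0 by (simp add: powr_divide)
    also have "\<dots> \<le> (M * N) powr \<gamma>" using MN x0 \<gamma> by (intro powr_mono2) auto
    finally show ?thesis .
  qed
  have s1: "sqrt (H * (M * N) powr \<gamma>) \<le> 2 * x powr ((\<theta> + \<gamma>) / 2)"
  proof -
    have "sqrt (H * (M * N) powr \<gamma>) \<le> sqrt (4 * x powr (\<theta> + \<gamma>))"
      using up nn by (intro real_sqrt_le_mono) (simp add: defs powr_add)
    thus ?thesis using x0 by (simp add: real_sqrt_mult sqrt_powr)
  qed
  have s2: "x powr ((\<theta> + \<gamma>) / 2) / 2 \<le> sqrt (H * (M * N) powr \<gamma>)"
  proof -
    have "sqrt (x powr (\<theta> + \<gamma>) / 4) \<le> sqrt (H * (M * N) powr \<gamma>)"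
      using low nn by (intro real_sqrt_le_mono) (simp add: defs powr_add)
    thus ?thesis using x0 by (simp add: real_sqrt_divide sqrt_powr)
  qed
  have "N / sqrt (H * (M * N) powr \<gamma>) \<le> N / (x powr ((\<theta> + \<gamma>) / 2) / 2)"
    using nn x0 by (intro divide_left_mono s2 mult_pos_pos divide_pos_pos real_sqrt_gt_zero) (use low x0 in auto)
  also have "\<dots> = 2 * x powr (\<nu> - (\<theta> + \<gamma>) / 2)" by (simp add: defs powr_diff)
  finally have s3: "N / sqrt (H * (M * N) powr \<gamma>) \<le> 2 * x powr (\<nu> - (\<theta> + \<gamma>) / 2)" .
  have "H * M * (sqrt (H * (M * N) powr \<gamma>) + N / sqrt (H * (M * N) powr \<gamma>))
    \<le> H * (2 * x powr (1 - \<nu>)) * (2 * x powr ((\<theta> + \<gamma>) / 2) + 2 * x powr (\<nu> - (\<theta> + \<gamma>) / 2))"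
    using nn M M0 by (intro mult_mono add_mono s1 s3 mult_nonneg_nonneg add_nonneg_nonneg) auto
  also have "\<dots> = 4 * (H * x powr (1 - \<nu>) * x powr ((\<theta> + \<gamma>) / 2)) + 4 * (H * x powr (1 - \<nu>) * x powr (\<nu> - (\<theta> + \<gamma>) / 2))" by algebra
  also have "\<dots> \<le> 4 * x powr (1 - 8 * \<epsilon>) + 4 * x powr (1 - 8 * \<epsilon>)"
  proof (intro add_mono mult_left_mono)
    show "H * x powr (1 - \<nu>) * x powr ((\<theta> + \<gamma>) / 2) \<le> x powr (1 - 8 * \<epsilon>)"
      unfolding defs powr_collapse by (rule mono) (use \<theta> \<nu> small \<epsilon> \<gamma> in \<open>simp add: field_simps\<close>)
    show "H * x powr (1 - \<nu>) * x powr (\<nu> - (\<theta> + \<gamma>) / 2) \<le> x powr (1 - 8 * \<epsilon>)"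
      unfolding defs powr_collapse by (rule mono) (use \<theta> \<nu> small \<epsilon> \<gamma> in \<open>simp add: field_simps\<close>)
  qed auto
  finally show ?thesis by simp
qed

text \<open>\<open>x powr y\<close> is the size of \<open>Y\<close>: the shift contributes
  \<open>2 * \<theta> + 20 * \<epsilon>\<close>, the factor \<open>H\<close> another \<theta>, and
  \<open>M powr \<gamma> * N powr (\<gamma> - 1)\<close> the remaining
  \<open>\<gamma> - \<nu>\<close>.\<close>

lemma type1_exponents_weyl:
  fixes x \<gamma> \<epsilon> \<nu> \<theta> k l Y Q L :: real
  assumes x: "x \<ge> 1" and \<gamma>: "0 < \<gamma>" "\<gamma> < 1" and \<epsilon>: "\<epsilon> > 0" and \<theta>: "\<theta> \<le> 1 - \<gamma> + \<epsilon>" "0 \<le> \<theta>"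
    and \<nu>: "\<nu> \<le> 1/2 + (1 - \<gamma>) + 10 * \<epsilon>" "1/2 - (1 - \<gamma>)/2 - 11 * \<epsilon> \<le> \<nu>"
    and small: "15 * (1 - \<gamma>) + 150 * \<epsilon> \<le> 2" and kl: "0 \<le> k" "k \<le> 1/2" "1/2 \<le> l" "l \<le> 1" "4 * k - 2 * l + 1 > 0"
    and gap: "240 * \<epsilon> \<le> (3 - 2 * l) - (1 - \<gamma>) * (12 * k - 2 * l + 13)"
    and defs: "N = x powr \<nu>" "H = x powr \<theta>" "M = x powr (1 - \<nu>) / 2"
    and Q: "x powr (2 * \<theta> + 20 * \<epsilon>) \<le> Q" "Q > 0"
    and y: "y = 3 * \<theta> + 20 * \<epsilon> + \<gamma> - \<nu>" "x powr y / 4 \<le> Y" "Y \<le> 4 * x powr y" and L: "L \<ge> 1"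
  shows "H\<^sup>2 * M * N * (M * N / Q + (sqrt Y + M / sqrt Y) * ((Y / N) powr k * N powr l) + (N + N * M / Y) * L) \<le> 14 * L * x powr (2 - 16 * \<epsilon>)"
proof -
  have x0: "x > 0" using x by simp
  have nn: "0 < N" "0 < H" "0 < M" using x0 by (simp_all add: defs)
  have Y0: "Y > 0" using y(2) x0 by (smt (verit) divide_pos_pos powr_gt_zero)
  have mono: "x powr a \<le> x powr (2 - 16 * \<epsilon>)" if "a \<le> 2 - 16 * \<epsilon>" for a using x that by (rule powr_mono[rotated])
  have MN: "M * N \<le> x" using x0 by (simp add: defs powr_add[symmetric])
  have M: "M \<le> x powr (1 - \<nu>)" by (simp add: defs)
  have Z: "(Y / N) powr k * N powr l \<le> 2 * x powr (k * (y - \<nu>) + l * \<nu>)"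
  proof -
    have "(Y / N) powr k \<le> (4 * x powr (y - \<nu>)) powr k"
      using y(3) Y0 nn kl by (intro powr_mono2) (auto simp: defs powr_diff divide_right_mono)
    also have "\<dots> = 4 powr k * x powr (k * (y - \<nu>))" by (simp add: powr_mult powr_powr mult.commute)
    also have "\<dots> \<le> 2 * x powr (k * (y - \<nu>))"
      using powr_mono[of k "1/2" "4::real"] kl by (intro mult_right_mono) (auto simp: powr_half_sqrt)
    finally have "(Y / N) powr k * N powr l \<le> 2 * x powr (k * (y - \<nu>)) * N powr l" by (intro mult_right_mono) auto
    thus ?thesis by (simp add: defs powr_add powr_powr mult_ac)
  qed
  have sY: "sqrt Y \<le> 2 * x powr (y / 2)"
    using real_sqrt_le_mono[OF y(3)] x0 by (simp add: real_sqrt_mult sqrt_powr)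
  have sY': "x powr (y / 2) / 2 \<le> sqrt Y"
    using real_sqrt_le_mono[OF y(2)] x0 by (simp add: real_sqrt_divide sqrt_powr)
  have "M / sqrt Y \<le> x powr (1 - \<nu>) / (x powr (y / 2) / 2)"
    using M nn sY' x0 Y0 by (intro frac_le) auto
  also have "\<dots> = 2 * x powr (1 - \<nu> - y / 2)" by (simp add: powr_diff)
  finally have MY: "M / sqrt Y \<le> 2 * x powr (1 - \<nu> - y / 2)" .
  \<comment> \<open>Both exponents have slope \<open>l - 2 * k - 1/2\<close> in \<nu>, which is
    negative, so the lower bound for \<nu> is the worst case; with
    \<open>\<theta> = 1 - \<gamma>\<close> the first inequality is then \<open>gap\<close> up to
    terms in \<epsilon>. The products \<open>m1\<close> to \<open>m3\<close> are supplied so that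
    the rest is linear.\<close>
  have gap2: "2 * \<theta> + 1 + (y / 2 + (k * (y - \<nu>) + l * \<nu>)) \<le> 2 - 16 * \<epsilon>"
    and gap3: "2 * \<theta> + 1 + (1 - \<nu> - y / 2 + (k * (y - \<nu>) + l * \<nu>)) \<le> 2 - 16 * \<epsilon>"
  proof -
    define \<delta> where "\<delta> = 1 - \<gamma>"
    have \<theta>': "\<theta> \<le> \<delta> + \<epsilon>" and \<nu>': "1/2 - \<delta>/2 - 11 * \<epsilon> \<le> \<nu>" and gap': "240 * \<epsilon> \<le> (3 - 2 * l) - \<delta> * (12 * k - 2 * l + 13)"
      using \<theta> \<nu> gap by (simp_all add: \<delta>_def)
    have y': "y = 3 * \<theta> + 20 * \<epsilon> + 1 - \<delta> - \<nu>" using y by (simp add: \<delta>_def)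
    have \<delta>0: "0 < \<delta>" using \<gamma> by (simp add: \<delta>_def)
    have m1: "\<theta> * k \<le> (\<delta> + \<epsilon>) * k" using \<theta>' kl by (intro mult_right_mono) auto
    have m2: "(1/2 - \<delta>/2 - 11 * \<epsilon>) * (2 * k + 1/2 - l) \<le> \<nu> * (2 * k + 1/2 - l)" using \<nu>' kl by (intro mult_right_mono) auto
    have m3: "\<epsilon> * k \<le> \<epsilon> * (1/2)" "\<epsilon> * (1/2) \<le> \<epsilon> * l" using \<epsilon> kl by (intro mult_left_mono; simp)+
    show "2 * \<theta> + 1 + (y / 2 + (k * (y - \<nu>) + l * \<nu>)) \<le> 2 - 16 * \<epsilon>"
      using m1 m2 m3 gap' \<theta>' \<epsilon> unfolding y' by argo
    show "2 * \<theta> + 1 + (1 - \<nu> - y / 2 + (k * (y - \<nu>) + l * \<nu>)) \<le> 2 - 16 * \<epsilon>"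
      using m1 m2 m3 gap' \<theta>' \<epsilon> \<delta>0 unfolding y' by argo
  qed
  have t1: "H\<^sup>2 * x * (x / Q) \<le> x powr (2 - 16 * \<epsilon>)"
  proof -
    have "H\<^sup>2 * x * (x / Q) \<le> H\<^sup>2 * x * (x / x powr (2 * \<theta> + 20 * \<epsilon>))"
      using Q x0 by (intro mult_left_mono divide_left_mono) auto
    also have "\<dots> = x powr (2 * \<theta>) * x powr 1 * (x powr 1 / x powr (2 * \<theta> + 20 * \<epsilon>))" using x0 by (simp add: defs powr_squared)
    also have "\<dots> \<le> x powr (2 - 16 * \<epsilon>)" unfolding powr_collapse by (rule mono) (use \<epsilon> in simp)
    finally show ?thesis .
  qed
  have t2: "H\<^sup>2 * x * (sqrt Y * ((Y / N) powr k * N powr l)) \<le> 4 * x powr (2 - 16 * \<epsilon>)"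
  proof -
    have "H\<^sup>2 * x * (sqrt Y * ((Y / N) powr k * N powr l)) \<le> H\<^sup>2 * x * ((2 * x powr (y / 2)) * (2 * x powr (k * (y - \<nu>) + l * \<nu>)))"
      using x0 Y0 by (intro mult_left_mono mult_mono Z sY) auto
    also have "\<dots> = 4 * (x powr (2 * \<theta>) * x powr 1 * (x powr (y / 2) * x powr (k * (y - \<nu>) + l * \<nu>)))" using x0 by (simp add: defs powr_squared)
    also have "\<dots> = 4 * x powr (2 * \<theta> + 1 + (y / 2 + (k * (y - \<nu>) + l * \<nu>)))" unfolding powr_collapse ..
    also have "\<dots> \<le> 4 * x powr (2 - 16 * \<epsilon>)" using mono[OF gap2] by simp
    finally show ?thesis .
  qed
  have t3: "H\<^sup>2 * x * (M / sqrt Y * ((Y / N) powr k * N powr l)) \<le> 4 * x powr (2 - 16 * \<epsilon>)"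
  proof -
    have "H\<^sup>2 * x * (M / sqrt Y * ((Y / N) powr k * N powr l)) \<le> H\<^sup>2 * x * ((2 * x powr (1 - \<nu> - y / 2)) * (2 * x powr (k * (y - \<nu>) + l * \<nu>)))"
      using x0 Y0 nn by (intro mult_left_mono mult_mono Z MY) auto
    also have "\<dots> = 4 * (x powr (2 * \<theta>) * x powr 1 * (x powr (1 - \<nu> - y / 2) * x powr (k * (y - \<nu>) + l * \<nu>)))" using x0 by (simp add: defs powr_squared)
    also have "\<dots> = 4 * x powr (2 * \<theta> + 1 + (1 - \<nu> - y / 2 + (k * (y - \<nu>) + l * \<nu>)))" unfolding powr_collapse ..
    also have "\<dots> \<le> 4 * x powr (2 - 16 * \<epsilon>)" using mono[OF gap3] by simp
    finally show ?thesis .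
  qed
  have t4: "H\<^sup>2 * x * N \<le> x powr (2 - 16 * \<epsilon>)"
  proof -
    have "H\<^sup>2 * x * N = x powr (2 * \<theta>) * x powr 1 * x powr \<nu>" using x0 by (simp add: defs powr_squared)
    also have "\<dots> \<le> x powr (2 - 16 * \<epsilon>)" unfolding powr_collapse by (rule mono) (use \<theta> \<nu> small \<epsilon> \<gamma> in \<open>simp add: field_simps\<close>)
    finally show ?thesis .
  qed
  have t5: "H\<^sup>2 * x * (N * M / Y) \<le> 4 * x powr (2 - 16 * \<epsilon>)"
  proof -
    have "N * M / Y \<le> x / (x powr y / 4)" using MN y(2) x0 nn Y0 by (intro frac_le) (auto simp: mult.commute)
    hence "H\<^sup>2 * x * (N * M / Y) \<le> H\<^sup>2 * x * (x / (x powr y / 4))" using x0 by (intro mult_left_mono) auto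
    also have "\<dots> = 4 * (x powr (2 * \<theta>) * x powr 1 * (x powr 1 / x powr y))" using x0 by (simp add: defs powr_squared)
    also have "x powr (2 * \<theta>) * x powr 1 * (x powr 1 / x powr y) \<le> x powr (2 - 16 * \<epsilon>)"
      unfolding powr_collapse y(1) by (rule mono) (use \<theta> \<nu> small \<epsilon> \<gamma> in \<open>simp add: field_simps\<close>)
    finally show ?thesis by simp
  qed
  have "H\<^sup>2 * M * N * (M * N / Q + (sqrt Y + M / sqrt Y) * ((Y / N) powr k * N powr l) + (N + N * M / Y) * L)
    = H\<^sup>2 * (M * N) * (M * N / Q + (sqrt Y + M / sqrt Y) * ((Y / N) powr k * N powr l) + (N + N * M / Y) * L)" by simp
  also have "\<dots> \<le> H\<^sup>2 * x * (x / Q + (sqrt Y + M / sqrt Y) * ((Y / N) powr k * N powr l) + (N + N * M / Y) * L)"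
    using MN nn x0 Q Y0 L by (intro mult_mono add_mono order.refl divide_right_mono) auto
  also have "\<dots> = H\<^sup>2 * x * (x / Q) + H\<^sup>2 * x * (sqrt Y * ((Y / N) powr k * N powr l)) + H\<^sup>2 * x * (M / sqrt Y * ((Y / N) powr k * N powr l))
      + (H\<^sup>2 * x * N + H\<^sup>2 * x * (N * M / Y)) * L" by algebra
  also have "\<dots> \<le> x powr (2 - 16 * \<epsilon>) + 4 * x powr (2 - 16 * \<epsilon>) + 4 * x powr (2 - 16 * \<epsilon>) + (x powr (2 - 16 * \<epsilon>) + 4 * x powr (2 - 16 * \<epsilon>)) * L"
    using L by (intro add_mono t1 t2 t3 mult_right_mono t4 t5) auto
  also have "\<dots> \<le> 14 * L * x powr (2 - 16 * \<epsilon>)"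
  proof -
    have "9 * x powr (2 - 16 * \<epsilon>) \<le> 9 * x powr (2 - 16 * \<epsilon>) * L" using L mult_left_mono[OF L, of "9 * x powr (2 - 16 * \<epsilon>)"] by simp
    thus ?thesis by (simp add: algebra_simps)
  qed
  finally show ?thesis .
qed

section \<open>Type II and type I estimates for twisted sums\<close>

lemma obtain_exponent:
  fixes x t :: real
  assumes "x > 1" "t > 0"
  obtains \<nu> where "t = x powr \<nu>"
  using assms by (intro that[of "log x t"]) auto

text \<open>\<open>B\<close> is a single quantity that dominates logarithms, constants and, through
  a power, the coefficients; it will be a small power of \<open>x\<close>, so its exponents are mere
  bookkeeping.\<close>

theorem type2_twisted_sum:
  fixes \<gamma> :: real
  assumes \<gamma>: "0 < \<gamma>" "\<gamma> < 1"
  obtains C where "\<And>x \<epsilon> \<alpha> H J f g B. x > 1 \<Longrightarrow> \<epsilon> > 0 \<Longrightarrow> 15 * (1 - \<gamma>) + 150 * \<epsilon> \<le> 2 \<Longrightarrow> 4 \<le> x powr \<epsilon> \<Longrightarrow>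
    1 \<le> B \<Longrightarrow> C \<le> B \<Longrightarrow> 2 + log 2 x \<le> B \<Longrightarrow> 10 + 10 * ln x \<le> B \<Longrightarrow> 1 \<le> H \<Longrightarrow> H \<le> x powr (1 - \<gamma> + \<epsilon>) \<Longrightarrow>
    (\<And>h. is_interval (J h)) \<Longrightarrow> (\<And>h. J h \<subseteq> {x<..2 * x}) \<Longrightarrow>
    (\<And>n. real n \<le> 2 * x \<Longrightarrow> \<bar>arith_fun f n\<bar> \<le> B ^ 20) \<Longrightarrow> (\<And>n. real n \<le> 2 * x \<Longrightarrow> \<bar>arith_fun g n\<bar> \<le> B ^ 20) \<Longrightarrow>
    (\<And>n. arith_fun g n \<noteq> 0 \<Longrightarrow> x powr (1 - \<gamma> + 20 * \<epsilon>) \<le> real n \<and> real n \<le> (2 * x) powr (1/3)) \<Longrightarrow>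
    twisted_sum \<gamma> \<alpha> H J (f * g) \<le> B ^ 43 * x powr (1 - 6 * \<epsilon>)"
proof -
  obtain C where C: "C > 0" and bil: "\<forall>M\<ge>1. \<forall>N\<ge>1. \<forall>H\<ge>1. \<forall>K\<ge>1. \<forall>A\<ge>0. \<forall>B\<ge>0. \<forall>\<alpha>. \<forall>(a :: nat \<Rightarrow> complex) (b :: nat \<Rightarrow> complex) (c :: nat \<Rightarrow> complex) (J :: nat \<Rightarrow> real set).
    (\<forall>m. M \<le> real m \<and> real m \<le> 4 * M \<longrightarrow> norm (a m) \<le> A) \<longrightarrow> (\<forall>n. N < real n \<and> real n \<le> 2 * N \<longrightarrow> norm (b n) \<le> B) \<longrightarrow>
    (\<forall>h. norm (c h) \<le> 1) \<longrightarrow> (\<forall>h. is_interval (J h)) \<longrightarrow>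
    (norm (\<Sum>h | H < real h \<and> real h \<le> 2 * H. c h * (\<Sum>m | M \<le> real m \<and> real m \<le> 4 * M.
        \<Sum>n | N < real n \<and> real n \<le> 2 * N \<and> real (m * n) \<in> J h.
          a m * b n * expi (\<alpha> * real (m * n) + real h * real (m * n) powr \<gamma>))))\<^sup>2
    \<le> C * A\<^sup>2 * B\<^sup>2 * (1 + ln (2 * N)) * (1 + ln (2 * H)) * M * K * (H * N * M + (H * N + H\<^sup>2 * N\<^sup>2 / K) *
        (sqrt (H * N powr \<gamma> / K) * M powr (\<gamma>/2) + M powr (1 - \<gamma>/2) * N powr ((1 - \<gamma>) / 2)))"
    using bilinear_bound[OF \<gamma>] by blast
  show thesis
  proof (rule that[of "5 * C"])
    fix x \<epsilon> \<alpha> H B :: real and J :: "nat \<Rightarrow> real set" and f g :: arith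
    assume x: "x > 1" and \<epsilon>: "\<epsilon> > 0" and small: "15 * (1 - \<gamma>) + 150 * \<epsilon> \<le> 2" and x\<epsilon>: "4 \<le> x powr \<epsilon>"
      and B: "1 \<le> B" "5 * C \<le> B" "2 + log 2 x \<le> B" "10 + 10 * ln x \<le> B" and H: "1 \<le> H" "H \<le> x powr (1 - \<gamma> + \<epsilon>)"
      and J: "\<And>h. is_interval (J h)" "\<And>h. J h \<subseteq> {x<..2 * x}"
      and f: "\<And>n. real n \<le> 2 * x \<Longrightarrow> \<bar>arith_fun f n\<bar> \<le> B ^ 20" and g: "\<And>n. real n \<le> 2 * x \<Longrightarrow> \<bar>arith_fun g n\<bar> \<le> B ^ 20"
      and supp: "\<And>n. arith_fun g n \<noteq> 0 \<Longrightarrow> x powr (1 - \<gamma> + 20 * \<epsilon>) \<le> real n \<and> real n \<le> (2 * x) powr (1/3)"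
    \<comment> \<open>Half of the lower end of the support, so that the strict inequality
      \<open>N0 < n\<close> holds there; \<open>4 \<le> x powr \<epsilon>\<close> pays for the
      half.\<close>
    define N0 where "N0 = x powr (1 - \<gamma> + 20 * \<epsilon>) / 2"
    define W where "W = B ^ 42 * x powr (1 - 6 * \<epsilon>)"
    have W0: "W \<ge> 0" using B by (simp add: W_def)
    have up: "x powr a \<le> x powr b" if "a \<le> b" for a b using x that by (intro powr_mono) auto
    have N0: "x powr (1 - \<gamma> + 19 * \<epsilon>) \<le> N0"
    proof -
      have "x powr (1 - \<gamma> + 19 * \<epsilon>) * 2 \<le> x powr (1 - \<gamma> + 19 * \<epsilon>) * x powr \<epsilon>" using x\<epsilon> by (intro mult_left_mono) auto
      also have "\<dots> = x powr (1 - \<gamma> + 20 * \<epsilon>)" by (subst powr_add[symmetric]) (simp add: algebra_simps)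
      finally show ?thesis by (simp add: N0_def)
    qed
    have N01: "N0 \<ge> 1"
    proof -
      have "1 \<le> x powr (1 - \<gamma> + 19 * \<epsilon>)" using up[of 0 "1 - \<gamma> + 19 * \<epsilon>"] x \<gamma> \<epsilon> by simp
      thus ?thesis using N0 by linarith
    qed
    have U: "(2 * x) powr (1/3) \<le> 2 * x powr (1/3)"
    proof -
      have "(2 * x) powr (1/3) = 2 powr (1/3) * x powr (1/3)" using x by (simp add: powr_mult)
      also have "\<dots> \<le> 2 * x powr (1/3)" using powr_mono[of "1/3" 1 "2::real"] by (intro mult_right_mono) auto
      finally show ?thesis .
    qed
    have Hx: "H \<le> x" using H up[of "1 - \<gamma> + \<epsilon>" 1] x small \<epsilon> \<gamma> by simp
    have ln2: "ln (2::real) \<le> 1" using ln_le_minus_one[of "2::real"] by simp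
    have lnx: "0 \<le> ln x" using x by simp
    obtain \<theta> where \<theta>: "H = x powr \<theta>" using obtain_exponent[OF x, of H] H by auto
    have \<theta>': "\<theta> \<le> 1 - \<gamma> + \<epsilon>" "0 \<le> \<theta>"
      using H x powr_le_cancel_iff[OF x, of 0 \<theta>] unfolding \<theta> by auto
    have block: "twisted_sum \<gamma> \<alpha> H J (f * arith_cut (\<lambda>n. 2 ^ i * N0 < real n \<and> real n \<le> 2 * (2 ^ i * N0)) g) \<le> W" for i :: nat
    proof -
      define N where "N = 2 ^ i * N0"
      define G where "G = arith_cut (\<lambda>n. N < real n \<and> real n \<le> 2 * N) g"
      have NN0: "N0 \<le> N" using N01 mult_right_mono[of 1 "2 ^ i" N0] by (simp add: N_def)
      have N1: "N \<ge> 1" using NN0 N01 by linarith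
      have Gn: "\<bar>arith_fun G n\<bar> \<le> \<bar>arith_fun g n\<bar>" for n by (simp add: G_def arith_fun_cut)
      have Gs: "arith_fun G n \<noteq> 0 \<Longrightarrow> N < real n \<and> real n \<le> 2 * N \<and> arith_fun g n \<noteq> 0" for n by (auto simp: G_def arith_fun_cut split: if_splits)
      have "twisted_sum \<gamma> \<alpha> H J (f * G) \<le> W"
      proof (cases "N < (2 * x) powr (1/3)")
        case False
        have "twisted_sum \<gamma> \<alpha> H J (f * G) = 0"
        proof (rule twisted_sum_eq_0[OF J(2)], rule ccontr)
          fix n assume "arith_fun (f * G) n \<noteq> 0"
          then obtain a b where "n = a * b" "arith_fun G b \<noteq> 0" "a > 0" by (rule arith_fun_mult_nonzero)
          hence "N < real b" "arith_fun g b \<noteq> 0" using Gs[of b] by auto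
          thus False using supp[of b] False by linarith
        qed
        thus ?thesis using W0 by simp
      next
        case True
        obtain \<nu> where \<nu>: "N = x powr \<nu>" using obtain_exponent[OF x, of N] N1 by auto
        define M where "M = x / (2 * N)"
        have \<nu>1: "\<nu> \<le> 1/3 + \<epsilon>"
        proof -
          have "x powr \<nu> \<le> x powr \<epsilon> * x powr (1/3)" using True U x\<epsilon> mult_right_mono[of 2 "x powr \<epsilon>" "x powr (1/3)"] unfolding \<nu> by simp
          hence "x powr \<nu> \<le> x powr (1/3 + \<epsilon>)" by (simp add: powr_add mult.commute)
          thus ?thesis using x by simp
        qed
        have \<nu>2: "1 - \<gamma> + 19 * \<epsilon> \<le> \<nu>"
        proof -
          have "x powr (1 - \<gamma> + 19 * \<epsilon>) \<le> x powr \<nu>" using N0 NN0 unfolding \<nu>[symmetric] by linarith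
          thus ?thesis using x by simp
        qed
        have Mx: "M = x powr (1 - \<nu>) / 2" using x by (simp add: M_def \<nu> powr_diff)
        have M1: "M \<ge> 1"
        proof -
          have "x powr \<epsilon> \<le> x powr (1 - \<nu>)" using up \<nu>1 small \<gamma> by simp
          thus ?thesis unfolding Mx using x\<epsilon> by linarith
        qed
        have NM: "4 * M * N = 2 * x" using N1 by (simp add: M_def)
        have M4: "4 * M \<le> 2 * x" using NM N1 M1 mult_left_mono[of 1 N "4 * M"] by linarith
        have N2: "2 * N \<le> 2 * x" using NM N1 M1 mult_right_mono[of 2 "4 * M" N] by linarith
        define K where "K = x powr (\<nu> - \<theta> - 12 * \<epsilon>)"
        \<comment> \<open>This uses the lower end of the type II range: \<nu> exceeds \<theta> by at
          least \<open>18 * \<epsilon>\<close>.\<close>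
        have K: "K \<ge> 1" unfolding K_def using up[of 0 "\<nu> - \<theta> - 12 * \<epsilon>"] \<nu>2 \<theta>' x \<epsilon> by simp
        define S where "S h = (\<Sum>n::nat | real n \<in> J h. of_real (arith_fun (f * G) n) * expi (\<alpha> * real n + real h * real n powr \<gamma>))" for h
        \<comment> \<open>Phase that turns \<open>S h\<close> into its norm. For
          \<open>S h = 0\<close> division by zero gives \<open>c h = 0\<close>, which still
          satisfies \<open>c h * S h = norm (S h)\<close>.\<close>
        define c where "c h = of_real (norm (S h)) / S h" for h
        define a b where "a m = complex_of_real (arith_fun f m)" and "b n = complex_of_real (arith_fun G n)" for m n
        have Seq: "S h = (\<Sum>m::nat | M \<le> real m \<and> real m \<le> 4 * M. \<Sum>n::nat | N < real n \<and> real n \<le> 2 * N \<and> real (m * n) \<in> J h.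
            a m * b n * expi (\<alpha> * real (m * n) + real h * real (m * n) powr \<gamma>))" for h
          unfolding S_def a_def b_def of_real_mult[symmetric]
        proof (rule sum_mult_block_eq[where e = "\<lambda>n. expi (\<alpha> * real n + real h * real n powr \<gamma>)", OF J(2)])
          show "x \<ge> 0" using x by simp
          show "arith_fun G n \<noteq> 0 \<Longrightarrow> N < real n \<and> real n \<le> 2 * N" for n using Gs by blast
          fix m n :: nat assume n: "N < real n" "real n \<le> 2 * N" and mn: "x < real (m * n)" "real (m * n) \<le> 2 * x"
          have "real m * real n \<le> real m * (2 * N)" using n by (intro mult_left_mono) auto
          hence "x \<le> real m * (2 * N)" using mn by simp
          moreover have "real m * N \<le> real m * real n" using n by (intro mult_left_mono) auto
          hence "real m * N \<le> 2 * x" using mn by simp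
          ultimately show "M \<le> real m \<and> real m \<le> 4 * M" using N1 by (simp add: M_def field_simps)
        qed
        have cS: "c h * S h = of_real (norm (S h))" for h by (simp add: c_def)
        have c1: "norm (c h) \<le> 1" for h by (simp add: c_def norm_divide)
        define E where "E = M * K * (H * N * M + (H * N + H\<^sup>2 * N\<^sup>2 / K) *
          (sqrt (H * N powr \<gamma> / K) * M powr (\<gamma>/2) + M powr (1 - \<gamma>/2) * N powr ((1 - \<gamma>) / 2)))"
        have E: "E \<le> 5 * x powr (2 - 12 * \<epsilon>)"
          unfolding E_def by (rule type2_exponents[OF _ \<gamma> \<epsilon> \<theta>' \<nu>1 _ _ small \<nu> \<theta> K_def]) (use x M1 in \<open>auto simp: Mx\<close>)
        have E0: "0 \<le> E" unfolding E_def using M1 K H N1 by simp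
        have l1: "1 + ln (2 * N) \<le> B" "0 \<le> 1 + ln (2 * N)"
        proof -
          have "ln (2 * N) \<le> ln (2 * x)" using N2 N1 by simp
          also have "\<dots> = ln 2 + ln x" using x by (simp add: ln_mult)
          finally show "1 + ln (2 * N) \<le> B" using ln2 B lnx by linarith
        qed (use N1 in simp)
        have l2: "1 + ln (2 * H) \<le> B" "0 \<le> 1 + ln (2 * H)"
        proof -
          have "ln (2 * H) \<le> ln (2 * x)" using Hx H by simp
          also have "\<dots> = ln 2 + ln x" using x by (simp add: ln_mult)
          finally show "1 + ln (2 * H) \<le> B" using ln2 B lnx by linarith
        qed (use H in simp)
        have bd: "norm (b n) \<le> B ^ 20" if "real n \<le> 2 * N" for n
          using Gn[of n] g[of n] that N2 by (simp add: b_def)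
        have ad: "norm (a m) \<le> B ^ 20" if "real m \<le> 4 * M" for m
          using f[of m] that M4 by (simp add: a_def)
        have B20: "0 \<le> B ^ 20" using B by simp
        have "(norm (\<Sum>h::nat | H < real h \<and> real h \<le> 2 * H. c h * S h))\<^sup>2
          \<le> C * (B ^ 20)\<^sup>2 * (B ^ 20)\<^sup>2 * (1 + ln (2 * N)) * (1 + ln (2 * H)) * M * K * (H * N * M + (H * N + H\<^sup>2 * N\<^sup>2 / K) *
          (sqrt (H * N powr \<gamma> / K) * M powr (\<gamma>/2) + M powr (1 - \<gamma>/2) * N powr ((1 - \<gamma>) / 2)))"
          unfolding Seq
          by (rule bil[rule_format, OF M1 N1 H(1) K B20 B20 ad bd c1 J(1)]) auto
        also have "\<dots> = C * B ^ 80 * (1 + ln (2 * N)) * (1 + ln (2 * H)) * E" by (simp add: E_def power_mult[symmetric] power_add[symmetric])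
        \<comment> \<open>Two logarithms and the constant \<open>5 * C\<close> add three powers of
          \<open>B\<close> to \<open>B ^ 80\<close>; a fourth makes the exponent even for the square
          root.\<close>
        also have "\<dots> \<le> C * B ^ 80 * B * B * (5 * x powr (2 - 12 * \<epsilon>))"
          using C B E0 by (intro mult_mono l1 l2 E mult_nonneg_nonneg order.refl) auto
        also have "\<dots> = (5 * C) * (B ^ 82 * x powr (2 - 12 * \<epsilon>))"
          using power_add[of B 80 2] by (simp add: power2_eq_square)
        also have "\<dots> \<le> B * (B ^ 82 * x powr (2 - 12 * \<epsilon>))" using B by (intro mult_right_mono) auto
        also have "\<dots> \<le> B ^ 84 * x powr (2 - 12 * \<epsilon>)"
        proof -
          have "B ^ 83 \<le> B ^ 84" using B by (intro power_increasing) auto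
          hence "B ^ 83 * x powr (2 - 12 * \<epsilon>) \<le> B ^ 84 * x powr (2 - 12 * \<epsilon>)" by (intro mult_right_mono) auto
          thus ?thesis by (simp add: numeral_eq_Suc mult_ac)
        qed
        also have "\<dots> = W\<^sup>2" by (simp add: W_def power_mult_distrib powr_squared power_mult[symmetric])
        finally have "norm (\<Sum>h::nat | H < real h \<and> real h \<le> 2 * H. c h * S h) \<le> W" using W0 by (rule power2_le_imp_le)
        moreover have "(\<Sum>h::nat | H < real h \<and> real h \<le> 2 * H. c h * S h) = of_real (\<Sum>h::nat | H < real h \<and> real h \<le> 2 * H. norm (S h))" by (simp add: cS)
        ultimately have "(\<Sum>h::nat | H < real h \<and> real h \<le> 2 * H. norm (S h)) \<le> W" by (simp only: norm_of_real)
        thus ?thesis unfolding twisted_sum_def S_def .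
      qed
      thus ?thesis unfolding G_def N_def .
    qed
    have "twisted_sum \<gamma> \<alpha> H J (f * g) \<le> (2 + log 2 x) * W"
    proof (rule twisted_sum_dyadic[OF J(2) N01 _ _ W0 block])
      fix n assume "arith_fun g n \<noteq> 0"
      from supp[OF this] show "N0 < real n" using N01 unfolding N0_def by linarith
    qed (use x in auto)
    also have "\<dots> \<le> B * W" using B W0 by (intro mult_right_mono) auto
    also have "\<dots> = B ^ 43 * x powr (1 - 6 * \<epsilon>)" by (simp add: W_def numeral_eq_Suc)
    finally show "twisted_sum \<gamma> \<alpha> H J (f * g) \<le> B ^ 43 * x powr (1 - 6 * \<epsilon>)" .
  qed
qed

text \<open>\<open>M\<close> is a maximum with 1 because \<open>N\<close> may reach
  \<open>2 * x\<close>, where \<open>x / (2 * N)\<close> drops below 1; this happens only in the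
  range of the second derivative test.\<close>

lemma smooth_sum_le:
  fixes \<gamma> k l :: real
  assumes ep: "exponent_pair k l" and kl: "4 * k - 2 * l + 1 > 0" and \<gamma>: "0 < \<gamma>" "\<gamma> < 1"
  obtains C where "C > 0" and "\<And>x \<epsilon> \<alpha> H N M B t. x > 1 \<Longrightarrow> \<epsilon> > 0 \<Longrightarrow> 15 * (1 - \<gamma>) + 150 * \<epsilon> \<le> 2 \<Longrightarrow>
    240 * \<epsilon> \<le> (3 - 2 * l) - (1 - \<gamma>) * (12 * k - 2 * l + 13) \<Longrightarrow> 4 \<le> x powr \<epsilon> \<Longrightarrow> C \<le> x powr \<epsilon> \<Longrightarrow>
    C \<le> B \<Longrightarrow> 10 + 10 * ln x \<le> B \<Longrightarrow> 1 \<le> H \<Longrightarrow> H \<le> x powr (1 - \<gamma> + \<epsilon>) \<Longrightarrow>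
    x powr (1/2 - (1 - \<gamma>)/2 - 10 * \<epsilon>) / 2 \<le> N \<Longrightarrow> 1 \<le> N \<Longrightarrow> N \<le> 2 * x \<Longrightarrow> M = max 1 (x / (2 * N)) \<Longrightarrow>
    smooth_sum \<gamma> \<alpha> t H M N \<le> B\<^sup>2 * x powr (1 - 8 * \<epsilon>)"
proof -
  have kl': "0 \<le> k" "k \<le> 1/2" "1/2 \<le> l" "l \<le> 1" using ep by (auto simp: exponent_pair_def)
  obtain C1 where C1: "C1 > 0" "\<And>N M H \<alpha> \<theta>. N \<ge> 1 \<Longrightarrow> M \<ge> 1 \<Longrightarrow> H \<ge> 1 \<Longrightarrow>
    smooth_sum \<gamma> \<alpha> \<theta> H M N \<le> C1 * H * M * (sqrt (H * (M * N) powr \<gamma>) + N / sqrt (H * (M * N) powr \<gamma>))"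
  proof (rule smooth_sum_large[OF \<gamma>])
    fix C1 assume *: "C1 > 0" "\<And>N M H \<alpha> \<theta>. N \<ge> 1 \<Longrightarrow> M \<ge> 1 \<Longrightarrow> H \<ge> 1 \<Longrightarrow>
    smooth_sum \<gamma> \<alpha> \<theta> H M N \<le> C1 * H * M * (sqrt (H * (M * N) powr \<gamma>) + N / sqrt (H * (M * N) powr \<gamma>))"
    show thesis by (rule that[OF *])
  qed
  obtain C2 d where C2: "C2 > 0" and d: "d > 0" and weyl: "\<And>N M H \<alpha> \<theta> Q Y. N \<ge> 1 \<Longrightarrow> M \<ge> 1 \<Longrightarrow> H \<ge> 1 \<Longrightarrow> Q \<ge> 1 \<Longrightarrow> real Q \<le> d * N \<Longrightarrow> real Q \<le> N \<Longrightarrow>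
    \<gamma> * H * M powr \<gamma> * N powr (\<gamma> - 1) \<ge> 1 \<Longrightarrow> Y = 2 * \<gamma> * H * real Q * M powr \<gamma> * N powr (\<gamma> - 1) \<Longrightarrow>
    (smooth_sum \<gamma> \<alpha> \<theta> H M N)\<^sup>2 \<le> C2 * H\<^sup>2 * M * N * (M * N / real Q + (sqrt Y + M / sqrt Y) * ((Y / N) powr k * N powr l)
       + (N + N * M / Y) * (1 + ln (M * (1 + Y)) + ln (real Q)))"
  proof (rule smooth_sum_weyl[OF ep \<gamma>])
    fix C2 d assume *: "C2 > 0" "d > 0" "\<And>N M H \<alpha> \<theta> Q Y. N \<ge> 1 \<Longrightarrow> M \<ge> 1 \<Longrightarrow> H \<ge> 1 \<Longrightarrow> Q \<ge> 1 \<Longrightarrow> real Q \<le> d * N \<Longrightarrow> real Q \<le> N \<Longrightarrow>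
    \<gamma> * H * M powr \<gamma> * N powr (\<gamma> - 1) \<ge> 1 \<Longrightarrow> Y = 2 * \<gamma> * H * real Q * M powr \<gamma> * N powr (\<gamma> - 1) \<Longrightarrow>
    (smooth_sum \<gamma> \<alpha> \<theta> H M N)\<^sup>2 \<le> C2 * H\<^sup>2 * M * N * (M * N / real Q + (sqrt Y + M / sqrt Y) * ((Y / N) powr k * N powr l)
       + (N + N * M / Y) * (1 + ln (M * (1 + Y)) + ln (real Q)))"
    show thesis by (rule that[OF *])
  qed
  show thesis
  proof (rule that[of "8 * C1 + 14 * C2 + 2 / d"])
    show "8 * C1 + 14 * C2 + 2 / d > 0" using C1 C2 d by (intro add_pos_pos) auto
    fix x \<epsilon> \<alpha> H N M B t :: real
    assume x: "x > 1" and \<epsilon>: "\<epsilon> > 0" and small: "15 * (1 - \<gamma>) + 150 * \<epsilon> \<le> 2"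
      and gap: "240 * \<epsilon> \<le> (3 - 2 * l) - (1 - \<gamma>) * (12 * k - 2 * l + 13)" and x\<epsilon>: "4 \<le> x powr \<epsilon>" "8 * C1 + 14 * C2 + 2 / d \<le> x powr \<epsilon>"
      and B: "8 * C1 + 14 * C2 + 2 / d \<le> B" "10 + 10 * ln x \<le> B" and H: "1 \<le> H" "H \<le> x powr (1 - \<gamma> + \<epsilon>)"
      and N: "x powr (1/2 - (1 - \<gamma>)/2 - 10 * \<epsilon>) / 2 \<le> N" "1 \<le> N" "N \<le> 2 * x" and M: "M = max 1 (x / (2 * N))"
    have d': "0 < 2 / d" using d by simp
    have x\<epsilon>d: "2 / d \<le> x powr \<epsilon>" and BC: "8 * C1 \<le> B" "14 * C2 \<le> B" using x\<epsilon> B C1(1) C2 d' by linarith+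
    have lnx: "0 \<le> ln x" using x by simp
    have B1: "1 \<le> B" "10 \<le> B" using B lnx by linarith+
    have up: "x powr a \<le> x powr b" if "a \<le> b" for a b using x that by (intro powr_mono) auto
    obtain \<theta> where \<theta>: "H = x powr \<theta>" using that[of "log x H"] H x by (auto intro: that)
    have \<theta>': "\<theta> \<le> 1 - \<gamma> + \<epsilon>" "0 \<le> \<theta>"
      using H x powr_le_cancel_iff[OF x, of 0 \<theta>] unfolding \<theta> by auto
    obtain \<nu> where \<nu>: "N = x powr \<nu>" using that[of "log x N"] N x by (auto intro: that)
    have Mx: "x / (2 * N) = x powr (1 - \<nu>) / 2" using x by (simp add: \<nu> powr_diff)
    have M1: "M \<ge> 1" by (simp add: M)
    show "smooth_sum \<gamma> \<alpha> t H M N \<le> B\<^sup>2 * x powr (1 - 8 * \<epsilon>)"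
    proof (cases "1/2 + (1 - \<gamma>) + 10 * \<epsilon> \<le> \<nu>")
      case True
      have Mb: "x powr (1 - \<nu>) / 2 \<le> M" "M \<le> 2 * x powr (1 - \<nu>)"
      proof -
        show "x powr (1 - \<nu>) / 2 \<le> M" unfolding M Mx by simp
        have "1 \<le> 2 * x powr (1 - \<nu>)" using N x by (simp add: \<nu> powr_diff field_simps)
        moreover have "x powr (1 - \<nu>) / 2 \<le> 2 * x powr (1 - \<nu>)" using powr_ge_zero[of x "1 - \<nu>"] by linarith
        ultimately show "M \<le> 2 * x powr (1 - \<nu>)" unfolding M Mx by simp
      qed
      have "smooth_sum \<gamma> \<alpha> t H M N \<le> C1 * H * M * (sqrt (H * (M * N) powr \<gamma>) + N / sqrt (H * (M * N) powr \<gamma>))"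
        by (rule C1(2)[OF N(2) M1 H(1)])
      also have "\<dots> = C1 * (H * M * (sqrt (H * (M * N) powr \<gamma>) + N / sqrt (H * (M * N) powr \<gamma>)))" by simp
      also have "\<dots> \<le> C1 * (8 * x powr (1 - 8 * \<epsilon>))"
        using C1 x by (intro mult_left_mono type1_exponents_large[OF _ \<gamma> \<epsilon> \<theta>' True Mb small \<nu> \<theta>]) auto
      also have "\<dots> = (8 * C1) * x powr (1 - 8 * \<epsilon>)" by simp
      also have "\<dots> \<le> B\<^sup>2 * x powr (1 - 8 * \<epsilon>)"
      proof (intro mult_right_mono)
        have "B * 1 \<le> B * B" using B1 by (intro mult_left_mono) auto
        thus "8 * C1 \<le> B\<^sup>2" using BC by (simp add: power2_eq_square)
      qed auto
      finally show ?thesis .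
    next
      case False
      have \<nu>1: "\<nu> \<le> 1/2 + (1 - \<gamma>) + 10 * \<epsilon>" using False by simp
      have \<nu>2: "1/2 - (1 - \<gamma>)/2 - 11 * \<epsilon> \<le> \<nu>"
      proof -
        have "x powr (1/2 - (1 - \<gamma>)/2 - 11 * \<epsilon>) * 2 \<le> x powr (1/2 - (1 - \<gamma>)/2 - 11 * \<epsilon>) * x powr \<epsilon>" using x\<epsilon> by (intro mult_left_mono) auto
        also have "\<dots> = x powr (1/2 - (1 - \<gamma>)/2 - 10 * \<epsilon>)" by (subst powr_add[symmetric]) (simp add: algebra_simps)
        finally have "x powr (1/2 - (1 - \<gamma>)/2 - 11 * \<epsilon>) \<le> x powr \<nu>" using N(1) unfolding \<nu> by linarith
        thus ?thesis using x by simp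
      qed
      have "x powr \<epsilon> \<le> x powr (1 - \<nu>)" using \<nu>1 small \<epsilon> \<gamma> by (intro up) argo
      hence Mx': "M = x powr (1 - \<nu>) / 2" unfolding M Mx using x\<epsilon> by simp
      \<comment> \<open>This is \<open>H\<^sup>2 * x powr (20 * \<epsilon>)\<close>: the diagonal
        contributes at most about \<open>(H * x)\<^sup>2 / Q\<close> to the square, so this length
        saves \<open>x powr (20 * \<epsilon>)\<close> over \<open>x\<^sup>2\<close>.\<close>
      define q where "q = x powr (2 * \<theta> + 20 * \<epsilon>)"
      define Q where "Q = nat \<lceil>q\<rceil>"
      have q1: "1 \<le> q" unfolding q_def using up[of 0 "2 * \<theta> + 20 * \<epsilon>"] \<theta>' \<epsilon> x by simp
      have Qq: "q \<le> real Q" "real Q \<le> 2 * q" unfolding Q_def using q1 by linarith+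
      have Q1: "Q \<ge> 1" using Qq(1) q1 by linarith
      \<comment> \<open>The lower bound for \<nu> leaves room for a factor
        \<open>x powr \<epsilon>\<close>, which absorbs both \<open>d\<close> and the rounding in
        \<open>Q\<close>.\<close>
      have qN: "q * x powr \<epsilon> \<le> N" unfolding q_def \<nu> powr_add[symmetric] using \<nu>2 \<theta>' small \<epsilon> \<gamma> by (intro up) argo
      have QN: "real Q \<le> N"
      proof -
        have "q * 2 \<le> q * x powr \<epsilon>" using x\<epsilon> q1 by (intro mult_left_mono) auto
        thus ?thesis using Qq qN by linarith
      qed
      have QdN: "real Q \<le> d * N"
      proof -
        have "q * (2 / d) \<le> q * x powr \<epsilon>" using x\<epsilon>d q1 by (intro mult_left_mono) auto
        hence "q * (2 / d) \<le> N" using qN by linarith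
        hence "2 * q \<le> d * N" using d by (simp add: field_simps)
        thus ?thesis using Qq by linarith
      qed
      define G where "G = \<gamma> * H * M powr \<gamma> * N powr (\<gamma> - 1)"
      define g where "g = x powr (\<theta> + \<gamma> - \<nu>)"
      have g4: "4 \<le> g"
      proof -
        have "x powr \<epsilon> \<le> g" unfolding g_def using \<nu>1 \<theta>' small \<epsilon> \<gamma> by (intro up) argo
        thus ?thesis using x\<epsilon> by linarith
      qed
      have gM: "g = H * (x powr (1 - \<nu>)) powr \<gamma> * N powr (\<gamma> - 1)"
        unfolding g_def \<theta> \<nu> powr_collapse by (rule arg_cong[of _ _ "\<lambda>e. x powr e"]) argo
      have M\<gamma>: "M powr \<gamma> = (x powr (1 - \<nu>)) powr \<gamma> / 2 powr \<gamma>" unfolding Mx' by (rule powr_divide)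
      have two: "1 \<le> (2::real) powr \<gamma>" "(2::real) powr \<gamma> \<le> 2" using powr_mono[of \<gamma> 1 "2::real"] ge_one_powr_ge_zero[of 2 \<gamma>] \<gamma> by auto
      have Gg: "G = \<gamma> * g / 2 powr \<gamma>" unfolding G_def gM M\<gamma> by simp
      have G1: "G \<le> g"
      proof -
        have "\<gamma> * g / 2 powr \<gamma> \<le> 1 * g / 1" using two \<gamma> g4 by (intro frac_le mult_right_mono) auto
        thus ?thesis by (simp add: Gg)
      qed
      have G2: "g / 4 \<le> G"
      proof -
        have "(1/2) * g / 2 \<le> \<gamma> * g / 2 powr \<gamma>" using two \<gamma> g4 small \<epsilon> by (intro frac_le mult_right_mono) auto
        thus ?thesis by (simp add: Gg)
      qed
      define Y where "Y = 2 * \<gamma> * H * real Q * M powr \<gamma> * N powr (\<gamma> - 1)"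
      have YG: "Y = 2 * real Q * G" by (simp add: Y_def G_def)
      define y where "y = 3 * \<theta> + 20 * \<epsilon> + \<gamma> - \<nu>"
      have xy: "x powr y = q * g" unfolding q_def g_def powr_add[symmetric] y_def by (rule arg_cong[of _ _ "\<lambda>e. x powr e"]) argo
      have Y1: "x powr y / 4 \<le> Y"
      proof -
        have "q * (g / 4) \<le> real Q * G" using Qq G2 q1 g4 by (intro mult_mono) auto
        moreover have "0 \<le> real Q * G" using G2 g4 by simp
        ultimately show ?thesis unfolding xy YG by simp
      qed
      have Y2: "Y \<le> 4 * x powr y"
      proof -
        have "real Q * G \<le> (2 * q) * g" using Qq G1 G2 q1 g4 by (intro mult_mono) auto
        hence "2 * (real Q * G) \<le> 2 * (2 * q * g)" by (rule mult_left_mono) simp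
        also have "2 * (2 * q * g) = 4 * (q * g)" by simp
        finally show ?thesis unfolding xy YG by (simp only: mult.assoc)
      qed
      have Yp: "Y > 0" using Y1 x by (smt (verit) divide_pos_pos powr_gt_zero)
      define L where "L = 1 + ln (M * (1 + Y)) + ln (real Q)"
      have L1: "L \<ge> 1"
      proof -
        have "1 * 1 \<le> M * (1 + Y)" using M1 Yp by (intro mult_mono) auto
        hence "0 \<le> ln (M * (1 + Y))" by simp
        moreover have "0 \<le> ln (real Q)" using Q1 by simp
        ultimately show ?thesis by (simp add: L_def)
      qed
      have LB: "L \<le> B"
      proof -
        have nu0: "0 \<le> \<nu>" using \<nu>2 small \<epsilon> \<gamma> by argo
        have "x powr (1 - \<nu>) \<le> x powr 1" using nu0 by (intro up) simp
        hence Mle: "M \<le> x" using x unfolding Mx' by simp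
        have "x powr y \<le> x powr 2" unfolding y_def using nu0 \<theta>' small \<epsilon> \<gamma> by (intro up) argo
        hence "Y \<le> 4 * x ^ 2" using Y2 x by (simp add: powr_numeral)
        moreover have "1 \<le> x ^ 2" using x by simp
        ultimately have Yle: "1 + Y \<le> 5 * x ^ 2" by linarith
        have "M * (1 + Y) \<le> x * (5 * x ^ 2)" using Mle Yle M1 Yp x by (intro mult_mono) auto
        hence "ln (M * (1 + Y)) \<le> ln (x * (5 * x ^ 2))" using M1 Yp by (intro ln_mono) auto
        also have "\<dots> = ln 5 + 3 * ln x" using x by (simp add: ln_mult ln_realpow)
        finally have 1: "ln (M * (1 + Y)) \<le> 4 + 3 * ln x" using ln_le_minus_one[of "5::real"] by simp
        have "ln (real Q) \<le> ln (2 * x)" using QN N Q1 x by (intro ln_mono) auto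
        also have "\<dots> = ln 2 + ln x" using x by (simp add: ln_mult)
        finally have "ln (real Q) \<le> 1 + ln x" using ln_le_minus_one[of "2::real"] by simp
        thus ?thesis using 1 B lnx unfolding L_def by linarith
      qed
      have "(smooth_sum \<gamma> \<alpha> t H M N)\<^sup>2 \<le> C2 * H\<^sup>2 * M * N * (M * N / real Q + (sqrt Y + M / sqrt Y) * ((Y / N) powr k * N powr l)
       + (N + N * M / Y) * L)"
        unfolding L_def by (rule weyl[OF N(2) M1 H(1) Q1 QdN QN _ Y_def]) (use G2 g4 in \<open>simp add: G_def\<close>)
      also have "\<dots> = C2 * (H\<^sup>2 * M * N * (M * N / real Q + (sqrt Y + M / sqrt Y) * ((Y / N) powr k * N powr l)
       + (N + N * M / Y) * L))" by simp
      also have "\<dots> \<le> C2 * (14 * L * x powr (2 - 16 * \<epsilon>))"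
      proof (intro mult_left_mono type1_exponents_weyl[OF _ \<gamma> \<epsilon> \<theta>' \<nu>1 \<nu>2 small kl' kl gap \<nu> \<theta> Mx' _ _ y_def Y1 Y2 L1])
        show "x powr (2 * \<theta> + 20 * \<epsilon>) \<le> real Q" using Qq unfolding q_def by simp
        show "0 < real Q" using Q1 by simp
      qed (use x C2 in auto)
      also have "\<dots> = (14 * C2) * L * x powr (2 - 16 * \<epsilon>)" by simp
      also have "\<dots> \<le> B * B * x powr (2 - 16 * \<epsilon>)" using BC LB L1 B1 C2 by (intro mult_right_mono mult_mono) auto
      also have "\<dots> \<le> (B * B) * (B * B) * x powr (2 - 16 * \<epsilon>)"
      proof (intro mult_right_mono)
        have "1 * 1 \<le> B * B" using B1 by (intro mult_mono) auto
        thus "B * B \<le> B * B * (B * B)" using mult_left_mono[of 1 "B * B" "B * B"] by simp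
      qed auto
      also have "\<dots> = (B\<^sup>2 * x powr (1 - 8 * \<epsilon>))\<^sup>2" unfolding power_mult_distrib powr_squared by (simp add: power2_eq_square algebra_simps)
      finally show ?thesis by (rule power2_le_imp_le) auto
    qed
  qed
qed

text \<open>Cutting \<open>arith_zeta\<close> or \<open>arith_ln\<close> from below leaves a
  nondecreasing weight, as \<open>type1_block\<close> requires; the upper cut is the end of the
  dyadic block itself.\<close>

theorem type1_twisted_sum:
  fixes \<gamma> k l :: real
  assumes ep: "exponent_pair k l" and kl: "4 * k - 2 * l + 1 > 0" and \<gamma>: "0 < \<gamma>" "\<gamma> < 1"
  obtains C where "C > 0" and "\<And>x \<epsilon> \<alpha> H J f g B U. x > 1 \<Longrightarrow> \<epsilon> > 0 \<Longrightarrow> 15 * (1 - \<gamma>) + 150 * \<epsilon> \<le> 2 \<Longrightarrow>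
    240 * \<epsilon> \<le> (3 - 2 * l) - (1 - \<gamma>) * (12 * k - 2 * l + 13) \<Longrightarrow> 4 \<le> x powr \<epsilon> \<Longrightarrow> C \<le> x powr \<epsilon> \<Longrightarrow>
    C \<le> B \<Longrightarrow> 2 + log 2 x \<le> B \<Longrightarrow> 10 + 10 * ln x \<le> B \<Longrightarrow> 1 \<le> H \<Longrightarrow> H \<le> x powr (1 - \<gamma> + \<epsilon>) \<Longrightarrow>
    (\<And>h. is_interval (J h)) \<Longrightarrow> (\<And>h. J h \<subseteq> {x<..2 * x}) \<Longrightarrow>
    (\<And>n. real n \<le> 2 * x \<Longrightarrow> \<bar>arith_fun f n\<bar> \<le> B ^ 20) \<Longrightarrow> g \<in> {arith_zeta, arith_ln} \<Longrightarrow>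
    twisted_sum \<gamma> \<alpha> H J (f * arith_cut (\<lambda>n. U < real n \<and> x powr (1/2 - (1 - \<gamma>)/2 - 10 * \<epsilon>) \<le> real n) g) \<le> B ^ 26 * x powr (1 - 8 * \<epsilon>)"
proof (rule smooth_sum_le[OF ep kl \<gamma>])
  fix C assume C: "C > 0" and smooth: "\<And>x \<epsilon> \<alpha> H N M B t. x > 1 \<Longrightarrow> \<epsilon> > 0 \<Longrightarrow> 15 * (1 - \<gamma>) + 150 * \<epsilon> \<le> 2 \<Longrightarrow>
    240 * \<epsilon> \<le> (3 - 2 * l) - (1 - \<gamma>) * (12 * k - 2 * l + 13) \<Longrightarrow> 4 \<le> x powr \<epsilon> \<Longrightarrow> C \<le> x powr \<epsilon> \<Longrightarrow>
    C \<le> B \<Longrightarrow> 10 + 10 * ln x \<le> B \<Longrightarrow> 1 \<le> H \<Longrightarrow> H \<le> x powr (1 - \<gamma> + \<epsilon>) \<Longrightarrow>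
    x powr (1/2 - (1 - \<gamma>)/2 - 10 * \<epsilon>) / 2 \<le> N \<Longrightarrow> 1 \<le> N \<Longrightarrow> N \<le> 2 * x \<Longrightarrow> M = max 1 (x / (2 * N)) \<Longrightarrow>
    smooth_sum \<gamma> \<alpha> t H M N \<le> B\<^sup>2 * x powr (1 - 8 * \<epsilon>)"
  show thesis
  proof (rule that[OF C])
    fix x \<epsilon> \<alpha> H B U :: real and J :: "nat \<Rightarrow> real set" and f g :: arith
    assume x: "x > 1" and \<epsilon>: "\<epsilon> > 0" and small: "15 * (1 - \<gamma>) + 150 * \<epsilon> \<le> 2"
      and gap: "240 * \<epsilon> \<le> (3 - 2 * l) - (1 - \<gamma>) * (12 * k - 2 * l + 13)" and x\<epsilon>: "4 \<le> x powr \<epsilon>" "C \<le> x powr \<epsilon>"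
      and B: "C \<le> B" "2 + log 2 x \<le> B" "10 + 10 * ln x \<le> B" and H: "1 \<le> H" "H \<le> x powr (1 - \<gamma> + \<epsilon>)"
      and J: "\<And>h. is_interval (J h)" "\<And>h. J h \<subseteq> {x<..2 * x}"
      and f: "\<And>n. real n \<le> 2 * x \<Longrightarrow> \<bar>arith_fun f n\<bar> \<le> B ^ 20" and g: "g \<in> {arith_zeta, arith_ln}"
    define y where "y = x powr (1/2 - (1 - \<gamma>)/2 - 10 * \<epsilon>)"
    define g' where "g' = arith_cut (\<lambda>n. U < real n \<and> y \<le> real n) g"
    define W where "W = B\<^sup>2 * x powr (1 - 8 * \<epsilon>)"
    have lnx: "0 \<le> ln x" using x by simp
    have B1: "10 \<le> B" using B lnx by linarith
    have ln2: "ln (2::real) \<le> 1" using ln_le_minus_one[of "2::real"] by simp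
    have ln4: "ln (4 * x) \<le> 2 + ln x"
    proof -
      have "ln (4 * x) = ln 2 + (ln 2 + ln x)" using x ln_mult[of 2 "2 * x"] ln_mult[of 2 x] by simp
      thus ?thesis using ln2 by linarith
    qed
    have y4: "4 \<le> y"
    proof -
      have "x powr \<epsilon> \<le> y" unfolding y_def using x small \<gamma> \<epsilon> by (intro powr_mono) argo+
      thus ?thesis using x\<epsilon> by linarith
    qed
    have x4: "4 \<le> x"
    proof -
      have "x powr \<epsilon> \<le> x powr 1" using x small \<gamma> \<epsilon> by (intro powr_mono) argo+
      thus ?thesis using x\<epsilon> x by simp
    qed
    have block: "twisted_sum \<gamma> \<alpha> H J (f * arith_cut (\<lambda>n. 2 ^ i * (y / 2) < real n \<and> real n \<le> 2 * (2 ^ i * (y / 2))) g') \<le> B ^ 25 * x powr (1 - 8 * \<epsilon>)"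
      if i: "2 ^ i * (y / 2) \<le> 2 * x" for i :: nat
    proof -
      define N where "N = 2 ^ i * (y / 2)"
      define G where "G = arith_cut (\<lambda>n. N < real n \<and> real n \<le> 2 * N) g'"
      define M where "M = max 1 (x / (2 * N))"
      have Ny: "y / 2 \<le> N" using y4 mult_right_mono[of 1 "2 ^ i" "y / 2"] by (simp add: N_def)
      have N1: "1 \<le> N" using Ny y4 by linarith
      have N2: "N \<le> 2 * x" using i by (simp add: N_def)
      have M1: "M \<ge> 1" by (simp add: M_def)
      have W: "smooth_sum \<gamma> \<alpha> t H M N \<le> W" for t
        unfolding W_def by (rule smooth[OF x \<epsilon> small gap x\<epsilon> B(1,3) H _ N1 N2 M_def]) (use Ny in \<open>simp add: y_def\<close>)
      have W0: "0 \<le> W" by (simp add: W_def)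
      have lN: "2 + ln (2 * N) \<le> B" "0 \<le> 2 + ln (2 * N)"
      proof -
        have "ln (2 * N) \<le> ln (4 * x)" using N1 N2 by simp
        thus "2 + ln (2 * N) \<le> B" using ln4 B lnx by linarith
      qed (use N1 in simp)
      have M4: "4 * M \<le> 2 * x"
      proof -
        have "x / (2 * N) \<le> x / 2" using N1 x by (intro divide_left_mono) auto
        thus ?thesis using x4 by (simp add: M_def)
      qed
      have gn: "0 \<le> arith_fun g n" "real n \<le> 4 * x \<Longrightarrow> arith_fun g n \<le> B" for n
      proof -
        show "0 \<le> arith_fun g n" using g by (cases "n = 0") (auto simp: arith_zeta_def arith_ln_def arith_fun_arith_of)
        assume n: "real n \<le> 4 * x"
        show "arith_fun g n \<le> B"
        proof (cases "n = 0")
          case True thus ?thesis using B1 by simp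
        next
          case False
          hence "ln (real n) \<le> ln (4 * x)" using n by simp
          hence "ln (real n) \<le> B" using ln4 B lnx by linarith
          thus ?thesis using g B1 False by (auto simp: arith_zeta_def arith_ln_def arith_fun_arith_of)
        qed
      qed
      have gmono: "arith_fun g n \<le> arith_fun g (Suc n)" if "n > 0" for n
        using g that by (auto simp: arith_zeta_def arith_ln_def arith_fun_arith_of)
      have Gn: "arith_fun G n = (if U < real n \<and> y \<le> real n then arith_fun g n else 0)" if "N < real n" "real n \<le> 2 * N" for n
        using that by (simp add: G_def g'_def arith_fun_cut)
      have c1: "0 \<le> arith_fun G n \<and> arith_fun G n \<le> B" if "N < real n" "real n \<le> 2 * N" for n
        using Gn[OF that] gn[of n] that N2 B1 by auto
      have c2: "arith_fun G n \<le> arith_fun G (Suc n)" if n: "N < real n" "real (Suc n) \<le> 2 * N" for n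
      proof -
        have "n > 0" using n N1 by (intro gr0I) auto
        moreover have "arith_fun G n = (if U < real n \<and> y \<le> real n then arith_fun g n else 0)" by (rule Gn) (use n in auto)
        moreover have "arith_fun G (Suc n) = (if U < real (Suc n) \<and> y \<le> real (Suc n) then arith_fun g (Suc n) else 0)" by (rule Gn) (use n in auto)
        ultimately show ?thesis using gmono[of n] gn(1)[of "Suc n"] by auto
      qed
      have am: "\<bar>arith_fun f m\<bar> \<le> B ^ 20" if "M \<le> real m" "real m \<le> 4 * M" for m using f[of m] that M4 by simp
      have Seq: "(\<Sum>n::nat | real n \<in> J h. of_real (arith_fun (f * G) n) * expi (\<alpha> * real n + real h * real n powr \<gamma>))
        = (\<Sum>m::nat | M \<le> real m \<and> real m \<le> 4 * M. \<Sum>n::nat | N < real n \<and> real n \<le> 2 * N \<and> real (m * n) \<in> J h.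
            of_real (arith_fun f m * arith_fun G n) * expi (\<alpha> * real (m * n) + real h * real (m * n) powr \<gamma>))" for h
      proof (rule sum_mult_block_eq[where e = "\<lambda>n. expi (\<alpha> * real n + real h * real n powr \<gamma>)", OF J(2)])
        show "x \<ge> 0" using x by simp
        show "arith_fun G n \<noteq> 0 \<Longrightarrow> N < real n \<and> real n \<le> 2 * N" for n by (auto simp: G_def arith_fun_cut split: if_splits)
        fix m n :: nat assume n: "N < real n" "real n \<le> 2 * N" and mn: "x < real (m * n)" "real (m * n) \<le> 2 * x"
        have "m > 0" using mn x by (intro gr0I) auto
        moreover have "real m * real n \<le> real m * (2 * N)" using n by (intro mult_left_mono) auto
        hence "x \<le> real m * (2 * N)" using mn by simp
        hence "x / (2 * N) \<le> real m" using N1 by (simp add: field_simps)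
        moreover have "real m * N \<le> real m * real n" using n by (intro mult_left_mono) auto
        hence "real m * N \<le> 2 * x" using mn by simp
        hence "real m \<le> 4 * (x / (2 * N))" using N1 by (simp add: field_simps)
        ultimately show "M \<le> real m \<and> real m \<le> 4 * M" by (simp add: M_def)
      qed
      have B20: "0 \<le> B ^ 20" "0 \<le> B" using B1 by auto
      have "twisted_sum \<gamma> \<alpha> H J (f * G) \<le> 2 * B ^ 20 * B * (2 + ln (2 * N)) * W"
        unfolding twisted_sum_def Seq by (rule type1_block[where a = "arith_fun f" and c = "arith_fun G" and J = J, OF N1 M1 B20(1) am B20(2) c1 c2 J(1) W])
      also have "\<dots> \<le> B * B ^ 20 * B * B * W"
        using B1 lN W0 B20 by (intro mult_right_mono mult_mono) auto
      also have "\<dots> = B ^ 25 * x powr (1 - 8 * \<epsilon>)" using power_add[of B 20 5] by (simp add: W_def numeral_eq_Suc)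
      finally show ?thesis unfolding G_def N_def .
    qed
    have "twisted_sum \<gamma> \<alpha> H J (f * g') \<le> (2 + log 2 x) * (B ^ 25 * x powr (1 - 8 * \<epsilon>))"
    proof (rule twisted_sum_dyadic[OF J(2) _ _ _ _ block])
      show "1 \<le> y / 2" using y4 by simp
      show "arith_fun g' n \<noteq> 0 \<Longrightarrow> y / 2 < real n" for n using y4 by (auto simp: g'_def arith_fun_cut split: if_splits)
    qed (use x B1 in auto)
    also have "\<dots> \<le> B * (B ^ 25 * x powr (1 - 8 * \<epsilon>))" using B B1 by (intro mult_right_mono) auto
    also have "\<dots> = B ^ 26 * x powr (1 - 8 * \<epsilon>)" using power_add[of B 1 25] by simp
    finally show "twisted_sum \<gamma> \<alpha> H J (f * arith_cut (\<lambda>n. U < real n \<and> x powr (1/2 - (1 - \<gamma>)/2 - 10 * \<epsilon>) \<le> real n) g) \<le> B ^ 26 * x powr (1 - 8 * \<epsilon>)"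
      unfolding g'_def y_def .
  qed
qed

section \<open>Choice of the parameters and assembly\<close>

theorem theorem1p6:
  fixes k l \<gamma> :: real
  assumes "exponent_pair k l"
    and "4 * k - 2 * l + 1 > 0"
    and "max (13/15) ((12 * k + 10) / (12 * k - 2 * l + 13)) < \<gamma>"
    and "\<gamma> < 1"
  shows "\<exists>\<epsilon>\<^sub>0>0. \<forall>\<epsilon>. 0 < \<epsilon> \<and> \<epsilon> < \<epsilon>\<^sub>0 \<longrightarrow>
    (\<exists>C. \<forall>\<^sub>F x :: real in at_top.
      \<forall>H u \<alpha> :: real. \<forall>I J :: real set.
        1 \<le> H \<and> H \<le> x powr (1 - \<gamma> + \<epsilon>) \<and> 0 \<le> u \<and> u \<le> 1 \<and>
        dyadic_subinterval H I \<and> dyadic_subinterval x J \<longrightarrow>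
        (\<Sum>h :: nat | real h \<in> I.
           norm (\<Sum>n :: nat | real n \<in> J.
             mangoldt n * expi (\<alpha> * real n + real h * (real n + u) powr \<gamma>)))
        \<le> C * x powr (1 - \<epsilon>))"
proof -
  have \<gamma>: "0 < \<gamma>" "\<gamma> < 1" and \<gamma>13: "13/15 < \<gamma>" using assms by auto
  define D where "D = 12 * k - 2 * l + 13"
  define gap where "gap = (3 - 2 * l) - (1 - \<gamma>) * D"
  have gap: "gap > 0"
  proof -
    have D: "D > 0" using assms(1) by (simp add: D_def exponent_pair_def)
    have "(12 * k + 10) / D < \<gamma>" using assms(3) by (simp add: D_def)
    hence "12 * k + 10 < \<gamma> * D" using D by (simp add: divide_less_eq)
    moreover have "gap = 3 - 2 * l - D + \<gamma> * D" by (simp add: gap_def algebra_simps)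
    ultimately show ?thesis by (simp add: D_def)
  qed
  \<comment> \<open>The second entry is the slack in \<open>13/15 < \<gamma>\<close>, the third the
    slack in the condition on \<open>k\<close> and \<open>l\<close>; \<open>1/300\<close> leaves
    room in numerical inequalities such as \<open>z\<^sup>2 \<le> U\<close>.\<close>
  define \<epsilon>\<^sub>0 where "\<epsilon>\<^sub>0 = min (1/300) (min ((2 - 15 * (1 - \<gamma>)) / 150) (gap / 240))"
  have \<epsilon>0: "\<epsilon>\<^sub>0 > 0" using gap \<gamma>13 by (simp add: \<epsilon>\<^sub>0_def)
  show ?thesis
  proof (rule type2_twisted_sum[OF \<gamma>], rule type1_twisted_sum[OF assms(1,2) \<gamma>], rule exI[of _ \<epsilon>\<^sub>0], intro conjI allI impI \<epsilon>0)
    fix C2 C1 \<epsilon> :: real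
    assume type2: "\<And>x \<epsilon> \<alpha> H J f g B. x > 1 \<Longrightarrow> \<epsilon> > 0 \<Longrightarrow> 15 * (1 - \<gamma>) + 150 * \<epsilon> \<le> 2 \<Longrightarrow> 4 \<le> x powr \<epsilon> \<Longrightarrow>
      1 \<le> B \<Longrightarrow> C2 \<le> B \<Longrightarrow> 2 + log 2 x \<le> B \<Longrightarrow> 10 + 10 * ln x \<le> B \<Longrightarrow> 1 \<le> H \<Longrightarrow> H \<le> x powr (1 - \<gamma> + \<epsilon>) \<Longrightarrow>
      (\<And>h. is_interval (J h)) \<Longrightarrow> (\<And>h. J h \<subseteq> {x<..2 * x}) \<Longrightarrow>
      (\<And>n. real n \<le> 2 * x \<Longrightarrow> \<bar>arith_fun f n\<bar> \<le> B ^ 20) \<Longrightarrow> (\<And>n. real n \<le> 2 * x \<Longrightarrow> \<bar>arith_fun g n\<bar> \<le> B ^ 20) \<Longrightarrow>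
      (\<And>n. arith_fun g n \<noteq> 0 \<Longrightarrow> x powr (1 - \<gamma> + 20 * \<epsilon>) \<le> real n \<and> real n \<le> (2 * x) powr (1/3)) \<Longrightarrow>
      twisted_sum \<gamma> \<alpha> H J (f * g) \<le> B ^ 43 * x powr (1 - 6 * \<epsilon>)"
    assume "C1 > 0" and type1: "\<And>x \<epsilon> \<alpha> H J f g B U. x > 1 \<Longrightarrow> \<epsilon> > 0 \<Longrightarrow> 15 * (1 - \<gamma>) + 150 * \<epsilon> \<le> 2 \<Longrightarrow>
      240 * \<epsilon> \<le> (3 - 2 * l) - (1 - \<gamma>) * (12 * k - 2 * l + 13) \<Longrightarrow> 4 \<le> x powr \<epsilon> \<Longrightarrow> C1 \<le> x powr \<epsilon> \<Longrightarrow>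
      C1 \<le> B \<Longrightarrow> 2 + log 2 x \<le> B \<Longrightarrow> 10 + 10 * ln x \<le> B \<Longrightarrow> 1 \<le> H \<Longrightarrow> H \<le> x powr (1 - \<gamma> + \<epsilon>) \<Longrightarrow>
      (\<And>h. is_interval (J h)) \<Longrightarrow> (\<And>h. J h \<subseteq> {x<..2 * x}) \<Longrightarrow>
      (\<And>n. real n \<le> 2 * x \<Longrightarrow> \<bar>arith_fun f n\<bar> \<le> B ^ 20) \<Longrightarrow> g \<in> {arith_zeta, arith_ln} \<Longrightarrow>
      twisted_sum \<gamma> \<alpha> H J (f * arith_cut (\<lambda>n. U < real n \<and> x powr (1/2 - (1 - \<gamma>)/2 - 10 * \<epsilon>) \<le> real n) g) \<le> B ^ 26 * x powr (1 - 8 * \<epsilon>)"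
    assume "0 < \<epsilon> \<and> \<epsilon> < \<epsilon>\<^sub>0"
    hence \<epsilon>: "\<epsilon> > 0" and small: "15 * (1 - \<gamma>) + 150 * \<epsilon> \<le> 2" and \<epsilon>3: "\<epsilon> \<le> 1/300"
      and gap\<epsilon>: "240 * \<epsilon> \<le> (3 - 2 * l) - (1 - \<gamma>) * (12 * k - 2 * l + 13)"
      by (auto simp: \<epsilon>\<^sub>0_def gap_def D_def)
    have pw: "\<forall>\<^sub>F x::real in at_top. c \<le> x powr e" if "e > 0" for c e :: real
    proof -
      have "filterlim (\<lambda>x::real. x powr e) at_top at_top" using that by real_asymp
      thus ?thesis by (simp add: filterlim_at_top)
    qed
    obtain Cd where Cd: "Cd > 0" "\<And>n. n > 0 \<Longrightarrow> real (card (factor_pairs n)) \<le> Cd * real n powr (\<epsilon> / 200)"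
      using divisor_bound[of "\<epsilon> / 200"] \<epsilon> by auto
    have "\<forall>\<^sub>F x::real in at_top. 2 + log 2 x \<le> x powr (\<epsilon> / 100)" using \<epsilon> by real_asymp
    moreover have "\<forall>\<^sub>F x::real in at_top. 10 + 10 * ln x \<le> x powr (\<epsilon> / 100)" using \<epsilon> by real_asymp
    moreover have "\<forall>\<^sub>F x::real in at_top. 2 * Cd \<le> x powr (\<epsilon> / 200)" using \<epsilon> by (intro pw) auto
    moreover have "\<forall>\<^sub>F x::real in at_top. max C1 (max C2 4) \<le> x powr (\<epsilon> / 100)" using \<epsilon> by (intro pw) auto
    moreover have "\<forall>\<^sub>F x::real in at_top. x > 1" by (rule eventually_gt_at_top)
    ultimately have ev: "\<forall>\<^sub>F x::real in at_top. 2 + log 2 x \<le> x powr (\<epsilon> / 100) \<and> 10 + 10 * ln x \<le> x powr (\<epsilon> / 100)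
        \<and> 2 * Cd \<le> x powr (\<epsilon> / 200) \<and> max C1 (max C2 4) \<le> x powr (\<epsilon> / 100) \<and> x > 1"
      by eventually_elim blast
    show "\<exists>C. \<forall>\<^sub>F x :: real in at_top. \<forall>H u \<alpha> :: real. \<forall>I J :: real set.
        1 \<le> H \<and> H \<le> x powr (1 - \<gamma> + \<epsilon>) \<and> 0 \<le> u \<and> u \<le> 1 \<and> dyadic_subinterval H I \<and> dyadic_subinterval x J \<longrightarrow>
        (\<Sum>h :: nat | real h \<in> I. norm (\<Sum>n :: nat | real n \<in> J. mangoldt n * expi (\<alpha> * real n + real h * (real n + u) powr \<gamma>)))
        \<le> C * x powr (1 - \<epsilon>)"
    \<comment> \<open>\<open>5967 = 17 * 351\<close>: partial summation costs \<open>1 + 16 * H * x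
      powr (\<gamma> - 1) \<le> 17 * x powr \<epsilon>\<close>, the decomposition 351.\<close>
    proof (rule exI[of _ 5967], rule eventually_mono[OF ev], intro allI impI)
      fix x H u \<alpha> :: real and I J :: "real set"
      assume "2 + log 2 x \<le> x powr (\<epsilon> / 100) \<and> 10 + 10 * ln x \<le> x powr (\<epsilon> / 100)
        \<and> 2 * Cd \<le> x powr (\<epsilon> / 200) \<and> max C1 (max C2 4) \<le> x powr (\<epsilon> / 100) \<and> x > 1"
      hence B0: "2 + log 2 x \<le> x powr (\<epsilon> / 100)" "10 + 10 * ln x \<le> x powr (\<epsilon> / 100)" "C1 \<le> x powr (\<epsilon> / 100)" "C2 \<le> x powr (\<epsilon> / 100)"
          "4 \<le> x powr (\<epsilon> / 100)" and xCd: "2 * Cd \<le> x powr (\<epsilon> / 200)" and x: "x > 1" by auto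
      assume "1 \<le> H \<and> H \<le> x powr (1 - \<gamma> + \<epsilon>) \<and> 0 \<le> u \<and> u \<le> 1 \<and> dyadic_subinterval H I \<and> dyadic_subinterval x J"
      hence H: "1 \<le> H" "H \<le> x powr (1 - \<gamma> + \<epsilon>)" and u: "0 \<le> u" "u \<le> 1"
        and I: "I \<subseteq> {H<..2 * H}" and J: "is_interval J" "J \<subseteq> {x<..2 * x}" by (auto simp: dyadic_subinterval_def)
      \<comment> \<open>Powers up to \<open>B ^ 43\<close> cost less than
        \<open>x powr \<epsilon>\<close>, which is why \<epsilon> is divided by 100.\<close>
      define B where "B = x powr (\<epsilon> / 100)"
      define z where "z = x powr (1 - \<gamma> + 20 * \<epsilon>)"
      define Y where "Y = x powr (1/2 - (1 - \<gamma>)/2 - 10 * \<epsilon>)"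
      define U where "U = (2 * x) powr (1/3)"
      define R where "R = x powr (1 - 5 * \<epsilon>)"
      note B = B0[folded B_def]
      have B1: "1 \<le> B" using B by simp
      have up: "x powr a \<le> x powr b" if "a \<le> b" for a b using x that by (intro powr_mono) auto
      have B\<epsilon>: "B \<le> x powr \<epsilon>" unfolding B_def using \<epsilon> by (intro up) simp
      have x\<epsilon>: "4 \<le> x powr \<epsilon>" "C1 \<le> x powr \<epsilon>" using B\<epsilon> B by linarith+
      have lnx: "0 \<le> ln x" using x by simp
      have Bpow: "B ^ n = x powr (real n * (\<epsilon> / 100))" for n
        using x by (simp add: B_def powr_realpow[symmetric] powr_powr mult.commute)
      have core: "twisted_sum \<gamma> \<alpha> H J arith_mangoldt \<le> 351 * R" if J: "\<And>h. is_interval (J h)" "\<And>h. J h \<subseteq> {x<..2 * x}" for J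
      proof (rule mangoldt_decomposition[where x = x and z = z and U = U and Y = Y and B = B])
        show "twisted_sum \<gamma> \<alpha> H J f \<le> 0" if "\<And>n. x < real n \<Longrightarrow> real n \<le> 2 * x \<Longrightarrow> arith_fun f n = 0" for f
          using twisted_sum_eq_0[OF J(2) that] by simp
        show "1 < z" using x \<epsilon> \<gamma> powr_less_mono[of 0 "1 - \<gamma> + 20 * \<epsilon>" x] by (simp add: z_def)
        show "z\<^sup>2 \<le> U"
        proof -
          have "z\<^sup>2 \<le> x powr (1/3)" unfolding z_def powr_squared using small \<epsilon>3 by (intro up) argo
          also have "\<dots> \<le> U" unfolding U_def using x by (intro powr_mono2) auto
          finally show ?thesis .
        qed
        show "1 \<le> Y"
        proof -
          have "x powr 0 \<le> Y" unfolding Y_def using small \<epsilon> \<gamma> by (intro up) argo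
          thus ?thesis using x by simp
        qed
        show "z * Y\<^sup>2 \<le> x"
        proof -
          \<comment> \<open>The exponents are arranged to cancel: \<open>20 * \<epsilon>\<close>
            against twice \<open>10 * \<epsilon>\<close>, and \<open>1 - \<gamma>\<close> against
            twice its half.\<close>
          have "z * Y\<^sup>2 = x powr (1 - \<gamma> + 20 * \<epsilon> + 2 * (1/2 - (1 - \<gamma>)/2 - 10 * \<epsilon>))" unfolding z_def Y_def powr_collapse ..
          also have "1 - \<gamma> + 20 * \<epsilon> + 2 * (1/2 - (1 - \<gamma>)/2 - 10 * \<epsilon>) = 1" by argo
          finally show ?thesis using x by simp
        qed
        show "2 * x \<le> U ^ 3" using x by (simp add: U_def powr_realpow[symmetric] powr_powr)
        show "0 \<le> R" by (simp add: R_def)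
        show "real (card (factor_pairs n)) \<le> B" if n: "0 < n" "real n \<le> 2 * x" for n
        proof -
          have "real (card (factor_pairs n)) \<le> Cd * real n powr (\<epsilon> / 200)" by (rule Cd(2)[OF n(1)])
          also have "\<dots> \<le> Cd * (2 * x) powr (\<epsilon> / 200)" using Cd n \<epsilon> by (intro mult_left_mono powr_mono2) auto
          also have "\<dots> = Cd * 2 powr (\<epsilon> / 200) * x powr (\<epsilon> / 200)" using x by (simp add: powr_mult)
          also have "\<dots> \<le> Cd * 2 * x powr (\<epsilon> / 200)"
            using Cd powr_mono[of "\<epsilon> / 200" 1 "2::real"] \<epsilon>3 by (intro mult_right_mono mult_left_mono) auto
          also have "\<dots> \<le> x powr (\<epsilon> / 200) * x powr (\<epsilon> / 200)" using xCd by (intro mult_right_mono) auto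
          also have "\<dots> = B" by (simp add: B_def powr_add[symmetric])
          finally show ?thesis .
        qed
        show "ln (2 * x) \<le> B"
        proof -
          have "ln (2 * x) = ln 2 + ln x" using x by (simp add: ln_mult)
          moreover have "ln (2::real) \<le> 1" using ln_le_minus_one[of "2::real"] by simp
          ultimately show ?thesis using B(2) lnx by linarith
        qed
        show "twisted_sum \<gamma> \<alpha> H J (f * g) \<le> R"
          if fg: "\<And>n. real n \<le> 2 * x \<Longrightarrow> \<bar>arith_fun f n\<bar> \<le> B ^ 20" "\<And>n. real n \<le> 2 * x \<Longrightarrow> \<bar>arith_fun g n\<bar> \<le> B ^ 20"
            "\<And>n. arith_fun g n \<noteq> 0 \<Longrightarrow> z \<le> real n \<and> real n \<le> U" for f g
        proof -
          have "twisted_sum \<gamma> \<alpha> H J (f * g) \<le> B ^ 43 * x powr (1 - 6 * \<epsilon>)"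
            by (rule type2[OF x \<epsilon> small x\<epsilon>(1) B1 B(4,1,2) H J fg[unfolded z_def U_def]])
          also have "\<dots> \<le> R" unfolding Bpow R_def powr_collapse using \<epsilon> by (intro up) simp
          finally show ?thesis .
        qed
        show "twisted_sum \<gamma> \<alpha> H J (f * arith_cut (\<lambda>n. U < real n \<and> Y \<le> real n) g) \<le> R"
          if fg: "\<And>n. real n \<le> 2 * x \<Longrightarrow> \<bar>arith_fun f n\<bar> \<le> B ^ 20" "g \<in> {arith_zeta, arith_ln}" for f g
        proof -
          have "twisted_sum \<gamma> \<alpha> H J (f * arith_cut (\<lambda>n. U < real n \<and> Y \<le> real n) g) \<le> B ^ 26 * x powr (1 - 8 * \<epsilon>)"
            unfolding Y_def by (rule type1[OF x \<epsilon> small gap\<epsilon> x\<epsilon> B(3,1,2) H J fg])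
          also have "\<dots> \<le> R" unfolding Bpow R_def powr_collapse using \<epsilon> by (intro up) simp
          finally show ?thesis .
        qed
      qed (use B1 in \<open>auto simp: twisted_sum_add_le twisted_sum_uminus\<close>)
      have "(\<Sum>h :: nat | real h \<in> I. norm (\<Sum>n :: nat | real n \<in> J. mangoldt n * expi (\<alpha> * real n + real h * (real n + u) powr \<gamma>)))
          \<le> (1 + 16 * H * x powr (\<gamma> - 1)) * (351 * R)"
        using x by (intro shifted_mangoldt_sum_le \<gamma> H u J I core) auto
      also have "\<dots> \<le> (17 * x powr \<epsilon>) * (351 * R)"
      proof (intro mult_right_mono)
        have "H * x powr (\<gamma> - 1) \<le> x powr (1 - \<gamma> + \<epsilon>) * x powr (\<gamma> - 1)" using H by (intro mult_right_mono) auto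
        also have "\<dots> = x powr \<epsilon>" by (simp add: powr_add[symmetric])
        finally show "1 + 16 * H * x powr (\<gamma> - 1) \<le> 17 * x powr \<epsilon>" using x\<epsilon> by simp
      qed (simp add: R_def)
      also have "\<dots> = 5967 * x powr (\<epsilon> + (1 - 5 * \<epsilon>))" unfolding powr_add by (simp add: R_def)
      also have "\<dots> \<le> 5967 * x powr (1 - \<epsilon>)" using \<epsilon> by (intro mult_left_mono up) auto
      finally show "(\<Sum>h :: nat | real h \<in> I. norm (\<Sum>n :: nat | real n \<in> J. mangoldt n * expi (\<alpha> * real n + real h * (real n + u) powr \<gamma>)))
        \<le> 5967 * x powr (1 - \<epsilon>)" .
    qed
  qed
qed

end
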